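(* Let $N>1$ be a square-free integer and $k$ an even integer. For $z=x+iy\in\mathbb H$ and $\Re(s)>1-\frac k2$, the Fourier expansion of $\widehat G_{N,k}(z,s)$ is $$\begin{aligned}\widehat G_{N,k}(z,s)=\;&\frac{\Gamma(s+\frac k2+\frac{|k|}2)}{\Gamma(s+\frac k2)}\,\hat\zeta(2s+k)\,y^s\,\sqrt N^{\,s+\frac k2}f_N(s)\\&+(-1)^{k/2}\frac{\Gamma(s+\frac k2)\Gamma(s+\frac k2+\frac{|k|}2)}{\Gamma(s+k)\Gamma(s)}\,\hat\zeta(2-k-2s)\,y^{1-k-s}f_N(s)\\&\qquad\times\left(\sqrt N^{\,1-s-\frac k2}\prod_{p\mid N}\frac{1-p^{-1}}{1-p^{-2s-k}}+\sqrt N^{\,-1+s+\frac k2}\prod_{p\mid N}\frac{1-p^{1-k-2s}}{1-p^{-2s-k}}\right)\\&+\sum_{n\neq0}(-1)^{k/2}y^{-k/2}\frac{\Gamma(s+\frac k2+\frac{|k|}2)}{\Gamma(s+\frac k2+\mathrm{sgn}(n)\frac k2)}|n|^{-s-\frac k2}\sigma_{2s+k-1}(n)\,W_{\mathrm{sgn}(n)\frac k2,\,s+\frac{k-1}2}\!\left(\frac{4\pi|n|y}{\sqrt N}\right)f_{N,n}(1-k-s)f_N(s)\,e^{2\pi i nx/\sqrt N},\end{aligned}$$ where the last sum is over nonzero integers $n$ and products are over primes $p\mid N$.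
   Context: Let $(\mathbb Z\times\mathbb Z)_{N,L}=\bigsqcup_{t\ge1}\{(m,n)\in t\mathbb Z\times t\mathbb Z:\gcd(Nm,n)=t\}$ and $(\mathbb Z\times\mathbb Z)_{N,R}=\bigsqcup_{t\ge1}\{(m,n)\in t\mathbb Z\times t\mathbb Z:\gcd(m,Nn)=t\}$. For $\Re(s)>1-\frac k2$ and $z=x+iy\in\mathbb H$ define $$G_{N,k}(z,s)=\frac12\sum_{(m,n)\in(\mathbb Z\times\mathbb Z)_{N,L}}\frac{y^s}{|\sqrt N mz+n|^{2s}(\sqrt N mz+n)^k}+\frac12\sum_{(m,n)\in(\mathbb Z\times\mathbb Z)_{N,R}}\frac{y^s}{|mz+\sqrt N n|^{2s}(mz+\sqrt N n)^k}.$$ For a nonzero integer $b$ define the meromorphic function $$f_{N,b}(s)=\frac{N^{-(s-1)-\frac k2}\prod_{p\mid N}\left(\sum_{i=1}^{v_p(b)}(p-1)p^{i-1+i(2s+k-2)}-p^{v_p(b)+(v_p(b)+1)(2s+k-2)}\right)+1}{\prod_{p\mid N}\zeta_p^{-1}(-2s-k+2)\,\zeta_p(-2s-k+1;v_p(b))},$$ where $v_p$ is the $p$-adic valuation, $\zeta_p(s)=(1-p^{-s})^{-1}$, $\zeta_p^{-1}(s)=1-p^{-s}$, and $\zeta_p(s;v)=\sum_{n=0}^vp^{-ns}$. Put $f_N(s)=f_{N,1}(s)=\left((-1)^{\omega(N)}N^{(s-1)+\frac k2}+1\right)\prod_{p\mid N}(1-p^{2s+k-2})^{-1}$, with $\omega(N)$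 the number of distinct prime factors of $N$. The completed Eisenstein series is $$\widehat G_{N,k}(z,s)=\left(\frac{\pi}{\sqrt N}\right)^{-s-\frac k2}\Gamma\!\left(s+\frac k2+\frac{|k|}2\right)f_N(s)\,G_{N,k}(z,s).$$ $\hat\zeta(s)=\pi^{-s/2}\Gamma(s/2)\zeta(s)$ is the completed Riemann zeta function, $\sigma_w(n)=\sum_{d\mid n,\,d>0}d^w$, and $W_{\kappa,\mu}$ is the standard Whittaker $W$-function. *)

theory Defs
  imports
    "HOL-Complex_Analysis.Complex_Analysis"
    "HOL-Computational_Algebra.Computational_Algebra"
begin

section \<open>Zeta, divisor sums and the Whittaker function\<close>

text \<open>
  The Riemann zeta function is the analytic continuation of the Dirichlet series. By the identity
  theorem the property below determines the value at every point other than the pole at 1.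
\<close>

definition riemann_zeta :: "complex \<Rightarrow> complex" where
  "riemann_zeta = (SOME f. f holomorphic_on (- {1}) \<and>
     (\<forall>s. Re s > 1 \<longrightarrow> (\<lambda>n. of_nat (Suc n) powr (- s)) sums f s))"

text \<open>
  The pointwise product is wrong at the negative even integers, where the library sets
  \<^term>\<open>Gamma\<close> to 0 at its poles and the zeta function vanishes; there the value of the completed
  zeta function is the limit, which is what \<^const>\<open>remove_sings\<close> supplies.
\<close>

definition completed_zeta :: "complex \<Rightarrow> complex" where
  "completed_zeta =
     remove_sings (\<lambda>s. of_real pi powr (- s / 2) * Gamma (s / 2) * riemann_zeta s)"

definition divisor_sigma :: "complex \<Rightarrow> int \<Rightarrow> complex" where
  "divisor_sigma w n = (\<Sum>d | d > 0 \<and> d dvd n. of_int d powr w)"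

text \<open>
  On the positive real axis, the Whittaker function with parameters \<open>\<kappa>\<close>, \<open>\<mu>\<close> is the solution of
  Whittaker's equation
  \<open>W'' + (-1/4 + \<kappa>/x + (1/4 - \<mu>\<^sup>2)/x\<^sup>2) W = 0\<close> with \<open>W(x) \<sim> e\<^sup>-\<^sup>x\<^sup>/\<^sup>2 x\<^sup>\<kappa>\<close> as \<open>x\<close> tends to infinity.
  Solutions independent of it grow like \<open>e\<^sup>x\<^sup>/\<^sup>2 x\<^sup>-\<^sup>\<kappa>\<close>, so it is unique on the positive axis. Values at
  nonpositive arguments are left unspecified.
\<close>

definition is_whittaker_W :: "complex \<Rightarrow> complex \<Rightarrow> (real \<Rightarrow> complex) \<Rightarrow> bool" where
  "is_whittaker_W \<kappa> \<mu> W \<longleftrightarrow>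
     (\<exists>W'. \<forall>x>0. (W has_vector_derivative W' x) (at x) \<and>
        (W' has_vector_derivative
           - (- 1/4 + \<kappa> / of_real x + (1/4 - \<mu>\<^sup>2) / (of_real x)\<^sup>2) * W x) (at x)) \<and>
     ((\<lambda>x. W x / (of_real (exp (- x / 2)) * of_real x powr \<kappa>)) \<longlongrightarrow> 1) at_top"

definition whittaker_W :: "complex \<Rightarrow> complex \<Rightarrow> real \<Rightarrow> complex" where
  "whittaker_W \<kappa> \<mu> = (SOME W. is_whittaker_W \<kappa> \<mu> W)"


section \<open>The Eisenstein series\<close>

definition lattice_L :: "nat \<Rightarrow> (int \<times> int) set" where
  "lattice_L N = (\<Union>t\<in>{1..}. {(m, n). t dvd m \<and> t dvd n \<and> gcd (int N * m) n = t})"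

definition lattice_R :: "nat \<Rightarrow> (int \<times> int) set" where
  "lattice_R N = (\<Union>t\<in>{1..}. {(m, n). t dvd m \<and> t dvd n \<and> gcd m (int N * n) = t})"

definition eisenstein_term :: "int \<Rightarrow> complex \<Rightarrow> real \<Rightarrow> complex \<Rightarrow> complex" where
  "eisenstein_term k s y w =
     of_real y powr s / (of_real (cmod w) powr (2 * s) * w powi k)"

definition eisenstein_G :: "nat \<Rightarrow> int \<Rightarrow> complex \<Rightarrow> complex \<Rightarrow> complex" where
  "eisenstein_G N k z s =
     1/2 * (\<Sum>\<^sub>\<infinity>(m, n)\<in>lattice_L N.
        eisenstein_term k s (Im z) (of_real (sqrt (real N)) * of_int m * z + of_int n)) +
     1/2 * (\<Sum>\<^sub>\<infinity>(m, n)\<in>lattice_R N.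
        eisenstein_term k s (Im z) (of_int m * z + of_real (sqrt (real N)) * of_int n))"


section \<open>The local factors and the completed series\<close>

definition local_zeta_inverse :: "nat \<Rightarrow> complex \<Rightarrow> complex" where
  "local_zeta_inverse p s = 1 - of_nat p powr (- s)"

definition local_zeta_trunc :: "nat \<Rightarrow> complex \<Rightarrow> nat \<Rightarrow> complex" where
  "local_zeta_trunc p s v = (\<Sum>n\<le>v. of_nat p powr (- of_nat n * s))"

definition eisenstein_fb :: "nat \<Rightarrow> int \<Rightarrow> int \<Rightarrow> complex \<Rightarrow> complex" where
  "eisenstein_fb N k b s =
     (of_nat N powr (- (s - 1) - of_int k / 2) *
        (\<Prod>p\<in>prime_factors N. let v = multiplicity (int p) b; e = 2 * s + of_int k - 2 in
            (\<Sum>i=1..v. (of_nat p - 1) * of_nat p powr (of_nat i - 1 + of_nat i * e))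
              - of_nat p powr (of_nat v + (of_nat v + 1) * e)) + 1) /
     (\<Prod>p\<in>prime_factors N.
        local_zeta_inverse p (- 2 * s - of_int k + 2) *
        local_zeta_trunc p (- 2 * s - of_int k + 1) (multiplicity (int p) b))"

definition eisenstein_f :: "nat \<Rightarrow> int \<Rightarrow> complex \<Rightarrow> complex" where
  "eisenstein_f N k s = eisenstein_fb N k 1 s"

lemma eisenstein_f_closed_form:
  assumes "squarefree N"
  shows "eisenstein_f N k s =
    ((- 1) ^ card (prime_factors N) * of_nat N powr ((s - 1) + of_int k / 2) + 1) *
    (\<Prod>p\<in>prime_factors N. inverse (1 - of_nat p powr (2 * s + of_int k - 2)))"
proof -
  define e where "e = 2 * s + of_int k - (2 :: complex)"
  have N0: "N \<noteq> 0" using assms by (metis not_squarefree_0)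
  have "N = (\<Prod>p\<in>prime_factors N. p ^ multiplicity p N)"
    using prime_factorization_nat[of N] N0 by (simp add: prime_factors_multiplicity)
  also have "\<dots> = (\<Prod>p\<in>prime_factors N. p)"
    by (intro prod.cong refl) (use assms N0 squarefree_factorial_semiring'[of N] in auto)
  finally have Nprod: "(\<Prod>p\<in>prime_factors N. p) = N" by simp
  have "(\<Prod>p\<in>A. - (of_nat p powr e :: complex)) = (- 1) ^ card A * of_nat (\<Prod>p\<in>A. p) powr e"
    if "finite A" for A :: "nat set"
    using that
  proof (induction rule: finite_induct)
    case (insert a F)
    have "(of_nat a * of_nat (\<Prod>F) :: complex) powr e = of_nat a powr e * of_nat (\<Prod>F) powr e"
      by (rule powr_times_real) (simp_all del: of_nat_prod)
    with insert show ?case by (simp del: of_nat_prod)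
  qed simp
  from this[of "prime_factors N"]
  have *: "(\<Prod>p\<in>prime_factors N. - (of_nat p powr e)) =
      (- 1) ^ card (prime_factors N) * (of_nat N powr e :: complex)"
    by (simp add: Nprod del: of_nat_prod)
  have "- (s - 1) - of_int k / 2 + e = (s - 1) + of_int k / 2"
    by (simp add: e_def field_simps)
  hence **: "of_nat N powr (- (s - 1) - of_int k / 2) * of_nat N powr e =
      (of_nat N powr ((s - 1) + of_int k / 2) :: complex)"
    by (metis powr_add)
  have num: "(let v = multiplicity (int p) 1; e' = 2 * s + of_int k - 2 in
        (\<Sum>i=1..v. (of_nat p - 1) * of_nat p powr (of_nat i - 1 + of_nat i * e'))
          - of_nat p powr (of_nat v + (of_nat v + 1) * e')) = - (of_nat p powr e :: complex)" for p
    by (simp add: Let_def e_def)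
  have den: "local_zeta_inverse p (- 2 * s - of_int k + 2) *
      local_zeta_trunc p (- 2 * s - of_int k + 1) (multiplicity (int p) 1) = 1 - of_nat p powr e"
    if "p \<in> prime_factors N" for p
  proof -
    have "p \<noteq> 0" using that by (metis in_prime_factors_imp_prime not_prime_0)
    moreover have "- (- 2 * s - of_int k + 2) = e" by (simp add: e_def)
    ultimately show ?thesis
      unfolding local_zeta_inverse_def local_zeta_trunc_def by simp
  qed
  have "eisenstein_f N k s =
      (of_nat N powr (- (s - 1) - of_int k / 2) *
         ((- 1) ^ card (prime_factors N) * of_nat N powr e) + 1) /
      (\<Prod>p\<in>prime_factors N. 1 - of_nat p powr e)"
    unfolding eisenstein_f_def eisenstein_fb_def num * using den by (simp cong: prod.cong)
  also have "of_nat N powr (- (s - 1) - of_int k / 2) *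
         ((- 1) ^ card (prime_factors N) * of_nat N powr e) =
      (- 1) ^ card (prime_factors N) * (of_nat N powr ((s - 1) + of_int k / 2) :: complex)"
    unfolding **[symmetric] by (rule mult.left_commute)
  also have "(\<dots> + 1) / (\<Prod>p\<in>prime_factors N. 1 - of_nat p powr e) =
      (\<dots> + 1) * (\<Prod>p\<in>prime_factors N. inverse (1 - of_nat p powr e))"
    by (simp only: divide_inverse prod_inversef[symmetric] o_def)
  finally show ?thesis unfolding e_def .
qed

definition eisenstein_G_completed :: "nat \<Rightarrow> int \<Rightarrow> complex \<Rightarrow> complex \<Rightarrow> complex" where
  "eisenstein_G_completed N k z s =
     of_real (pi / sqrt (real N)) powr (- s - of_int k / 2) *
     Gamma (s + of_int k / 2 + of_int \<bar>k\<bar> / 2) * eisenstein_f N k s * eisenstein_G N k z s"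

text \<open>
  The term of index \<open>n \<noteq> 0\<close> in the Fourier expansion at \<open>x + iy\<close>. A pole of \<^term>\<open>Gamma\<close> in the
  denominator makes the quotient 0 under the library conventions, in agreement with the reciprocal
  Gamma function.
\<close>

definition fourier_term :: "nat \<Rightarrow> int \<Rightarrow> complex \<Rightarrow> real \<Rightarrow> real \<Rightarrow> int \<Rightarrow> complex" where
  "fourier_term N k s x y n =
     (- 1) powi (k div 2) * of_real y powr (- of_int k / 2) *
     (Gamma (s + of_int k / 2 + of_int \<bar>k\<bar> / 2) /
        Gamma (s + of_int k / 2 + of_int (sgn n) * (of_int k / 2))) *
     of_int \<bar>n\<bar> powr (- s - of_int k / 2) *
     divisor_sigma (2 * s + of_int k - 1) n *
     whittaker_W (of_int (sgn n) * (of_int k / 2)) (s + (of_int k - 1) / 2)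
       (4 * pi * of_int \<bar>n\<bar> * y / sqrt (real N)) *
     eisenstein_fb N k n (1 - of_int k - s) * eisenstein_f N k s *
     exp (2 * of_real pi * \<i> * of_int n * of_real x / of_real (sqrt (real N)))"

end

theory Submission
  imports Defs "HOL-Probability.Probability"
begin

text \<open>
  Put \<open>\<sigma> = s + k/2\<close>. The two lattices are unions of multiples of coprime pairs, so by homogeneity
  of the summand their sums, multiplied by the product of \<open>1 - p\<^sup>-\<^sup>2\<^sup>\<sigma>\<close> over \<open>p\<close> dividing \<open>N\<close>, become
  sums over all pairs with one coordinate prime to \<open>N\<close>. Inclusion-exclusion over the primes dividing
  \<open>N\<close> writes these as weighted sums over \<open>c \<ge> 1\<close> of full rows \<open>\<Sum>\<^sub>l T(c z/\<surd>N + l)\<close>, to which Poisson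
  summation applies. The Fourier transform of \<open>(x + i y)\<^sup>-\<^sup>a (x - i y)\<^sup>-\<^sup>b\<close> satisfies a second order
  equation in \<open>y\<close> which turns into Whittaker's equation. The decaying solution is unique up to a
  constant, and contiguity relations in \<open>(a, b)\<close> determine the constant. Collecting the terms \<open>c l = n\<close>
  gives divisor sums that factor over the primes dividing \<open>N\<close>; the functional equation of the zeta
  function handles the term \<open>n = 0\<close>.
\<close>

text \<open>Both \<open>riemann_zeta\<close> and \<open>whittaker_W\<close> are choices, so nothing
  is known about them until a function with the characterising property has been built: for zeta by
  theta inversion, for Whittaker's function by Kummer's integral. The latter contains
  u^(\<sigma>-\<kappa>-1) and diverges at 0 once \<kappa> >= Re \<sigma>. This shapes the central
  part. For weight j <= 0 the Fourier transform is compared with Kummer's integral as the argument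
  tends to 0. For j > 0 the transform itself, divided by its constant, is the witness, and its
  growth is carried up from weight 0 by a raising relation. Since only a power bound for the
  transform is known beforehand, uniqueness is proved for solutions that may still grow more slowly
  than exp(x/4). On Re \<sigma> > 1 the summand and its derivatives are O(1/(1+x^2)) along a row,
  and this one decay class is all that Poisson summation asks for. The odd-looking numerator of
  \<open>eisenstein_fb\<close> is what telescoping leaves of a local divisor sum at a prime dividing
  N.\<close>

section \<open>Differentiation under the integral sign and integrals of derivatives\<close>

text \<open>Only \<open>f\<close> needs a majorant. Cauchy's inequality on discs of radius r/4 turns
  it into the majorant 4g/r for the derivative on the half ball, the mean value inequality passes
  this on to the difference quotients, and dominated convergence along null sequences finishes.
  Measurability of \<open>f' z0\<close> is inherited as a pointwise limit of quotients.\<close>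

lemma has_field_derivative_integral:
  fixes f f' :: "complex \<Rightarrow> 'a \<Rightarrow> complex" and g :: "'a \<Rightarrow> real"
  assumes r: "r > 0"
    and meas: "\<And>z. z \<in> ball z0 r \<Longrightarrow> f z \<in> borel_measurable M"
    and deriv: "\<And>z x. z \<in> ball z0 r \<Longrightarrow> x \<in> space M \<Longrightarrow> ((\<lambda>z. f z x) has_field_derivative f' z x) (at z)"
    and bound: "\<And>z x. z \<in> ball z0 r \<Longrightarrow> x \<in> space M \<Longrightarrow> norm (f z x) \<le> g x"
    and g: "integrable M g"
  shows "integrable M (f' z0)"
    and "((\<lambda>z. LINT x|M. f z x) has_field_derivative (LINT x|M. f' z0 x)) (at z0)"
proof -
  have int: "integrable M (f z)" if "z \<in> ball z0 r" for z
    using meas[OF that] bound[OF that]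
    by (intro Bochner_Integration.integrable_bound[OF g]) (auto intro!: AE_I2 order_trans[OF _ abs_ge_self])
  have bd: "norm (f' z x) \<le> 4 * g x / r" if z: "z \<in> ball z0 (r/2)" and x: "x \<in> space M" for z x
  proof -
    have sub: "cball z (r/4) \<subseteq> ball z0 r"
    proof
      fix w assume "w \<in> cball z (r/4)"
      with z dist_triangle[of z0 w z] r show "w \<in> ball z0 r" by (auto simp: dist_commute)
    qed
    have "(\<lambda>z. f z x) holomorphic_on ball z0 r"
      unfolding holomorphic_on_def field_differentiable_def using has_field_derivative_at_within[OF deriv[OF _ x]] by blast
    hence "(\<lambda>z. f z x) holomorphic_on cball z (r/4)"
      using sub holomorphic_on_subset by blast
    hence "norm ((deriv ^^ 1) (\<lambda>z. f z x) z) \<le> fact 1 * g x / (r/4)^1"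
      by (intro Cauchy_inequality bound x)
         (use r sub in \<open>auto intro: holomorphic_on_subset holomorphic_on_imp_continuous_on simp: subset_eq dist_norm\<close>)
    moreover have "deriv (\<lambda>z. f z x) z = f' z x"
      using z r x by (intro DERIV_imp_deriv deriv) auto
    ultimately show ?thesis by (simp add: field_simps)
  qed
  define q where "q = (\<lambda>h x. (f (z0 + h) x - f z0 x) / h)"
  have qb: "norm (q h x) \<le> 4 * g x / r" if "norm h < r/2" "x \<in> space M" for h x
  proof (cases "h = 0")
    case False
    have "norm (f (z0+h) x - f z0 x) \<le> 4 * g x / r * norm (z0 + h - z0)"
      using that r bd by (intro field_differentiable_bound[of "ball z0 (r/2)" _ "\<lambda>z. f' z x"])
        (auto intro!: has_field_derivative_at_within[OF deriv] simp: dist_norm)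
    thus ?thesis using False by (simp add: q_def norm_divide field_simps)
  next
    case True
    have "0 \<le> norm (f z0 x)" by simp
    also have "\<dots> \<le> g x" using that r by (intro bound) auto
    finally have "0 \<le> g x" .
    thus ?thesis using True r by (simp add: q_def)
  qed
  have lim: "((\<lambda>h. q h x) \<longlongrightarrow> f' z0 x) (at 0)" if "x \<in> space M" for x
    using deriv[of z0 x] that r by (simp add: DERIV_def q_def)
  have key: "integrable M (f' z0) \<and> (\<lambda>n. LINT x|M. q (X n) x) \<longlonglongrightarrow> (LINT x|M. f' z0 x)"
    if X: "X \<longlonglongrightarrow> 0" "\<And>n. X n \<noteq> 0" "\<And>n. norm (X n) < r/2" for X
  proof -
    have m: "q (X n) \<in> borel_measurable M" for n
      unfolding q_def using X(3)[of n] r by (intro borel_measurable_divide borel_measurable_diff meas) (auto simp: dist_norm)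
    have l: "(\<lambda>n. q (X n) x) \<longlonglongrightarrow> f' z0 x" if "x \<in> space M" for x
      using lim[OF that] X(1,2) by (auto simp: tendsto_at_iff_sequentially o_def)
    have m': "f' z0 \<in> borel_measurable M"
      by (rule borel_measurable_LIMSEQ_metric[OF m l])
    show ?thesis
      using X(3) qb by (intro conjI integrable_dominated_convergence[OF m' m, of "\<lambda>x. 4 * g x / r"]
         integral_dominated_convergence[OF m' m, of "\<lambda>x. 4 * g x / r"])
        (auto intro!: AE_I2 l g)
  qed
  \<comment> \<open>Any single null sequence of nonzero points in the half ball gives integrability
    of \<open>f' z0\<close>; the limit of the quotients below needs all sequences.\<close>
  define X0 where "X0 = (\<lambda>n. complex_of_real (r / 3 / real (Suc n)))"
  have "X0 \<longlonglongrightarrow> 0"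
    unfolding X0_def using tendsto_of_real[OF LIMSEQ_Suc[OF lim_const_over_n[of "r/3"]], where 'a = complex] by simp
  moreover have "norm (X0 n) < r/2" for n
  proof -
    have "r / 3 / real (Suc n) \<le> r / 3" using r by (simp add: field_simps)
    thus ?thesis using r unfolding X0_def norm_of_real by simp
  qed
  moreover have "X0 n \<noteq> 0" for n
    unfolding X0_def using r by (simp del: of_nat_Suc of_real_divide)
  ultimately show "integrable M (f' z0)"
    using key[of X0] by blast
  have "((\<lambda>h. LINT x|M. q h x) \<longlongrightarrow> (LINT x|M. f' z0 x)) (at 0)"
    unfolding tendsto_at_iff_sequentially
  proof (intro allI impI)
    fix X assume X: "\<forall>i. X i \<in> UNIV - {0}" "X \<longlonglongrightarrow> (0::complex)"
    from X(2) have "eventually (\<lambda>n. norm (X n) < r/2) sequentially"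
      using r tendstoD[OF X(2), of "r/2"] by (simp add: dist_norm)
    \<comment> \<open>An arbitrary null sequence may start outside the half ball, so an initial
      segment is dropped.\<close>
    then obtain n0 where n0: "\<And>n. n \<ge> n0 \<Longrightarrow> norm (X n) < r/2"
      by (auto simp: eventually_sequentially)
    have "(\<lambda>n. X (n + n0)) \<longlonglongrightarrow> 0" using X(2) by (rule LIMSEQ_ignore_initial_segment)
    hence "(\<lambda>n. LINT x|M. q (X (n + n0)) x) \<longlonglongrightarrow> (LINT x|M. f' z0 x)"
      using key[of "\<lambda>n. X (n + n0)"] X n0 by auto
    thus "((\<lambda>h. LINT x|M. q h x) \<circ> X) \<longlonglongrightarrow> (LINT x|M. f' z0 x)"
      unfolding o_def by (rule LIMSEQ_offset)
  qed
  moreover have "(LINT x|M. q h x) = ((LINT x|M. f (z0 + h) x) - (LINT x|M. f z0 x)) / h"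
    if "norm h < r/2" for h
    unfolding q_def using that r by (subst Bochner_Integration.integral_diff[symmetric]) (auto intro!: int simp: dist_norm)
  moreover have "eventually (\<lambda>h::complex. norm h < r/2) (at 0)"
    unfolding eventually_at using r by (intro exI[of _ "r/2"]) auto
  ultimately have "((\<lambda>h. ((LINT x|M. f (z0 + h) x) - (LINT x|M. f z0 x)) / h) \<longlongrightarrow> (LINT x|M. f' z0 x)) (at 0)"
    by (subst tendsto_cong[where g = "\<lambda>h. LINT x|M. q h x"]) (auto elim!: eventually_mono)
  thus "((\<lambda>z. LINT x|M. f z x) has_field_derivative (LINT x|M. f' z0 x)) (at z0)"
    by (simp add: DERIV_def)
qed

lemma integral_derivative_lborel:
  fixes f f' :: "real \<Rightarrow> complex"
  assumes "\<And>x. (f has_vector_derivative f' x) (at x)" "continuous_on UNIV f'" "integrable lborel f'"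
    and "(f \<longlongrightarrow> a) at_bot" "(f \<longlongrightarrow> b) at_top"
  shows "(LINT x|lborel. f' x) = b - a"
proof -
  have "(LBINT x=-\<infinity>..\<infinity>. f' x) = b - a"
    using assms by (intro interval_integral_FTC_integrable[where F = f])
      (auto simp: continuous_on_eq_continuous_at einterval_def set_integrable_def ereal_tendsto_simps1)
  thus ?thesis by (simp add: interval_lebesgue_integral_def einterval_def set_lebesgue_integral_def)
qed

lemma integral_derivative_lborel_interval:
  fixes f f' :: "real \<Rightarrow> complex"
  assumes "a \<le> b" "\<And>x. x \<in> {a..b} \<Longrightarrow> (f has_vector_derivative f' x) (at x within {a..b})" "continuous_on {a..b} f'"
  shows "set_integrable lborel {a..b} f'" "(LINT x:{a..b}|lborel. f' x) = f b - f a"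
proof -
  show *: "set_integrable lborel {a..b} f'"
    using assms(3) by (rule borel_integrable_compact[OF compact_Icc, folded set_integrable_def])
  show "(LINT x:{a..b}|lborel. f' x) = f b - f a"
    using fundamental_theorem_of_calculus[OF assms(1,2)] set_borel_integral_eq_integral(2)[OF *]
    by (metis integral_unique)
qed

lemma integrable_inverse_1_plus_square_lborel: "integrable lborel (\<lambda>x::real. 1 / (1 + x\<^sup>2))"
  using integrable_inverse_1_plus_square by (simp add: set_integrable_def einterval_def inverse_eq_divide)

section \<open>Poisson summation\<close>

text \<open>The series is the real part of the dilogarithm on the unit circle. On a circle of radius
  r < 1 the derivative of the dilogarithm in the angle is a multiple of ln(1 - z). The imaginary
  part of this logarithm is at most \<pi> in modulus, so r may tend to 1 under the integral, and on
  the unit circle it is a linear sawtooth. The constant of integration is Euler's value of zeta at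
  2.\<close>

lemma dilog_circle:
  fixes x :: real assumes x: "0 \<le> x" "x \<le> 1"
  shows "(\<lambda>m. cos (2 * pi * real (Suc m) * x) / (real (Suc m))\<^sup>2) sums (pi\<^sup>2 * (x\<^sup>2 - x + 1/6))"
proof -
  \<comment> \<open>The coefficient at 0 is 1/0 = 0, so the power series may start at index
    0.\<close>
  define c where "c = (\<lambda>n. 1 / (of_nat n)\<^sup>2 :: complex)"
  define P where "P = (\<lambda>z. \<Sum>n. c n * z ^ n)"
  have cS: "c (Suc n) = of_real (1 / (real (Suc n))\<^sup>2)" for n by (simp add: c_def)
  have sc: "summable (\<lambda>n. norm (c n))"
  proof -
    have "summable (\<lambda>n. norm (c (Suc n)))"
      unfolding cS norm_of_real using inverse_squares_sums[THEN sums_summable] by (simp add: add.commute)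
    thus ?thesis by (rule summable_Suc_iff[THEN iffD1])
  qed
  have sm: "summable (\<lambda>n. c n * z ^ n)" if "norm z \<le> 1" for z
  proof (rule summable_comparison_test'[OF sc])
    fix n show "norm (c n * z ^ n) \<le> norm (c n)"
      using that by (simp add: norm_mult norm_power mult_left_le power_le_one)
  qed
  have contP: "continuous_on (cball 0 1) P"
  proof -
    have "uniform_limit (cball 0 1) (\<lambda>N z. \<Sum>n<N. c n * z ^ n) (\<lambda>z. \<Sum>n. c n * z ^ n) sequentially"
      by (rule Weierstrass_m_test[OF _ sc])
         (simp add: norm_mult norm_power mult_left_le power_le_one)
    thus ?thesis unfolding P_def
      by (rule uniform_limit_theorem[rotated]) (auto intro!: always_eventually continuous_intros)
  qed
  have dP: "(P has_field_derivative (\<Sum>n. diffs c n * z ^ n)) (at z)" if "norm z < 1" for z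
    unfolding P_def by (rule termdiffs_strong[of _ 1]) (use sm[of 1] that in auto)
  have dPz: "z * (\<Sum>n. diffs c n * z ^ n) = - Ln (1 - z)" if z: "norm z < 1" for z
  proof -
    have "(\<lambda>n. (-1)^Suc n / of_nat n * (-z)^n) sums ln (1 + (-z))"
      by (rule Ln_series) (use z in auto)
    hence "(\<lambda>n. (-1)^Suc (Suc n) / of_nat (Suc n) * (-z)^(Suc n)) sums ln (1 - z)"
      by (subst sums_Suc_iff) simp
    also have "(\<lambda>n. (-1)^Suc (Suc n) / of_nat (Suc n) * (-z)^(Suc n)) = (\<lambda>n. - (z * (diffs c n * z ^ n)))"
    proof
      fix n
      have "diffs c n = 1 / of_nat (Suc n)"
        by (simp add: diffs_def c_def power2_eq_square del: of_nat_Suc)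
      moreover have "(-1)^Suc (Suc n) * (-z)^(Suc n) = - (z * z ^ n)"
        by (cases "even n") simp_all
      ultimately have "((-1)^Suc (Suc n) * (-z)^(Suc n)) / of_nat (Suc n) = - (z * (diffs c n * z ^ n))"
        by (simp only:) (simp del: of_nat_Suc)
      thus "(-1)^Suc (Suc n) / of_nat (Suc n) * (-z)^(Suc n) = - (z * (diffs c n * z ^ n))"
        by (simp only: times_divide_eq_left)
    qed
    finally have "(\<lambda>n. z * (diffs c n * z ^ n)) sums - ln (1 - z)"
      using sums_minus by fastforce
    moreover have "summable (\<lambda>n. diffs c n * z ^ n)"
      by (rule termdiff_converges[of _ 1]) (use z sm in auto)
    ultimately show ?thesis
      by (metis sums_unique suminf_mult)
  qed
  define e where "e = (\<lambda>t. exp (2 * of_real pi * \<i> * of_real t) :: complex)"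
  have ne: "norm (e t) = 1" for t by (simp add: e_def norm_exp_eq_Re)
  have de: "(e has_vector_derivative (2 * of_real pi * \<i> * e t)) (at t within A)" for t A
    unfolding e_def by (auto intro!: derivative_eq_intros has_vector_derivative_real_field)
  have FTC: "((\<lambda>t. 2 * pi * Im (Ln (1 - of_real r * e t))) has_integral Re (P (r * e x)) - Re (P r)) {0..x}"
    if r: "0 < r" "r < 1" for r
  proof -
    have "((\<lambda>t. P (r * e t)) has_vector_derivative - 2 * of_real pi * \<i> * Ln (1 - of_real r * e t)) (at t within {0..x})" for t
    proof -
      have "norm (r * e t) < 1" using r by (simp add: norm_mult ne)
      note D = dP[OF this] and Z = dPz[OF this]
      have "((\<lambda>t. of_real r * e t) has_vector_derivative of_real r * (2 * of_real pi * \<i> * e t)) (at t within {0..x})"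
        by (intro has_vector_derivative_mult_right de)
      from field_vector_diff_chain_within[OF this has_field_derivative_at_within[OF D]]
      have "((\<lambda>t. P (r * e t)) has_vector_derivative (of_real r * (2 * of_real pi * \<i> * e t)) * (\<Sum>n. diffs c n * (r * e t) ^ n)) (at t within {0..x})"
        by (simp add: o_def)
      also have "(of_real r * (2 * of_real pi * \<i> * e t)) * (\<Sum>n. diffs c n * (r * e t) ^ n) =
          2 * of_real pi * \<i> * (of_real r * e t * (\<Sum>n. diffs c n * (r * e t) ^ n))" by (simp add: algebra_simps)
      also note Z
      finally show ?thesis by simp
    qed
    hence "((\<lambda>t. - 2 * of_real pi * \<i> * Ln (1 - of_real r * e t)) has_integral P (r * e x) - P (r * e 0)) {0..x}"
      using x by (intro fundamental_theorem_of_calculus) auto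
    from has_integral_Re[OF this] show ?thesis by (simp add: e_def)
  qed
  \<comment> \<open>At t = 0 and t = 1 the point \<open>e t\<close> is 1, and
    \<open>Ln (1 - r)\<close> is real for every r < 1; hence the pointwise limit there is 0 and not
    the sawtooth value. The two points are discarded later as a finite exceptional set.\<close>
  define g where "g = (\<lambda>t. if t = 0 \<or> t = 1 then 0 else 2 * pi * (pi * t - pi/2))"
  define rr where "rr = (\<lambda>n. 1 - 1 / real (Suc (Suc n)))"
  have rr: "0 < rr n" "rr n < 1" for n by (auto simp: rr_def field_simps)
  have rra: "\<bar>rr n\<bar> < 1" for n using rr[of n] by auto
  have rrlim: "rr \<longlonglongrightarrow> 1"
    unfolding rr_def by real_asymp
  have Lne: "Im (Ln (1 - e t)) = pi * t - pi/2" "Re (1 - e t) > 0" if t: "0 < t" "t < 1" for t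
  proof -
    have s: "sin (pi * t) > 0" using t by (intro sin_gt_zero) (auto simp: field_simps)
    have dbl: "2 * pi * t = 2 * (pi * t)" by simp
    have "e t = cis (2 * (pi * t))" by (simp add: e_def cis_conv_exp algebra_simps)
    \<comment> \<open>Half-angle form of the chord from \<open>e t\<close> to 1. For 0 < t < 1 its
      angle lies strictly between -\<pi>/2 and \<pi>/2, so the principal logarithm reads it
      off.\<close>
    hence E: "1 - e t = complex_of_real (2 * sin (pi * t)) * exp (\<i> * of_real (pi * t - pi/2))"
      unfolding cis_conv_exp[symmetric]
      by (auto simp: complex_eq_iff cos_double_sin sin_double cos_diff sin_diff power2_eq_square)
    have "1 - e t = exp (Complex (ln (2 * sin (pi * t))) (pi * t - pi/2))"
      unfolding E cis_conv_exp[symmetric] using s by (simp add: exp_eq_polar)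
    moreover have "Ln (exp (Complex (ln (2 * sin (pi * t))) (pi * t - pi/2))) = Complex (ln (2 * sin (pi * t))) (pi * t - pi/2)"
    proof (rule Ln_exp)
      have "0 < pi * t" "pi * t < pi" using t by auto
      thus "- pi < Im (Complex (ln (2 * sin (pi * t))) (pi * t - pi/2))" "Im (Complex (ln (2 * sin (pi * t))) (pi * t - pi/2)) \<le> pi"
        unfolding complex.sel by linarith+
    qed
    ultimately show "Im (Ln (1 - e t)) = pi * t - pi/2" by simp
    show "Re (1 - e t) > 0"
      unfolding E using s t by (simp add: Re_exp cos_diff)
  qed
  have lim: "(\<lambda>n. Re (P (rr n * e x)) - Re (P (rr n))) \<longlonglongrightarrow> integral {0..x} g"
  proof -
    have "(\<lambda>n. integral {0..x} (\<lambda>t. 2 * pi * Im (Ln (1 - of_real (rr n) * e t)))) \<longlonglongrightarrow> integral {0..x} g"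
    proof (rule dominated_convergence(2))
      show "(\<lambda>t. 2 * pi * Im (Ln (1 - of_real (rr n) * e t))) integrable_on {0..x}" for n
        using FTC[OF rr] by blast
      show "(\<lambda>t::real. 2 * pi * pi) integrable_on {0..x}" by (rule integrable_const_ivl)
      have Im_le: "\<bar>Im (Ln (1 - of_real (rr n) * e t))\<bar> \<le> pi" for n t
      proof -
        have "norm (rr n * e t) < 1" using rr[of n] by (simp add: norm_mult ne)
        hence "1 - rr n * e t \<noteq> 0" by auto
        from Im_Ln_le_pi[OF this] mpi_less_Im_Ln[OF this] show ?thesis by simp
      qed
      show "norm (2 * pi * Im (Ln (1 - of_real (rr n) * e t))) \<le> 2 * pi * pi" for n t
        using Im_le[of n t] by (simp add: abs_mult)
      fix t assume t: "t \<in> {0..x}"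
      show "(\<lambda>n. 2 * pi * Im (Ln (1 - of_real (rr n) * e t))) \<longlonglongrightarrow> g t"
      proof (cases "t = 0 \<or> t = 1")
        case True
        hence "e t = 1" by (auto simp: e_def)
        moreover have "Im (Ln (1 - complex_of_real (rr n))) = 0" for n
          using Ln_of_real[of "1 - rr n"] rr[of n] by (simp)
        ultimately show ?thesis using True by (simp add: g_def)
      next
        case False
        with t x have t: "0 < t" "t < 1" by auto
        have "1 - e t \<notin> \<real>\<^sub>\<le>\<^sub>0" using Lne(2)[OF t] by (auto simp: complex_nonpos_Reals_iff)
        hence "(\<lambda>n. 2 * pi * Im (Ln (1 - of_real (rr n) * e t))) \<longlonglongrightarrow> 2 * pi * Im (Ln (1 - of_real 1 * e t))"
          by (intro tendsto_intros rrlim) auto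
        thus ?thesis using Lne[OF t] False by (simp add: g_def)
      qed
    qed
    thus ?thesis unfolding integral_unique[OF FTC[OF rr]] .
  qed
  have "(\<lambda>n. Re (P (rr n * e x)) - Re (P (rr n))) \<longlonglongrightarrow> Re (P (of_real 1 * e x)) - Re (P (of_real 1))"
    by (intro tendsto_intros continuous_on_tendsto_compose[OF contP] rrlim)
       (use rra in \<open>auto simp: norm_mult ne intro!: less_imp_le always_eventually\<close>)
  from LIMSEQ_unique[OF this lim] have 1: "Re (P (e x)) = Re (P 1) + integral {0..x} g" by simp
  have "((\<lambda>t. 2 * pi * (pi * t - pi/2)) has_integral (pi\<^sup>2 * (x\<^sup>2 - x) - pi\<^sup>2 * (0\<^sup>2 - 0))) {0..x}"
    using x by (intro fundamental_theorem_of_calculus)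
      (auto intro!: derivative_eq_intros simp: has_real_derivative_iff_has_vector_derivative[symmetric] power2_eq_square algebra_simps)
  hence "(g has_integral (pi\<^sup>2 * (x\<^sup>2 - x))) {0..x}"
    by (intro has_integral_spike_finite[of "{0,1}" _ g "\<lambda>t. 2 * pi * (pi * t - pi/2)"]) (auto simp: g_def)
  hence 2: "integral {0..x} g = pi\<^sup>2 * (x\<^sup>2 - x)" by (rule integral_unique)
  have P1: "(\<lambda>n. Re (c (Suc n) * z ^ Suc n)) sums Re (P z)" if "norm z \<le> 1" for z
  proof -
    have "(\<lambda>n. c n * z ^ n) sums P z" unfolding P_def using sm[OF that] by (rule summable_sums)
    hence "(\<lambda>n. c (Suc n) * z ^ Suc n) sums P z" by (subst sums_Suc_iff) (simp add: c_def)
    thus ?thesis by (rule sums_Re)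
  qed
  have ee: "e x ^ n = cis (2 * pi * real n * x)" for n
    by (simp add: e_def cis_conv_exp exp_of_nat_mult[symmetric] algebra_simps)
  have "(\<lambda>n. Re (c (Suc n) * 1 ^ Suc n)) sums (pi\<^sup>2 / 6)"
    unfolding cS using inverse_squares_sums by (simp add: add.commute)
  hence P1': "Re (P 1) = pi\<^sup>2 / 6"
    by (intro sums_unique2[OF P1[of 1]]) auto
  have "Re (c (Suc n) * e x ^ Suc n) = cos (2 * pi * real (Suc n) * x) / (real (Suc n))\<^sup>2" for n
    unfolding ee cS by simp
  hence "(\<lambda>m. cos (2 * pi * real (Suc m) * x) / (real (Suc m))\<^sup>2) sums Re (P (e x))"
    using P1[of "e x"] by (simp add: ne)
  also have "Re (P (e x)) = pi\<^sup>2 * (x\<^sup>2 - x + 1/6)"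
    unfolding 1 2 P1' by (simp add: algebra_simps)
  finally show ?thesis .
qed

section \<open>Unordered sums over the integers\<close>

text \<open>An unordered sum needs absolute summability in addition to countable additivity. It is
  obtained by bounding the finite sums of integrals of the norm; \<open>int_decode\<close> only
  supplies an enumeration of the intervals.\<close>

lemma sum_unit_intervals:
  fixes G :: "real \<Rightarrow> 'b :: {banach, second_countable_topology}"
  assumes G: "integrable lborel G"
  shows "((\<lambda>n::int. LINT x:{of_int n..<of_int n + 1}|lborel. G x) has_sum (LINT x|lborel. G x)) UNIV"
proof -
  define A where "A = (\<lambda>i. {real_of_int (int_decode i)..<of_int (int_decode i) + 1})"
  have U: "(\<Union>i. A i) = UNIV"
  proof -
    have "x \<in> A (int_encode \<lfloor>x\<rfloor>)" for x by (auto simp: A_def)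
    thus ?thesis by blast
  qed
  have disj: "A i \<inter> A j = {}" if "i \<noteq> j" for i j
  proof -
    have "int_decode i \<noteq> int_decode j" using that by (metis int_decode_inverse)
    moreover have "\<lfloor>x\<rfloor> = int_decode i" if "x \<in> A i" for x i
      using that by (auto simp: A_def floor_unique)
    ultimately show ?thesis by (metis disjoint_iff)
  qed
  have *: "(LINT x|lborel. H x) = (\<Sum>i. (LINT x:(A i)|lborel. H x))" "summable (\<lambda>i. norm (LINT x:(A i)|lborel. H x))"
    if "integrable lborel H" for H :: "real \<Rightarrow> 'c :: {banach, second_countable_topology}"
  proof -
    have meas: "A i \<in> sets lborel" for i by (simp add: A_def)
    have H': "set_integrable lborel (\<Union>i. A i) H" using that by (simp add: U set_integrable_def)
    show "(LINT x|lborel. H x) = (\<Sum>i. (LINT x:(A i)|lborel. H x))"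
      using lebesgue_integral_countable_add[OF meas disj H'] by (simp add: U set_lebesgue_integral_def)
    have int: "set_integrable lborel (A i) (\<lambda>x. norm (H x))" for i
      by (rule set_integrable_norm, rule set_integrable_subset[OF H' meas]) auto
    have s: "summable (\<lambda>i. LINT x:(A i)|lborel. norm (H x))"
    proof (rule bounded_imp_summable)
      fix m
      show "0 \<le> (LINT x:(A m)|lborel. norm (H x))"
        unfolding set_lebesgue_integral_def by (rule Bochner_Integration.integral_nonneg) auto
      have "(\<Sum>i\<le>m. LINT x:(A i)|lborel. norm (H x)) = (LINT x:(\<Union>i\<in>{..m}. A i)|lborel. norm (H x))"
        by (rule set_integral_finite_Union[symmetric]) (use disj int in \<open>auto simp: disjoint_family_on_def A_def\<close>)
      also have "\<dots> \<le> (LINT x|lborel. norm (H x))"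
        unfolding set_lebesgue_integral_def using that
        by (intro integral_mono integrable_norm integrable_mult_indicator)
           (auto simp: A_def indicator_def)
      finally show "(\<Sum>i\<le>m. LINT x:(A i)|lborel. norm (H x)) \<le> (LINT x|lborel. norm (H x))" .
    qed
    show "summable (\<lambda>i. norm (LINT x:(A i)|lborel. H x))"
    proof (rule summable_comparison_test'[OF s])
      fix i
      have "set_integrable lborel (A i) H"
        by (rule set_integrable_subset[OF H' meas]) auto
      thus "norm (norm (LINT x:A i|lborel. H x)) \<le> (LINT x:A i|lborel. norm (H x))"
        by (simp add: set_integral_norm_bound)
    qed
  qed
  have "((\<lambda>i. LINT x:(A i)|lborel. G x) has_sum (LINT x|lborel. G x)) UNIV"
    unfolding *(1)[OF G] using *(2)[OF G]
    by (intro norm_summable_imp_has_sum summable_sums summable_norm_cancel[OF *(2)[OF G]])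
  thus ?thesis
    unfolding A_def
    by (subst has_sum_reindex_bij_betw[OF bij_int_decode, symmetric]) (simp add: o_def)
qed

lemma abs_summable_on_int:
  fixes f :: "int \<Rightarrow> 'b :: banach"
  assumes "summable (\<lambda>n. norm (f (int n)))" "summable (\<lambda>n. norm (f (- int n)))"
  shows "(\<lambda>n. norm (f n)) summable_on UNIV"
proof -
  have 1: "(\<lambda>x. norm (f x)) summable_on range int"
    using assms(1) by (subst summable_on_reindex) (auto simp: o_def intro!: norm_summable_imp_summable_on)
  have 2: "(\<lambda>x. norm (f x)) summable_on range (\<lambda>n. - int n)"
    using assms(2) by (subst summable_on_reindex) (auto simp: o_def inj_on_def intro!: norm_summable_imp_summable_on)
  have "range int \<union> range (\<lambda>n. - int n) = UNIV"
    by (metis (mono_tags, lifting) UNIV_eq_I UnCI int_cases2 rangeI)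
  with summable_on_union[OF 1 2] show ?thesis by simp
qed

lemma abs_summable_on_int_quadratic:
  fixes f :: "int \<Rightarrow> 'b :: banach"
  assumes "\<And>n. norm (f n) \<le> C / (1 + (of_int n)\<^sup>2)"
  shows "(\<lambda>n. norm (f n)) summable_on UNIV"
proof -
  have "norm (f 0) \<le> C" using assms[of 0] by simp
  hence C: "C \<ge> 0" using norm_ge_zero order_trans by blast
  have *: "summable (\<lambda>n. C * inverse (real n ^ 2))"
    using inverse_power_summable[of 2, where 'a = real] by (intro summable_mult) auto
  have **: "C / (1 + (real n)\<^sup>2) \<le> C * inverse (real n ^ 2)" if "n > 0" for n
    unfolding divide_inverse using C that by (intro mult_left_mono le_imp_inverse_le) auto
  have A: "norm (f (int n)) \<le> C / (1 + (real n)\<^sup>2)" for n using assms[of "int n"] by simp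
  have "summable (\<lambda>n. norm (f (int n)))"
    by (rule summable_comparison_test_ev[OF _ *], rule eventually_mono[OF eventually_gt_at_top[of 0]])
       (use order_trans[OF A **] in simp)
  moreover have A': "norm (f (- int n)) \<le> C / (1 + (real n)\<^sup>2)" for n using assms[of "- int n"] by simp
  have "summable (\<lambda>n. norm (f (- int n)))"
    by (intro summable_comparison_test_ev[OF _ *], intro eventually_mono[OF eventually_gt_at_top[of 0]])
       (use order_trans[OF A' **] in simp)
  ultimately show ?thesis by (rule abs_summable_on_int)
qed

lemma has_sum_diff':
  fixes f g :: "'a \<Rightarrow> 'b :: topological_ab_group_add"
  assumes "(f has_sum a) A" "(g has_sum b) A"
  shows "((\<lambda>x. f x - g x) has_sum (a - b)) A"
  using has_sum_add[OF assms(1), of "\<lambda>x. - g x" "- b"] has_sum_uminus[where f = g and a = "- b" and A = A] assms(2) by simp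

text \<open>Pairing m with -m turns the unordered sum into an ordinary series, the form in which
  cosine and theta series deliver their values.\<close>

lemma infsum_int_sums:
  fixes f :: "int \<Rightarrow> 'b :: banach"
  assumes "(\<lambda>n. norm (f n)) summable_on UNIV"
  shows "(\<lambda>m. f (int (Suc m)) + f (- int (Suc m))) sums (infsum f UNIV - f 0)"
proof -
  have s: "f summable_on A" for A
    using abs_summable_summable[OF assms] summable_on_subset_banach by blast
  have pos: "((\<lambda>m. f (int (Suc m))) has_sum infsum f {0<..}) UNIV"
  proof -
    have "bij_betw (\<lambda>m. int (Suc m)) UNIV {0<..}"
      by (rule bij_betwI[where g = "\<lambda>n. nat (n - 1)"]) auto
    from has_sum_reindex_bij_betw[OF this, of f "infsum f {0<..}"] s show ?thesis by (simp add: has_sum_infsum)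
  qed
  have neg: "((\<lambda>m. f (- int (Suc m))) has_sum infsum f {..<0}) UNIV"
  proof -
    have "bij_betw (\<lambda>m. - int (Suc m)) UNIV {..<0}"
      by (rule bij_betwI[where g = "\<lambda>n. nat (- n - 1)"]) auto
    from has_sum_reindex_bij_betw[OF this, of f "infsum f {..<0}"] s show ?thesis by (simp add: has_sum_infsum)
  qed
  have "infsum f UNIV = infsum f ({0<..} \<union> {..<0} \<union> {0})" by (rule arg_cong[where f = "infsum f"]) auto
  also have "\<dots> = infsum f {0<..} + infsum f {..<0} + f 0"
    by (subst infsum_Un_disjoint; (subst infsum_Un_disjoint)?) (auto intro: s)
  finally show ?thesis
    using has_sum_imp_sums[OF has_sum_add[OF pos neg]] by simp
qed

section \<open>Fourier integrals and Poisson summation\<close>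

text \<open>Angular frequency without a normalising factor: d/dx becomes multiplication by
  \<open>\<i> * \<nu>\<close>, and the frequencies dual to the integers are
  \<open>2 * pi * n\<close>.\<close>

definition fourier :: "(real \<Rightarrow> complex) \<Rightarrow> real \<Rightarrow> complex" where
  "fourier F \<nu> = (LINT x|lborel. F x * exp (- (\<i> * of_real (\<nu> * x))))"

text \<open>One decay class serves for integrability and for the boundary terms of integration by
  parts. The kernels of the Eisenstein series and the Gaussians of the theta function belong to it
  together with their first two derivatives.\<close>

lemma quadratic_decay:
  fixes F :: "real \<Rightarrow> complex"
  assumes b: "\<And>x. norm (F x) \<le> C / (1 + x\<^sup>2)"
  shows quadratic_decay_integrable: "continuous_on UNIV F \<Longrightarrow> integrable lborel F"
    and quadratic_decay_at_top: "(F \<longlongrightarrow> 0) at_top"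
    and quadratic_decay_at_bot: "(F \<longlongrightarrow> 0) at_bot"
proof -
  have g: "integrable lborel (\<lambda>x. C / (1 + x\<^sup>2))"
    using integrable_mult_right[OF integrable_inverse_1_plus_square_lborel, of C] by simp
  show "integrable lborel F" if "continuous_on UNIV F"
    by (rule Bochner_Integration.integrable_bound[OF g])
       (use that b in \<open>auto intro!: borel_measurable_continuous_onI AE_I2 order_trans[OF b] abs_ge_self simp del: abs_divide\<close>)
  show "(F \<longlongrightarrow> 0) at_top"
    by (rule Lim_null_comparison[OF always_eventually, of _ "\<lambda>x. C / (1 + x\<^sup>2)"]) (use b in auto, real_asymp)
  show "(F \<longlongrightarrow> 0) at_bot"
    by (rule Lim_null_comparison[OF always_eventually, of _ "\<lambda>x. C / (1 + x\<^sup>2)"]) (use b in auto, real_asymp)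
qed

lemma fourier_derivative:
  assumes d: "\<And>x. (F has_vector_derivative F1 x) (at x)" and c: "continuous_on UNIV F1"
    and b: "\<And>x. norm (F x) \<le> C / (1 + x\<^sup>2)" and b1: "\<And>x. norm (F1 x) \<le> C / (1 + x\<^sup>2)"
  shows "fourier F1 \<nu> = \<i> * of_real \<nu> * fourier F \<nu>"
proof -
  have c0: "continuous_on UNIV F"
    using d by (auto intro!: continuous_at_imp_continuous_on has_vector_derivative_continuous)
  let ?e = "\<lambda>x. exp (- (\<i> * of_real (\<nu> * x)))"
  have ne: "norm (?e x) = 1" for x by (simp add: norm_exp_eq_Re)
  have de: "(?e has_vector_derivative (- \<i> * \<nu> * ?e x)) (at x)" for x
    by (auto intro!: derivative_eq_intros has_vector_derivative_real_field)
  have i0: "integrable lborel (\<lambda>x. F x * ?e x)"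
    by (rule quadratic_decay_integrable) (use b ne in \<open>auto simp: norm_mult intro!: continuous_intros c0\<close>)
  have i1: "integrable lborel (\<lambda>x. F1 x * ?e x)"
    by (rule quadratic_decay_integrable) (use b1 ne in \<open>auto simp: norm_mult intro!: continuous_intros c\<close>)
  have "(LINT x|lborel. F1 x * ?e x + - (\<i> * \<nu>) * (F x * ?e x)) = 0 - 0"
  proof (rule integral_derivative_lborel[where f = "\<lambda>x. F x * ?e x"])
    fix x show "((\<lambda>x. F x * ?e x) has_vector_derivative F1 x * ?e x + - (\<i> * \<nu>) * (F x * ?e x)) (at x)"
      using has_vector_derivative_mult[OF d de, of x] by (simp add: algebra_simps)
  next
    show "continuous_on UNIV (\<lambda>x. F1 x * ?e x + - (\<i> * \<nu>) * (F x * ?e x))"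
      by (intro continuous_intros c c0)
    show "complex_integrable lborel (\<lambda>x. F1 x * ?e x + - (\<i> * \<nu>) * (F x * ?e x))"
      using i0 i1 by (intro Bochner_Integration.integrable_add integrable_mult_right)
    have "norm (F x * ?e x) \<le> C / (1 + x\<^sup>2)" for x
      using b ne by (simp add: norm_mult)
    thus "((\<lambda>x. F x * ?e x) \<longlongrightarrow> 0) at_bot" "((\<lambda>x. F x * ?e x) \<longlongrightarrow> 0) at_top"
      by (rule quadratic_decay_at_bot, rule quadratic_decay_at_top)
  qed
  thus ?thesis unfolding fourier_def
    by (subst (asm) Bochner_Integration.integral_add[OF i1 integrable_mult_right[OF i0]], subst (asm) integral_mult_right_zero) simp
qed

text \<open>Two integrations by parts against B(t) = t^2 - t + 1/6. The identity B'' = 2 produces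
  the term 2F, B equals 1/6 at both ends, and B' equals -1 and 1 there, so the endpoint values of F
  add up. Half-open intervals are used because their integer translates tile the line.\<close>

lemma euler_maclaurin_unit:
  fixes F F1 F2 :: "real \<Rightarrow> complex"
  assumes d0: "\<And>x. (F has_vector_derivative F1 x) (at x)" and d1: "\<And>x. (F1 has_vector_derivative F2 x) (at x)"
    and c: "continuous_on UNIV F2"
  shows "(LINT x:{a..<a+1}|lborel. F2 x * of_real ((x - a)\<^sup>2 - (x - a) + 1/6) - 2 * F x) =
    (F1 (a + 1) - F1 a) / 6 - F (a + 1) - F a"
proof -
  have c0: "continuous_on A F" for A
    using d0 by (auto intro!: continuous_at_imp_continuous_on has_vector_derivative_continuous)
  let ?G = "\<lambda>x. F2 x * of_real ((x - a)\<^sup>2 - (x - a) + 1/6) - 2 * F x"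
  let ?f = "\<lambda>x. F1 x * of_real ((x - a)\<^sup>2 - (x - a) + 1/6) - F x * of_real (2 * (x - a) - 1)"
  have "(LINT x:{a..<a+1}|lborel. ?G x) = (LINT x:{a..a+1}|lborel. ?G x)"
    by (rule set_integral_discrete_difference[where X = "{a+1}"]) auto
  also have "\<dots> = ?f (a+1) - ?f a"
  proof (rule integral_derivative_lborel_interval(2))
    fix x
    have A: "((\<lambda>x. of_real ((x - a)\<^sup>2 - (x - a) + 1/6)) has_vector_derivative (of_real (2 * (x - a) - 1) :: complex)) (at x)"
      by (intro has_vector_derivative_of_real) (auto intro!: derivative_eq_intros)
    have B: "((\<lambda>x. of_real (2 * (x - a) - 1)) has_vector_derivative (of_real 2 :: complex)) (at x)"
      by (intro has_vector_derivative_of_real) (auto intro!: derivative_eq_intros)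
    show "(?f has_vector_derivative ?G x) (at x within {a..a+1})"
      by (rule has_vector_derivative_at_within)
         (rule has_vector_derivative_eq_rhs, rule has_vector_derivative_diff[OF has_vector_derivative_mult[OF d1 A] has_vector_derivative_mult[OF d0 B]], simp add: algebra_simps)
  next
    show "continuous_on {a..a + 1} ?G"
      by (intro continuous_intros c0 continuous_on_subset[OF c]) auto
  qed simp
  also have "\<dots> = (F1 (a + 1) - F1 a) / 6 - F (a + 1) - F a" by (simp add: field_simps)
  finally show ?thesis .
qed

text \<open>Summed over all unit intervals, the Euler-Maclaurin identity loses its \<open>F1\<close>
  terms by translation invariance and expresses the sum of \<open>F\<close> through the integral of
  \<open>F\<close> and that of \<open>F2\<close> times the periodic Bernoulli function. The cosine
  series of the latter has coefficients of order 1/m^2, so it may be integrated termwise. Each term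
  is a value of the transform of \<open>F2\<close>, which is -\<nu>^2 times that of
  \<open>F\<close>, and \<nu>^2 cancels the coefficient. In this way no pointwise convergence of the
  Fourier series of a periodisation is involved.\<close>

lemma poisson_summation:
  fixes F F1 F2 :: "real \<Rightarrow> complex"
  assumes d0: "\<And>x. (F has_vector_derivative F1 x) (at x)" and d1: "\<And>x. (F1 has_vector_derivative F2 x) (at x)"
    and c2: "continuous_on UNIV F2"
    and b0: "\<And>x. norm (F x) \<le> C / (1 + x\<^sup>2)" and b1: "\<And>x. norm (F1 x) \<le> C / (1 + x\<^sup>2)"
    and b2: "\<And>x. norm (F2 x) \<le> C / (1 + x\<^sup>2)"
  shows poisson_bound: "\<nu>\<^sup>2 * norm (fourier F \<nu>) \<le> (LINT x|lborel. norm (F2 x))"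
    and poisson_abs_summable: "(\<lambda>n::int. norm (fourier F (2 * pi * of_int n))) summable_on UNIV"
    and poisson_infsum: "(\<Sum>\<^sub>\<infinity>n::int. F (of_int n)) = (\<Sum>\<^sub>\<infinity>n::int. fourier F (2 * pi * of_int n))"
proof -
  have c0: "continuous_on UNIV F"
    using d0 by (auto intro!: continuous_at_imp_continuous_on has_vector_derivative_continuous)
  have c1: "continuous_on UNIV F1"
    using d1 by (auto intro!: continuous_at_imp_continuous_on has_vector_derivative_continuous)
  have i0: "integrable lborel F" by (rule quadratic_decay_integrable[OF b0 c0])
  have i2: "integrable lborel F2" by (rule quadratic_decay_integrable[OF b2 c2])
  have f2: "fourier F2 \<nu> = - of_real (\<nu>\<^sup>2) * fourier F \<nu>" for \<nu>
    using fourier_derivative[OF d0 c1 b0 b1, of \<nu>] fourier_derivative[OF d1 c2 b1 b2, of \<nu>]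
    by (simp add: power2_eq_square algebra_simps)
  have bound: "\<nu>\<^sup>2 * norm (fourier F \<nu>) \<le> (LINT x|lborel. norm (F2 x))" for \<nu>
  proof -
    have "\<nu>\<^sup>2 * norm (fourier F \<nu>) = norm (fourier F2 \<nu>)" unfolding f2 norm_mult norm_minus_cancel norm_of_real by simp
    also have "\<dots> \<le> (LINT x|lborel. norm (F2 x * exp (- (\<i> * of_real (\<nu> * x)))))"
      unfolding fourier_def by (rule integral_norm_bound)
    finally show ?thesis by (simp add: norm_mult norm_exp_eq_Re)
  qed
  thus "\<nu>\<^sup>2 * norm (fourier F \<nu>) \<le> (LINT x|lborel. norm (F2 x))" for \<nu> .
  show summ: "(\<lambda>n::int. norm (fourier F (2 * pi * of_int n))) summable_on UNIV"
  \<comment> \<open>The first summand of C handles n \<noteq> 0, where 1 + n^2 <= (2 \<pi> n)^2; the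
    second handles n = 0.\<close>
  proof (rule abs_summable_on_int_quadratic[where C = "(LINT x|lborel. norm (F2 x)) + norm (fourier F 0)"])
    fix n :: int
    let ?K = "LINT x|lborel. norm (F2 x)"
    show "norm (fourier F (2 * pi * of_int n)) \<le> (?K + norm (fourier F 0)) / (1 + (of_int n)\<^sup>2)"
    proof (cases "n = 0")
      case True thus ?thesis by (simp add: Bochner_Integration.integral_nonneg)
    next
      case False
      have "1 \<le> \<bar>n\<bar>" using False by simp
      hence "1 \<le> \<bar>real_of_int n\<bar>" by linarith
      hence n1: "1 \<le> (real_of_int n)\<^sup>2" by (metis abs_1 abs_le_square_iff one_power2)
      have p: "1 * 1 \<le> pi * pi" using pi_gt3 by (intro mult_mono) auto
      have "1 + (real_of_int n)\<^sup>2 \<le> 4 * (pi * pi) * (real_of_int n)\<^sup>2"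
        using n1 mult_right_mono[OF p, of "(real_of_int n)\<^sup>2"] by simp
      also have "\<dots> = (2 * pi * of_int n)\<^sup>2" by (simp add: power2_eq_square)
      finally have "(1 + (real_of_int n)\<^sup>2) * norm (fourier F (2 * pi * of_int n)) \<le>
         (2 * pi * of_int n)\<^sup>2 * norm (fourier F (2 * pi * of_int n))"
        by (intro mult_right_mono) auto
      also have "\<dots> \<le> ?K" by (rule bound)
      also have "\<dots> \<le> ?K + norm (fourier F 0)" by simp
      finally show ?thesis by (simp add: field_simps add_pos_nonneg)
    qed
  qed
  define b where "b = (\<lambda>x::real. (frac x)\<^sup>2 - frac x + 1/6)"
  have bb: "\<bar>b x\<bar> \<le> 1" for x
  proof -
    have "0 \<le> frac x" "frac x < 1" by (auto simp: frac_lt_1)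
    moreover from this have "(frac x)\<^sup>2 \<le> frac x" "0 \<le> (frac x)\<^sup>2" by (auto simp: power2_eq_square mult_left_le)
    ultimately show ?thesis unfolding b_def by linarith
  qed
  have bmeas: "b \<in> borel_measurable lborel" unfolding b_def frac_def by measurable
  have ib: "integrable lborel (\<lambda>x. F2 x * of_real (b x))"
    by (rule Bochner_Integration.integrable_bound[OF i2])
       (use bmeas i2 bb in \<open>auto simp: norm_mult mult_left_le\<close>)
  have iG: "integrable lborel (\<lambda>x. F2 x * of_real (b x) - 2 * F x)"
    by (intro Bochner_Integration.integrable_diff ib integrable_mult_right i0)
  have F_s: "(\<lambda>n::int. F (of_int n)) summable_on UNIV"
    by (rule abs_summable_summable, rule abs_summable_on_int_quadratic[OF b0])
  have F1_s: "(\<lambda>n::int. F1 (of_int n)) summable_on UNIV"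
    by (rule abs_summable_summable, rule abs_summable_on_int_quadratic[OF b1])
  have bij: "bij_betw (\<lambda>n::int. n + 1) UNIV UNIV" by (rule bij_betwI[where g = "\<lambda>n. n - 1"]) auto
  have hF: "((\<lambda>n::int. F (of_int n + 1)) has_sum (\<Sum>\<^sub>\<infinity>n::int. F (of_int n))) UNIV"
    using has_sum_reindex_bij_betw[OF bij, of "\<lambda>n. F (of_int n)"] has_sum_infsum[OF F_s] by simp
  have hF1: "((\<lambda>n::int. F1 (of_int n + 1)) has_sum (\<Sum>\<^sub>\<infinity>n::int. F1 (of_int n))) UNIV"
    using has_sum_reindex_bij_betw[OF bij, of "\<lambda>n. F1 (of_int n)"] has_sum_infsum[OF F1_s] by simp
  have hs: "((\<lambda>n::int. (F1 (of_int n + 1) - F1 (of_int n)) * (1/6) - F (of_int n + 1) - F (of_int n)) has_sum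
     ((\<Sum>\<^sub>\<infinity>n::int. F1 (of_int n)) - (\<Sum>\<^sub>\<infinity>n::int. F1 (of_int n))) * (1/6) - (\<Sum>\<^sub>\<infinity>n::int. F (of_int n)) - (\<Sum>\<^sub>\<infinity>n::int. F (of_int n))) UNIV"
    by (intro has_sum_diff' has_sum_cmult_left hF hF1 has_sum_infsum F_s F1_s)
  have E: "(LINT x:{of_int n..<of_int n + 1}|lborel. F2 x * of_real (b x) - 2 * F x) =
      (F1 (of_int n + 1) - F1 (of_int n)) * (1/6) - F (of_int n + 1) - F (of_int n)" for n :: int
  proof -
    have fr: "frac x = x - of_int n" if "x \<in> {of_int n..<of_int n + 1}" for x
    proof -
      have "\<lfloor>x\<rfloor> = n" using that by (auto simp: floor_unique)
      thus ?thesis by (simp add: frac_def)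
    qed
    have "(LINT x:{of_int n..<of_int n + 1}|lborel. F2 x * of_real (b x) - 2 * F x) =
       (LINT x:{of_int n..<of_int n + 1}|lborel. F2 x * of_real ((x - of_int n)\<^sup>2 - (x - of_int n) + 1/6) - 2 * F x)"
    proof (rule set_lebesgue_integral_cong)
      show "\<forall>x. x \<in> {real_of_int n..<real_of_int n + 1} \<longrightarrow> F2 x * of_real (b x) - 2 * F x =
          F2 x * of_real ((x - of_int n)\<^sup>2 - (x - of_int n) + 1/6) - 2 * F x"
        unfolding b_def by (intro allI impI) (simp only: fr)
    qed simp
    thus ?thesis using euler_maclaurin_unit[OF d0 d1 c2, of "of_int n"] by simp
  qed
  have "(LINT x|lborel. F2 x * of_real (b x) - 2 * F x) = - 2 * (\<Sum>\<^sub>\<infinity>n::int. F (of_int n))"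
    using has_sum_unique[OF sum_unit_intervals[OF iG, unfolded E] hs] by simp
  also have "(LINT x|lborel. F2 x * of_real (b x) - 2 * F x) = (LINT x|lborel. F2 x * of_real (b x)) - 2 * fourier F 0"
    using ib i0 by (simp add: fourier_def)
  finally have EM: "(LINT x|lborel. F2 x * of_real (b x)) - 2 * fourier F 0 = - 2 * (\<Sum>\<^sub>\<infinity>n::int. F (of_int n))" .
  \<comment> \<open>Term m of the cosine series of \<open>b\<close>, multiplied by
    \<open>F2\<close>; dividing the identity on the circle by \<pi>^2 gives the coefficient 1/(\<pi>
    (m+1))^2.\<close>
  define t where "t = (\<lambda>m x. F2 x * of_real (cos (2 * pi * real (Suc m) * x) / (pi * real (Suc m))\<^sup>2))"
  have ti: "integrable lborel (t m)" for m
  proof -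
    have "integrable lborel (\<lambda>x. of_real (1 / (pi * real (Suc m))\<^sup>2) * (F2 x * of_real (cos (2 * pi * real (Suc m) * x))))"
      by (rule integrable_mult_right, rule Bochner_Integration.integrable_bound[OF i2])
         (use i2 in \<open>auto simp: norm_mult mult_left_le\<close>)
    also have "(\<lambda>x. of_real (1 / (pi * real (Suc m))\<^sup>2) * (F2 x * of_real (cos (2 * pi * real (Suc m) * x)))) = t m"
      by (simp add: t_def fun_eq_iff)
    finally show ?thesis .
  qed
  have isq: "summable (\<lambda>n. 1 / (real n + 1)\<^sup>2)"
    using sums_summable[OF inverse_squares_sums] by (simp add: add.commute)
  have "(\<lambda>m. 1 / (pi * real (Suc m))\<^sup>2) = (\<lambda>m. 1 / pi\<^sup>2 * (1 / (real m + 1)\<^sup>2))"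
    by (simp add: fun_eq_iff power_mult_distrib add.commute)
  hence sq: "summable (\<lambda>m. 1 / (pi * real (Suc m))\<^sup>2)"
    using summable_mult[OF isq, of "1 / pi\<^sup>2"] by (simp only:)
  have nt: "norm (t m x) \<le> norm (F2 x) * (1 / (pi * real (Suc m))\<^sup>2)" for m x
    unfolding t_def norm_mult norm_of_real
    by (intro mult_left_mono) (auto simp: abs_divide intro!: divide_right_mono)
  have ts: "(\<lambda>m. t m x) sums (F2 x * of_real (b x))" for x
  proof -
    have "(\<lambda>m. cos (2 * pi * real (Suc m) * frac x) / (real (Suc m))\<^sup>2 * (1/pi\<^sup>2)) sums (pi\<^sup>2 * ((frac x)\<^sup>2 - frac x + 1/6) * (1/pi\<^sup>2))"
      using frac_lt_1[of x] by (intro sums_mult2 dilog_circle) auto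
    also have "pi\<^sup>2 * ((frac x)\<^sup>2 - frac x + 1/6) * (1/pi\<^sup>2) = b x" by (simp add: b_def)
    also have "(\<lambda>m. cos (2 * pi * real (Suc m) * frac x) / (real (Suc m))\<^sup>2 * (1/pi\<^sup>2)) = (\<lambda>m. cos (2 * pi * real (Suc m) * x) / (pi * real (Suc m))\<^sup>2)"
    proof
      fix m
      have "2 * pi * real (Suc m) * x = 2 * pi * real (Suc m) * frac x + 2 * pi * of_int (int (Suc m) * \<lfloor>x\<rfloor>)"
        by (simp add: frac_def algebra_simps)
      hence "cos (2 * pi * real (Suc m) * x) = cos (2 * pi * real (Suc m) * frac x)"
        by (simp only: cos_add cos_int_2pin sin_int_2pin mult_1_right mult_zero_right diff_zero)
      thus "cos (2 * pi * real (Suc m) * frac x) / (real (Suc m))\<^sup>2 * (1/pi\<^sup>2) = cos (2 * pi * real (Suc m) * x) / (pi * real (Suc m))\<^sup>2"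
        by (simp add: power_mult_distrib)
    qed
    finally show ?thesis unfolding t_def by (intro sums_mult sums_of_real)
  qed
  have "(\<lambda>m. LINT x|lborel. t m x) sums (LINT x|lborel. (\<Sum>m. t m x))"
  proof (rule sums_integral[OF ti])
    show "AE x in lborel. summable (\<lambda>m. norm (t m x))"
      by (intro AE_I2 summable_comparison_test'[OF summable_mult[OF sq]]) (use nt in auto)
    show "summable (\<lambda>m. LINT x|lborel. norm (t m x))"
    proof (rule summable_comparison_test'[OF summable_mult[OF sq]])
      fix m
      have "(LINT x|lborel. norm (t m x)) \<le> (LINT x|lborel. norm (F2 x) * (1 / (pi * real (Suc m))\<^sup>2))"
        using ti i2 nt by (intro integral_mono integrable_norm integrable_mult_left) auto
      thus "norm (LINT x|lborel. norm (t m x)) \<le> (LINT x|lborel. norm (F2 x)) * (1 / (pi * real (Suc m))\<^sup>2)"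
        by (simp add: Bochner_Integration.integral_nonneg)
    qed
  qed
  also have "(\<lambda>x. \<Sum>m. t m x) = (\<lambda>x. F2 x * of_real (b x))"
    using sums_unique[OF ts] by (simp add: fun_eq_iff)
  finally have S1: "(\<lambda>m. LINT x|lborel. t m x) sums (LINT x|lborel. F2 x * of_real (b x))" .
  have tm: "(LINT x|lborel. t m x) = - 2 * (fourier F (2 * pi * of_int (int (Suc m))) + fourier F (2 * pi * of_int (- int (Suc m))))" for m
  proof -
    define \<nu> where "\<nu> = 2 * pi * real (Suc m)"
    let ?e = "\<lambda>s x. F2 x * exp (- (\<i> * of_real (s * \<nu> * x)))"
    have ie: "integrable lborel (?e s)" for s
      by (rule quadratic_decay_integrable[of _ C]) (use b2 in \<open>auto simp: norm_mult norm_exp_eq_Re intro!: continuous_intros c2\<close>)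
    \<comment> \<open>With \<nu> = 2 \<pi> (m+1) the coefficient is 4/\<nu>^2, and the cosine
      contributes a factor 1/2 for each sign of the frequency.\<close>
    have "t m = (\<lambda>x. (2 / of_real (\<nu>\<^sup>2)) * (?e 1 x + ?e (-1) x))"
    proof
      fix x
      have "of_real (cos (\<nu> * x)) = (exp (\<i> * of_real (\<nu> * x)) + exp (- (\<i> * of_real (\<nu> * x)))) / (2::complex)"
        by (simp add: cos_of_real[symmetric] cos_exp_eq)
      moreover have "of_real (cos (2 * pi * real (Suc m) * x) / (pi * real (Suc m))\<^sup>2) = of_real (cos (\<nu> * x)) * (4 / of_real (\<nu>\<^sup>2) :: complex)"
        by (simp add: \<nu>_def power2_eq_square del: of_nat_Suc)
      ultimately have "t m x = F2 x * ((exp (\<i> * of_real (\<nu> * x)) + exp (- (\<i> * of_real (\<nu> * x)))) / 2 * (4 / of_real (\<nu>\<^sup>2)))"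
        unfolding t_def by (simp only:)
      also have "W * ((A + B) / 2 * (4 / V)) = 2 / V * (W * A + W * B)" for A B V W :: complex
        by (cases "V = 0") (simp_all add: field_simps)
      finally show "t m x = (2 / of_real (\<nu>\<^sup>2)) * (?e 1 x + ?e (-1) x)"
        by simp
    qed
    hence "(LINT x|lborel. t m x) = (2 / of_real (\<nu>\<^sup>2)) * ((LINT x|lborel. ?e 1 x) + (LINT x|lborel. ?e (-1) x))"
      by (simp only: integral_mult_right_zero Bochner_Integration.integral_add[OF ie ie])
    also have "\<dots> = (2 / of_real (\<nu>\<^sup>2)) * (fourier F2 \<nu> + fourier F2 (-\<nu>))"
      by (simp add: fourier_def)
    also have "\<dots> = - 2 * (fourier F \<nu> + fourier F (-\<nu>))"
    proof -
      have "\<nu> \<noteq> 0" by (simp add: \<nu>_def)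
      thus ?thesis unfolding f2 by (simp add: field_simps)
    qed
    also have "- \<nu> = 2 * pi * of_int (- int (Suc m))" by (simp add: \<nu>_def algebra_simps)
    finally show ?thesis by (simp add: \<nu>_def)
  qed
  have "(\<lambda>m. - 2 * (fourier F (2 * pi * of_int (int (Suc m))) + fourier F (2 * pi * of_int (- int (Suc m))))) sums
      (- 2 * ((\<Sum>\<^sub>\<infinity>n::int. fourier F (2 * pi * of_int n)) - fourier F (2 * pi * of_int 0)))"
    by (intro sums_mult infsum_int_sums[OF summ])
  from sums_unique2[OF this S1[unfolded tm]] EM
  show "(\<Sum>\<^sub>\<infinity>n::int. F (of_int n)) = (\<Sum>\<^sub>\<infinity>n::int. fourier F (2 * pi * of_int n))"
    by (simp add: algebra_simps)
qed

section \<open>The Fourier transform of the summand\<close>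

text \<open>Two separate principal powers rather than one power of a product: for Re y > 0 both
  bases avoid the negative real axis. The height y is complex so that holomorphy yields the
  derivatives in y, and Cauchy's inequality their bounds.\<close>

definition kern :: "complex \<Rightarrow> complex \<Rightarrow> complex \<Rightarrow> real \<Rightarrow> complex" where
  "kern a b y x = (of_real x + \<i> * y) powr (- a) * (of_real x - \<i> * y) powr (- b)"

definition kern_hat :: "complex \<Rightarrow> complex \<Rightarrow> real \<Rightarrow> complex \<Rightarrow> complex" where
  "kern_hat a b \<nu> y = fourier (kern a b y) \<nu>"

lemma kern_not_nonpos:
  assumes "Re y > 0"
  shows "of_real x + \<i> * y \<notin> \<real>\<^sub>\<le>\<^sub>0" "of_real x - \<i> * y \<notin> \<real>\<^sub>\<le>\<^sub>0" "of_real x + \<i> * y \<noteq> 0" "of_real x - \<i> * y \<noteq> 0"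
  using assms by (auto simp: complex_nonpos_Reals_iff complex_eq_iff)

text \<open>The modulus of w^c is exp(Re c ln |w| - Im c Arg w). Here ln |w| differs from ln t by at
  most ln K, and Arg w is at most \<pi> in modulus, so the constant depends on c and K
  alone.\<close>

lemma norm_powr_le:
  assumes w: "w \<noteq> 0" and K: "K \<ge> 1" and t: "t > 0" and b: "norm w \<le> K * t" "t \<le> K * norm w"
  shows "norm (w powr c) \<le> exp (\<bar>Re c\<bar> * ln K + \<bar>Im c\<bar> * pi) * t powr (Re c)"
proof -
  have nw: "norm w > 0" using w by simp
  have "ln (norm w) \<le> ln (K * t)" "ln t \<le> ln (K * norm w)" using b nw t K by auto
  hence "\<bar>ln (norm w) - ln t\<bar> \<le> ln K" using nw t K by (auto simp: ln_mult)
  hence "\<bar>Re c * (ln (norm w) - ln t)\<bar> \<le> \<bar>Re c\<bar> * ln K" unfolding abs_mult by (intro mult_left_mono) auto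
  moreover have "\<bar>Im (Ln w)\<bar> \<le> pi" using Im_Ln_le_pi[OF w] mpi_less_Im_Ln[OF w] by auto
  hence "\<bar>Im c * Im (Ln w)\<bar> \<le> \<bar>Im c\<bar> * pi" unfolding abs_mult by (intro mult_left_mono) auto
  moreover have "Re c * ln (norm w) = Re c * (ln (norm w) - ln t) + Re c * ln t" by (simp add: algebra_simps)
  ultimately have "Re c * ln (norm w) - Im c * Im (Ln w) \<le> \<bar>Re c\<bar> * ln K + \<bar>Im c\<bar> * pi + Re c * ln t" by linarith
  thus ?thesis using w t by (simp add: powr_def norm_exp_eq_Re Re_Ln exp_add[symmetric])
qed

text \<open>The bound has to be uniform for y near y0, since it is the majorant for differentiation
  under the integral. Both bases have modulus comparable to 1 + |x|, so the real parts of the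
  exponents add up to -Re(a + b) <= -2.\<close>

lemma kern_bound:
  assumes y0: "Re y0 > 0" and ab: "Re (a + b) \<ge> 2"
  obtains r C where "r > 0" "\<And>y. y \<in> ball y0 r \<Longrightarrow> Re y > 0"
    "\<And>y x. y \<in> ball y0 r \<Longrightarrow> norm (kern a b y x) \<le> C / (1 + x\<^sup>2)"
proof -
  define r where "r = Re y0 / 2"
  define R where "R = norm y0 + r"
  \<comment> \<open>One constant for both comparisons with 1 + |x|: the upper one costs 1 + R, the
    lower one 1 + (1 + R)/r, because both bases have modulus above r.\<close>
  define K where "K = 2 + R + (1 + R) / r"
  have r: "r > 0" using y0 by (simp add: r_def)
  have R: "R > 0" using r by (simp add: R_def add_nonneg_pos)
  have K: "K \<ge> 1" using r R by (simp add: K_def)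
  define E where "E = (\<lambda>c. exp (\<bar>Re c\<bar> * ln K + \<bar>Im c\<bar> * pi))"
  have pos: "Re y > r" if "y \<in> ball y0 r" for y
    using that abs_Re_le_cmod[of "y0 - y"] by (simp add: r_def dist_norm abs_if split: if_splits)
  have "norm (kern a b y x) \<le> (E (-a) * E (-b)) / (1 + x\<^sup>2)" if y: "y \<in> ball y0 r" for y x
  proof -
    let ?t = "1 + \<bar>x\<bar>"
    have ny: "norm y \<le> R"
      using y norm_triangle_ineq2[of y y0] by (simp add: R_def dist_norm norm_minus_commute)
    have *: "norm w \<le> K * ?t \<and> ?t \<le> K * norm w \<and> w \<noteq> 0" if w: "w = of_real x + u * y" "norm u = 1" "\<bar>Im w\<bar> = Re y" for u w
    proof (intro conjI)
      have "norm w \<le> \<bar>x\<bar> + norm y" using norm_triangle_ineq[of "of_real x" "u * y"] w by (simp add: norm_mult)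
      also have "\<dots> \<le> \<bar>x\<bar> + R" using ny by simp
      also have "\<dots> \<le> (1 + R) * ?t" using R by (simp add: algebra_simps)
      also have "\<dots> \<le> K * ?t" using R r by (intro mult_right_mono) (auto simp: K_def)
      finally show "norm w \<le> K * ?t" .
      have wr: "norm w > r" using abs_Im_le_cmod[of w] w(3) pos[OF y] by simp
      have "\<bar>x\<bar> \<le> norm w + norm y" using norm_triangle_ineq4[of w "u * y"] w by (simp add: norm_mult)
      hence "?t \<le> norm w + (1 + R) * 1" using ny by simp
      also have "\<dots> \<le> norm w + (1 + R) * (norm w / r)" using wr r R by (intro add_left_mono mult_left_mono) auto
      also have "\<dots> = (1 + (1 + R) / r) * norm w" by (simp add: algebra_simps)
      also have "\<dots> \<le> K * norm w" using R by (intro mult_right_mono) (auto simp: K_def)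
      finally show "?t \<le> K * norm w" .
      show "w \<noteq> 0" using wr r by auto
    qed
    have t: "?t > 0" by (simp add: add_pos_nonneg)
    have p: "Re y > 0" using pos[OF y] r by simp
    have "norm ((of_real x + \<i> * y) powr (-a)) \<le> E (-a) * ?t powr (Re (-a))"
      unfolding E_def using *[of "of_real x + \<i> * y" \<i>] p t K by (intro norm_powr_le) auto
    moreover have "norm ((of_real x - \<i> * y) powr (-b)) \<le> E (-b) * ?t powr (Re (-b))"
      unfolding E_def using *[of "of_real x - \<i> * y" "-\<i>"] p t K by (intro norm_powr_le) auto
    ultimately have "norm (kern a b y x) \<le> (E (-a) * ?t powr (Re (-a))) * (E (-b) * ?t powr (Re (-b)))"
      unfolding kern_def norm_mult by (intro mult_mono) (auto simp: E_def)
    also have "\<dots> = E (-a) * E (-b) * ?t powr (- Re (a + b))" by (simp add: powr_add[symmetric] algebra_simps)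
    also have "\<dots> \<le> E (-a) * E (-b) * ?t powr (- 2)"
      using ab by (intro mult_left_mono powr_mono) (auto simp: E_def)
    also have "?t powr (-2) = 1 / ?t\<^sup>2" using t by (simp add: powr_minus powr_numeral inverse_eq_divide)
    also have "1 / ?t\<^sup>2 \<le> 1 / (1 + x\<^sup>2)"
    proof (intro divide_left_mono mult_pos_pos)
      show "1 + x\<^sup>2 \<le> ?t\<^sup>2" by (simp add: power2_eq_square algebra_simps)
    qed (use t in \<open>auto simp: add_pos_nonneg\<close>)
    finally show ?thesis by (simp add: E_def mult_left_mono)
  qed
  with r pos that show ?thesis by (meson less_trans)
qed

lemma kern_bound':
  assumes "Re y > 0" "Re (a + b) \<ge> 2"
  shows "\<exists>C. \<forall>x. norm (kern a b y x) \<le> C / (1 + x\<^sup>2)"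
  using kern_bound[OF assms] by (metis centre_in_ball)

lemma kern_deriv_y:
  assumes y: "Re y > 0"
  shows "((\<lambda>y. kern a b y x) has_field_derivative (- \<i> * a * kern (a + 1) b y x + \<i> * b * kern a (b + 1) y x)) (at y)"
proof -
  have e: "- c - 1 = - (c + 1)" for c :: complex by simp
  note n = kern_not_nonpos[OF y, of x]
  have "((\<lambda>y. (of_real x + \<i> * y) powr (- a) * (of_real x - \<i> * y) powr (- b)) has_field_derivative
     (\<i> * (- a * (of_real x + \<i> * y) powr (- a - 1))) * (of_real x - \<i> * y) powr (- b) +
     (- \<i> * (- b * (of_real x - \<i> * y) powr (- b - 1))) * (of_real x + \<i> * y) powr (- a)) (at y)"
    using n by (auto intro!: derivative_eq_intros)
  thus ?thesis unfolding kern_def e by (simp only: mult_ac minus_mult_commute mult_minus_left) (simp add: mult_ac)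
qed

lemma kern_deriv_x:
  assumes y: "Re y > 0"
  shows "(kern a b y has_vector_derivative (- a * kern (a + 1) b y x - b * kern a (b + 1) y x)) (at x)"
proof -
  have e: "- c - 1 = - (c + 1)" for c :: complex by simp
  note n = kern_not_nonpos[OF y, of x]
  have "((\<lambda>x. (x + \<i> * y) powr (- a) * (x - \<i> * y) powr (- b)) has_field_derivative
     (- a * (of_real x + \<i> * y) powr (- a - 1)) * (of_real x - \<i> * y) powr (- b) +
     (- b * (of_real x - \<i> * y) powr (- b - 1)) * (of_real x + \<i> * y) powr (- a)) (at (of_real x))"
    using n by (auto intro!: derivative_eq_intros)
  from has_vector_derivative_real_field[OF this] show ?thesis
    unfolding kern_def[abs_def] e by (simp add: mult_ac)
qed

lemma kern_continuous: "Re y > 0 \<Longrightarrow> continuous_on A (kern a b y)"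
  using kern_deriv_x by (auto intro!: continuous_at_imp_continuous_on has_vector_derivative_continuous)

text \<open>The two bases differ by \<open>2 * \<i> * y\<close>; so a factor y can be traded for a
  shift of one exponent.\<close>

lemma kern_contiguous:
  assumes y: "Re y > 0"
  shows "2 * \<i> * y * kern (a + 1) (b + 1) y x = kern a (b + 1) y x - kern (a + 1) b y x"
proof -
  have *: "w powr (- c) = w * w powr (- (c + 1))" if "w \<noteq> 0" for w c :: complex
  proof -
    have "w powr (- c) = w powr (1 + (- (c + 1)))" by simp
    also have "\<dots> = w * w powr (- (c + 1))" using that by (subst powr_add) auto
    finally show ?thesis .
  qed
  note n = kern_not_nonpos[OF y, of x]
  show ?thesis
    unfolding kern_def *[OF n(3), of a] *[OF n(4), of b] by (simp add: algebra_simps)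
qed

lemma kern_exp_integrable:
  assumes "Re y > 0" "Re (a + b) \<ge> 2"
  shows "integrable lborel (\<lambda>x. kern a b y x * exp (- (\<i> * of_real (\<nu> * x))))"
proof -
  obtain C where "\<And>x. norm (kern a b y x) \<le> C / (1 + x\<^sup>2)" using kern_bound'[OF assms] by blast
  thus ?thesis
    by (intro quadratic_decay_integrable[of _ C])
       (auto simp: norm_mult norm_exp_eq_Re intro!: continuous_intros kern_continuous assms)
qed

section \<open>Relations satisfied by the transform of the kernel\<close>

lemma kern_hat_deriv:
  assumes y: "Re y > 0" and ab: "Re (a + b) \<ge> 2"
  shows "(kern_hat a b \<nu> has_field_derivative (- \<i> * a * kern_hat (a + 1) b \<nu> y + \<i> * b * kern_hat a (b + 1) \<nu> y)) (at y)"
proof -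
  obtain r C where r: "r > 0" "\<And>z. z \<in> ball y r \<Longrightarrow> Re z > 0"
    and C: "\<And>z x. z \<in> ball y r \<Longrightarrow> norm (kern a b z x) \<le> C / (1 + x\<^sup>2)"
    using kern_bound[OF y ab] by metis
  let ?e = "\<lambda>x. exp (- (\<i> * of_real (\<nu> * x)))"
  have "((\<lambda>z. LINT x|lborel. kern a b z x * ?e x) has_field_derivative
     (LINT x|lborel. (- \<i> * a * kern (a + 1) b y x + \<i> * b * kern a (b + 1) y x) * ?e x)) (at y)"
  proof (rule has_field_derivative_integral(2)[where f' = "\<lambda>z x. (- \<i> * a * kern (a + 1) b z x + \<i> * b * kern a (b + 1) z x) * ?e x" and g = "\<lambda>x. C / (1 + x\<^sup>2)"])
    show "integrable lborel (\<lambda>x::real. C / (1 + x\<^sup>2))"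
      using integrable_mult_right[OF integrable_inverse_1_plus_square_lborel, of C] by simp
    show "(\<lambda>x. kern a b z x * ?e x) \<in> borel_measurable lborel" if "z \<in> ball y r" for z
      using kern_continuous[of z UNIV a b] r(2)[OF that]
      by (auto intro!: borel_measurable_continuous_onI continuous_intros)
    show "((\<lambda>z. kern a b z x * ?e x) has_field_derivative
         (- \<i> * a * kern (a + 1) b z x + \<i> * b * kern a (b + 1) z x) * ?e x) (at z)" if "z \<in> ball y r" for z x
      by (intro DERIV_cmult_right kern_deriv_y r that)
  qed (use r C in \<open>auto simp: norm_mult norm_exp_eq_Re\<close>)
  also have "(LINT x|lborel. (- \<i> * a * kern (a + 1) b y x + \<i> * b * kern a (b + 1) y x) * ?e x) =
    (LINT x|lborel. (- \<i> * a) * (kern (a + 1) b y x * ?e x) + (\<i> * b) * (kern a (b + 1) y x * ?e x))"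
    by (simp add: algebra_simps)
  also have "\<dots> = (- \<i> * a) * kern_hat (a + 1) b \<nu> y + (\<i> * b) * kern_hat a (b + 1) \<nu> y"
    unfolding kern_hat_def fourier_def
    using kern_exp_integrable[OF y, of "a+1" b \<nu>] kern_exp_integrable[OF y, of a "b+1" \<nu>] ab
    by (subst Bochner_Integration.integral_add) (auto intro!: integrable_mult_right simp del: mult_minus_left)
  finally show ?thesis by (simp add: kern_hat_def[abs_def] fourier_def)
qed

lemma fourier_add:
  assumes "integrable lborel (\<lambda>x. F x * exp (- (\<i> * of_real (\<nu> * x))))" "integrable lborel (\<lambda>x. G x * exp (- (\<i> * of_real (\<nu> * x))))"
  shows "fourier (\<lambda>x. c * F x + d * G x) \<nu> = c * fourier F \<nu> + d * fourier G \<nu>"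
proof -
  have "fourier (\<lambda>x. c * F x + d * G x) \<nu> = (LINT x|lborel. c * (F x * exp (- (\<i> * of_real (\<nu> * x)))) + d * (G x * exp (- (\<i> * of_real (\<nu> * x)))))"
    unfolding fourier_def by (simp add: algebra_simps)
  also have "\<dots> = c * fourier F \<nu> + d * fourier G \<nu>"
    unfolding fourier_def by (simp only: Bochner_Integration.integral_add[OF integrable_mult_right[OF assms(1)] integrable_mult_right[OF assms(2)]] integral_mult_right_zero)
  finally show ?thesis .
qed

lemma quadratic_bound_add:
  fixes f g :: "real \<Rightarrow> complex" and c d :: complex
  assumes "\<And>x::real. norm (f x) \<le> C / (1 + x\<^sup>2)" "\<And>x. norm (g x) \<le> D / (1 + x\<^sup>2)"
  shows "norm (c * f x + d * g x) \<le> (norm c * C + norm d * D) / (1 + x\<^sup>2)"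
proof -
  have "norm (c * f x + d * g x) \<le> norm c * norm (f x) + norm d * norm (g x)"
    using norm_triangle_ineq[of "c * f x" "d * g x"] by (simp add: norm_mult)
  also have "\<dots> \<le> norm c * (C / (1 + x\<^sup>2)) + norm d * (D / (1 + x\<^sup>2))"
    by (intro add_mono mult_left_mono assms) auto
  finally show ?thesis by (simp add: add_divide_distrib)
qed

lemma kern_hat_ibp:
  assumes y: "Re y > 0" and ab: "Re (a + b) \<ge> 2"
  shows "\<i> * \<nu> * kern_hat a b \<nu> y = - a * kern_hat (a + 1) b \<nu> y - b * kern_hat a (b + 1) \<nu> y"
proof -
  obtain C where C: "\<And>x. norm (kern a b y x) \<le> C / (1 + x\<^sup>2)" using kern_bound'[OF y ab] by blast
  have ab': "Re (a + 1 + b) \<ge> 2" "Re (a + (b + 1)) \<ge> 2" using ab by auto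
  obtain C1 where C1: "\<And>x. norm (kern (a+1) b y x) \<le> C1 / (1 + x\<^sup>2)" using kern_bound'[OF y ab'(1)] by blast
  obtain C2 where C2: "\<And>x. norm (kern a (b+1) y x) \<le> C2 / (1 + x\<^sup>2)" using kern_bound'[OF y ab'(2)] by blast
  define D where "D = max C (norm (-a) * C1 + norm (-b) * C2)"
  have D: "c / (1 + x\<^sup>2) \<le> D / (1 + x\<^sup>2)" if "c \<le> D" for c x :: real
    by (intro divide_right_mono that) (simp add: add_nonneg_nonneg)
  have "fourier (\<lambda>x. (-a) * kern (a + 1) b y x + (-b) * kern a (b + 1) y x) \<nu> = \<i> * of_real \<nu> * fourier (kern a b y) \<nu>"
  proof (rule fourier_derivative)
    show "norm (kern a b y x) \<le> D / (1 + x\<^sup>2)" for x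
      by (rule order_trans[OF C D]) (simp add: D_def)
    show "norm ((-a) * kern (a + 1) b y x + (-b) * kern a (b + 1) y x) \<le> D / (1 + x\<^sup>2)" for x
      by (rule order_trans[OF quadratic_bound_add[OF C1 C2] D]) (simp add: D_def)
    show "(kern a b y has_vector_derivative (-a) * kern (a + 1) b y x + (-b) * kern a (b + 1) y x) (at x)" for x
      using kern_deriv_x[OF y, of a b x] by simp
  qed (intro continuous_intros kern_continuous y)
  also have "fourier (\<lambda>x. (-a) * kern (a + 1) b y x + (-b) * kern a (b + 1) y x) \<nu> = (-a) * kern_hat (a+1) b \<nu> y + (-b) * kern_hat a (b+1) \<nu> y"
    unfolding kern_hat_def by (intro fourier_add kern_exp_integrable y ab')
  finally show ?thesis by (simp add: kern_hat_def)
qed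

lemma kern_hat_contiguous:
  assumes y: "Re y > 0" and ab: "Re (a + b) \<ge> 1"
  shows "2 * \<i> * y * kern_hat (a + 1) (b + 1) \<nu> y = kern_hat a (b + 1) \<nu> y - kern_hat (a + 1) b \<nu> y"
proof -
  have "2 * \<i> * y * kern_hat (a + 1) (b + 1) \<nu> y = (LINT x|lborel. 2 * \<i> * y * (kern (a + 1) (b + 1) y x * exp (- (\<i> * of_real (\<nu> * x)))))"
    unfolding kern_hat_def fourier_def by (simp only: integral_mult_right_zero)
  also have "(\<lambda>x. 2 * \<i> * y * (kern (a + 1) (b + 1) y x * exp (- (\<i> * of_real (\<nu> * x))))) =
      (\<lambda>x. kern a (b + 1) y x * exp (- (\<i> * of_real (\<nu> * x))) - kern (a + 1) b y x * exp (- (\<i> * of_real (\<nu> * x))))"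
    unfolding mult.assoc[symmetric] kern_contiguous[OF y] by (simp add: algebra_simps)
  also have "integral\<^sup>L lborel \<dots> = kern_hat a (b + 1) \<nu> y - kern_hat (a + 1) b \<nu> y"
    unfolding kern_hat_def fourier_def using y ab
    by (intro Bochner_Integration.integral_diff kern_exp_integrable) auto
  finally show ?thesis .
qed

text \<open>The substitution x -> c x; the powers split because c is a positive real. It serves to
  extract c from a row c z + l, and to move the height to 1 at the price of a new frequency.\<close>

lemma kern_hat_scale:
  assumes c: "c > 0" and y: "y > 0"
  shows "kern_hat a b \<nu> (of_real (c * y)) = of_real c powr (1 - a - b) * kern_hat a b (c * \<nu>) (of_real y)"
proof -
  have *: "(of_real c * w) powr u = of_real c powr u * w powr u" if "w \<noteq> 0" for w u :: complex
    using that c Ln_times_of_real[of c w] by (auto simp: powr_def Ln_of_real distrib_left exp_add)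
  have h: "kern a b (of_real (c * y)) (0 + c * x) = of_real c powr (- a - b) * kern a b (of_real y) x" for x
  proof -
    have "of_real (c * x) + \<i> * of_real (c * y) = of_real c * (of_real x + \<i> * of_real y)"
      "of_real (c * x) - \<i> * of_real (c * y) = of_real c * (of_real x - \<i> * of_real y)" by (simp_all add: algebra_simps)
    note sc = this
    have nz: "of_real x + \<i> * of_real y \<noteq> 0" "of_real x - \<i> * of_real y \<noteq> 0"
      using kern_not_nonpos[of "of_real y" x] y by auto
    have "kern a b (of_real (c * y)) (0 + c * x) = (of_real c powr (- a) * (of_real x + \<i> * of_real y) powr (-a)) * (of_real c powr (- b) * (of_real x - \<i> * of_real y) powr (-b))"
      unfolding kern_def by (simp only: add_0 sc *[OF nz(1)] *[OF nz(2)])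
    also have "\<dots> = (of_real c powr (- a) * of_real c powr (- b)) * kern a b (of_real y) x" unfolding kern_def by (simp add: algebra_simps)
    also have "of_real c powr (- a) * of_real c powr (- b) = of_real c powr (- a - b)"
      using c by (simp add: powr_add[symmetric])
    finally show ?thesis .
  qed
  have "kern_hat a b \<nu> (of_real (c * y)) = \<bar>c\<bar> *\<^sub>R (LINT x|lborel. kern a b (of_real (c * y)) (0 + c * x) * exp (- (\<i> * of_real (\<nu> * (0 + c * x)))))"
    unfolding kern_hat_def fourier_def by (rule lborel_integral_real_affine) (use c in auto)
  also have "(\<lambda>x. kern a b (of_real (c * y)) (0 + c * x) * exp (- (\<i> * of_real (\<nu> * (0 + c * x))))) =
      (\<lambda>x. of_real c powr (- a - b) * (kern a b (of_real y) x * exp (- (\<i> * of_real (c * \<nu> * x)))))"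
    unfolding h by (simp add: mult_ac)
  also have "\<bar>c\<bar> *\<^sub>R integral\<^sup>L lborel \<dots> = (of_real c * of_real c powr (- a - b)) * kern_hat a b (c * \<nu>) (of_real y)"
    unfolding kern_hat_def fourier_def integral_mult_right_zero using c by (simp add: scaleR_conv_of_real)
  also have "of_real c * of_real c powr (- a - b) = of_real c powr (1 + (- a - b))"
    using c by (subst powr_add) auto
  finally show ?thesis by (simp add: algebra_simps)
qed

text \<open>After scaling to height 1, letting the height tend to 0 amounts to letting the frequency
  tend to 0, and dominated convergence permits that.\<close>

lemma kern_hat_zero_limit:
  assumes y: "Re y > 0" and ab: "Re (a + b) \<ge> 2" and X: "X \<longlonglongrightarrow> 0"
  shows "(\<lambda>n. kern_hat a b (X n) y) \<longlonglongrightarrow> kern_hat a b 0 y"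
proof -
  obtain C where C: "\<And>x. norm (kern a b y x) \<le> C / (1 + x\<^sup>2)" using kern_bound'[OF y ab] by blast
  have m: "(\<lambda>x. kern a b y x * exp (- (\<i> * of_real (\<nu> * x)))) \<in> borel_measurable lborel" for \<nu>
    using kern_continuous[OF y, of UNIV a b] by (auto intro!: borel_measurable_continuous_onI continuous_intros)
  show ?thesis unfolding kern_hat_def fourier_def
  proof (rule integral_dominated_convergence[where w = "\<lambda>x. C / (1 + x\<^sup>2)"])
    show "AE x in lborel. (\<lambda>n. kern a b y x * exp (- (\<i> * of_real (X n * x)))) \<longlonglongrightarrow> kern a b y x * exp (- (\<i> * of_real (0 * x)))"
      by (intro AE_I2 tendsto_intros X)
    show "integrable lborel (\<lambda>x::real. C / (1 + x\<^sup>2))"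
      using integrable_mult_right[OF integrable_inverse_1_plus_square_lborel, of C] by simp
    show "AE x in lborel. norm (kern a b y x * exp (- (\<i> * of_real (X n * x)))) \<le> C / (1 + x\<^sup>2)" for n
      using C by (auto simp: norm_mult norm_exp_eq_Re)
  qed (rule m)+
qed

lemma kern_hat_bounded:
  assumes y: "Re y > 0" and ab: "Re (a + b) \<ge> 2"
  obtains C where "\<And>\<nu>. norm (kern_hat a b \<nu> y) \<le> C"
proof
  show "norm (kern_hat a b \<nu> y) \<le> (LINT x|lborel. norm (kern a b y x))" for \<nu>
    unfolding kern_hat_def fourier_def
    using integral_norm_bound[of lborel "\<lambda>x. kern a b y x * exp (- (\<i> * of_real (\<nu> * x)))"]
    by (simp add: norm_mult norm_exp_eq_Re)
qed

text \<open>The offset X only multiplies the transform by a phase. Each x-derivative raises a + b by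
  one, so the quadratic bound holds for the two derivatives as well.\<close>

lemma kern_hat_poisson:
  assumes y: "Re y > 0" and ab: "Re (a + b) \<ge> 2"
  shows kern_hat_decay: "\<exists>K. \<forall>\<nu>. \<nu>\<^sup>2 * norm (kern_hat a b \<nu> y) \<le> K"
    and kern_hat_poisson_infsum: "(\<Sum>\<^sub>\<infinity>n::int. kern a b y (X + of_int n)) =
      (\<Sum>\<^sub>\<infinity>l::int. kern_hat a b (2 * pi * of_int l) y * exp (2 * of_real pi * \<i> * of_int l * of_real X))"
proof -
  let ?F = "\<lambda>X x. kern a b y (X + x)"
  let ?F1 = "\<lambda>X x. (-a) * kern (a + 1) b y (X + x) + (-b) * kern a (b + 1) y (X + x)"
  let ?F2 = "\<lambda>X x. (-a) * ((-(a+1)) * kern (a + 1 + 1) b y (X + x) + (-b) * kern (a + 1) (b + 1) y (X + x)) +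
     (-b) * ((-a) * kern (a + 1) (b + 1) y (X + x) + (-(b+1)) * kern a (b + 1 + 1) y (X + x))"
  have D: "((\<lambda>x. kern a b y (X + x)) has_vector_derivative (- a * kern (a + 1) b y (X + x) + (- b) * kern a (b + 1) y (X + x))) (at x)" for a b X x
  proof -
    have "((\<lambda>x. X + x) has_vector_derivative 1) (at x)"
      by (auto intro!: derivative_eq_intros)
    from vector_diff_chain_at[OF this kern_deriv_x[OF y]] show ?thesis by (simp add: o_def)
  qed
  have d0: "(?F X has_vector_derivative ?F1 X x) (at x)" for X x by (rule D)
  have d1: "(?F1 X has_vector_derivative ?F2 X x) (at x)" for X x
    by (intro has_vector_derivative_add has_vector_derivative_mult_right D)
  have c2: "continuous_on UNIV (?F2 X)" for X
    by (intro continuous_intros continuous_on_compose2[OF kern_continuous[OF y, of UNIV]]) auto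
  have "\<exists>C. \<forall>x. norm (kern u v y (X + x)) \<le> C / (1 + x\<^sup>2)" if uv: "Re (u + v) \<ge> 2" for u v X
  proof -
    obtain C where C: "\<And>x. norm (kern u v y x) \<le> C / (1 + x\<^sup>2)" using kern_bound'[OF y uv] by blast
    have "C \<ge> 0" using order_trans[OF norm_ge_zero C[of 0]] by simp
    \<comment> \<open>A translation costs only a constant: 1 + x^2 <= (2 + 2 X^2)(1 + (X + x)^2),
      which comes from (x + 2 X)^2 >= 0.\<close>
    have "norm (kern u v y (X + x)) \<le> (C * (2 + 2 * X\<^sup>2)) / (1 + x\<^sup>2)" for x
    proof -
      have "x\<^sup>2 \<le> 2 * (X + x)\<^sup>2 + 2 * X\<^sup>2"
        using zero_le_power2[of "x + 2 * X"] by (simp add: power2_eq_square algebra_simps)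
      moreover have "0 \<le> (X + x)\<^sup>2 * X\<^sup>2" by simp
      moreover have "(2 + 2 * X\<^sup>2) * (1 + (X + x)\<^sup>2) = 2 + 2 * (X + x)\<^sup>2 + 2 * X\<^sup>2 + 2 * ((X + x)\<^sup>2 * X\<^sup>2)"
        by (simp add: algebra_simps)
      ultimately have "1 + x\<^sup>2 \<le> (2 + 2 * X\<^sup>2) * (1 + (X + x)\<^sup>2)" by linarith
      hence "C * (1 + x\<^sup>2) \<le> C * ((2 + 2 * X\<^sup>2) * (1 + (X + x)\<^sup>2))"
        using \<open>C \<ge> 0\<close> by (intro mult_left_mono)
      hence "C / (1 + (X + x)\<^sup>2) \<le> (C * (2 + 2 * X\<^sup>2)) / (1 + x\<^sup>2)"
        by (simp add: divide_simps add_pos_nonneg mult_ac not_less add_nonneg_eq_0_iff)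
      with C[of "X + x"] show ?thesis by linarith
    qed
    thus ?thesis by blast
  qed
  note B = this
  have B2: "\<exists>C. \<forall>x::real. norm (c * f x + d * g x) \<le> C / (1 + x\<^sup>2)"
    if "\<exists>C. \<forall>x. norm (f x :: complex) \<le> C / (1 + x\<^sup>2)" "\<exists>C. \<forall>x. norm (g x) \<le> C / (1 + x\<^sup>2)" for f g :: "real \<Rightarrow> complex" and c d :: complex
    using that quadratic_bound_add[where f = f and g = g and c = c and d = d] by blast
  have "\<exists>C. (\<forall>x. norm (?F X x) \<le> C / (1 + x\<^sup>2)) \<and> (\<forall>x. norm (?F1 X x) \<le> C / (1 + x\<^sup>2)) \<and> (\<forall>x. norm (?F2 X x) \<le> C / (1 + x\<^sup>2))" for X
  proof -
    obtain C0 where C0: "\<And>x. norm (?F X x) \<le> C0 / (1 + x\<^sup>2)" using B[of a b X] ab by blast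
    have "\<exists>C. \<forall>x. norm (?F1 X x) \<le> C / (1 + x\<^sup>2)" using ab by (intro B2 B) auto
    then obtain C1 where C1: "\<And>x. norm (?F1 X x) \<le> C1 / (1 + x\<^sup>2)" by blast
    have "\<exists>C. \<forall>x. norm (?F2 X x) \<le> C / (1 + x\<^sup>2)" using ab by (intro B2 B) auto
    then obtain C2 where C2: "\<And>x. norm (?F2 X x) \<le> C2 / (1 + x\<^sup>2)" by blast
    have M: "c / (1 + x\<^sup>2) \<le> max C0 (max C1 C2) / (1 + x\<^sup>2)" if "c \<le> max C0 (max C1 C2)" for c x :: real
      by (intro divide_right_mono that) (simp add: add_nonneg_nonneg)
    show ?thesis
      by (intro exI[of _ "max C0 (max C1 C2)"] conjI allI order_trans[OF C0 M] order_trans[OF C1 M] order_trans[OF C2 M]) auto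
  qed
  then obtain C where C: "\<And>x. norm (?F X x) \<le> C X / (1 + x\<^sup>2)" "\<And>x. norm (?F1 X x) \<le> C X / (1 + x\<^sup>2)" "\<And>x. norm (?F2 X x) \<le> C X / (1 + x\<^sup>2)" for X
    by metis
  note P = poisson_summation[OF d0 d1 c2 C]
  show "\<exists>K. \<forall>\<nu>. \<nu>\<^sup>2 * norm (kern_hat a b \<nu> y) \<le> K"
    using P(1)[of _ 0, unfolded add_0] unfolding kern_hat_def by blast
  have sh: "fourier (?F X) \<nu> = kern_hat a b \<nu> y * exp (\<i> * of_real (\<nu> * X))" for \<nu>
  proof -
    have "kern_hat a b \<nu> y = (LINT x|lborel. kern a b y (X + x) * exp (- (\<i> * of_real (\<nu> * (X + x)))))"
      unfolding kern_hat_def fourier_def using lborel_integral_real_affine[of 1 "\<lambda>x. kern a b y x * exp (- (\<i> * of_real (\<nu> * x)))" X] by simp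
    also have "\<dots> = (LINT x|lborel. exp (- (\<i> * of_real (\<nu> * X))) * (kern a b y (X + x) * exp (- (\<i> * of_real (\<nu> * x)))))"
    proof -
      have "exp (- (\<i> * of_real (\<nu> * (X + x)))) = exp (- (\<i> * of_real (\<nu> * X))) * exp (- (\<i> * of_real (\<nu> * x)))" for x
        by (simp add: exp_add[symmetric] algebra_simps)
      thus ?thesis by (simp only: mult_ac)
    qed
    also have "\<dots> = exp (- (\<i> * of_real (\<nu> * X))) * fourier (?F X) \<nu>"
      unfolding fourier_def by (rule integral_mult_right_zero)
    finally show ?thesis by (simp add: exp_minus field_simps)
  qed
  show "(\<Sum>\<^sub>\<infinity>n::int. kern a b y (X + of_int n)) =
      (\<Sum>\<^sub>\<infinity>l::int. kern_hat a b (2 * pi * of_int l) y * exp (2 * of_real pi * \<i> * of_int l * of_real X))"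
    unfolding P(3)[of X] sh by (intro infsum_cong) (simp add: mult_ac)
qed

section \<open>Kernels with exponents \<sigma> + j and \<sigma> - j\<close>

lemma powr_of_int': "w \<noteq> 0 \<Longrightarrow> w powr of_int j = w powi j" for w :: complex
  by (simp add: complex_powr_of_int)

text \<open>The arguments of w and its conjugate cancel, as \<open>Ln (cnj w) = cnj (Ln w)\<close>
  off the negative axis. Only a power of |w| and an integer power of cnj w / w remain, so no branch
  is left; in this shape the kernel can be matched with the Eisenstein summand.\<close>

lemma kern_integer:
  assumes y: "y > 0"
  shows "kern (\<sigma> + of_int j) (\<sigma> - of_int j) (of_real y) x =
     of_real (cmod (Complex x y)) powr (- 2 * \<sigma>) * ((of_real x - \<i> * of_real y) / (of_real x + \<i> * of_real y)) powi j"
proof -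
  define w where "w = of_real x + \<i> * of_real y"
  have n: "w \<notin> \<real>\<^sub>\<le>\<^sub>0" "cnj w \<notin> \<real>\<^sub>\<le>\<^sub>0" "w \<noteq> 0" "cnj w \<noteq> 0"
    using kern_not_nonpos[of "of_real y" x] y by (auto simp: w_def)
  have cw: "of_real x - \<i> * of_real y = cnj w" by (simp add: w_def)
  have W: "Complex x y = w" by (simp add: w_def complex_eq_iff)
  have "kern (\<sigma> + of_int j) (\<sigma> - of_int j) (of_real y) x = w powr (- \<sigma> + of_int (- j)) * cnj w powr (- \<sigma> + of_int j)"
    unfolding kern_def cw w_def[symmetric] by (simp add: algebra_simps)
  also have "\<dots> = (w powr (- \<sigma>) * cnj w powr (- \<sigma>)) * (w powr of_int (- j) * cnj w powr of_int j)"
    unfolding powr_add by (simp only: mult_ac)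
  also have "w powr of_int (- j) * cnj w powr of_int j = (cnj w / w) powi j"
    unfolding powr_of_int'[OF n(3)] powr_of_int'[OF n(4)] by (simp add: power_int_minus power_int_divide_distrib field_simps)
  also have "w powr (- \<sigma>) * cnj w powr (- \<sigma>) = of_real (cmod w) powr (- 2 * \<sigma>)"
  proof -
    have "Ln (cnj w) = cnj (Ln w)" using n(1) by (rule cnj_Ln[symmetric])
    hence "Ln w + Ln (cnj w) = of_real (2 * ln (cmod w))"
      using complex_add_cnj[of "Ln w"] n(3) by (simp add: Re_Ln)
    moreover have "w powr (- \<sigma>) * cnj w powr (- \<sigma>) = exp (- \<sigma> * (Ln w + Ln (cnj w)))"
      using n by (simp add: powr_def exp_add[symmetric] algebra_simps)
    ultimately show ?thesis using n by (simp add: powr_def Ln_of_real algebra_simps)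
  qed
  finally show ?thesis unfolding W cw w_def[symmetric] .
qed

text \<open>The substitution x -> -x inverts (x - iy)/(x + iy). For general exponents it would
  create phases; for exponents \<sigma> + j and \<sigma> - j it merely changes the sign of j, so
  negative frequencies reduce to positive ones.\<close>

lemma kern_hat_reflect:
  assumes y: "y > 0"
  shows "kern_hat (\<sigma> + of_int j) (\<sigma> - of_int j) \<nu> (of_real y) = kern_hat (\<sigma> - of_int j) (\<sigma> + of_int j) (- \<nu>) (of_real y)"
proof -
  have h: "kern (\<sigma> + of_int j) (\<sigma> - of_int j) (of_real y) (0 + (-1) * x) = kern (\<sigma> - of_int j) (\<sigma> + of_int j) (of_real y) x" for x
  proof -
    have "cmod (Complex (-x) y) = cmod (Complex x y)" by (simp add: cmod_def)
    moreover have "(of_real (-x) - \<i> * of_real y) / (of_real (-x) + \<i> * of_real y) = inverse ((of_real x - \<i> * of_real y) / (of_real x + \<i> * of_real y))"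
      using kern_not_nonpos[of "of_real y" x] kern_not_nonpos[of "of_real y" "-x"] y by (simp add: field_simps)
    ultimately have "kern (\<sigma> + of_int j) (\<sigma> - of_int j) (of_real y) (- x) = of_real (cmod (Complex x y)) powr (- 2 * \<sigma>) *
        (inverse ((of_real x - \<i> * of_real y) / (of_real x + \<i> * of_real y))) powi j"
      by (simp only: kern_integer[OF y, of \<sigma> j "-x"])
    thus ?thesis
      using kern_integer[OF y, of \<sigma> "-j" x] by (simp add: power_int_minus power_int_inverse del: inverse_divide)
  qed
  have "kern_hat (\<sigma> + of_int j) (\<sigma> - of_int j) \<nu> (of_real y) = \<bar>-1\<bar> *\<^sub>R (LINT x|lborel. kern (\<sigma> + of_int j) (\<sigma> - of_int j) (of_real y) (0 + (-1) * x) * exp (- (\<i> * of_real (\<nu> * (0 + (-1) * x)))))"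
    unfolding kern_hat_def fourier_def by (rule lborel_integral_real_affine) auto
  thus ?thesis unfolding h by (simp add: kern_hat_def fourier_def)
qed

section \<open>Whittaker's equation and Kummer integrals\<close>

lemma continuous_on_of_real_powr:
  assumes "continuous_on S f" "\<And>x. x \<in> S \<Longrightarrow> f x > 0"
  shows "continuous_on S (\<lambda>x. of_real (f x) powr c :: complex)"
proof -
  have "continuous_on S (\<lambda>x. exp (c * of_real (ln (f x))))"
    by (intro continuous_intros assms(1)) (use assms(2) in force)
  also have "?this \<longleftrightarrow> ?thesis"
    by (rule continuous_on_cong) (use assms(2) in \<open>auto simp: powr_def Ln_of_real dest!: assms(2)\<close>)
  finally show ?thesis .
qed

lemma tendsto_of_real_powr:
  assumes "(f \<longlongrightarrow> l) F" "l > 0"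
  shows "((\<lambda>x. of_real (f x) powr c :: complex) \<longlongrightarrow> of_real l powr c) F"
  by (rule tendsto_powr_complex[OF _ tendsto_of_real[OF assms(1)] tendsto_const])
     (use assms(2) in \<open>auto simp: complex_nonpos_Reals_iff\<close>)

lemma gamma_integral_lborel:
  assumes z: "Re z > 0" and c: "c > 0"
  shows gamma_set_integrable: "set_integrable lborel {0<..} (\<lambda>t. of_real t powr (z - 1) * of_real (exp (- (c * t))))"
    and gamma_set_integral: "(LINT t:{0<..}|lborel. of_real t powr (z - 1) * of_real (exp (- (c * t)))) = Gamma z * of_real c powr (- z)"
proof -
  let ?g = "\<lambda>t::real. complex_of_real t powr (z - 1) * of_real (exp (- t))"
  have g_eq: "(\<lambda>t. complex_of_real t powr (z - 1) / of_real (exp t)) = ?g"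
    by (simp add: exp_minus field_simps)
  have m: "(\<lambda>t. indicator {0<..} t *\<^sub>R ?g t) \<in> borel_measurable borel"
  proof (rule borel_measurable_continuous_on_indicator)
    show "continuous_on {0<..} ?g" by (intro continuous_intros) auto
  qed simp
  have i1: "set_integrable lborel {0<..} ?g"
    using absolutely_integrable_Gamma_integral'[OF z] m
    unfolding set_integrable_def g_eq by (simp add: integrable_completion)
  have v1: "(LINT t:{0<..}|lborel. ?g t) = Gamma z"
    using set_borel_integral_eq_integral(2)[OF i1] integral_unique[OF Gamma_integral_complex'[OF z]]
    unfolding g_eq by simp
  have e: "indicator {0<..} (0 + c * t) *\<^sub>R ?g (0 + c * t) = of_real c powr (z - 1) * (indicator {0<..} t *\<^sub>R (of_real t powr (z - 1) * of_real (exp (- (c * t)))))" for t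
  proof (cases "t > 0")
    case True
    hence "(of_real c * of_real t :: complex) powr (z - 1) = of_real c powr (z - 1) * of_real t powr (z - 1)"
      using c by (intro powr_times_real) auto
    thus ?thesis using True c by (simp add: indicator_def)
  next
    case False thus ?thesis using c by (simp add: indicator_def zero_less_mult_iff)
  qed
  have c0: "of_real c powr (z - 1) \<noteq> (0::complex)" using c by simp
  have "integrable lborel (\<lambda>t. indicator {0<..} (0 + c * t) *\<^sub>R ?g (0 + c * t))"
    using c i1 unfolding set_integrable_def by (intro lborel_integrable_real_affine) auto
  thus "set_integrable lborel {0<..} (\<lambda>t. of_real t powr (z - 1) * of_real (exp (- (c * t))))"
    unfolding e set_integrable_def
  proof -
    let ?C = "of_real c powr (z - 1) :: complex"
    assume J: "integrable lborel (\<lambda>t. ?C * (indicator {0<..} t *\<^sub>R (of_real t powr (z - 1) * of_real (exp (- (c * t))))))"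
    have "integrable lborel (\<lambda>t. inverse ?C * (?C * (indicator {0<..} t *\<^sub>R (of_real t powr (z - 1) * of_real (exp (- (c * t)))))))"
      by (rule integrable_mult_right) (rule J)
    thus "integrable lborel (\<lambda>t. indicator {0<..} t *\<^sub>R (of_real t powr (z - 1) * complex_of_real (exp (- (c * t)))))"
      by (simp only: mult.assoc[symmetric] left_inverse[OF c0] mult_1_left)
  qed
  have "Gamma z = \<bar>c\<bar> *\<^sub>R (LINT t|lborel. indicator {0<..} (0 + c * t) *\<^sub>R ?g (0 + c * t))"
    unfolding v1[symmetric] set_lebesgue_integral_def by (rule lborel_integral_real_affine) (use c in auto)
  also have "\<dots> = (of_real c * of_real c powr (z - 1)) * (LINT t:{0<..}|lborel. of_real t powr (z - 1) * of_real (exp (- (c * t))))"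
    unfolding e set_lebesgue_integral_def using c by (simp add: scaleR_conv_of_real)
  also have "of_real c * of_real c powr (z - 1) = of_real c powr z"
    using powr_add[of "of_real c :: complex" 1 "z - 1"] c by simp
  finally show "(LINT t:{0<..}|lborel. of_real t powr (z - 1) * of_real (exp (- (c * t)))) = Gamma z * of_real c powr (- z)"
    using c by (simp add: powr_minus field_simps)
qed

lemma gamma_set_integrable_real:
  fixes r c :: real
  assumes "r > 0" "c > 0"
  shows "set_integrable lborel {0<..} (\<lambda>t. t powr (r - 1) * exp (- (c * t)))"
proof -
  have "set_integrable lborel {0<..} (\<lambda>t. norm (complex_of_real t powr (of_real r - 1) * of_real (exp (- (c * t)))))"
    by (rule set_integrable_norm, rule gamma_set_integrable) (use assms in auto)
  also have "?this \<longleftrightarrow> ?thesis"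
    by (rule set_integrable_cong) (auto simp: norm_mult norm_powr_real_powr)
  finally show ?thesis .
qed

text \<open>A single term of the exponential series, of index M >= m, already dominates the power,
  and the constant does not depend on the exponent \<open>m'\<close>.\<close>

lemma one_plus_powr_le_exp:
  fixes e m :: real
  assumes e: "e > 0"
  obtains C where "C > 0" "\<And>u m'. u \<ge> 0 \<Longrightarrow> m' \<le> m \<Longrightarrow> (1 + u) powr m' \<le> C * exp (e * u)"
proof -
  define M where "M = nat \<lceil>m\<rceil>"
  have mM: "m \<le> real M" unfolding M_def by linarith
  have "(1 + u) powr m' \<le> (fact M * exp e / e ^ M) * exp (e * u)" if "u \<ge> 0" "m' \<le> m" for u m'
  proof -
    have "(1 + u) powr m' \<le> (1 + u) powr real M" using that mM by (intro powr_mono) auto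
    also have "\<dots> = (1 + u) ^ M" using that by (simp add: powr_realpow)
    also have "\<dots> = (e * (1 + u)) ^ M / e ^ M" using e by (simp add: power_mult_distrib)
    also have "(e * (1 + u)) ^ M / e ^ M \<le> fact M * exp (e * (1 + u)) / e ^ M"
    proof (rule divide_right_mono)
      have s: "(\<lambda>n. (e * (1 + u)) ^ n /\<^sub>R fact n) sums exp (e * (1 + u))" by (rule exp_converges)
      have "(\<Sum>n\<in>{M}. (e * (1 + u)) ^ n /\<^sub>R fact n) \<le> exp (e * (1 + u))"
        unfolding sums_unique[OF s]
        by (rule sum_le_suminf[OF sums_summable[OF s]]) (use e that in auto)
      thus "(e * (1 + u)) ^ M \<le> fact M * exp (e * (1 + u))" by (simp add: field_simps)
    qed (use e in auto)
    finally show ?thesis by (simp add: distrib_left exp_add mult_ac)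
  qed
  moreover have "fact M * exp e / e ^ M > 0" using e by simp
  ultimately show ?thesis using that by blast
qed

section \<open>Uniqueness of the decaying solution of Whittaker's equation\<close>

text \<open>An energy estimate: E = |h|^2 + |h'|^2 satisfies |E'| <= (1 + Q) E, where Q bounds q
  between x0 and x. The factor exp(-(1 + Q) t) to the right of x0, or exp((1 + Q) t) to the left,
  makes E monotone, and E vanishes at x0.\<close>

lemma linear_ode_zero:
  fixes h h' q :: "real \<Rightarrow> complex"
  assumes d: "\<And>x. x > 0 \<Longrightarrow> (h has_vector_derivative h' x) (at x)"
    and d': "\<And>x. x > 0 \<Longrightarrow> (h' has_vector_derivative q x * h x) (at x)"
    and q: "continuous_on {0<..} q" and x0: "x0 > 0" "h x0 = 0" "h' x0 = 0" and x: "x > 0"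
  shows "h x = 0"
proof -
  define E where "E = (\<lambda>x. h x \<bullet> h x + h' x \<bullet> h' x)"
  define lo where "lo = min x x0"
  define hi where "hi = max x x0"
  have lo: "lo > 0" "lo \<le> hi" using x x0 by (auto simp: lo_def hi_def)
  have "compact (q ` {lo..hi})"
    using lo by (intro compact_continuous_image continuous_on_subset[OF q]) auto
  then obtain Q where Q: "\<And>t. t \<in> {lo..hi} \<Longrightarrow> norm (q t) \<le> Q"
    using compact_imp_bounded bounded_iff by (metis imageI)
  have Q0: "Q \<ge> 0" using order_trans[OF norm_ge_zero Q[of lo]] lo by auto
  define E' where "E' = (\<lambda>t. 2 * (h t \<bullet> h' t) + 2 * (h' t \<bullet> (q t * h t)))"
  have dE: "(E has_real_derivative E' t) (at t)" if "t > 0" for t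
  proof -
    have "(h has_derivative (\<lambda>s. s *\<^sub>R h' t)) (at t)" "(h' has_derivative (\<lambda>s. s *\<^sub>R (q t * h t))) (at t)"
      using d d' that by (auto simp: has_vector_derivative_def)
    hence "(E has_derivative (\<lambda>s. (h t \<bullet> (s *\<^sub>R h' t) + (s *\<^sub>R h' t) \<bullet> h t) + (h' t \<bullet> (s *\<^sub>R (q t * h t)) + (s *\<^sub>R (q t * h t)) \<bullet> h' t))) (at t)"
      unfolding E_def by (intro has_derivative_add has_derivative_inner)
    thus ?thesis unfolding has_field_derivative_def E'_def
      by (rule has_derivative_eq_rhs) (simp add: fun_eq_iff inner_commute algebra_simps)
  qed
  have E'le: "\<bar>E' t\<bar> \<le> (1 + Q) * E t" if t: "t \<in> {lo..hi}" for t
  proof -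
    have a: "\<bar>h t \<bullet> h' t\<bar> \<le> norm (h t) * norm (h' t)" by (rule Cauchy_Schwarz_ineq2)
    have "\<bar>h' t \<bullet> (q t * h t)\<bar> \<le> norm (h' t) * (norm (q t) * norm (h t))"
      using Cauchy_Schwarz_ineq2[of "h' t" "q t * h t"] by (simp add: norm_mult)
    also have "\<dots> \<le> norm (h' t) * (Q * norm (h t))" by (intro mult_left_mono mult_right_mono Q t) auto
    finally have b: "\<bar>h' t \<bullet> (q t * h t)\<bar> \<le> Q * (norm (h t) * norm (h' t))" by (simp add: mult_ac)
    have "2 * (norm (h t) * norm (h' t)) \<le> E t"
      using sum_squares_bound[of "norm (h t)" "norm (h' t)"] by (simp add: E_def dot_square_norm mult.assoc)
    hence "(1 + Q) * (2 * (norm (h t) * norm (h' t))) \<le> (1 + Q) * E t" using Q0 by (intro mult_left_mono) auto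
    moreover have "\<bar>E' t\<bar> \<le> 2 * \<bar>h t \<bullet> h' t\<bar> + 2 * \<bar>h' t \<bullet> (q t * h t)\<bar>" unfolding E'_def by linarith
    ultimately show ?thesis using a b by (simp add: algebra_simps)
  qed
  have Ex0: "E x0 = 0" by (simp add: E_def x0)
  have "E x \<le> 0"
  proof (cases "x \<ge> x0")
    case True
    have "exp (- (1 + Q) * x) * E x \<le> exp (- (1 + Q) * x0) * E x0"
    proof (rule DERIV_nonpos_imp_nonincreasing[OF True])
      fix t assume t: "x0 \<le> t" "t \<le> x"
      have "((\<lambda>t. exp (- (1 + Q) * t) * E t) has_real_derivative exp (- (1 + Q) * t) * (E' t - (1 + Q) * E t)) (at t)"
        using t x0 by (auto intro!: derivative_eq_intros dE simp: algebra_simps)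
      moreover have "E' t - (1 + Q) * E t \<le> 0" using E'le[of t] t by (auto simp: lo_def hi_def)
      ultimately show "\<exists>y. ((\<lambda>t. exp (- (1 + Q) * t) * E t) has_real_derivative y) (at t) \<and> y \<le> 0"
        by (intro exI conjI) (auto intro!: mult_nonneg_nonpos)
    qed
    thus ?thesis unfolding Ex0 by (simp add: mult_le_0_iff)
  next
    case False
    hence F: "x \<le> x0" by simp
    have "exp ((1 + Q) * x) * E x \<le> exp ((1 + Q) * x0) * E x0"
    proof (rule DERIV_nonneg_imp_nondecreasing[OF F])
      fix t assume t: "x \<le> t" "t \<le> x0"
      have "((\<lambda>t. exp ((1 + Q) * t) * E t) has_real_derivative exp ((1 + Q) * t) * (E' t + (1 + Q) * E t)) (at t)"
        using t x by (auto intro!: derivative_eq_intros dE simp: algebra_simps)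
      moreover have "E' t + (1 + Q) * E t \<ge> 0" using E'le[of t] t by (auto simp: lo_def hi_def)
      hence "exp ((1 + Q) * t) * (E' t + (1 + Q) * E t) \<ge> 0" by simp
      ultimately show "\<exists>y. ((\<lambda>t. exp ((1 + Q) * t) * E t) has_real_derivative y) (at t) \<and> y \<ge> 0"
        by blast
    qed
    thus ?thesis unfolding Ex0 by (simp add: mult_le_0_iff)
  qed
  hence "h x \<bullet> h x \<le> 0" unfolding E_def using inner_ge_zero[of "h' x"] by linarith
  thus ?thesis using inner_ge_zero[of "h x"] by (metis inner_eq_zero_iff order_antisym)
qed

text \<open>The derivative is an argument and not bound by a quantifier, because Wronskians and the
  raising relation speak about it.\<close>

definition whittaker_ode :: "complex \<Rightarrow> complex \<Rightarrow> (real \<Rightarrow> complex) \<Rightarrow> (real \<Rightarrow> complex) \<Rightarrow> bool" where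
  "whittaker_ode \<kappa> \<mu> W W' \<longleftrightarrow> (\<forall>x>0. (W has_vector_derivative W' x) (at x) \<and>
        (W' has_vector_derivative - (- 1/4 + \<kappa> / of_real x + (1/4 - \<mu>\<^sup>2) / (of_real x)\<^sup>2) * W x) (at x))"

lemma is_whittaker_W_iff: "is_whittaker_W \<kappa> \<mu> W \<longleftrightarrow> (\<exists>W'. whittaker_ode \<kappa> \<mu> W W') \<and>
    ((\<lambda>x. W x / (of_real (exp (- x / 2)) * of_real x powr \<kappa>)) \<longlongrightarrow> 1) at_top"
  by (simp add: is_whittaker_W_def whittaker_ode_def)

text \<open>The Wronskian c of f and W is constant, and (f/W)' = -c/W^2. If c were not 0, then
  1/W^2, which grows like exp(x) times a power, would force f to grow faster than the hypothesis
  allows. So c = 0, and f agrees with a multiple of W to first order at one point, hence everywhere.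
  Growth below exp(x/4) is tolerated because the Fourier transform comes without any known
  exponential decay.\<close>

lemma whittaker_decaying_unique:
  fixes \<kappa> :: real
  assumes f: "whittaker_ode (of_real \<kappa>) \<mu> f f'" and W: "whittaker_ode (of_real \<kappa>) \<mu> W W'"
    and lim: "((\<lambda>x. W x / (of_real (exp (- x / 2)) * of_real x powr of_real \<kappa>)) \<longlongrightarrow> 1) at_top"
    and dec: "((\<lambda>x. f x * of_real (exp (- x / 4))) \<longlongrightarrow> 0) at_top"
  obtains C where "\<And>x. x > 0 \<Longrightarrow> f x = C * W x"
proof -
  let ?q = "\<lambda>x. - (- 1/4 + of_real \<kappa> / of_real x + (1/4 - \<mu>\<^sup>2) / (of_real x)\<^sup>2) :: complex"
  have df: "(f has_vector_derivative f' x) (at x)" "(f' has_vector_derivative ?q x * f x) (at x)"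
    and dW: "(W has_vector_derivative W' x) (at x)" "(W' has_vector_derivative ?q x * W x) (at x)" if "x > 0" for x
    using f W that by (auto simp: whittaker_ode_def)
  define A where "A = (\<lambda>x. W x / of_real (exp (- x / 2) * x powr \<kappa>))"
  have A: "(A \<longlongrightarrow> 1) at_top"
    by (rule Lim_transform_eventually[OF lim], rule eventually_mono[OF eventually_gt_at_top[of 0]]) (simp add: A_def powr_of_real)
  define c where "c = f 1 * W' 1 - f' 1 * W 1"
  have wr: "f x * W' x - f' x * W x = c" if x: "x > 0" for x
  proof -
    have dz: "((\<lambda>x. f x * W' x - f' x * W x) has_vector_derivative 0) (at x within {0<..})" if x: "x \<in> {0<..}" for x
    proof -
      have "((\<lambda>x. f x * W' x - f' x * W x) has_vector_derivative (f x * (?q x * W x) + f' x * W' x) - (f' x * W' x + (?q x * f x) * W x)) (at x)"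
        using x by (intro has_vector_derivative_diff has_vector_derivative_mult df dW) auto
      also have "(f x * (?q x * W x) + f' x * W' x) - (f' x * W' x + (?q x * f x) * W x) = 0" by (simp add: algebra_simps)
      finally show ?thesis by (rule has_vector_derivative_at_within)
    qed
    obtain d where d: "\<And>x. x \<in> {0<..} \<Longrightarrow> f x * W' x - f' x * W x = d"
      using has_vector_derivative_zero_constant[OF convex_real_interval(3) dz] by metis
    have "f 1 * W' 1 - f' 1 * W 1 = d" "f x * W' x - f' x * W x = d" using d x by auto
    thus ?thesis by (simp add: c_def)
  qed
  have A2: "((\<lambda>x. Re (inverse (A x ^ 2))) \<longlongrightarrow> 1) at_top"
    using tendsto_Re[OF tendsto_inverse[OF tendsto_power[OF A, of 2]]] by simp
  have ev: "eventually (\<lambda>x. x > 0 \<and> W x \<noteq> 0 \<and> Re (inverse (A x ^ 2)) > 1/2) at_top"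
  proof -
    have "eventually (\<lambda>x. dist (A x) 1 < 1) at_top" using tendstoD[OF A, of 1] by simp
    hence "eventually (\<lambda>x. W x \<noteq> 0) at_top" by eventually_elim (auto simp: A_def)
    moreover have "eventually (\<lambda>x. Re (inverse (A x ^ 2)) > 1/2) at_top" using order_tendstoD(1)[OF A2, of "1/2"] by simp
    ultimately show ?thesis using eventually_gt_at_top[of 0] by eventually_elim auto
  qed
  have c0: "c = 0"
  proof (rule ccontr)
    assume c: "c \<noteq> 0"
    \<comment> \<open>85/100 = 1/4 + 1/2 + 1/10. The summands pay for the allowed growth of f, for
      the exponential in 1/W and for the power x^(-\<kappa>); the total stays below 1, so exp x also
      absorbs x^(-2\<kappa>).\<close>
    have "eventually (\<lambda>x::real. exp x * x powr (- 2 * \<kappa>) * (1/2) \<ge> 85/100 * exp (85/100 * x)) at_top" by real_asymp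
    with ev have "eventually (\<lambda>x. x > 0 \<and> W x \<noteq> 0 \<and> Re (inverse (A x ^ 2)) > 1/2 \<and> exp x * x powr (- 2 * \<kappa>) * (1/2) \<ge> 85/100 * exp (85/100 * x)) at_top"
      by eventually_elim auto
    then obtain X where X: "\<And>x. x \<ge> X \<Longrightarrow> x > 0 \<and> W x \<noteq> 0 \<and> Re (inverse (A x ^ 2)) > 1/2 \<and> exp x * x powr (- 2 * \<kappa>) * (1/2) \<ge> 85/100 * exp (85/100 * x)"
      by (auto simp: eventually_at_top_linorder)
    \<comment> \<open>Normalised so that v' = 1/W^2. Comparing Re v with exp(85 x/100) by means of D
      gives a lower bound for Re v that contradicts \<open>vlim\<close>.\<close>
    define v where "v = (\<lambda>x. - (f x / W x) / c)"
    have dv: "(v has_vector_derivative inverse (W x ^ 2)) (at x)" if x: "x \<ge> X" for x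
    proof -
      have x0: "x > 0" "W x \<noteq> 0" using X[OF x] by auto
      have "((\<lambda>x. inverse (W x)) has_vector_derivative W' x * - (inverse (W x) ^ Suc (Suc 0))) (at x)"
        using field_vector_diff_chain_at[OF dW(1)[OF x0(1)] DERIV_inverse[OF x0(2)]] by (simp add: o_def)
      from has_vector_derivative_mult[OF df(1)[OF x0(1)] this]
      have "((\<lambda>x. f x / W x) has_vector_derivative (f' x * W x - f x * W' x) / (W x * W x)) (at x)"
        using x0 by (simp add: field_simps)
      hence "((\<lambda>x. - (f x / W x) * (1 / c)) has_vector_derivative - ((f' x * W x - f x * W' x) / (W x * W x)) * (1 / c)) (at x)"
        by (intro has_vector_derivative_mult_left has_vector_derivative_minus)
      also have "- ((f' x * W x - f x * W' x) / (W x * W x)) * (1 / c) = inverse (W x ^ 2)"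
      proof -
        have "f' x * W x - f x * W' x = - c" unfolding wr[OF x0(1), symmetric] by simp
        thus ?thesis using c by (simp only:) (simp add: power2_eq_square field_simps)
      qed
      finally show ?thesis by (simp add: v_def)
    qed
    have Rv: "Re (inverse (W x ^ 2)) \<ge> 85/100 * exp (85/100 * x)" if x: "x \<ge> X" for x
    proof -
      have x0: "x > 0" using X[OF x] by auto
      have "W x = of_real (exp (- x / 2) * x powr \<kappa>) * A x" using x0 by (simp add: A_def)
      hence "inverse (W x ^ 2) = of_real (inverse ((exp (- x / 2) * x powr \<kappa>)\<^sup>2)) * inverse (A x ^ 2)"
        by (simp add: power_mult_distrib)
      also have "inverse ((exp (- x / 2) * x powr \<kappa>)\<^sup>2) = exp x * x powr (- 2 * \<kappa>)"
        using x0 by (simp add: power_mult_distrib exp_double[symmetric] exp_minus[symmetric] powr_power powr_minus[symmetric] mult.commute)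
      finally have "Re (inverse (W x ^ 2)) = exp x * x powr (- 2 * \<kappa>) * Re (inverse (A x ^ 2))" by simp
      also have "\<dots> \<ge> exp x * x powr (- 2 * \<kappa>) * (1/2)" using X[OF x] by (intro mult_left_mono) auto
      finally show ?thesis using X[OF x] by linarith
    qed
    define D where "D = (\<lambda>x. Re (v x) - exp (85/100 * x))"
    have mono: "D X \<le> D x" if "x \<ge> X" for x
    proof (rule DERIV_nonneg_imp_nondecreasing[OF that])
      fix t assume t: "X \<le> t" "t \<le> x"
      have "((\<lambda>x. Re (v x)) has_real_derivative Re (inverse (W t ^ 2))) (at t)"
        using dv[OF t(1)] by (rule has_field_derivative_Re)
      moreover have "((\<lambda>x. exp (85/100 * x)) has_real_derivative 85/100 * exp (85/100 * t)) (at t)"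
        by (auto intro!: derivative_eq_intros)
      ultimately have "(D has_real_derivative Re (inverse (W t ^ 2)) - 85/100 * exp (85/100 * t)) (at t)"
        unfolding D_def by (rule DERIV_diff)
      thus "\<exists>y. (D has_real_derivative y) (at t) \<and> 0 \<le> y" using Rv[OF t(1)] by auto
    qed
    have vlim: "((\<lambda>x. Re (v x) * exp (- (85/100) * x)) \<longlongrightarrow> 0) at_top"
    proof -
      have "((\<lambda>x. (f x * of_real (exp (- x / 4))) * inverse (A x) * (- 1 / c) * of_real (exp (- x / 10) * x powr (- \<kappa>))) \<longlongrightarrow> 0 * inverse 1 * (- 1 / c) * of_real 0) at_top"
      proof (intro tendsto_mult dec tendsto_inverse A tendsto_const tendsto_of_real)
        show "((\<lambda>x::real. exp (- x / 10) * x powr (- \<kappa>)) \<longlongrightarrow> 0) at_top" by real_asymp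
      qed simp
      hence "((\<lambda>x. Re ((f x * of_real (exp (- x / 4))) * inverse (A x) * (- 1 / c) * of_real (exp (- x / 10) * x powr (- \<kappa>)))) \<longlongrightarrow> 0) at_top"
        using tendsto_Re by fastforce
      moreover have "eventually (\<lambda>x. Re ((f x * of_real (exp (- x / 4))) * inverse (A x) * (- 1 / c) * of_real (exp (- x / 10) * x powr (- \<kappa>))) = Re (v x) * exp (- (85/100) * x)) at_top"
        using eventually_gt_at_top[of 0]
      proof eventually_elim
        fix x :: real assume x: "x > 0"
        have "exp (- (85/100) * x) = exp (- x / 4) * (exp (- x / 10) * exp (- x / 2))" by (simp add: exp_add[symmetric])
        hence E: "v x * of_real (exp (- (85/100) * x)) = (f x * of_real (exp (- x / 4))) * inverse (A x) * (- 1 / c) * of_real (exp (- x / 10) * x powr (- \<kappa>))"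
          using x by (simp add: v_def A_def powr_minus field_simps)
        show "Re ((f x * of_real (exp (- x / 4))) * inverse (A x) * (- 1 / c) * of_real (exp (- x / 10) * x powr (- \<kappa>))) = Re (v x) * exp (- (85/100) * x)"
          unfolding E[symmetric] by simp
      qed
      ultimately show ?thesis by (rule Lim_transform_eventually)
    qed
    have L: "((\<lambda>x. D X * exp (- (85/100) * x) + 1) \<longlongrightarrow> D X * 0 + 1) at_top"
    proof (intro tendsto_add tendsto_mult tendsto_const)
      show "((\<lambda>x::real. exp (- (85/100) * x)) \<longlongrightarrow> 0) at_top" by real_asymp
    qed
    have "eventually (\<lambda>x. D X * exp (- (85/100) * x) + 1 \<le> Re (v x) * exp (- (85/100) * x)) at_top"
      using eventually_ge_at_top[of X]
    proof eventually_elim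
      fix x assume "X \<le> x"
      hence "D X * exp (- (85/100) * x) \<le> D x * exp (- (85/100) * x)" using mono by (intro mult_right_mono) auto
      also have "D x * exp (- (85/100) * x) = Re (v x) * exp (- (85/100) * x) - 1"
        by (simp add: D_def left_diff_distrib exp_add[symmetric])
      finally show "D X * exp (- (85/100) * x) + 1 \<le> Re (v x) * exp (- (85/100) * x)" by simp
    qed
    from tendsto_le[OF trivial_limit_at_top_linorder vlim L this] show False by simp
  qed
  obtain X where X: "X > 0" "W X \<noteq> 0"
    using eventually_happens[OF ev] by auto
  define C where "C = f X / W X"
  have "f x - C * W x = 0" if x: "x > 0" for x
  proof (rule linear_ode_zero[where h = "\<lambda>x. f x - C * W x" and h' = "\<lambda>x. f' x - C * W' x" and q = ?q and ?x0.0 = X])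
    fix x :: real assume x: "x > 0"
    show "((\<lambda>x. f x - C * W x) has_vector_derivative f' x - C * W' x) (at x)"
      by (intro has_vector_derivative_diff has_vector_derivative_mult_right df dW x)
    have "((\<lambda>x. f' x - C * W' x) has_vector_derivative ?q x * f x - C * (?q x * W x)) (at x)"
      by (intro has_vector_derivative_diff has_vector_derivative_mult_right df dW x)
    also have "a * f x - C * (a * W x) = a * (f x - C * W x)" for a by (simp add: algebra_simps)
    finally show "((\<lambda>x. f' x - C * W' x) has_vector_derivative ?q x * (f x - C * W x)) (at x)" .
  next
    show "continuous_on {0<..} ?q" by (intro continuous_intros) auto
    show "f X - C * W X = 0" using X by (simp add: C_def)
    show "f' X - C * W' X = 0" using wr[OF X(1)] X c0 unfolding C_def by (simp add: field_simps)
  qed (use X x in auto)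
  hence "f x = C * W x" if "x > 0" for x using that by simp
  thus ?thesis by (rule that)
qed

lemma whittaker_decay:
  assumes "((\<lambda>x. W x / (of_real (exp (- x / 2)) * of_real x powr of_real \<kappa>)) \<longlongrightarrow> L) at_top"
  shows "((\<lambda>x. W x * of_real (exp (- x / 4))) \<longlongrightarrow> (0::complex)) at_top"
proof -
  have "((\<lambda>x. (W x / (of_real (exp (- x / 2)) * of_real x powr of_real \<kappa>)) * of_real (exp (- 3 * x / 4) * x powr \<kappa>)) \<longlongrightarrow> L * of_real 0) at_top"
    by (intro tendsto_mult assms tendsto_of_real) real_asymp
  moreover have "eventually (\<lambda>x. (W x / (of_real (exp (- x / 2)) * of_real x powr of_real \<kappa>)) * of_real (exp (- 3 * x / 4) * x powr \<kappa>) = W x * of_real (exp (- x / 4))) at_top"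
    using eventually_gt_at_top[of 0]
  proof eventually_elim
    fix x :: real assume x: "x > 0"
    have "exp (- 3 * x / 4) = exp (- x / 2) * exp (- x / 4)" by (simp add: exp_add[symmetric])
    thus "(W x / (of_real (exp (- x / 2)) * of_real x powr of_real \<kappa>)) * of_real (exp (- 3 * x / 4) * x powr \<kappa>) = W x * of_real (exp (- x / 4))"
      using x by (simp add: powr_of_real)
  qed
  ultimately show ?thesis using Lim_transform_eventually by fastforce
qed

text \<open>Any solution with the right asymptotics makes the choice in \<open>whittaker_W\<close>
  legitimate. The chosen function is then a multiple of it by uniqueness, and equal limits at
  infinity force the factor 1.\<close>

lemma whittaker_W_eqI:
  assumes W: "is_whittaker_W (of_real \<kappa>) \<mu> W" and x: "x > 0"
  shows "whittaker_W (of_real \<kappa>) \<mu> x = W x"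
proof -
  let ?V = "whittaker_W (of_real \<kappa>) \<mu>"
  have V: "is_whittaker_W (of_real \<kappa>) \<mu> ?V" unfolding whittaker_W_def by (rule someI[of "is_whittaker_W (of_real \<kappa>) \<mu>", OF W])
  obtain W' where W': "whittaker_ode (of_real \<kappa>) \<mu> W W'" using W by (auto simp: is_whittaker_W_iff)
  obtain V' where V': "whittaker_ode (of_real \<kappa>) \<mu> ?V V'" using V by (auto simp: is_whittaker_W_iff)
  have l: "((\<lambda>x. W x / (of_real (exp (- x / 2)) * of_real x powr of_real \<kappa>)) \<longlongrightarrow> 1) at_top"
    "((\<lambda>x. ?V x / (of_real (exp (- x / 2)) * of_real x powr of_real \<kappa>)) \<longlongrightarrow> 1) at_top"
    using W V by (auto simp: is_whittaker_W_iff)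
  obtain C where C: "\<And>x. x > 0 \<Longrightarrow> ?V x = C * W x"
    using whittaker_decaying_unique[OF V' W' l(1) whittaker_decay[OF l(2)]] by metis
  have "((\<lambda>x. C * (W x / (of_real (exp (- x / 2)) * of_real x powr of_real \<kappa>))) \<longlongrightarrow> C * 1) at_top"
    by (intro tendsto_intros l)
  moreover have "eventually (\<lambda>x. C * (W x / (of_real (exp (- x / 2)) * of_real x powr of_real \<kappa>)) = ?V x / (of_real (exp (- x / 2)) * of_real x powr of_real \<kappa>)) at_top"
    by (rule eventually_mono[OF eventually_gt_at_top[of 0]]) (simp add: C)
  ultimately have "((\<lambda>x. ?V x / (of_real (exp (- x / 2)) * of_real x powr of_real \<kappa>)) \<longlongrightarrow> C * 1) at_top"
    by (rule Lim_transform_eventually)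
  with l(2) have "C = 1" using tendsto_unique[OF trivial_limit_at_top_linorder] by fastforce
  thus ?thesis using C[OF x] by simp
qed

section \<open>Kummer integrals and their limits\<close>

text \<open>This is \<open>Gamma a\<close> times Tricomi's function U(a, a + d, X). The exponent of
  1 + u is parametrised by d so that raising a or d by one multiplies the integrand by u or by 1 +
  u.\<close>

definition kummer_integral :: "complex \<Rightarrow> complex \<Rightarrow> complex \<Rightarrow> complex" where
  "kummer_integral a d X = (LINT u:{0<..}|lborel. of_real u powr (a - 1) * of_real (1 + u) powr (d - 1) * exp (- (X * of_real u)))"

lemma kummer_integrable_bound:
  fixes a m \<delta> :: real
  assumes "a > 0" "\<delta> > 0"
  shows "set_integrable lborel {0<..} (\<lambda>u. u powr (a - 1) * (1 + u) powr m * exp (- (\<delta> * u)))"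
proof -
  obtain C where C: "C > 0" "\<And>u m'. u \<ge> 0 \<Longrightarrow> m' \<le> m \<Longrightarrow> (1 + u) powr m' \<le> C * exp (\<delta>/2 * u)"
    using one_plus_powr_le_exp[of "\<delta>/2" m] assms by auto
  have "set_integrable lborel {0<..} (\<lambda>u. C * (u powr (a - 1) * exp (- (\<delta>/2 * u))))"
    using gamma_set_integrable_real[of a "\<delta>/2"] assms by simp
  thus ?thesis
  proof (rule set_integrable_bound)
    show "set_borel_measurable lborel {0<..} (\<lambda>u. u powr (a - 1) * (1 + u) powr m * exp (- (\<delta> * u)))"
      unfolding set_borel_measurable_def
      by measurable
    show "AE x in lborel. x \<in> {0<..} \<longrightarrow> norm (x powr (a - 1) * (1 + x) powr m * exp (- (\<delta> * x))) \<le> norm (C * (x powr (a - 1) * exp (- (\<delta>/2 * x))))"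
    proof (intro AE_I2 impI)
      fix u :: real assume "u \<in> {0<..}"
      hence u: "u > 0" by simp
      have "(1 + u) powr m * exp (- (\<delta> * u)) \<le> (C * exp (\<delta>/2 * u)) * exp (- (\<delta> * u))"
        using u C by (intro mult_right_mono) auto
      also have "\<dots> = C * exp (- (\<delta>/2 * u))" by (simp add: exp_add[symmetric] field_simps)
      finally have "u powr (a - 1) * ((1 + u) powr m * exp (- (\<delta> * u))) \<le> u powr (a - 1) * (C * exp (- (\<delta>/2 * u)))"
        by (intro mult_left_mono) auto
      thus "norm (u powr (a - 1) * (1 + u) powr m * exp (- (\<delta> * u))) \<le> norm (C * (u powr (a - 1) * exp (- (\<delta>/2 * u))))"
        using C by (simp add: abs_mult mult_ac)
    qed
  qed
qed

lemma kummer_norm: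
  assumes "u > 0"
  shows "norm (of_real u powr (a - 1) * of_real (1 + u) powr (d - 1) * exp (- (X * of_real u))) =
    u powr (Re a - 1) * (1 + u) powr (Re d - 1) * exp (- (Re X * u))"
proof -
  have "norm (complex_of_real u powr (a - 1)) = u powr (Re a - 1)" "norm (complex_of_real (1 + u) powr (d - 1)) = (1 + u) powr (Re d - 1)"
    using assms by (simp_all add: norm_powr_real_powr del: of_real_add)
  thus ?thesis by (simp add: norm_mult norm_exp_eq_Re)
qed

lemma kummer_measurable:
  "(\<lambda>u. indicator {0<..} u *\<^sub>R (of_real u powr (a - 1) * of_real (1 + u) powr (d - 1) * exp (- (X * of_real u)) :: complex)) \<in> borel_measurable borel"
proof (rule borel_measurable_continuous_on_indicator)
  show "continuous_on {0<..} (\<lambda>u::real. of_real u powr (a - 1) * of_real (1 + u) powr (d - 1) * exp (- (X * of_real u)) :: complex)"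
    by (intro continuous_intros continuous_on_of_real_powr) auto
qed simp

lemma kummer_integrable:
  assumes "Re a > 0" "Re X > 0"
  shows "set_integrable lborel {0<..} (\<lambda>u. of_real u powr (a - 1) * of_real (1 + u) powr (d - 1) * exp (- (X * of_real u)) :: complex)"
proof (rule set_integrable_bound[OF kummer_integrable_bound[OF assms, of "Re d - 1"]])
  show "set_borel_measurable lborel {0<..} (\<lambda>u. of_real u powr (a - 1) * of_real (1 + u) powr (d - 1) * exp (- (X * of_real u)) :: complex)"
    unfolding set_borel_measurable_def using kummer_measurable[of a d X] by simp
qed (intro AE_I2 impI, simp add: kummer_norm del: of_real_add)

lemma kummer_deriv:
  assumes a: "Re a > 0" and X: "Re X > 0"
  shows "(kummer_integral a d has_field_derivative - kummer_integral (a + 1) d X) (at X)"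
proof -
  let ?f = "\<lambda>a X u. indicator {0<..} u *\<^sub>R (of_real u powr (a - 1) * of_real (1 + u) powr (d - 1) * exp (- (X * of_real u)) :: complex)"
  let ?g = "\<lambda>u. indicator {0<..} u *\<^sub>R (u powr (Re a - 1) * (1 + u) powr (Re d - 1) * exp (- (Re X / 2 * u)))"
  have "((\<lambda>z. LINT u|lborel. ?f a z u) has_field_derivative (LINT u|lborel. - ?f (a + 1) X u)) (at X)"
  proof (rule has_field_derivative_integral(2)[where f' = "\<lambda>z u. - ?f (a + 1) z u" and r = "Re X / 2" and g = ?g])
    show "integrable lborel ?g"
      using kummer_integrable_bound[OF a, of "Re X / 2" "Re d - 1"] X by (simp add: set_integrable_def)
    show "?f a z \<in> borel_measurable lborel" for z using kummer_measurable by simp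
    show "((\<lambda>z. ?f a z u) has_field_derivative - ?f (a + 1) z u) (at z)" for z u
    proof (cases "u > 0")
      case True
      have p: "of_real u powr a = of_real u * (of_real u powr (a - 1) :: complex)"
        using powr_add[of "of_real u :: complex" 1 "a - 1"] True by simp
      have "((\<lambda>z. of_real u powr (a - 1) * of_real (1 + u) powr (d - 1) * exp (- (z * of_real u))) has_field_derivative
        of_real u powr (a - 1) * of_real (1 + u) powr (d - 1) * (exp (- (z * of_real u)) * (- of_real u))) (at z)"
        by (auto intro!: derivative_eq_intros)
      thus ?thesis using True by (simp add: p mult_ac)
    qed simp
    fix z u assume "z \<in> ball X (Re X / 2)"
    hence "Re X / 2 \<le> Re z" using abs_Re_le_cmod[of "X - z"] by (simp add: dist_norm)
    thus "norm (?f a z u) \<le> ?g u"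
      by (cases "u > 0") (auto simp: kummer_norm simp del: of_real_add intro!: mult_left_mono mult_right_mono)
  qed (use X in auto)
  thus ?thesis unfolding kummer_integral_def[abs_def] set_lebesgue_integral_def by simp
qed

lemma powr_mult_base':
  fixes w c :: complex
  assumes "w \<noteq> 0"
  shows "w powr (c + 1 - 1) = w * w powr (c - 1)"
proof -
  have "w powr (c + 1 - 1) = w powr (1 + (c - 1))" by simp
  also have "\<dots> = w * w powr (c - 1)" unfolding powr_add using assms by simp
  finally show ?thesis .
qed

lemma kummer_contiguous:
  assumes a: "Re a > 0" and X: "Re X > 0"
  shows "kummer_integral a (d + 1) X = kummer_integral a d X + kummer_integral (a + 1) d X"
proof -
  have a1: "Re (a + 1) > 0" using a by simp
  have "kummer_integral a d X + kummer_integral (a + 1) d X = (LINT u:{0<..}|lborel. of_real u powr (a - 1) * of_real (1 + u) powr (d - 1) * exp (- (X * of_real u)) +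
     of_real u powr (a + 1 - 1) * of_real (1 + u) powr (d - 1) * exp (- (X * of_real u)))"
    unfolding kummer_integral_def by (rule set_integral_add(2)[OF kummer_integrable[OF a X] kummer_integrable[OF a1 X], symmetric])
  also have "\<dots> = kummer_integral a (d + 1) X"
    unfolding kummer_integral_def
  proof (rule set_lebesgue_integral_cong)
    show "\<forall>u. u \<in> {0<..} \<longrightarrow> of_real u powr (a - 1) * of_real (1 + u) powr (d - 1) * exp (- (X * of_real u)) +
     of_real u powr (a + 1 - 1) * of_real (1 + u) powr (d - 1) * exp (- (X * of_real u)) = of_real u powr (a - 1) * of_real (1 + u) powr (d + 1 - 1) * exp (- (X * of_real u))"
    proof (intro allI impI)
      fix u :: real assume "u \<in> {0<..}"
      hence "u \<noteq> 0" "1 + u \<noteq> 0" by auto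
      hence u: "complex_of_real u \<noteq> 0" "complex_of_real (1 + u) \<noteq> 0" by (simp_all only: of_real_eq_0_iff not_False_eq_True)
      have e1: "of_real u powr (a + 1 - 1) = of_real u * (of_real u powr (a - 1) :: complex)"
        by (rule powr_mult_base'[OF u(1)])
      have e2: "of_real (1 + u) powr (d + 1 - 1) = of_real (1 + u) * (of_real (1 + u) powr (d - 1) :: complex)"
        by (rule powr_mult_base'[OF u(2)])
      have "A * B * e + (v * A) * B * e = A * ((1 + v) * B) * e" for A B e v :: complex
        by (simp add: algebra_simps)
      thus "of_real u powr (a - 1) * of_real (1 + u) powr (d - 1) * exp (- (X * of_real u)) +
     of_real u powr (a + 1 - 1) * of_real (1 + u) powr (d - 1) * exp (- (X * of_real u)) = of_real u powr (a - 1) * of_real (1 + u) powr (d + 1 - 1) * exp (- (X * of_real u))"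
        unfolding e1 e2 unfolding of_real_add of_real_1 by this
    qed
  qed simp
  finally show ?thesis ..
qed

text \<open>The right integrand minus the left one is the derivative of u^a (1 + u)^d exp(-X u),
  which vanishes at 0 because Re a > 0 and at infinity because X > 0.\<close>

lemma kummer_ibp:
  assumes a: "Re a > 0" and X: "X > 0"
  shows "of_real X * kummer_integral (a + 1) (d + 1) (of_real X) = a * kummer_integral a (d + 1) (of_real X) + d * kummer_integral (a + 1) d (of_real X)"
proof -
  let ?t = "\<lambda>a d u. of_real u powr (a - 1) * of_real (1 + u) powr (d - 1) * exp (- (of_real X * of_real u)) :: complex"
  let ?D = "\<lambda>u. (a * ?t a (d + 1) u + d * ?t (a + 1) d u) - of_real X * ?t (a + 1) (d + 1) u"
  have a1: "Re (a + 1) > 0" using a by simp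
  have X': "Re (of_real X) > 0" using X by simp
  have i1: "set_integrable lborel {0<..} (\<lambda>u. a * ?t a (d + 1) u)"
    and i2: "set_integrable lborel {0<..} (\<lambda>u. d * ?t (a + 1) d u)"
    and i3: "set_integrable lborel {0<..} (\<lambda>u. of_real X * ?t (a + 1) (d + 1) u)"
    by (intro set_integrable_mult_right kummer_integrable a a1 X')+
  have i: "set_integrable lborel {0<..} ?D"
    by (intro set_integral_diff set_integral_add i1 i2 i3)
  have "(LBINT u=0..\<infinity>. ?D u) = 0 - 0"
  proof (rule interval_integral_FTC_integrable[where F = "?t (a + 1) (d + 1)"])
    fix u assume "0 < ereal u"
    hence u: "u > 0" by simp
    have c: "complex_of_real (1 + u) \<notin> \<real>\<^sub>\<le>\<^sub>0" "complex_of_real u \<notin> \<real>\<^sub>\<le>\<^sub>0"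
      unfolding complex_nonpos_Reals_iff using u by auto
    have "((\<lambda>u. u powr a * (1 + u) powr d * exp (- (of_real X * u))) has_field_derivative
        ((a * of_real u powr (a - 1)) * of_real (1 + u) powr d + (d * of_real (1 + u) powr (d - 1)) * of_real u powr a) * exp (- (of_real X * of_real u)) +
        (exp (- (of_real X * of_real u)) * (- of_real X)) * (of_real u powr a * of_real (1 + u) powr d)) (at (of_real u))"
      using c by (auto intro!: derivative_eq_intros)
    from has_vector_derivative_real_field[OF this]
    show "(?t (a + 1) (d + 1) has_vector_derivative ?D u) (at u)"
      by (simp add: algebra_simps)
    show "isCont ?D u"
      using c by (intro continuous_intros) auto
  next
    show "set_integrable lborel (einterval 0 \<infinity>) ?D"
    proof -
      have "einterval 0 \<infinity> = {0<..}" by (auto simp: einterval_def)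
      thus ?thesis using i by simp
    qed
    have nt: "norm (?t (a + 1) (d + 1) u) = u powr Re a * ((1 + u) powr Re d * exp (- (X * u)))" if "u > 0" for u
      using kummer_norm[OF that, of "a + 1" "d + 1" "of_real X"] by simp
    show "((?t (a + 1) (d + 1) \<circ> real_of_ereal) \<longlongrightarrow> 0) (at_right 0)"
    proof -
      have "((\<lambda>u. u powr Re a * ((1 + u) powr Re d * exp (- (X * u)))) \<longlongrightarrow> 0) (at_right 0)" using a by real_asymp
      moreover have "eventually (\<lambda>u. norm (?t (a + 1) (d + 1) u) = u powr Re a * ((1 + u) powr Re d * exp (- (X * u)))) (at_right 0)"
        using eventually_at_right_less[of 0] by eventually_elim (rule nt)
      ultimately have "((\<lambda>u. norm (?t (a + 1) (d + 1) u)) \<longlongrightarrow> 0) (at_right 0)"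
        by (subst tendsto_cong)
      hence "(?t (a + 1) (d + 1) \<longlongrightarrow> 0) (at_right 0)" by (rule tendsto_norm_zero_cancel)
      thus ?thesis by (simp add: zero_ereal_def ereal_tendsto_simps1)
    qed
    show "((?t (a + 1) (d + 1) \<circ> real_of_ereal) \<longlongrightarrow> 0) (at_left \<infinity>)"
    proof -
      have "((\<lambda>u. u powr Re a * ((1 + u) powr Re d * exp (- (X * u)))) \<longlongrightarrow> 0) at_top" using X by real_asymp
      moreover have "eventually (\<lambda>u. norm (?t (a + 1) (d + 1) u) = u powr Re a * ((1 + u) powr Re d * exp (- (X * u)))) at_top"
        using eventually_gt_at_top[of 0] by eventually_elim (rule nt)
      ultimately have "((\<lambda>u. norm (?t (a + 1) (d + 1) u)) \<longlongrightarrow> 0) at_top"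
        by (subst tendsto_cong)
      hence "(?t (a + 1) (d + 1) \<longlongrightarrow> 0) at_top" by (rule tendsto_norm_zero_cancel)
      thus ?thesis by (simp add: ereal_tendsto_simps1)
    qed
  qed auto
  moreover have "(LBINT u=0..\<infinity>. ?D u) = (LINT u:{0<..}|lborel. ?D u)"
  proof -
    have "einterval 0 \<infinity> = {0<..}" by (auto simp: einterval_def)
    thus ?thesis by (simp add: interval_lebesgue_integral_def)
  qed
  moreover have "(LINT u:{0<..}|lborel. ?D u) = a * kummer_integral a (d + 1) (of_real X) + d * kummer_integral (a + 1) d (of_real X) - of_real X * kummer_integral (a + 1) (d + 1) (of_real X)"
    unfolding set_integral_diff(2)[OF set_integral_add(1)[OF i1 i2] i3] set_integral_add(2)[OF i1 i2] kummer_integral_def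
    by (simp only: set_integral_mult_right)
  ultimately show ?thesis by simp
qed

text \<open>Substituting t = X u turns the product into the integral of t^(a-1) (1 + t/X)^(d-1)
  exp(-t), whose middle factor tends to 1.\<close>

lemma kummer_at_top:
  assumes a: "Re a > 0"
  shows "((\<lambda>X. of_real X powr a * kummer_integral a d (of_real X)) \<longlongrightarrow> Gamma a) at_top"
proof -
  let ?s = "\<lambda>X t. indicator {0<..} t *\<^sub>R (of_real t powr (a - 1) * of_real (1 + t / X) powr (d - 1) * of_real (exp (- t))) :: complex"
  define m where "m = \<bar>Re d - 1\<bar>"
  \<comment> \<open>With \<open>max 1 X\<close> in place of X the integrand is dominated for every
    real X, and nothing changes for X >= 1.\<close>
  have "((\<lambda>X. LINT t|lborel. ?s (max 1 X) t) \<longlongrightarrow> (LINT t|lborel. indicator {0<..} t *\<^sub>R (of_real t powr (a - 1) * of_real (exp (- (1 * t)))))) at_top"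
  proof (rule integral_dominated_convergence_at_top)
    show "integrable lborel (\<lambda>t. indicator {0<..} t *\<^sub>R (t powr (Re a - 1) * (1 + t) powr m * exp (- (1 * t))))"
      using kummer_integrable_bound[OF a, of 1 m] by (simp add: set_integrable_def)
    show "(\<lambda>t. indicator {0<..} t *\<^sub>R (of_real t powr (a - 1) * of_real (exp (- (1 * t)))) :: complex) \<in> borel_measurable lborel"
      using gamma_set_integrable[OF a, of 1] unfolding set_integrable_def by (auto dest: borel_measurable_integrable)
    show "?s (max 1 X) \<in> borel_measurable lborel" for X
    proof -
      have "?s (max 1 X) \<in> borel_measurable borel"
      proof (rule borel_measurable_continuous_on_indicator)
        show "continuous_on {0<..} (\<lambda>t. of_real t powr (a - 1) * of_real (1 + t / max 1 X) powr (d - 1) * of_real (exp (- t)) :: complex)"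
          by (intro continuous_intros continuous_on_of_real_powr) (auto intro!: add_pos_pos divide_pos_pos)
      qed simp
      thus ?thesis by simp
    qed
    show "AE t in lborel. ((\<lambda>X. ?s (max 1 X) t) \<longlongrightarrow> indicator {0<..} t *\<^sub>R (of_real t powr (a - 1) * of_real (exp (- (1 * t))))) at_top"
    proof (intro AE_I2)
      fix t :: real
      have "((\<lambda>X. 1 + t / max 1 X) \<longlongrightarrow> 1) at_top" by real_asymp
      hence "((\<lambda>X. complex_of_real (1 + t / max 1 X) powr (d - 1)) \<longlongrightarrow> of_real 1 powr (d - 1)) at_top"
        by (rule tendsto_of_real_powr) simp
      hence "((\<lambda>X. ?s (max 1 X) t) \<longlongrightarrow> indicator {0<..} t *\<^sub>R (of_real t powr (a - 1) * of_real 1 powr (d - 1) * of_real (exp (- t)))) at_top"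
        by (intro tendsto_scaleR tendsto_mult tendsto_const)
      thus "((\<lambda>X. ?s (max 1 X) t) \<longlongrightarrow> indicator {0<..} t *\<^sub>R (of_real t powr (a - 1) * of_real (exp (- (1 * t))))) at_top" by simp
    qed
    show "\<forall>\<^sub>F X in at_top. AE t in lborel. norm (?s (max 1 X) t) \<le> indicator {0<..} t *\<^sub>R (t powr (Re a - 1) * (1 + t) powr m * exp (- (1 * t)))"
    proof (intro always_eventually allI AE_I2)
      fix X t :: real
      show "norm (?s (max 1 X) t) \<le> indicator {0<..} t *\<^sub>R (t powr (Re a - 1) * (1 + t) powr m * exp (- (1 * t)))"
      proof (cases "t > 0")
        case True
        have p: "1 \<le> 1 + t / max 1 X" "1 + t / max 1 X \<le> 1 + t"
          using True divide_left_mono[of 1 "max 1 X" t] by auto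
        have "norm (complex_of_real (1 + t / max 1 X) powr (d - 1)) = (1 + t / max 1 X) powr (Re d - 1)"
          using p by (subst norm_powr_real_powr) auto
        also have "\<dots> \<le> (1 + t / max 1 X) powr m" using p by (intro powr_mono) (auto simp: m_def)
        also have "\<dots> \<le> (1 + t) powr m" using p by (intro powr_mono2) (auto simp: m_def)
        finally have "norm (complex_of_real (1 + t / max 1 X) powr (d - 1)) \<le> (1 + t) powr m" .
        moreover have "norm (complex_of_real t powr (a - 1)) = t powr (Re a - 1)"
          using True by (subst norm_powr_real_powr) auto
        ultimately show ?thesis using True by (simp add: norm_mult mult_left_mono mult_right_mono del: of_real_add)
      qed simp
    qed
  qed
  also have "(LINT t|lborel. indicator {0<..} t *\<^sub>R (of_real t powr (a - 1) * of_real (exp (- (1 * t))))) = Gamma a"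
    using gamma_set_integral[OF a, of 1] by (simp add: set_lebesgue_integral_def)
  finally have L: "((\<lambda>X. LINT t|lborel. ?s (max 1 X) t) \<longlongrightarrow> Gamma a) at_top" .
  show ?thesis
  proof (rule Lim_transform_eventually[OF L], rule eventually_mono[OF eventually_ge_at_top[of 1]])
    fix X :: real assume X: "1 \<le> X"
    have e: "indicator {0<..} (0 + X * u) *\<^sub>R (of_real (0 + X * u) powr (a - 1) * of_real (1 + (0 + X * u) / X) powr (d - 1) * of_real (exp (- (0 + X * u)))) =
      of_real X powr (a - 1) * (indicator {0<..} u *\<^sub>R (of_real u powr (a - 1) * of_real (1 + u) powr (d - 1) * exp (- (of_real X * of_real u))))" for u
    proof (cases "u > 0")
      case True
      hence "(of_real X * of_real u :: complex) powr (a - 1) = of_real X powr (a - 1) * of_real u powr (a - 1)"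
        using X by (intro powr_times_real) auto
      thus ?thesis using True X by (simp add: indicator_def exp_of_real[symmetric])
    next
      case False thus ?thesis using X by (simp add: indicator_def zero_less_mult_iff)
    qed
    have "(LINT t|lborel. ?s (max 1 X) t) = (LINT t|lborel. ?s X t)" using X by (simp add: max_def)
    also have "\<dots> = \<bar>X\<bar> *\<^sub>R (LINT u|lborel. ?s X (0 + X * u))"
      by (rule lborel_integral_real_affine) (use X in auto)
    also have "\<dots> = (of_real X * of_real X powr (a - 1)) * kummer_integral a d (of_real X)"
      unfolding e kummer_integral_def set_lebesgue_integral_def integral_mult_right_zero using X by (simp add: scaleR_conv_of_real)
    also have "of_real X * of_real X powr (a - 1) = of_real X powr a"
      using powr_add[of "of_real X :: complex" 1 "a - 1"] X by simp
    finally show "(LINT t|lborel. ?s (max 1 X) t) = of_real X powr a * kummer_integral a d (of_real X)" .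
  qed
qed

text \<open>Substituting t = X u gives the integral of t^(a-1) (X + t)^(d-1) exp(-t), whose limit
  for X -> 0 is a Gamma integral that converges because Re(a + d) > 1. The sequence 1/(n+1) is
  enough to identify a constant later.\<close>

lemma kummer_at_zero:
  assumes a: "Re a > 0" and ad: "Re (a + d) > 1"
  shows "(\<lambda>n. of_real (1 / real (Suc n)) powr (a + d - 1) * kummer_integral a d (of_real (1 / real (Suc n)))) \<longlonglongrightarrow> Gamma (a + d - 1)"
proof -
  let ?s = "\<lambda>X t. indicator {0<..} t *\<^sub>R (of_real t powr (a - 1) * of_real (X + t) powr (d - 1) * of_real (exp (- t))) :: complex"
  let ?x = "\<lambda>n. 1 / real (Suc n)"
  define m where "m = Re d - 1"
  have x: "0 < ?x n" "?x n \<le> 1" for n by auto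
  let ?w1 = "\<lambda>t. indicator {0<..} t *\<^sub>R (t powr (Re (a + d) - 1 - 1) * exp (- (1 * t)))"
  let ?w2 = "\<lambda>t. indicator {0<..} t *\<^sub>R (t powr (Re a - 1) * (1 + t) powr m * exp (- (1 * t)))"
  have "(\<lambda>n. LINT t|lborel. ?s (?x n) t) \<longlonglongrightarrow> (LINT t|lborel. indicator {0<..} t *\<^sub>R (of_real t powr (a + d - 1 - 1) * of_real (exp (- (1 * t)))))"
  proof (rule integral_dominated_convergence)
    show "integrable lborel (\<lambda>t. ?w1 t + ?w2 t)"
      using kummer_integrable_bound[OF a, of 1 m] gamma_set_integrable_real[of "Re (a + d) - 1" 1] ad
      by (intro Bochner_Integration.integrable_add) (auto simp: set_integrable_def)
    have "Re (a + d - 1) > 0" using ad by simp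
    from gamma_set_integrable[OF this, of 1]
    show "(\<lambda>t. indicator {0<..} t *\<^sub>R (of_real t powr (a + d - 1 - 1) * of_real (exp (- (1 * t)))) :: complex) \<in> borel_measurable lborel"
      unfolding set_integrable_def by (auto dest: borel_measurable_integrable)
    show "?s (?x n) \<in> borel_measurable lborel" for n
    proof -
      have "?s (?x n) \<in> borel_measurable borel"
      proof (rule borel_measurable_continuous_on_indicator)
        show "continuous_on {0<..} (\<lambda>t. of_real t powr (a - 1) * of_real (?x n + t) powr (d - 1) * of_real (exp (- t)) :: complex)"
          using x(1)[of n] by (intro continuous_intros continuous_on_of_real_powr) (auto intro!: add_pos_pos)
      qed simp
      thus ?thesis by simp
    qed
    show "AE t in lborel. (\<lambda>n. ?s (?x n) t) \<longlonglongrightarrow> indicator {0<..} t *\<^sub>R (of_real t powr (a + d - 1 - 1) * of_real (exp (- (1 * t))))"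
    proof (intro AE_I2)
      fix t :: real
      show "(\<lambda>n. ?s (?x n) t) \<longlonglongrightarrow> indicator {0<..} t *\<^sub>R (of_real t powr (a + d - 1 - 1) * of_real (exp (- (1 * t))))"
      proof (cases "t > 0")
        case True
        have "(\<lambda>n. ?x n + t) \<longlonglongrightarrow> t" by real_asymp
        hence "(\<lambda>n. complex_of_real (?x n + t) powr (d - 1)) \<longlonglongrightarrow> of_real t powr (d - 1)"
          by (rule tendsto_of_real_powr) (rule True)
        hence "(\<lambda>n. ?s (?x n) t) \<longlonglongrightarrow> indicator {0<..} t *\<^sub>R (of_real t powr (a - 1) * of_real t powr (d - 1) * of_real (exp (- t)))"
          by (intro tendsto_scaleR tendsto_mult tendsto_const)
        also have "complex_of_real t powr (a - 1) * of_real t powr (d - 1) = of_real t powr (a + d - 1 - 1)"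
          by (simp add: powr_add[symmetric])
        finally show ?thesis by simp
      qed simp
    qed
    show "AE t in lborel. norm (?s (?x n) t) \<le> ?w1 t + ?w2 t" for n
    proof (intro AE_I2)
      fix t :: real
      show "norm (?s (?x n) t) \<le> ?w1 t + ?w2 t"
      proof (cases "t > 0")
        case True
        have p: "t \<le> ?x n + t" "?x n + t \<le> 1 + t" "0 < ?x n + t" using True x[of n] by (auto intro: add_pos_pos)
        have "norm (complex_of_real (?x n + t) powr (d - 1)) = (?x n + t) powr m"
          using p unfolding m_def by (subst norm_powr_real_powr) auto
        \<comment> \<open>For 0 < X <= 1 the power of X + t lies below its value at X = 1 or at X =
          0, according to the sign of m; the majorant contains both.\<close>
        also have "\<dots> \<le> t powr m + (1 + t) powr m"
        proof (cases "m \<ge> 0")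
          case True
          hence "(?x n + t) powr m \<le> (1 + t) powr m" using p by (intro powr_mono2) auto
          thus ?thesis by (simp add: add_increasing)
        next
          case False
          hence "(?x n + t) powr m \<le> t powr m" using p \<open>t > 0\<close> by (intro powr_mono2') auto
          thus ?thesis by (simp add: add_increasing2)
        qed
        finally have "norm (complex_of_real t powr (a - 1)) * norm (complex_of_real (?x n + t) powr (d - 1)) * exp (- t) \<le> t powr (Re a - 1) * (t powr m + (1 + t) powr m) * exp (- t)"
          using True by (intro mult_right_mono mult_mono) (auto simp: norm_powr_real_powr)
        also have "\<dots> = (t powr (Re a - 1) * t powr m) * exp (- t) + t powr (Re a - 1) * (1 + t) powr m * exp (- t)"
          by (simp add: algebra_simps)
        also have "t powr (Re a - 1) * t powr m = t powr (Re (a + d) - 1 - 1)" by (simp add: powr_add[symmetric] m_def)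
        finally show ?thesis using True by (simp add: norm_mult del: of_real_add)
      qed simp
    qed
  qed
  also have "(LINT t|lborel. indicator {0<..} t *\<^sub>R (of_real t powr (a + d - 1 - 1) * of_real (exp (- (1 * t))))) = Gamma (a + d - 1)"
    using gamma_set_integral[of "a + d - 1" 1] ad by (simp add: set_lebesgue_integral_def)
  finally have LL: "(\<lambda>n. LINT t|lborel. ?s (?x n) t) \<longlonglongrightarrow> Gamma (a + d - 1)" .
  have R: "(LINT t|lborel. ?s X t) = of_real X powr (a + d - 1) * kummer_integral a d (of_real X)" if X: "X > 0" for X
  proof -
    have e: "?s X (0 + X * u) = of_real X powr (a - 1) * of_real X powr (d - 1) * (indicator {0<..} u *\<^sub>R (of_real u powr (a - 1) * of_real (1 + u) powr (d - 1) * exp (- (of_real X * of_real u))))" for u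
    proof (cases "u > 0")
      case True
      hence "(of_real X * of_real u :: complex) powr (a - 1) = of_real X powr (a - 1) * of_real u powr (a - 1)"
        using X by (intro powr_times_real) auto
      moreover have "complex_of_real (X + X * u) powr (d - 1) = of_real X powr (d - 1) * of_real (1 + u) powr (d - 1)"
      proof -
        have "complex_of_real (X + X * u) = of_real X * of_real (1 + u)" by (simp add: algebra_simps)
        thus ?thesis using powr_times_real[of "of_real X :: complex" "of_real (1 + u)" "d - 1"] True X by simp
      qed
      ultimately show ?thesis using True X by (simp add: indicator_def exp_of_real[symmetric] del: of_real_add)
    next
      case False thus ?thesis using X by (simp add: indicator_def zero_less_mult_iff)
    qed
    have "(LINT t|lborel. ?s X t) = \<bar>X\<bar> *\<^sub>R (LINT u|lborel. ?s X (0 + X * u))"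
      by (rule lborel_integral_real_affine) (use X in auto)
    also have "\<dots> = (of_real X * (of_real X powr (a - 1) * of_real X powr (d - 1))) * kummer_integral a d (of_real X)"
      unfolding e kummer_integral_def set_lebesgue_integral_def integral_mult_right_zero using X by (simp add: scaleR_conv_of_real)
    also have "of_real X * (of_real X powr (a - 1) * of_real X powr (d - 1)) = (of_real X powr (1 + (a - 1 + (d - 1))) :: complex)"
      using X by (subst powr_add, subst powr_add) auto
    also have "1 + (a - 1 + (d - 1)) = a + d - 1" by simp
    finally show ?thesis .
  qed
  show ?thesis using LL unfolding R[OF x(1)] .
qed

text \<open>For \<open>\<kappa> \<le> 0\<close> Whittaker's function is the classical confluent hypergeometric integral.\<close>

lemma whittaker_exists_nonpos:
  fixes \<kappa> :: real
  assumes k: "\<kappa> \<le> 0" and \<sigma>: "Re \<sigma> > 1"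
  obtains W W' where "whittaker_ode (of_real \<kappa>) (\<sigma> - 1/2) W W'"
    "((\<lambda>x. W x / (of_real (exp (- x / 2)) * of_real x powr of_real \<kappa>)) \<longlongrightarrow> 1) at_top"
    "((\<lambda>x. W' x / (of_real (exp (- x / 2)) * of_real x powr of_real \<kappa>)) \<longlongrightarrow> - 1/2) at_top"
    "(\<lambda>n. of_real (1 / real (Suc n)) powr (\<sigma> - 1) * W (1 / real (Suc n))) \<longlonglongrightarrow> Gamma (2 * \<sigma> - 1) * rGamma (\<sigma> - of_real \<kappa>)"
proof -
  \<comment> \<open>The parameters in W = exp(-x/2) x^(\<mu>+1/2) U(\<mu>-\<kappa>+1/2, 1+2\<mu>, x)
    for \<mu> = \<sigma> - 1/2. The condition \<kappa> <= 0 gives Re a > 1, so the integral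
    converges.\<close>
  define a where "a = \<sigma> - of_real \<kappa>"
  define d where "d = \<sigma> + of_real \<kappa>"
  have a: "Re a > 0" "Re (a + 1) > 0" "Re (a + 2) > 0" and a1: "Re a > 1" using k \<sigma> by (auto simp: a_def)
  have ad: "a + d = 2 * \<sigma>" by (simp add: a_def d_def)
  have Ga: "Gamma a \<noteq> 0" using a(1) by (auto simp: Gamma_eq_zero_iff elim!: nonpos_Ints_cases)
  define T where "T = (\<lambda>i x. kummer_integral (a + of_nat i) d (of_real x))"
  have dT: "(T i has_vector_derivative - T (Suc i) x) (at x)" if "x > 0" for i x
  proof -
    have "Re (a + of_nat i) > 0" using a by simp
    from kummer_deriv[OF this, of "of_real x" d] that
    have "(kummer_integral (a + of_nat i) d has_field_derivative - kummer_integral (a + of_nat (Suc i)) d (of_real x)) (at (of_real x))"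
      by (simp add: algebra_simps)
    from has_vector_derivative_real_field[OF this] show ?thesis unfolding T_def .
  qed
  \<comment> \<open>Up to sign the \<open>T i\<close> are the successive derivatives of
    \<open>T 0\<close>, so this recursion is Kummer's equation; d is eliminated by a + d = 2
    \<sigma>.\<close>
  have rel: "T 2 x = (a * T 0 x + 2 * \<sigma> * T 1 x) / of_real x - T 1 x" if x: "x > 0" for x
  proof -
    have X: "Re (of_real x) > 0" using x by simp
    have "of_real x * (T 1 x + T 2 x) = a * (T 0 x + T 1 x) + d * T 1 x"
      using kummer_ibp[OF a(1) x, of d] kummer_contiguous[OF a(1) X, of d] kummer_contiguous[OF a(2) X, of d]
      unfolding T_def by (simp add: add.assoc)
    also have "\<dots> = a * T 0 x + (a + d) * T 1 x" by (simp add: algebra_simps)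
    finally show ?thesis unfolding ad using x by (simp add: field_simps)
  qed
  \<comment> \<open>The factor \<open>rGamma a\<close> cancels the Gamma factor of the Kummer
    integral, so that the limit at infinity becomes 1.\<close>
  define E where "E = (\<lambda>x. rGamma a * of_real (exp (- x / 2)) * of_real x powr \<sigma> :: complex)"
  have dE: "(E has_vector_derivative (- 1/2 + \<sigma> / of_real x) * E x) (at x)" if x: "x > 0" for x
  proof -
    have c: "complex_of_real x \<notin> \<real>\<^sub>\<le>\<^sub>0" using x by (auto simp: complex_nonpos_Reals_iff)
    have p: "complex_of_real x powr (\<sigma> - 1) = of_real x powr \<sigma> / of_real x" using x by (simp add: powr_diff)
    have "((\<lambda>z. rGamma a * exp (- z / 2) * z powr \<sigma>) has_field_derivative
      (rGamma a * (exp (- of_real x / 2) * (- 1/2))) * of_real x powr \<sigma> + (\<sigma> * of_real x powr (\<sigma> - 1)) * (rGamma a * exp (- of_real x / 2))) (at (of_real x))"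
      using c by (auto intro!: derivative_eq_intros)
    from has_vector_derivative_real_field[OF this] show ?thesis
      unfolding E_def p by (simp add: exp_of_real[symmetric] field_simps)
  qed
  define W where "W = (\<lambda>x. E x * T 0 x)"
  define W' where "W' = (\<lambda>x. E x * ((- 1/2 + \<sigma> / of_real x) * T 0 x - T 1 x))"
  have ode: "whittaker_ode (of_real \<kappa>) (\<sigma> - 1/2) W W'"
    unfolding whittaker_ode_def
  proof (intro allI impI conjI)
    fix x :: real assume x: "x > 0"
    have "(W has_vector_derivative E x * (- T (Suc 0) x) + ((- 1/2 + \<sigma> / of_real x) * E x) * T 0 x) (at x)"
      unfolding W_def by (intro has_vector_derivative_mult dE dT x)
    thus "(W has_vector_derivative W' x) (at x)" unfolding W'_def by (simp add: algebra_simps)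
    have dq: "((\<lambda>x. - 1/2 + \<sigma> / of_real x) has_vector_derivative - (\<sigma> / (of_real x)\<^sup>2)) (at x)"
    proof -
      have "((\<lambda>z. - 1/2 + \<sigma> / z) has_field_derivative - (\<sigma> / (of_real x)\<^sup>2)) (at (of_real x))"
        using x by (auto intro!: derivative_eq_intros simp: power2_eq_square)
      from has_vector_derivative_real_field[OF this] show ?thesis .
    qed
    let ?q = "- 1/2 + \<sigma> / complex_of_real x"
    have "(W' has_vector_derivative E x * ((?q * (- T (Suc 0) x) + (- (\<sigma> / (of_real x)\<^sup>2)) * T 0 x) - (- T (Suc 1) x)) + (?q * E x) * (?q * T 0 x - T 1 x)) (at x)"
      unfolding W'_def by (intro has_vector_derivative_mult has_vector_derivative_diff dE dT dq x)
    also have "E x * ((?q * (- T (Suc 0) x) + (- (\<sigma> / (of_real x)\<^sup>2)) * T 0 x) - (- T (Suc 1) x)) + (?q * E x) * (?q * T 0 x - T 1 x) =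
      - (- 1/4 + of_real \<kappa> / of_real x + (1/4 - (\<sigma> - 1/2)\<^sup>2) / (of_real x)\<^sup>2) * W x"
    proof -
      have "T (Suc 1) x = T 2 x" by (simp add: numeral_2_eq_2)
      hence r: "T (Suc 1) x = (a * T 0 x + 2 * \<sigma> * T 1 x) / of_real x - T 1 x" using rel[OF x] by simp
      have ak: "of_real \<kappa> = \<sigma> - a" by (simp add: a_def)
      have key: "E*(((- 1/2+\<sigma>*i)*(-t1) + (-(\<sigma>*i^2))*t0) - (-((a*t0+2*\<sigma>*t1)*i - t1))) + ((- 1/2+\<sigma>*i)*E)*((- 1/2+\<sigma>*i)*t0 - t1) =
          -(- 1/4+(\<sigma>-a)*i+(1/4-(\<sigma>-1/2)^2)*i^2)*(E*t0)" for E i t0 t1 a \<sigma> :: complex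
        by (simp add: field_simps power2_eq_square)
      show ?thesis unfolding r W_def ak divide_inverse unfolding One_nat_def
        by (rule key[where E = "E x" and i = "inverse (of_real x)" and ?t1.0 = "T (Suc 0) x" and ?t0.0 = "T 0 x", unfolded divide_inverse power_inverse])
    qed
    finally show "(W' has_vector_derivative - (- 1/4 + of_real \<kappa> / of_real x + (1/4 - (\<sigma> - 1/2)\<^sup>2) / (of_real x)\<^sup>2) * W x) (at x)" .
  qed
  let ?\<Phi> = "\<lambda>x. of_real (exp (- x / 2)) * of_real x powr of_real \<kappa> :: complex"
  have EF: "E x / ?\<Phi> x = rGamma a * of_real x powr a" if "x > 0" for x
  proof -
    have "of_real x powr \<sigma> = of_real x powr a * (of_real x powr of_real \<kappa> :: complex)" by (simp add: powr_add[symmetric] a_def)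
    thus ?thesis using that by (simp add: E_def)
  qed
  have rg: "rGamma a * Gamma a = 1" using Ga by (simp add: rGamma_inverse_Gamma)
  have L0: "((\<lambda>x. W x / ?\<Phi> x) \<longlongrightarrow> 1) at_top"
  proof (rule Lim_transform_eventually)
    show "((\<lambda>x. rGamma a * (of_real x powr a * kummer_integral a d (of_real x))) \<longlongrightarrow> 1) at_top"
      using tendsto_mult[OF tendsto_const[of "rGamma a"] kummer_at_top[OF a(1), of d]] rg by simp
    show "eventually (\<lambda>x. rGamma a * (of_real x powr a * kummer_integral a d (of_real x)) = W x / ?\<Phi> x) at_top"
    proof (rule eventually_mono[OF eventually_gt_at_top[of 0]])
      fix x :: real assume x: "0 < x"
      have "W x / ?\<Phi> x = (E x / ?\<Phi> x) * T 0 x" by (simp add: W_def)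
      thus "rGamma a * (of_real x powr a * kummer_integral a d (of_real x)) = W x / ?\<Phi> x"
        unfolding EF[OF x] by (simp add: T_def mult_ac)
    qed
  qed
  have inv0: "((\<lambda>x. inverse (complex_of_real x)) \<longlongrightarrow> 0) at_top"
    using tendsto_of_real[OF tendsto_inverse_0_at_top[OF filterlim_ident], where 'a = complex] by simp
  \<comment> \<open>\<open>T 1\<close> is smaller than \<open>T 0\<close> by a factor of order 1/x,
    so the limit of W' comes from the derivative of exp(-x/2) alone.\<close>
  have L1: "((\<lambda>x. E x * T 1 x / ?\<Phi> x) \<longlongrightarrow> 0) at_top"
  proof (rule Lim_transform_eventually)
    show "((\<lambda>x. rGamma a * (inverse (of_real x) * (of_real x powr (a + 1) * kummer_integral (a + 1) d (of_real x)))) \<longlongrightarrow> 0) at_top"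
      using tendsto_mult[OF tendsto_const[of "rGamma a"] tendsto_mult[OF inv0 kummer_at_top[OF a(2), of d]]] by simp
    show "eventually (\<lambda>x. rGamma a * (inverse (of_real x) * (of_real x powr (a + 1) * kummer_integral (a + 1) d (of_real x))) = E x * T 1 x / ?\<Phi> x) at_top"
    proof (rule eventually_mono[OF eventually_gt_at_top[of 0]])
      fix x :: real assume x: "0 < x"
      have "complex_of_real x powr (a + 1) = of_real x powr a * of_real x" using x by (simp add: powr_add)
      moreover have "E x * T 1 x / ?\<Phi> x = (E x / ?\<Phi> x) * T 1 x" by simp
      ultimately show "rGamma a * (inverse (of_real x) * (of_real x powr (a + 1) * kummer_integral (a + 1) d (of_real x))) = E x * T 1 x / ?\<Phi> x"
        unfolding EF[OF x] using x by (simp add: T_def)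
    qed
  qed
  have L2: "((\<lambda>x. W' x / ?\<Phi> x) \<longlongrightarrow> - 1/2) at_top"
  proof -
    have q: "((\<lambda>x. \<sigma> / complex_of_real x) \<longlongrightarrow> \<sigma> * 0) at_top"
      unfolding divide_inverse by (intro tendsto_mult tendsto_const inv0)
    have T: "((\<lambda>x. (- 1/2 + \<sigma> / of_real x) * (W x / ?\<Phi> x) - E x * T 1 x / ?\<Phi> x) \<longlongrightarrow> (- 1/2 + \<sigma> * 0) * 1 - 0) at_top"
      by (intro tendsto_diff tendsto_mult tendsto_add tendsto_const q L0 L1)
    have "q * (e * t0 / p) - e * t1 / p = e * (q * t0 - t1) / p" for q e t0 t1 p :: complex
      by (simp add: diff_divide_distrib right_diff_distrib mult_ac)
    hence EQ: "(- 1/2 + \<sigma> / of_real x) * (W x / ?\<Phi> x) - E x * T 1 x / ?\<Phi> x = W' x / ?\<Phi> x" for x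
      unfolding W_def W'_def by (simp only:)
    show ?thesis using T unfolding EQ by (simp only: mult_zero_right mult_1_right add_0_right diff_zero)
  qed
  \<comment> \<open>The behaviour at 0 is recorded because it will identify the constant between the
    Fourier transform and W.\<close>
  have L3: "(\<lambda>n. of_real (1 / real (Suc n)) powr (\<sigma> - 1) * W (1 / real (Suc n))) \<longlonglongrightarrow> Gamma (2 * \<sigma> - 1) * rGamma (\<sigma> - of_real \<kappa>)"
  proof -
    have adr: "Re (a + d) > 1" unfolding ad using \<sigma> by simp
    have ex: "(\<lambda>n. complex_of_real (exp (- (1 / real (Suc n)) / 2))) \<longlonglongrightarrow> of_real 1"
      by (rule tendsto_of_real) real_asymp
    have "(\<lambda>n. rGamma a * of_real (exp (- (1 / real (Suc n)) / 2)) * (of_real (1 / real (Suc n)) powr (a + d - 1) * kummer_integral a d (of_real (1 / real (Suc n))))) \<longlonglongrightarrow> rGamma a * of_real 1 * Gamma (a + d - 1)"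
      by (intro tendsto_mult tendsto_const ex kummer_at_zero a adr)
    moreover have "rGamma a * of_real (exp (- x / 2)) * (of_real x powr (a + d - 1) * kummer_integral a d (of_real x)) = of_real x powr (\<sigma> - 1) * W x" for x
    proof -
      have "of_real x powr (a + d - 1) = of_real x powr (\<sigma> - 1) * (of_real x powr \<sigma> :: complex)"
        unfolding ad powr_add[symmetric] by (simp add: algebra_simps)
      thus ?thesis by (simp add: W_def E_def T_def)
    qed
    moreover have "rGamma a * of_real 1 * Gamma (a + d - 1) = Gamma (2 * \<sigma> - 1) * rGamma (\<sigma> - of_real \<kappa>)"
      by (simp only: ad) (simp add: a_def)
    ultimately show ?thesis by (simp only:)
  qed
  show ?thesis using that[OF ode L0 L2 L3] .
qed

section \<open>Fourier coefficients as Whittaker functions\<close>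

lemma gaussian_integral:
  assumes "t > 0"
  shows "has_bochner_integral lborel (\<lambda>x. exp (- (t * x\<^sup>2))) (sqrt (pi / t))"
proof -
  define s where "s = 1 / sqrt (2 * t)"
  have s: "s > 0" "s\<^sup>2 = 1 / (2 * t)" using assms by (auto simp: s_def power_divide)
  have "has_bochner_integral lborel (normal_density 0 s) 1"
    using s by (simp add: has_bochner_integral_iff)
  hence "has_bochner_integral lborel (\<lambda>x. sqrt (pi / t) * normal_density 0 s x) (sqrt (pi / t) * 1)"
    by (intro has_bochner_integral_mult_right)
  also have "(\<lambda>x. sqrt (pi / t) * normal_density 0 s x) = (\<lambda>x. exp (- (t * x\<^sup>2)))"
    using assms by (simp add: normal_density_def s(2) fun_eq_iff mult.commute)
  finally show ?thesis by simp
qed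

text \<open>Gamma(\<sigma>) (1 + x^2)^(-\<sigma>) is the integral of t^(\<sigma>-1) exp(-(1 + x^2)
  t) over t > 0. After exchanging the integrals, the Gaussian in x contributes sqrt(\<pi>/t), which
  shifts the argument of Gamma by 1/2.\<close>

lemma kern_hat_zero_base:
  assumes \<sigma>: "Re \<sigma> > 1"
  shows "Gamma \<sigma> * kern_hat \<sigma> \<sigma> 0 1 = of_real (sqrt pi) * Gamma (\<sigma> - 1/2)"
proof -
  let ?g = "\<lambda>t. indicator {0<..} t *\<^sub>R (complex_of_real t powr (\<sigma> - 1) * of_real (exp (- (1 * t))))"
  let ?f = "\<lambda>t x. ?g t * of_real (exp (- (t * x\<^sup>2)))"
  have gm: "?g \<in> borel_measurable borel"
    using gamma_set_integrable[of \<sigma> 1] \<sigma> unfolding set_integrable_def by (auto dest: borel_measurable_integrable)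
  have [measurable]: "(\<lambda>(t, x). ?f t x) \<in> borel_measurable (lborel \<Otimes>\<^sub>M lborel)"
  proof -
    have "(\<lambda>p. ?g (fst p)) \<in> borel_measurable (lborel \<Otimes>\<^sub>M lborel)"
      by (rule measurable_compose[OF measurable_fst]) (use gm in simp)
    moreover have "(\<lambda>p. complex_of_real (exp (- (fst p * (snd p)\<^sup>2)))) \<in> borel_measurable ((lborel :: real measure) \<Otimes>\<^sub>M (lborel :: real measure))"
      by measurable
    ultimately show ?thesis unfolding case_prod_beta by (rule borel_measurable_times)
  qed
  have xint: "integrable lborel (\<lambda>x. ?f t x)" and xval: "(LINT x|lborel. ?f t x) = of_real (sqrt pi) * (indicator {0<..} t *\<^sub>R (of_real t powr (\<sigma> - 1/2 - 1) * of_real (exp (- (1 * t)))))"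
    and xnorm: "(LINT x|lborel. norm (?f t x)) = sqrt pi * (indicator {0<..} t *\<^sub>R (t powr (Re \<sigma> - 1/2 - 1) * exp (- (1 * t))))" for t
  proof -
    show "integrable lborel (\<lambda>x. ?f t x)"
    proof (cases "t > 0")
      case True
      from gaussian_integral[OF this] have "integrable lborel (\<lambda>x. exp (- (t * x\<^sup>2)))" by (simp add: has_bochner_integral_iff)
      hence "integrable lborel (\<lambda>x. complex_of_real (exp (- (t * x\<^sup>2))))" by (rule integrable_of_real)
      thus ?thesis by (rule integrable_mult_right)
    qed simp
    show "(LINT x|lborel. ?f t x) = of_real (sqrt pi) * (indicator {0<..} t *\<^sub>R (of_real t powr (\<sigma> - 1/2 - 1) * of_real (exp (- (1 * t)))))"
    proof (cases "t > 0")
      case True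
      have "(LINT x|lborel. ?f t x) = ?g t * of_real (LINT x|lborel. exp (- (t * x\<^sup>2)))"
        by (simp only: integral_mult_right_zero integral_complex_of_real)
      also have "(LINT x|lborel. exp (- (t * x\<^sup>2))) = sqrt pi * t powr (-1/2)"
        using gaussian_integral[OF True] True by (simp add: has_bochner_integral_iff real_sqrt_divide powr_minus powr_half_sqrt field_simps)
      also have "?g t * of_real (sqrt pi * t powr (-1/2)) = of_real (sqrt pi) * ((of_real t powr (\<sigma> - 1) * of_real t powr (- 1/2)) * of_real (exp (- (1 * t))))"
        using True by (simp add: powr_of_real[symmetric])
      also have "of_real t powr (\<sigma> - 1) * of_real t powr (- 1/2) = (of_real t powr (\<sigma> - 1/2 - 1) :: complex)"
        unfolding powr_add[symmetric] by (simp add: algebra_simps)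
      finally show ?thesis using True by simp
    qed simp
    show "(LINT x|lborel. norm (?f t x)) = sqrt pi * (indicator {0<..} t *\<^sub>R (t powr (Re \<sigma> - 1/2 - 1) * exp (- (1 * t))))"
    proof (cases "t > 0")
      case True
      have "(LINT x|lborel. norm (?f t x)) = (LINT x|lborel. t powr (Re \<sigma> - 1) * exp (- t) * exp (- (t * x\<^sup>2)))"
        using True by (simp add: norm_mult norm_powr_real_powr)
      also have "\<dots> = t powr (Re \<sigma> - 1) * exp (- t) * (LINT x|lborel. exp (- (t * x\<^sup>2)))"
        by (simp only: integral_mult_right_zero)
      also have "(LINT x|lborel. exp (- (t * x\<^sup>2))) = sqrt pi * t powr (-1/2)"
        using gaussian_integral[OF True] True by (simp add: has_bochner_integral_iff real_sqrt_divide powr_minus powr_half_sqrt field_simps)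
      also have "t powr (Re \<sigma> - 1) * exp (- t) * (sqrt pi * t powr (-1/2)) = sqrt pi * ((t powr (Re \<sigma> - 1) * t powr (- 1/2)) * exp (- t))" by simp
      also have "t powr (Re \<sigma> - 1) * t powr (- 1/2) = t powr (Re \<sigma> - 1/2 - 1)" unfolding powr_add[symmetric] by (simp add: algebra_simps)
      finally show ?thesis using True by simp
    qed simp
  qed
  have I: "integrable (lborel \<Otimes>\<^sub>M lborel) (\<lambda>(t, x). ?f t x)"
  proof (rule lborel_pair.Fubini_integrable)
    show "integrable lborel (\<lambda>t. LINT x|lborel. norm (case (t, x) of (t, x) \<Rightarrow> ?f t x))"
      unfolding prod.case xnorm using gamma_set_integrable_real[of "Re \<sigma> - 1/2" 1] \<sigma>
      by (intro integrable_mult_right) (simp add: set_integrable_def)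
    show "AE t in lborel. integrable lborel (\<lambda>x. case (t, x) of (t, x) \<Rightarrow> ?f t x)"
      unfolding prod.case by (intro AE_I2 xint)
  qed measurable
  have F: "(LINT x|lborel. LINT t|lborel. ?f t x) = (LINT t|lborel. LINT x|lborel. ?f t x)"
    by (rule lborel_pair.Fubini_integral[OF I])
  have G: "(LINT t|lborel. LINT x|lborel. ?f t x) = of_real (sqrt pi) * Gamma (\<sigma> - 1/2)"
    unfolding xval unfolding integral_mult_right_zero
    using gamma_set_integral[of "\<sigma> - 1/2" 1] \<sigma> by (simp add: set_lebesgue_integral_def)
  have H: "(LINT t|lborel. ?f t x) = Gamma \<sigma> * kern \<sigma> \<sigma> 1 x" for x
  proof -
    have p: "1 + x\<^sup>2 > 0" by (simp add: add_pos_nonneg)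
    have "(LINT t|lborel. ?f t x) = (LINT t:{0<..}|lborel. of_real t powr (\<sigma> - 1) * of_real (exp (- ((1 + x\<^sup>2) * t))))"
    proof -
      have "exp (- ((1 + x\<^sup>2) * t)) = exp (- (1 * t)) * exp (- (t * x\<^sup>2))" for t
        by (simp add: exp_add[symmetric] algebra_simps)
      thus ?thesis unfolding set_lebesgue_integral_def by (simp only: of_real_mult mult_scaleR_left mult.assoc)
    qed
    also have "\<dots> = Gamma \<sigma> * of_real (1 + x\<^sup>2) powr (- \<sigma>)"
      using \<sigma> p by (intro gamma_set_integral) auto
    also have "of_real (1 + x\<^sup>2) powr (- \<sigma>) = kern \<sigma> \<sigma> 1 x"
    proof -
      have "kern \<sigma> \<sigma> 1 x = of_real (cmod (Complex x 1)) powr (- 2 * \<sigma>)"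
        using kern_integer[of 1 \<sigma> 0 x] by simp
      also have "cmod (Complex x 1) = sqrt (1 + x\<^sup>2)" by (simp add: cmod_def add.commute)
      also have "of_real (sqrt (1 + x\<^sup>2)) powr (- 2 * \<sigma>) = of_real (1 + x\<^sup>2) powr (- \<sigma>)"
        using p by (simp add: powr_def Ln_of_real ln_sqrt del: of_real_add)
      finally show ?thesis ..
    qed
    finally show ?thesis .
  qed
  have "Gamma \<sigma> * kern_hat \<sigma> \<sigma> 0 1 = (LINT x|lborel. Gamma \<sigma> * kern \<sigma> \<sigma> 1 x)"
    by (simp add: kern_hat_def fourier_def)
  thus ?thesis unfolding H[symmetric] F G .
qed

text \<open>At frequency 0 the transform is homogeneous of degree 1 - a - b in the height. Equating
  its derivative with the general derivative formula, and eliminating by integration by parts at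
  \<nu> = 0 and by contiguity, moves one unit from b to a.\<close>

lemma kern_hat_zero_raise:
  assumes ab: "Re (a + b) \<ge> 2"
  shows "a * kern_hat (a + 1) (b - 1) 0 1 = (1 - b) * kern_hat a b 0 1"
proof -
  have "((\<lambda>t. kern_hat a b 0 (of_real t)) has_vector_derivative (- \<i> * a * kern_hat (a + 1) b 0 (of_real 1) + \<i> * b * kern_hat a (b + 1) 0 (of_real 1))) (at 1)"
    by (rule has_vector_derivative_real_field, rule kern_hat_deriv) (use ab in auto)
  moreover have "((\<lambda>t. kern_hat a b 0 (of_real t)) has_vector_derivative (1 - a - b) * kern_hat a b 0 1) (at 1)"
  proof -
    have "((\<lambda>t. of_real t powr (1 - a - b) * kern_hat a b 0 1) has_vector_derivative ((1 - a - b) * of_real 1 powr (1 - a - b - 1)) * kern_hat a b 0 1) (at 1)"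
      by (rule has_vector_derivative_real_field[of "\<lambda>z. z powr (1 - a - b) * kern_hat a b 0 1"])
         (auto intro!: derivative_eq_intros simp: complex_nonpos_Reals_iff)
    hence D: "((\<lambda>t. of_real t powr (1 - a - b) * kern_hat a b 0 1) has_vector_derivative (1 - a - b) * kern_hat a b 0 1) (at 1)"
      by simp
    have E: "of_real t powr (1 - a - b) * kern_hat a b 0 1 = kern_hat a b 0 (of_real t)" if "t > 0" for t
      using kern_hat_scale[OF that, of 1 a b 0] by simp
    show ?thesis
      by (rule has_vector_derivative_transform_within_open[OF D, of "{0<..}"]) (use E in auto)
  qed
  ultimately have 1: "- \<i> * a * kern_hat (a + 1) b 0 1 + \<i> * b * kern_hat a (b + 1) 0 1 = (1 - a - b) * kern_hat a b 0 1"
    using vector_derivative_unique_at by fastforce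
  have 2: "a * kern_hat (a + 1) b 0 1 = - (b * kern_hat a (b + 1) 0 1)"
    using kern_hat_ibp[of 1 a b 0] ab by (simp add: algebra_simps)
  have 3: "2 * \<i> * kern_hat (a + 1) b 0 1 = kern_hat a b 0 1 - kern_hat (a + 1) (b - 1) 0 1"
    using kern_hat_contiguous[of 1 a "b - 1" 0] ab by simp
  have 4: "- 2 * \<i> * a * kern_hat (a + 1) b 0 1 = (1 - a - b) * kern_hat a b 0 1"
  proof -
    have h2: "b * kern_hat a (b + 1) 0 1 = - (a * kern_hat (a + 1) b 0 1)" using 2 by simp
    have "- \<i> * a * kern_hat (a + 1) b 0 1 + \<i> * b * kern_hat a (b + 1) 0 1 = - \<i> * a * kern_hat (a + 1) b 0 1 + \<i> * (b * kern_hat a (b + 1) 0 1)"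
      by (simp only: mult.assoc)
    also have "\<dots> = - 2 * \<i> * a * kern_hat (a + 1) b 0 1" unfolding h2 by (simp add: algebra_simps)
    finally show ?thesis using 1 by (simp only:)
  qed
  have "a * kern_hat (a + 1) (b - 1) 0 1 = a * kern_hat a b 0 1 - a * (2 * \<i> * kern_hat (a + 1) b 0 1)"
    unfolding 3 by (simp add: algebra_simps)
  also have "\<dots> = a * kern_hat a b 0 1 + (- 2 * \<i> * a * kern_hat (a + 1) b 0 1)" by simp
  also have "\<dots> = (1 - b) * kern_hat a b 0 1" unfolding 4 by (simp add: algebra_simps)
  finally show ?thesis .
qed

lemma Gamma_nonzero_Re:
  fixes z :: complex
  assumes "Re z > 0"
  shows "Gamma z \<noteq> 0" "rGamma z \<noteq> 0"
  using assms by (auto simp: Gamma_eq_zero_iff rGamma_eq_zero_iff elim!: nonpos_Ints_cases)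

text \<open>The reciprocal Gamma function also covers the case where \<sigma> - j is a pole of
  Gamma: there the transform vanishes.\<close>

lemma kern_hat_zero_nat:
  assumes \<sigma>: "Re \<sigma> > 1"
  shows "kern_hat (\<sigma> + of_nat j) (\<sigma> - of_nat j) 0 1 = of_real (sqrt pi) * Gamma (\<sigma> - 1/2) * Gamma \<sigma> * (-1) ^ j * rGamma (\<sigma> + of_nat j) * rGamma (\<sigma> - of_nat j)"
proof (induction j)
  case 0
  have "Gamma \<sigma> \<noteq> 0" using \<sigma> by (auto simp: Gamma_eq_zero_iff elim!: nonpos_Ints_cases)
  thus ?case using kern_hat_zero_base[OF \<sigma>] by (simp add: rGamma_inverse_Gamma field_simps)
next
  case (Suc j)
  let ?a = "\<sigma> + of_nat j" and ?b = "\<sigma> - of_nat j"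
  have a0: "?a \<noteq> 0" using \<sigma> by (auto simp: complex_eq_iff)
  have s: "\<sigma> + of_nat (Suc j) = ?a + 1" "\<sigma> - of_nat (Suc j) = ?b - 1" by (simp_all add: algebra_simps)
  have r1: "rGamma ?a = ?a * rGamma (?a + 1)" by (simp add: rGamma_plus1)
  have r2: "rGamma (?b - 1) = (?b - 1) * rGamma ?b" using rGamma_plus1[of "?b - 1"] by simp
  have "?a * kern_hat (?a + 1) (?b - 1) 0 1 = (1 - ?b) * kern_hat ?a ?b 0 1"
    by (rule kern_hat_zero_raise) (use \<sigma> in simp)
  also have "\<dots> = ?a * (of_real (sqrt pi) * Gamma (\<sigma> - 1/2) * Gamma \<sigma> * (-1) ^ Suc j * rGamma (?a + 1) * ((?b - 1) * rGamma ?b))"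
    unfolding Suc.IH r1 by (simp add: algebra_simps)
  finally show ?case unfolding s r2 mult_left_cancel[OF a0] .
qed

text \<open>Negative j follow by reflection, which leaves the frequency 0 unchanged, and the right
  side is symmetric in j and -j.\<close>

lemma kern_hat_zero_half:
  assumes \<sigma>: "Re \<sigma> > 1"
  shows "kern_hat (\<sigma> + of_int j) (\<sigma> - of_int j) 0 1 = of_real (sqrt pi) * Gamma (\<sigma> - 1/2) * Gamma \<sigma> * (-1) powi j * rGamma (\<sigma> + of_int j) * rGamma (\<sigma> - of_int j)"
proof (cases j)
  case (nonneg n)
  thus ?thesis using kern_hat_zero_nat[OF \<sigma>, of n] by simp
next
  case (neg n)
  have oj: "of_int j = - (of_nat (Suc n) :: complex)" using neg by simp
  have "kern_hat (\<sigma> + of_nat (Suc n)) (\<sigma> - of_nat (Suc n)) 0 1 = kern_hat (\<sigma> - of_nat (Suc n)) (\<sigma> + of_nat (Suc n)) 0 1"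
    using kern_hat_reflect[of 1 \<sigma> "int (Suc n)" 0] by (simp only: of_int_of_nat_eq minus_zero of_real_1)
  moreover have "(-1) powi j = (-1 :: complex) ^ Suc n"
    unfolding neg power_int_minus_one_minus by (rule power_int_of_nat)
  ultimately show ?thesis
    using kern_hat_zero_nat[OF \<sigma>, of "Suc n"] unfolding oj add_uminus_conv_diff diff_minus_eq_add by (simp only: mult_ac)
qed

text \<open>Legendre duplication applied to the previous formula. The version with sqrt \<pi> fits
  the completed zeta function at 2\<sigma> - 1; this one exhibits Gamma(2\<sigma> - 1), which occurs
  in the limit of Whittaker's function at 0.\<close>

lemma kern_hat_zero:
  assumes \<sigma>: "Re \<sigma> > 1"
  shows "kern_hat (\<sigma> + of_int j) (\<sigma> - of_int j) 0 1 = of_real pi * 2 powr (2 - 2 * \<sigma>) * Gamma (2 * \<sigma> - 1) * (-1) powi j * rGamma (\<sigma> + of_int j) * rGamma (\<sigma> - of_int j)"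
proof -
  have "\<sigma> - 1/2 \<notin> \<int>\<^sub>\<le>\<^sub>0 \<and> \<sigma> - 1/2 + 1/2 \<notin> \<int>\<^sub>\<le>\<^sub>0" using \<sigma> by (auto elim!: nonpos_Ints_cases simp: complex_eq_iff)
  hence "Gamma (\<sigma> - 1/2) * Gamma (\<sigma> - 1/2 + 1/2) = exp ((1 - 2 * (\<sigma> - 1/2)) * of_real (ln 2)) * of_real (sqrt pi) * Gamma (2 * (\<sigma> - 1/2))"
    by (intro Gamma_legendre_duplication) auto
  also have "exp ((1 - 2 * (\<sigma> - 1/2)) * of_real (ln 2)) = 2 powr (2 - 2 * \<sigma>)"
    using Ln_of_real[of 2] by (simp add: powr_def algebra_simps)
  also have "2 * (\<sigma> - 1/2) = 2 * \<sigma> - 1" by simp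
  finally have D: "Gamma (\<sigma> - 1/2) * Gamma \<sigma> = 2 powr (2 - 2 * \<sigma>) * of_real (sqrt pi) * Gamma (2 * \<sigma> - 1)" by simp
  have sp: "complex_of_real (sqrt pi) * of_real (sqrt pi) = of_real pi"
    by (simp flip: of_real_mult)
  have "kern_hat (\<sigma> + of_int j) (\<sigma> - of_int j) 0 1 = of_real (sqrt pi) * (Gamma (\<sigma> - 1/2) * Gamma \<sigma>) * (-1) powi j * rGamma (\<sigma> + of_int j) * rGamma (\<sigma> - of_int j)"
    unfolding kern_hat_zero_half[OF \<sigma>] by (simp only: mult.assoc)
  also have "\<dots> = (complex_of_real (sqrt pi) * of_real (sqrt pi)) * 2 powr (2 - 2 * \<sigma>) * Gamma (2 * \<sigma> - 1) * (-1) powi j * rGamma (\<sigma> + of_int j) * rGamma (\<sigma> - of_int j)"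
    unfolding D by (simp only: mult_ac)
  finally show ?thesis unfolding sp .
qed

section \<open>From the transform to Whittaker's function\<close>

text \<open>The variable X = 2 \<nu> y normalises the constant coefficient of the equation in y to
  1/4, and the factor X^\<sigma> removes its first-order term. The difference 2j of the exponents
  becomes \<kappa> = j, their sum 2\<sigma> becomes \<mu> = \<sigma> - 1/2.\<close>

definition kern_whit :: "complex \<Rightarrow> real \<Rightarrow> int \<Rightarrow> real \<Rightarrow> complex" where
  "kern_whit \<sigma> \<nu> j X = of_real X powr \<sigma> * kern_hat (\<sigma> + of_int j) (\<sigma> - of_int j) \<nu> (of_real (X / (2 * \<nu>)))"

definition kern_hat_deriv :: "complex \<Rightarrow> complex \<Rightarrow> real \<Rightarrow> complex \<Rightarrow> complex" where
  "kern_hat_deriv a b \<nu> y = - \<i> * a * kern_hat (a + 1) b \<nu> y + \<i> * b * kern_hat a (b + 1) \<nu> y"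

definition kern_whit_deriv :: "complex \<Rightarrow> real \<Rightarrow> int \<Rightarrow> real \<Rightarrow> complex" where
  "kern_whit_deriv \<sigma> \<nu> j X = of_real X powr \<sigma> * (\<sigma> / of_real X * kern_hat (\<sigma> + of_int j) (\<sigma> - of_int j) \<nu> (of_real (X / (2 * \<nu>))) +
      kern_hat_deriv (\<sigma> + of_int j) (\<sigma> - of_int j) \<nu> (of_real (X / (2 * \<nu>))) / of_real (2 * \<nu>))"

text \<open>A second derivative shifts the exponents by two in total. Integration by parts for the
  once shifted transforms A and B removes the unmixed double shifts, and contiguity replaces the
  mixed one C by (B - A)/(2 i y); this is where the singular term 1/y comes from.\<close>

lemma kern_hat_ode:
  assumes y: "Re y > 0" and ab: "Re (a + b) \<ge> 2"
  shows "(kern_hat_deriv a b \<nu> has_field_derivative (of_real \<nu>)\<^sup>2 * kern_hat a b \<nu> y - ((a + b) * kern_hat_deriv a b \<nu> y + \<nu> * (a - b) * kern_hat a b \<nu> y) / y) (at y)"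
proof -
  define A where "A = kern_hat (a + 1) b \<nu> y"
  define B where "B = kern_hat a (b + 1) \<nu> y"
  define C where "C = kern_hat (a + 1) (b + 1) \<nu> y"
  define J where "J = kern_hat a b \<nu> y"
  have y0: "y \<noteq> 0" using y by auto
  have 1: "\<i> * \<nu> * J = - a * A - b * B" unfolding J_def A_def B_def by (rule kern_hat_ibp[OF y ab])
  have 2: "\<i> * \<nu> * A = - (a + 1) * kern_hat (a + 1 + 1) b \<nu> y - b * C" unfolding C_def A_def by (rule kern_hat_ibp[OF y]) (use ab in simp)
  have 3: "\<i> * \<nu> * B = - a * C - (b + 1) * kern_hat a (b + 1 + 1) \<nu> y" unfolding C_def B_def by (rule kern_hat_ibp[OF y]) (use ab in simp)
  have 4: "2 * \<i> * y * C = B - A" unfolding A_def B_def C_def by (rule kern_hat_contiguous[OF y]) (use ab in simp)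
  have "(kern_hat_deriv a b \<nu> has_field_derivative (- \<i> * a * (- \<i> * (a + 1) * kern_hat (a + 1 + 1) b \<nu> y + \<i> * b * C) + \<i> * b * (- \<i> * a * C + \<i> * (b + 1) * kern_hat a (b + 1 + 1) \<nu> y))) (at y)"
    unfolding kern_hat_deriv_def[abs_def] C_def
    by (intro DERIV_add DERIV_cmult kern_hat_deriv y) (use ab in auto)
  also have "- \<i> * a * (- \<i> * (a + 1) * kern_hat (a + 1 + 1) b \<nu> y + \<i> * b * C) + \<i> * b * (- \<i> * a * C + \<i> * (b + 1) * kern_hat a (b + 1 + 1) \<nu> y) =
     (of_real \<nu>)\<^sup>2 * J - ((a + b) * (- \<i> * a * A + \<i> * b * B) + \<nu> * (a - b) * J) / y"
  proof -
    have D: "(a + 1) * kern_hat (a + 1 + 1) b \<nu> y = - \<i> * \<nu> * A - b * C"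
    proof -
      have "(a + 1) * kern_hat (a + 1 + 1) b \<nu> y = - (- (a + 1) * kern_hat (a + 1 + 1) b \<nu> y - b * C) - b * C" by (simp add: algebra_simps)
      thus ?thesis unfolding 2[symmetric] by simp
    qed
    have E: "(b + 1) * kern_hat a (b + 1 + 1) \<nu> y = - \<i> * \<nu> * B - a * C"
    proof -
      have "(b + 1) * kern_hat a (b + 1 + 1) \<nu> y = - (- a * C - (b + 1) * kern_hat a (b + 1 + 1) \<nu> y) - a * C" by (simp add: algebra_simps)
      thus ?thesis unfolding 3[symmetric] by simp
    qed
    have nJ: "\<nu> * J = \<i> * (a * A + b * B)"
    proof -
      have "\<i> * (\<i> * \<nu> * J) = \<i> * (- a * A - b * B)" unfolding 1 ..
      thus ?thesis by (simp add: algebra_simps)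
    qed
    have "- \<i> * a * (- \<i> * (a + 1) * kern_hat (a + 1 + 1) b \<nu> y + \<i> * b * C) + \<i> * b * (- \<i> * a * C + \<i> * (b + 1) * kern_hat a (b + 1 + 1) \<nu> y) =
      - a * ((a + 1) * kern_hat (a + 1 + 1) b \<nu> y) - b * ((b + 1) * kern_hat a (b + 1 + 1) \<nu> y) + 2 * a * b * C"
      by (simp add: algebra_simps)
    also have "\<dots> = \<nu> * (\<i> * (a * A + b * B)) + 4 * a * b * C" unfolding D E by (simp add: algebra_simps)
    also have "\<nu> * (\<i> * (a * A + b * B)) = (of_real \<nu>)\<^sup>2 * J" unfolding nJ[symmetric] by (simp add: power2_eq_square)
    also have "4 * a * b * C = - (((a + b) * (- \<i> * a * A + \<i> * b * B) + \<nu> * (a - b) * J) / y)"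
    proof -
      have "y * (4 * a * b * C) = - 2 * \<i> * a * b * (2 * \<i> * y * C)" by (simp add: algebra_simps)
      also have "\<dots> = - ((a + b) * (- \<i> * a * A + \<i> * b * B) + (a - b) * (\<i> * (a * A + b * B)))"
        unfolding 4 by (simp add: algebra_simps)
      also have "(a - b) * (\<i> * (a * A + b * B)) = \<nu> * (a - b) * J" unfolding nJ[symmetric] by simp
      finally have "4 * a * b * C = (- ((a + b) * (- \<i> * a * A + \<i> * b * B) + \<nu> * (a - b) * J)) / y"
        using y0 by (simp only: nonzero_eq_divide_eq[OF y0] mult.commute)
      thus ?thesis by (simp only: minus_divide_left)
    qed
    finally show ?thesis by (simp only: add_uminus_conv_diff)
  qed
  finally show ?thesis unfolding J_def A_def B_def kern_hat_deriv_def .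
qed

lemma kern_whit_ode:
  assumes \<sigma>: "Re \<sigma> > 1" and \<nu>: "\<nu> > 0"
  shows "whittaker_ode (of_int j) (\<sigma> - 1/2) (kern_whit \<sigma> \<nu> j) (kern_whit_deriv \<sigma> \<nu> j)"
  unfolding whittaker_ode_def
proof (intro allI impI conjI)
  fix X :: real assume X: "X > 0"
  define a where "a = \<sigma> + of_int j"
  define b where "b = \<sigma> - of_int j"
  have ab: "Re (a + b) \<ge> 2" using \<sigma> by (simp add: a_def b_def)
  define c where "c = complex_of_real (2 * \<nu>)"
  have c0: "c \<noteq> 0" using \<nu> by (simp add: c_def)
  define V where "V = (\<lambda>X. kern_hat a b \<nu> (of_real (X / (2 * \<nu>))))"
  define V1 where "V1 = (\<lambda>X. kern_hat_deriv a b \<nu> (of_real (X / (2 * \<nu>))))"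
  define P where "P = (\<lambda>X. complex_of_real X powr \<sigma>)"
  have Xc: "complex_of_real X \<notin> \<real>\<^sub>\<le>\<^sub>0" using X by (auto simp: complex_nonpos_Reals_iff)
  have sc: "((\<lambda>X. f (complex_of_real (X / (2 * \<nu>)))) has_vector_derivative D / c) (at X)"
    if "(f has_field_derivative D) (at (of_real (X / (2 * \<nu>))))" for f D
  proof -
    have "((\<lambda>X. complex_of_real (X / (2 * \<nu>))) has_vector_derivative (1 / c)) (at X)"
      unfolding c_def using \<nu> by (auto intro!: derivative_eq_intros)
    from field_vector_diff_chain_at[OF this, of f D] that show ?thesis by (simp add: o_def)
  qed
  have yp: "Re (complex_of_real (X / (2 * \<nu>))) > 0" using X \<nu> by simp
  have dV: "(V has_vector_derivative V1 X / c) (at X)"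
    unfolding V_def V1_def by (rule sc) (use kern_hat_deriv[OF yp ab, of \<nu>] in \<open>simp add: kern_hat_deriv_def\<close>)
  have dV1: "(V1 has_vector_derivative ((of_real \<nu>)\<^sup>2 * V X - ((a + b) * V1 X + \<nu> * (a - b) * V X) / (of_real (X / (2 * \<nu>)))) / c) (at X)"
    unfolding V_def V1_def by (rule sc, rule kern_hat_ode[OF yp ab])
  have dP: "(P has_vector_derivative (\<sigma> / of_real X) * P X) (at X)"
  proof -
    have p: "complex_of_real X powr (\<sigma> - 1) = of_real X powr \<sigma> / of_real X" using X by (simp add: powr_diff)
    have "((\<lambda>z. z powr \<sigma>) has_field_derivative \<sigma> * of_real X powr (\<sigma> - 1)) (at (of_real X))"
      using Xc by (auto intro!: derivative_eq_intros)
    from has_vector_derivative_real_field[OF this] show ?thesis unfolding P_def p by simp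
  qed
  have W: "kern_whit \<sigma> \<nu> j = (\<lambda>X. P X * V X)" unfolding kern_whit_def P_def V_def a_def b_def by auto
  have W': "kern_whit_deriv \<sigma> \<nu> j = (\<lambda>X. P X * (\<sigma> / of_real X * V X + V1 X / c))" unfolding kern_whit_deriv_def P_def V_def V1_def a_def b_def c_def by auto
  have "(kern_whit \<sigma> \<nu> j has_vector_derivative P X * (V1 X / c) + (\<sigma> / of_real X) * P X * V X) (at X)"
    unfolding W by (intro has_vector_derivative_mult dP dV)
  thus "(kern_whit \<sigma> \<nu> j has_vector_derivative kern_whit_deriv \<sigma> \<nu> j X) (at X)" unfolding W' by (simp add: algebra_simps)
  have dq: "((\<lambda>x. \<sigma> / of_real x) has_vector_derivative - (\<sigma> / (of_real X)\<^sup>2)) (at X)"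
  proof -
    have "((\<lambda>z. \<sigma> / z) has_field_derivative - (\<sigma> / (of_real X)\<^sup>2)) (at (of_real X))"
      using X by (auto intro!: derivative_eq_intros simp: power2_eq_square)
    from has_vector_derivative_real_field[OF this] show ?thesis .
  qed
  let ?V1' = "((of_real \<nu>)\<^sup>2 * V X - ((a + b) * V1 X + \<nu> * (a - b) * V X) / (of_real (X / (2 * \<nu>)))) / c"
  have "(kern_whit_deriv \<sigma> \<nu> j has_vector_derivative P X * ((\<sigma> / of_real X * (V1 X / c) + (- (\<sigma> / (of_real X)\<^sup>2)) * V X) + ?V1' / c) + (\<sigma> / of_real X) * P X * (\<sigma> / of_real X * V X + V1 X / c)) (at X)"
    unfolding W' by (intro has_vector_derivative_mult has_vector_derivative_add has_vector_derivative_divide dP dV dV1 dq)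
  also have "P X * ((\<sigma> / of_real X * (V1 X / c) + (- (\<sigma> / (of_real X)\<^sup>2)) * V X) + ?V1' / c) + (\<sigma> / of_real X) * P X * (\<sigma> / of_real X * V X + V1 X / c) =
     - (- 1/4 + of_int j / of_real X + (1/4 - (\<sigma> - 1/2)\<^sup>2) / (of_real X)\<^sup>2) * kern_whit \<sigma> \<nu> j X"
  proof -
    define i where "i = inverse (complex_of_real X)"
    define w where "w = V1 X / c"
    have q: "\<sigma> / of_real X = \<sigma> * i" "\<sigma> / (of_real X)\<^sup>2 = \<sigma> * i\<^sup>2" "of_int j / of_real X = of_int j * i"
      "(1/4 - (\<sigma> - 1/2)\<^sup>2) / (of_real X)\<^sup>2 = (1/4 - (\<sigma> - 1/2)\<^sup>2) * i\<^sup>2"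
      by (simp_all only: divide_inverse i_def power_inverse)
    have s1: "a + b = 2 * \<sigma>" "a - b = 2 * of_int j" by (simp_all add: a_def b_def)
    have "?V1' / c = V X / 4 - 2 * \<sigma> * w * i - of_int j * V X * i"
      unfolding s1 w_def i_def c_def using X \<nu> by (simp add: field_simps power2_eq_square)
    note V1e = this
    have key: "p * ((\<sigma> * i * w + (- (\<sigma> * i\<^sup>2)) * v) + (v / 4 - 2 * \<sigma> * w * i - jj * v * i)) + (\<sigma> * i) * p * (\<sigma> * i * v + w) =
       - (- 1/4 + jj * i + (1/4 - (\<sigma> - 1/2)\<^sup>2) * i\<^sup>2) * (p * v)" for p v jj :: complex
      by (simp add: field_simps power2_eq_square)
    show ?thesis unfolding V1e unfolding q w_def[symmetric] W by (rule key)
  qed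
  finally show "(kern_whit_deriv \<sigma> \<nu> j has_vector_derivative - (- 1/4 + of_int j / of_real X + (1/4 - (\<sigma> - 1/2)\<^sup>2) / (of_real X)\<^sup>2) * kern_whit \<sigma> \<nu> j X) (at X)" .
qed

text \<open>Scaling to height 1 leaves X only in the frequency X/2. Hence X^(\<sigma>-1) times the
  function is bounded in X and has a limit for X -> 0.\<close>

lemma kern_whit_scale:
  assumes X: "X > 0" and \<nu>: "\<nu> > 0"
  shows "of_real X powr (\<sigma> - 1) * kern_whit \<sigma> \<nu> j X = of_real (2 * \<nu>) powr (2 * \<sigma> - 1) * kern_hat (\<sigma> + of_int j) (\<sigma> - of_int j) (X / 2) 1"
proof -
  have "kern_hat (\<sigma> + of_int j) (\<sigma> - of_int j) \<nu> (of_real (X / (2 * \<nu>) * 1)) = of_real (X / (2 * \<nu>)) powr (1 - (\<sigma> + of_int j) - (\<sigma> - of_int j)) * kern_hat (\<sigma> + of_int j) (\<sigma> - of_int j) (X / (2 * \<nu>) * \<nu>) (of_real 1)"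
    by (rule kern_hat_scale) (use assms in auto)
  moreover have "X / (2 * \<nu>) * \<nu> = X / 2" using \<nu> by simp
  moreover have "1 - (\<sigma> + of_int j) - (\<sigma> - of_int j) = - (2 * \<sigma> - 1)" by simp
  moreover have "complex_of_real (X / (2 * \<nu>)) powr (- (2 * \<sigma> - 1)) = of_real X powr (- (2 * \<sigma> - 1)) * of_real (2 * \<nu>) powr (2 * \<sigma> - 1)"
  proof -
    have l: "ln (X / (2 * \<nu>)) = ln X - ln (2 * \<nu>)" using assms by (simp add: ln_div)
    have "complex_of_real (X / (2 * \<nu>)) powr (- (2 * \<sigma> - 1)) = exp (- (2 * \<sigma> - 1) * of_real (ln (X / (2 * \<nu>))))"
      using assms Ln_of_real[of "X / (2 * \<nu>)"] by (simp only: powr_def of_real_eq_0_iff) simp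
    also have "\<dots> = exp (- (2 * \<sigma> - 1) * of_real (ln X) + (2 * \<sigma> - 1) * of_real (ln (2 * \<nu>)))"
      unfolding l of_real_diff by (simp only: right_diff_distrib minus_mult_minus mult_minus_left diff_minus_eq_add)
    also have "\<dots> = of_real X powr (- (2 * \<sigma> - 1)) * of_real (2 * \<nu>) powr (2 * \<sigma> - 1)"
      using assms Ln_of_real[of X] Ln_of_real[of "2 * \<nu>"] by (simp only: exp_add powr_def of_real_eq_0_iff) simp
    finally show ?thesis .
  qed
  ultimately have "of_real X powr (\<sigma> - 1) * kern_whit \<sigma> \<nu> j X = (of_real X powr (\<sigma> - 1) * (of_real X powr \<sigma> * of_real X powr (- (2 * \<sigma> - 1)))) * of_real (2 * \<nu>) powr (2 * \<sigma> - 1) * kern_hat (\<sigma> + of_int j) (\<sigma> - of_int j) (X / 2) 1"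
    unfolding kern_whit_def by (simp only: mult_1_right of_real_1 mult.assoc)
  also have "of_real X powr (\<sigma> - 1) * (of_real X powr \<sigma> * of_real X powr (- (2 * \<sigma> - 1))) = (1::complex)"
    unfolding powr_add[symmetric] using X by simp
  finally show ?thesis by simp
qed

lemma kern_whit_decay:
  assumes \<sigma>: "Re \<sigma> > 1" and \<nu>: "\<nu> > 0"
  shows "((\<lambda>X. kern_whit \<sigma> \<nu> j X * of_real (exp (- X / 4))) \<longlongrightarrow> 0) at_top"
proof -
  obtain C where C: "\<And>\<eta>. norm (kern_hat (\<sigma> + of_int j) (\<sigma> - of_int j) \<eta> 1) \<le> C"
    using kern_hat_bounded[of 1 "\<sigma> + of_int j" "\<sigma> - of_int j"] \<sigma> by auto
  define K where "K = norm (complex_of_real (2 * \<nu>) powr (2 * \<sigma> - 1)) * C"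
  show ?thesis
  proof (rule Lim_null_comparison)
    show "((\<lambda>X. X powr (1 - Re \<sigma>) * K * exp (- X / 4)) \<longlongrightarrow> 0) at_top" by real_asymp
    show "eventually (\<lambda>X. norm (kern_whit \<sigma> \<nu> j X * of_real (exp (- X / 4))) \<le> X powr (1 - Re \<sigma>) * K * exp (- X / 4)) at_top"
    proof (rule eventually_mono[OF eventually_gt_at_top[of 0]])
      fix X :: real assume X: "X > 0"
      have "norm (of_real X powr (\<sigma> - 1) * kern_whit \<sigma> \<nu> j X) \<le> K"
        unfolding kern_whit_scale[OF X \<nu>] norm_mult K_def by (intro mult_left_mono C) auto
      hence "X powr (Re \<sigma> - 1) * norm (kern_whit \<sigma> \<nu> j X) \<le> K" using X by (simp add: norm_mult norm_powr_real_powr)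
      hence "X powr (1 - Re \<sigma>) * (X powr (Re \<sigma> - 1) * norm (kern_whit \<sigma> \<nu> j X)) \<le> X powr (1 - Re \<sigma>) * K" by (intro mult_left_mono) auto
      also have "X powr (1 - Re \<sigma>) * (X powr (Re \<sigma> - 1) * norm (kern_whit \<sigma> \<nu> j X)) = norm (kern_whit \<sigma> \<nu> j X)"
        using X by (simp add: mult.assoc[symmetric] powr_add[symmetric])
      finally show "norm (kern_whit \<sigma> \<nu> j X * of_real (exp (- X / 4))) \<le> X powr (1 - Re \<sigma>) * K * exp (- X / 4)"
        by (simp add: norm_mult mult_right_mono)
    qed
  qed
qed

definition kern_whit_const :: "complex \<Rightarrow> real \<Rightarrow> int \<Rightarrow> complex" where
  "kern_whit_const \<sigma> \<nu> j = (-1) powi j * 2 * of_real pi * of_real \<nu> powr (2 * \<sigma> - 1) * rGamma (\<sigma> + of_int j)"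

text \<open>Uniqueness gives a proportionality, and multiplying by X^(\<sigma>-1) with X -> 0 gives
  its factor: the transform tends to a multiple of its value at frequency 0, Whittaker's function to
  Gamma(2\<sigma>-1)/Gamma(\<sigma>-j). The latter is not 0 because j <= 0, so the constant can be
  read off. The derivatives are included because they start the raising induction.\<close>

lemma kern_whit_nonpos:
  assumes \<sigma>: "Re \<sigma> > 1" and \<nu>: "\<nu> > 0" and j: "j \<le> 0"
  obtains W W' where "whittaker_ode (of_int j) (\<sigma> - 1/2) W W'"
    "((\<lambda>x. W x / (of_real (exp (- x / 2)) * of_real x powr of_int j)) \<longlongrightarrow> 1) at_top"
    "((\<lambda>x. W' x / (of_real (exp (- x / 2)) * of_real x powr of_int j)) \<longlongrightarrow> - 1/2) at_top"
    "\<And>X. X > 0 \<Longrightarrow> kern_whit \<sigma> \<nu> j X = kern_whit_const \<sigma> \<nu> j * W X"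
    "\<And>X. X > 0 \<Longrightarrow> kern_whit_deriv \<sigma> \<nu> j X = kern_whit_const \<sigma> \<nu> j * W' X"
proof -
  have "real_of_int j \<le> 0" using j by simp
  note ex = whittaker_exists_nonpos[OF this \<sigma>, unfolded of_real_of_int_eq]
  obtain W W' where
    W: "whittaker_ode (of_int j) (\<sigma> - 1/2) W W'"
    "((\<lambda>x. W x / (of_real (exp (- x / 2)) * of_real x powr of_int j)) \<longlongrightarrow> 1) at_top"
    "((\<lambda>x. W' x / (of_real (exp (- x / 2)) * of_real x powr of_int j)) \<longlongrightarrow> - 1/2) at_top"
    "(\<lambda>n. of_real (1 / real (Suc n)) powr (\<sigma> - 1) * W (1 / real (Suc n))) \<longlonglongrightarrow> Gamma (2 * \<sigma> - 1) * rGamma (\<sigma> - of_int j)"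
    by (rule ex) (rule that; assumption)
  obtain C where C: "\<And>x. x > 0 \<Longrightarrow> kern_whit \<sigma> \<nu> j x = C * W x"
    by (rule whittaker_decaying_unique[of "of_int j", unfolded of_real_of_int_eq, OF kern_whit_ode[OF \<sigma> \<nu>] W(1,2) kern_whit_decay[OF \<sigma> \<nu>]])
       (rule that; blast)
  let ?x = "\<lambda>n. 1 / real (Suc n)"
  have "(\<lambda>n. kern_hat (\<sigma> + of_int j) (\<sigma> - of_int j) (?x n / 2) 1) \<longlonglongrightarrow> kern_hat (\<sigma> + of_int j) (\<sigma> - of_int j) 0 1"
    by (rule kern_hat_zero_limit) (use \<sigma> in \<open>simp, simp, real_asymp\<close>)
  hence "(\<lambda>n. of_real (2 * \<nu>) powr (2 * \<sigma> - 1) * kern_hat (\<sigma> + of_int j) (\<sigma> - of_int j) (?x n / 2) 1) \<longlonglongrightarrow> of_real (2 * \<nu>) powr (2 * \<sigma> - 1) * kern_hat (\<sigma> + of_int j) (\<sigma> - of_int j) 0 1"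
    by (intro tendsto_mult tendsto_const)
  moreover have "of_real (2 * \<nu>) powr (2 * \<sigma> - 1) * kern_hat (\<sigma> + of_int j) (\<sigma> - of_int j) (?x n / 2) 1 = C * (of_real (?x n) powr (\<sigma> - 1) * W (?x n))" for n
  proof -
    have x: "?x n > 0" by simp
    show ?thesis unfolding kern_whit_scale[OF x \<nu>, symmetric] C[OF x] by (simp only: mult_ac)
  qed
  ultimately have "(\<lambda>n. C * (of_real (?x n) powr (\<sigma> - 1) * W (?x n))) \<longlonglongrightarrow> of_real (2 * \<nu>) powr (2 * \<sigma> - 1) * kern_hat (\<sigma> + of_int j) (\<sigma> - of_int j) 0 1" by (simp only:)
  from LIMSEQ_unique[OF this tendsto_mult[OF tendsto_const W(4)]]
  have "C * (Gamma (2 * \<sigma> - 1) * rGamma (\<sigma> - of_int j)) = of_real (2 * \<nu>) powr (2 * \<sigma> - 1) * kern_hat (\<sigma> + of_int j) (\<sigma> - of_int j) 0 1" ..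
  also have "\<dots> = (of_real (2 * \<nu>) powr (2 * \<sigma> - 1) * 2 powr (2 - 2 * \<sigma>)) * of_real pi * (-1) powi j * rGamma (\<sigma> + of_int j) * (Gamma (2 * \<sigma> - 1) * rGamma (\<sigma> - of_int j))"
    unfolding kern_hat_zero[OF \<sigma>] by (simp only: mult_ac)
  also have "of_real (2 * \<nu>) powr (2 * \<sigma> - 1) * 2 powr (2 - 2 * \<sigma>) = 2 * of_real \<nu> powr (2 * \<sigma> - 1)"
  proof -
    have "(of_real 2 * of_real \<nu>) powr (2 * \<sigma> - 1) = of_real 2 powr (2 * \<sigma> - 1) * (of_real \<nu> powr (2 * \<sigma> - 1) :: complex)"
      using \<nu> by (intro powr_times_real) auto
    moreover have "(2::complex) powr (2 * \<sigma> - 1) * 2 powr (2 - 2 * \<sigma>) = 2"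
      unfolding powr_add[symmetric] by simp
    ultimately show ?thesis by (simp add: mult_ac)
  qed
  finally have "C * (Gamma (2 * \<sigma> - 1) * rGamma (\<sigma> - of_int j)) = kern_whit_const \<sigma> \<nu> j * (Gamma (2 * \<sigma> - 1) * rGamma (\<sigma> - of_int j))"
    unfolding kern_whit_const_def by (simp only: mult_ac)
  moreover have "Gamma (2 * \<sigma> - 1) \<noteq> 0" using \<sigma> by (intro Gamma_nonzero_Re) simp
  moreover have "rGamma (\<sigma> - of_int j) \<noteq> 0" using \<sigma> j by (intro Gamma_nonzero_Re) simp
  ultimately have Cc: "C = kern_whit_const \<sigma> \<nu> j" by simp
  have "kern_whit_deriv \<sigma> \<nu> j x = C * W' x" if x: "x > 0" for x
  proof -
    have "(kern_whit \<sigma> \<nu> j has_vector_derivative kern_whit_deriv \<sigma> \<nu> j x) (at x)" using kern_whit_ode[OF \<sigma> \<nu>, of j] x by (simp add: whittaker_ode_def)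
    moreover have "(kern_whit \<sigma> \<nu> j has_vector_derivative C * W' x) (at x)"
    proof (rule has_vector_derivative_transform_within_open[of "\<lambda>x. C * W x" _ _ "{0<..}"])
      show "((\<lambda>x. C * W x) has_vector_derivative C * W' x) (at x)"
        using W(1) x by (intro has_vector_derivative_mult_right) (simp add: whittaker_ode_def)
    qed (use x C in auto)
    ultimately show ?thesis by (rule vector_derivative_unique_at)
  qed
  thus ?thesis using that[OF W(1-3)] C Cc by blast
qed

text \<open>Integration by parts and contiguity express the transform at (a + 1, b - 1) through that
  at (a, b) and its y-derivative, by eliminating the transforms in which a single exponent is
  shifted. For Whittaker functions this is the first-order operator that raises \<kappa> by
  1.\<close>

lemma kern_whit_raise:
  assumes \<sigma>: "Re \<sigma> > 1" and \<nu>: "\<nu> > 0" and X: "X > 0" and j: "j \<ge> 0"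
  shows "(\<sigma> + of_int j) * kern_whit \<sigma> \<nu> (j + 1) X = of_int j * kern_whit \<sigma> \<nu> j X + of_real X * kern_whit_deriv \<sigma> \<nu> j X - of_real X / 2 * kern_whit \<sigma> \<nu> j X"
proof -
  define a where "a = \<sigma> + of_int j"
  define b where "b = \<sigma> - of_int j"
  define y where "y = complex_of_real (X / (2 * \<nu>))"
  have ab: "Re (a + b) \<ge> 2" using \<sigma> by (simp add: a_def b_def)
  have y: "Re y > 0" using X \<nu> by (simp add: y_def)
  define J where "J = kern_hat a b \<nu> y"
  define A where "A = kern_hat (a + 1) b \<nu> y"
  have 3: "2 * \<i> * y * A = J - kern_hat (a + 1) (b - 1) \<nu> y"
    using kern_hat_contiguous[OF y, of a "b - 1" \<nu>] ab by (simp add: A_def J_def)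
  have "\<i> * (\<i> * \<nu> * J) = \<i> * (- a * A - b * kern_hat a (b + 1) \<nu> y)" unfolding J_def A_def kern_hat_ibp[OF y ab] ..
  hence 1: "\<nu> * J = \<i> * (a * A + b * kern_hat a (b + 1) \<nu> y)" by (simp add: algebra_simps)
  have 2: "kern_hat_deriv a b \<nu> y - \<nu> * J = - 2 * \<i> * a * A" unfolding 1 kern_hat_deriv_def A_def by (simp add: algebra_simps)
  have "a * kern_hat (a + 1) (b - 1) \<nu> y = a * J + y * (- 2 * \<i> * a * A)"
  proof -
    have h: "kern_hat (a + 1) (b - 1) \<nu> y = J - 2 * \<i> * y * A" unfolding 3 by simp
    show ?thesis unfolding h by (simp add: algebra_simps)
  qed
  hence R: "a * kern_hat (a + 1) (b - 1) \<nu> y = a * J + y * (kern_hat_deriv a b \<nu> y - \<nu> * J)" unfolding 2 .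
  have s: "\<sigma> + of_int (j + 1) = a + 1" "\<sigma> - of_int (j + 1) = b - 1" by (simp_all add: a_def b_def)
  have yX: "y * \<nu> = of_real X / 2" "y = of_real X / of_real (2 * \<nu>)" using \<nu> by (simp_all add: y_def)
  have X0: "complex_of_real X \<noteq> 0" using X by simp
  have "(\<sigma> + of_int j) * kern_whit \<sigma> \<nu> (j + 1) X = of_real X powr \<sigma> * (a * kern_hat (a + 1) (b - 1) \<nu> y)"
    unfolding kern_whit_def s a_def[symmetric] y_def[symmetric] by simp
  also have "\<dots> = of_real X powr \<sigma> * (a * J + y * kern_hat_deriv a b \<nu> y - (y * \<nu>) * J)" unfolding R by (simp add: algebra_simps)
  also have "y * kern_hat_deriv a b \<nu> y = of_real X * (kern_hat_deriv a b \<nu> y / of_real (2 * \<nu>))" by (subst yX(2)) simp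
  also have "of_real X powr \<sigma> * (a * J + of_real X * (kern_hat_deriv a b \<nu> y / of_real (2 * \<nu>)) - (y * \<nu>) * J) =
     of_int j * (of_real X powr \<sigma> * J) + of_real X * (of_real X powr \<sigma> * (\<sigma> / of_real X * J + kern_hat_deriv a b \<nu> y / of_real (2 * \<nu>))) - of_real X / 2 * (of_real X powr \<sigma> * J)"
  proof -
    have "p * (a * J + x * D - (x / 2) * J) = jj * (p * J) + x * (p * (\<sigma> / x * J + D)) - x / 2 * (p * J)" if "x \<noteq> 0" "a = \<sigma> + jj" for p x D jj
      using that by (simp add: field_simps)
    from this[OF X0 a_def] show ?thesis unfolding yX(1) .
  qed
  finally show ?thesis unfolding kern_whit_def kern_whit_deriv_def a_def[symmetric] b_def[symmetric] y_def[symmetric] J_def .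
qed

text \<open>For large positive weight Kummer's integral diverges, so the growth is carried upward
  from weight 0. The raising relation involves the derivative, hence both limits form the induction
  hypothesis. Relative to exp(-x/2) x^n the leading terms of x W' - x/2 W add up to -c x, and the
  remaining term is smaller by a factor 1/x; dividing by \<sigma> + n reproduces the recursion of
  \<open>kern_whit_const\<close>.\<close>

lemma kern_whit_asymptotics:
  assumes \<sigma>: "Re \<sigma> > 1" and \<nu>: "\<nu> > 0"
  shows "((\<lambda>x. kern_whit \<sigma> \<nu> (int n) x / (of_real (exp (- x / 2)) * of_real x powr of_nat n)) \<longlongrightarrow> kern_whit_const \<sigma> \<nu> (int n)) at_top \<and>
    ((\<lambda>x. kern_whit_deriv \<sigma> \<nu> (int n) x / (of_real (exp (- x / 2)) * of_real x powr of_nat n)) \<longlongrightarrow> - kern_whit_const \<sigma> \<nu> (int n) / 2) at_top"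
proof (induction n)
  case 0
  obtain W W' where W:
    "((\<lambda>x. W x / (of_real (exp (- x / 2)) * of_real x powr of_int 0)) \<longlongrightarrow> 1) at_top"
    "((\<lambda>x. W' x / (of_real (exp (- x / 2)) * of_real x powr of_int 0)) \<longlongrightarrow> - 1/2) at_top"
    "\<And>X. X > 0 \<Longrightarrow> kern_whit \<sigma> \<nu> 0 X = kern_whit_const \<sigma> \<nu> 0 * W X"
    "\<And>X. X > 0 \<Longrightarrow> kern_whit_deriv \<sigma> \<nu> 0 X = kern_whit_const \<sigma> \<nu> 0 * W' X"
    by (rule kern_whit_nonpos[OF \<sigma> \<nu> order_refl]) (rule that; blast)
  have "((\<lambda>x. kern_whit_const \<sigma> \<nu> 0 * (W x / (of_real (exp (- x / 2)) * of_real x powr of_int 0))) \<longlongrightarrow> kern_whit_const \<sigma> \<nu> 0 * 1) at_top"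
    "((\<lambda>x. kern_whit_const \<sigma> \<nu> 0 * (W' x / (of_real (exp (- x / 2)) * of_real x powr of_int 0))) \<longlongrightarrow> kern_whit_const \<sigma> \<nu> 0 * (- 1/2)) at_top"
    by (intro tendsto_mult tendsto_const W)+
  note L = this
  have "((\<lambda>x. kern_whit \<sigma> \<nu> 0 x / (of_real (exp (- x / 2)) * of_real x powr of_int 0)) \<longlongrightarrow> kern_whit_const \<sigma> \<nu> 0 * 1) at_top"
    by (rule Lim_transform_eventually[OF L(1)], rule eventually_mono[OF eventually_gt_at_top[of 0]]) (simp only: W(3) times_divide_eq_right)
  moreover have "((\<lambda>x. kern_whit_deriv \<sigma> \<nu> 0 x / (of_real (exp (- x / 2)) * of_real x powr of_int 0)) \<longlongrightarrow> kern_whit_const \<sigma> \<nu> 0 * (- 1/2)) at_top"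
    by (rule Lim_transform_eventually[OF L(2)], rule eventually_mono[OF eventually_gt_at_top[of 0]]) (simp only: W(4) times_divide_eq_right)
  ultimately show ?case by simp
next
  case (Suc n)
  let ?a = "\<sigma> + of_nat n"
  let ?P = "\<lambda>x. of_real (exp (- x / 2)) * of_real x powr of_nat n :: complex"
  let ?Q = "\<lambda>x. of_real (exp (- x / 2)) * of_real x powr of_nat (Suc n) :: complex"
  define c where "c = kern_whit_const \<sigma> \<nu> (int n)"
  define W where "W = kern_whit \<sigma> \<nu> (int n)"
  define W' where "W' = kern_whit_deriv \<sigma> \<nu> (int n)"
  define V where "V = kern_whit \<sigma> \<nu> (int (Suc n))"
  define V' where "V' = kern_whit_deriv \<sigma> \<nu> (int (Suc n))"
  define m where "m = (1/4 - (\<sigma> - 1/2)\<^sup>2)"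
  have IH: "((\<lambda>x. W x / ?P x) \<longlongrightarrow> c) at_top" "((\<lambda>x. W' x / ?P x) \<longlongrightarrow> - c / 2) at_top"
    using Suc.IH unfolding W_def W'_def c_def by auto
  have a0: "?a \<noteq> 0" using \<sigma> by (auto simp: complex_eq_iff)
  have cS: "kern_whit_const \<sigma> \<nu> (int (Suc n)) = - c / ?a"
  proof -
    have r: "rGamma ?a = ?a * rGamma (?a + 1)" by (simp add: rGamma_plus1)
    have s: "\<sigma> + of_int (int (Suc n)) = ?a + 1" "\<sigma> + of_int (int n) = ?a" by simp_all
    have "rGamma (?a + 1) = rGamma ?a / ?a" unfolding r using a0 by simp
    thus ?thesis unfolding c_def kern_whit_const_def s power_int_of_nat by simp
  qed
  have raise: "?a * V x = of_nat n * W x + of_real x * W' x - of_real x / 2 * W x" if "x > 0" for x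
    using kern_whit_raise[OF \<sigma> \<nu> that, of "int n"] by (simp add: W_def W'_def V_def add.commute)
  have dW: "(W has_vector_derivative W' x) (at x)" "(W' has_vector_derivative - (- 1/4 + of_nat n / of_real x + m / (of_real x)\<^sup>2) * W x) (at x)" if "x > 0" for x
    using kern_whit_ode[OF \<sigma> \<nu>, of "int n"] that by (auto simp: whittaker_ode_def W_def W'_def m_def)
  have dV: "(V has_vector_derivative V' x) (at x)" if "x > 0" for x
    using kern_whit_ode[OF \<sigma> \<nu>, of "int (Suc n)"] that unfolding V_def V'_def whittaker_ode_def by blast
  \<comment> \<open>The raising relation differentiated, with the second derivative of W replaced by
    means of Whittaker's equation.\<close>
  have raise': "?a * V' x = of_nat n * W' x + (of_real x * (- (- 1/4 + of_nat n / of_real x + m / (of_real x)\<^sup>2) * W x) + W' x) - (of_real x / 2 * W' x + 1/2 * W x)" if x: "x > 0" for x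
  proof -
    have idd: "(complex_of_real has_vector_derivative 1) (at x)"
      by (auto intro!: derivative_eq_intros)
    have idd2: "((\<lambda>x. complex_of_real x / 2) has_vector_derivative 1/2) (at x)"
      by (rule has_vector_derivative_divide[OF idd])
    have "((\<lambda>x. of_nat n * W x + of_real x * W' x - of_real x / 2 * W x) has_vector_derivative
       of_nat n * W' x + (of_real x * (- (- 1/4 + of_nat n / of_real x + m / (of_real x)\<^sup>2) * W x) + 1 * W' x) - (of_real x / 2 * W' x + 1/2 * W x)) (at x)"
      by (intro has_vector_derivative_diff has_vector_derivative_add has_vector_derivative_mult has_vector_derivative_mult_right dW x idd idd2)
    hence "((\<lambda>x. ?a * V x) has_vector_derivative
       of_nat n * W' x + (of_real x * (- (- 1/4 + of_nat n / of_real x + m / (of_real x)\<^sup>2) * W x) + 1 * W' x) - (of_real x / 2 * W' x + 1/2 * W x)) (at x)"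
      by (rule has_vector_derivative_transform_within_open[of _ _ _ "{0<..}"]) (use raise x in auto)
    from vector_derivative_unique_at[OF this has_vector_derivative_mult_right[OF dV[OF x]]] show ?thesis by simp
  qed
  have inv0: "((\<lambda>x. inverse (complex_of_real x)) \<longlongrightarrow> 0) at_top"
    using tendsto_of_real[OF tendsto_inverse_0_at_top[OF filterlim_ident], where 'a = complex] by simp
  have Q: "?Q x = ?P x * of_real x" if "x > 0" for x
    using that by (simp add: powr_add)
  have L1: "((\<lambda>x. V x / ?Q x) \<longlongrightarrow> - c / ?a) at_top"
  proof (rule Lim_transform_eventually)
    show "((\<lambda>x. (of_nat n * inverse (of_real x) * (W x / ?P x) + W' x / ?P x - 1/2 * (W x / ?P x)) / ?a) \<longlongrightarrow> - c / ?a) at_top"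
    proof -
      have "((\<lambda>x. (of_nat n * inverse (of_real x) * (W x / ?P x) + W' x / ?P x - 1/2 * (W x / ?P x)) / ?a) \<longlongrightarrow> (of_nat n * 0 * c + - c / 2 - 1/2 * c) / ?a) at_top"
        by (intro tendsto_divide tendsto_diff tendsto_add tendsto_mult tendsto_const inv0 IH a0)
      thus ?thesis by simp
    qed
    show "eventually (\<lambda>x. (of_nat n * inverse (of_real x) * (W x / ?P x) + W' x / ?P x - 1/2 * (W x / ?P x)) / ?a = V x / ?Q x) at_top"
    proof (rule eventually_mono[OF eventually_gt_at_top[of 0]])
      fix x :: real assume x: "0 < x"
      have gen: "(nn * inverse xx * (w / p) + w' / p - 1/2 * (w / p)) / a = v / (p * xx)"
        if "xx \<noteq> 0" "p \<noteq> 0" "a \<noteq> 0" "a * v = nn * w + xx * w' - xx / 2 * w" for nn xx w p w' a v :: complex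
      proof -
        have v: "v = (nn * w + xx * w' - xx / 2 * w) / a" using that by (simp add: field_simps)
        show ?thesis unfolding v using that by (simp add: field_simps)
      qed
      show "(of_nat n * inverse (of_real x) * (W x / ?P x) + W' x / ?P x - 1/2 * (W x / ?P x)) / ?a = V x / ?Q x"
        unfolding Q[OF x] by (rule gen[OF _ _ a0 raise[OF x]]) (use x in auto)
    qed
  qed
  have L2: "((\<lambda>x. V' x / ?Q x) \<longlongrightarrow> - (- c / ?a) / 2) at_top"
  proof (rule Lim_transform_eventually)
    let ?i = "\<lambda>x. inverse (complex_of_real x)"
    let ?E = "\<lambda>x. (of_nat (Suc n) * ?i x * (W' x / ?P x) + (1/4 - of_nat n * ?i x - m * (?i x)\<^sup>2) * (W x / ?P x) - 1/2 * (W' x / ?P x) - 1/2 * ?i x * (W x / ?P x)) / ?a"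
    show "(?E \<longlongrightarrow> - (- c / ?a) / 2) at_top"
    proof -
      have "(?E \<longlongrightarrow> (of_nat (Suc n) * 0 * (- c / 2) + (1/4 - of_nat n * 0 - m * 0\<^sup>2) * c - 1/2 * (- c / 2) - 1/2 * 0 * c) / ?a) at_top"
        by (intro tendsto_divide tendsto_diff tendsto_add tendsto_mult tendsto_power tendsto_const inv0 IH a0)
      moreover have "(of_nat (Suc n) * 0 * (- c / 2) + (1/4 - of_nat n * 0 - m * 0\<^sup>2) * c - 1/2 * (- c / 2) - 1/2 * 0 * c) / ?a = - (- c / ?a) / 2"
        by (simp add: field_simps)
      ultimately show ?thesis by (simp only:)
    qed
    show "eventually (\<lambda>x. ?E x = V' x / ?Q x) at_top"
    proof (rule eventually_mono[OF eventually_gt_at_top[of 0]])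
      fix x :: real assume x: "0 < x"
      have gen: "((nn + 1) * inverse xx * (w' / p) + (1/4 - nn * inverse xx - m * (inverse xx)\<^sup>2) * (w / p) - 1/2 * (w' / p) - 1/2 * inverse xx * (w / p)) / a = v / (p * xx)"
        if "xx \<noteq> 0" "p \<noteq> 0" "a \<noteq> 0" "a * v = nn * w' + (xx * (- (- 1/4 + nn / xx + m / xx\<^sup>2) * w) + w') - (xx / 2 * w' + 1/2 * w)" for nn xx w p w' a v :: complex
      proof -
        have v: "v = (nn * w' + (xx * (- (- 1/4 + nn / xx + m / xx\<^sup>2) * w) + w') - (xx / 2 * w' + 1/2 * w)) / a" using that by (simp add: field_simps)
        show ?thesis unfolding v using that(1-3) by (simp add: field_simps power2_eq_square)
      qed
      have nS: "of_nat (Suc n) = (of_nat n + 1 :: complex)" by simp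
      show "?E x = V' x / ?Q x"
        unfolding Q[OF x] unfolding nS by (rule gen[OF _ _ a0 raise'[OF x]]) (use x in auto)
    qed
  qed
  show ?case using L1 L2 unfolding cS V_def V'_def by blast
qed

text \<open>For j > 0 the transform divided by its constant solves the equation and has the right
  growth, so it is itself the witness that gives \<open>whittaker_W\<close> its meaning. The
  constant is not 0 because \<sigma> + j is no pole of Gamma.\<close>

theorem kern_whit_whittaker:
  assumes \<sigma>: "Re \<sigma> > 1" and \<nu>: "\<nu> > 0" and X: "X > 0"
  shows "kern_whit \<sigma> \<nu> j X = kern_whit_const \<sigma> \<nu> j * whittaker_W (of_int j) (\<sigma> - 1/2) X"
proof (cases "j \<le> 0")
  case True
  obtain W W' where W: "whittaker_ode (of_int j) (\<sigma> - 1/2) W W'"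
    "((\<lambda>x. W x / (of_real (exp (- x / 2)) * of_real x powr of_int j)) \<longlongrightarrow> 1) at_top"
    "\<And>X. X > 0 \<Longrightarrow> kern_whit \<sigma> \<nu> j X = kern_whit_const \<sigma> \<nu> j * W X"
    by (rule kern_whit_nonpos[OF \<sigma> \<nu> True]) (rule that; blast)
  have "is_whittaker_W (of_real (of_int j)) (\<sigma> - 1/2) W"
    using W unfolding is_whittaker_W_iff of_real_of_int_eq by blast
  from whittaker_W_eqI[OF this X] W(3)[OF X] show ?thesis by simp
next
  case False
  define n where "n = nat j"
  have j: "j = int n" using False by (simp add: n_def)
  define c where "c = kern_whit_const \<sigma> \<nu> j"
  have c0: "c \<noteq> 0"
  proof -
    have "rGamma (\<sigma> + of_int j) \<noteq> 0" using \<sigma> j by (intro Gamma_nonzero_Re) simp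
    thus ?thesis using \<nu> by (simp add: c_def kern_whit_const_def)
  qed
  have "is_whittaker_W (of_real (of_int j)) (\<sigma> - 1/2) (\<lambda>x. kern_whit \<sigma> \<nu> j x / c)"
    unfolding is_whittaker_W_iff of_real_of_int_eq
  proof
    have "whittaker_ode (of_int j) (\<sigma> - 1/2) (\<lambda>x. kern_whit \<sigma> \<nu> j x / c) (\<lambda>x. kern_whit_deriv \<sigma> \<nu> j x / c)"
      unfolding whittaker_ode_def
    proof (intro allI impI conjI)
      fix x :: real assume x: "x > 0"
      have o: "(kern_whit \<sigma> \<nu> j has_vector_derivative kern_whit_deriv \<sigma> \<nu> j x) (at x)"
        "(kern_whit_deriv \<sigma> \<nu> j has_vector_derivative - (- 1/4 + of_int j / of_real x + (1/4 - (\<sigma> - 1/2)\<^sup>2) / (of_real x)\<^sup>2) * kern_whit \<sigma> \<nu> j x) (at x)"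
        using kern_whit_ode[OF \<sigma> \<nu>, of j] x unfolding whittaker_ode_def by blast+
      show "((\<lambda>x. kern_whit \<sigma> \<nu> j x / c) has_vector_derivative kern_whit_deriv \<sigma> \<nu> j x / c) (at x)"
        by (rule has_vector_derivative_divide[OF o(1)])
      show "((\<lambda>x. kern_whit_deriv \<sigma> \<nu> j x / c) has_vector_derivative - (- 1/4 + of_int j / of_real x + (1/4 - (\<sigma> - 1/2)\<^sup>2) / (of_real x)\<^sup>2) * (kern_whit \<sigma> \<nu> j x / c)) (at x)"
        unfolding times_divide_eq_right by (rule has_vector_derivative_divide[OF o(2)])
    qed
    thus "\<exists>W'. whittaker_ode (of_int j) (\<sigma> - 1/2) (\<lambda>x. kern_whit \<sigma> \<nu> j x / c) W'" by blast
    have "((\<lambda>x. kern_whit \<sigma> \<nu> j x / (of_real (exp (- x / 2)) * of_real x powr of_int j)) \<longlongrightarrow> c) at_top"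
      using kern_whit_asymptotics[OF \<sigma> \<nu>, of n] by (simp add: j c_def)
    from tendsto_divide[OF this tendsto_const c0]
    show "((\<lambda>x. kern_whit \<sigma> \<nu> j x / c / (of_real (exp (- x / 2)) * of_real x powr of_int j)) \<longlongrightarrow> 1) at_top"
      using c0 by (simp add: mult.commute)
  qed
  from whittaker_W_eqI[OF this X] c0 show ?thesis by (simp add: c_def)
qed

section \<open>The completed zeta function\<close>

text \<open>The characteristic function of the standard normal distribution, rescaled by x -> c x
  with c^2 = 2 \<pi> t.\<close>

lemma gaussian_fourier:
  assumes t: "t > 0"
  shows "fourier (\<lambda>x. of_real (exp (- (pi * t * x\<^sup>2)))) \<nu> = of_real (1 / sqrt t * exp (- (\<nu>\<^sup>2 / (4 * pi * t))))"
proof -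
  define c where "c = sqrt (2 * pi * t)"
  have c: "c > 0" "c\<^sup>2 = 2 * pi * t" using t by (auto simp: c_def)
  define s where "s = - \<nu> / c"
  have "of_real (exp (- (s\<^sup>2) / 2)) = (CLINT x|std_normal_distribution. iexp (s * x))"
    using char_std_normal_distribution by (simp add: char_def fun_eq_iff)
  also have "\<dots> = (CLINT x|lborel. std_normal_density x *\<^sub>R iexp (s * x))"
    by (rule integral_density) auto
  also have "\<dots> = \<bar>c\<bar> *\<^sub>R (CLINT x|lborel. std_normal_density (0 + c * x) *\<^sub>R iexp (s * (0 + c * x)))"
    by (rule lborel_integral_real_affine) (use c in auto)
  also have "(\<lambda>x. std_normal_density (0 + c * x) *\<^sub>R iexp (s * (0 + c * x))) = (\<lambda>x. of_real (1 / sqrt (2 * pi)) * (of_real (exp (- (pi * t * x\<^sup>2))) * exp (- (\<i> * of_real (\<nu> * x)))))"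
  proof
    fix x
    have "(c * x)\<^sup>2 / 2 = pi * t * x\<^sup>2" by (simp add: power_mult_distrib c(2))
    moreover have "s * (c * x) = - (\<nu> * x)" using c by (simp add: s_def)
    ultimately show "std_normal_density (0 + c * x) *\<^sub>R iexp (s * (0 + c * x)) = of_real (1 / sqrt (2 * pi)) * (of_real (exp (- (pi * t * x\<^sup>2))) * exp (- (\<i> * of_real (\<nu> * x))))"
      by (simp add: std_normal_density_def scaleR_conv_of_real)
  qed
  also have "\<bar>c\<bar> *\<^sub>R integral\<^sup>L lborel \<dots> = of_real (c * (1 / sqrt (2 * pi))) * fourier (\<lambda>x. of_real (exp (- (pi * t * x\<^sup>2)))) \<nu>"
    unfolding fourier_def integral_mult_right_zero using c by (simp add: scaleR_conv_of_real)
  also have "c * (1 / sqrt (2 * pi)) = sqrt t" using t by (simp add: c_def real_sqrt_mult)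
  also have "s\<^sup>2 / 2 = \<nu>\<^sup>2 / (4 * pi * t)" using c by (simp add: s_def power_divide)
  hence "exp (- (s\<^sup>2) / 2) = exp (- (\<nu>\<^sup>2 / (4 * pi * t)))" by (metis minus_divide_left)
  finally have "of_real (exp (- (\<nu>\<^sup>2 / (4 * pi * t)))) = of_real (sqrt t) * fourier (\<lambda>x. of_real (exp (- (pi * t * x\<^sup>2)))) \<nu>"
    using \<open>exp (- (s\<^sup>2) / 2) = exp (- (\<nu>\<^sup>2 / (4 * pi * t)))\<close> by (simp only:)
  thus ?thesis using t by (simp add: field_simps)
qed

section \<open>The theta function and its Mellin transform\<close>

text \<open>The classical theta function at t is \<open>1 + 2 * psi t\<close>; only the terms of
  positive index enter the Mellin transform.\<close>

definition psi :: "real \<Rightarrow> real" where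
  "psi t = (\<Sum>n. exp (- (pi * (real (Suc n))\<^sup>2 * t)))"

lemma psi_term_le:
  assumes "t > 0"
  shows "exp (- (pi * (real (Suc n))\<^sup>2 * t)) \<le> exp (- (pi * t)) * exp (- (pi * t)) ^ n"
proof -
  have "real (Suc n) \<le> (real (Suc n))\<^sup>2" by (simp add: power2_eq_square)
  hence "pi * t * real (Suc n) \<le> pi * t * (real (Suc n))\<^sup>2" using assms by (intro mult_left_mono) auto
  hence "exp (- (pi * (real (Suc n))\<^sup>2 * t)) \<le> exp (real (Suc n) * (- (pi * t)))" by (simp add: mult_ac)
  also have "\<dots> = exp (- (pi * t)) ^ Suc n" by (rule exp_of_nat_mult)
  finally show ?thesis by simp
qed

lemma psi_summable:
  assumes "t > 0"
  shows "summable (\<lambda>n. exp (- (pi * (real (Suc n))\<^sup>2 * t)))"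
proof (rule summable_comparison_test')
  show "summable (\<lambda>n. exp (- (pi * t)) * exp (- (pi * t)) ^ n)"
    using assms by (intro summable_mult summable_geometric) simp
  show "norm (exp (- (pi * (real (Suc n))\<^sup>2 * t))) \<le> exp (- (pi * t)) * exp (- (pi * t)) ^ n" for n
    using psi_term_le[OF assms, of n] by simp
qed

lemma psi_bound:
  obtains C where "C > 0" "\<And>t. t \<ge> 1 \<Longrightarrow> 0 \<le> psi t \<and> psi t \<le> C * exp (- (pi * t))"
proof
  show "(\<Sum>n. exp (- pi) ^ n) > 0"
    by (intro suminf_pos summable_geometric) auto
  fix t :: real assume t: "t \<ge> 1"
  hence t0: "t > 0" by simp
  have "psi t \<le> (\<Sum>n. exp (- (pi * t)) * exp (- pi) ^ n)"
    unfolding psi_def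
  proof (rule suminf_le[OF _ psi_summable[OF t0]])
    show "summable (\<lambda>n. exp (- (pi * t)) * exp (- pi) ^ n)"
      by (intro summable_mult summable_geometric) simp
    show "exp (- (pi * (real (Suc n))\<^sup>2 * t)) \<le> exp (- (pi * t)) * exp (- pi) ^ n" for n
    proof -
      have "exp (- (pi * t)) ^ n \<le> exp (- pi) ^ n" using t by (intro power_mono) auto
      hence "exp (- (pi * t)) * exp (- (pi * t)) ^ n \<le> exp (- (pi * t)) * exp (- pi) ^ n" by (intro mult_left_mono) auto
      with psi_term_le[OF t0, of n] show ?thesis by linarith
    qed
  qed
  also have "\<dots> = exp (- (pi * t)) * (\<Sum>n. exp (- pi) ^ n)"
    by (intro suminf_mult summable_geometric) simp
  finally have "psi t \<le> (\<Sum>n. exp (- pi) ^ n) * exp (- (pi * t))" by (simp add: mult.commute)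
  moreover have "0 \<le> psi t" unfolding psi_def by (intro suminf_nonneg psi_summable t0) auto
  ultimately show "0 \<le> psi t \<and> psi t \<le> (\<Sum>n. exp (- pi) ^ n) * exp (- (pi * t))" by simp
qed

lemma psi_measurable [measurable]: "psi \<in> borel_measurable borel"
  unfolding psi_def[abs_def] by measurable

text \<open>Poisson summation for the Gaussian. The quadratic bound for it and its two derivatives
  holds because the polynomial factors are at most a multiple of 1 + x^2, while (1 + x^2)^2
  exp(-\<pi> t x^2) is bounded.\<close>

lemma psi_transform:
  assumes t: "t > 0"
  shows "1 + 2 * psi t = 1 / sqrt t * (1 + 2 * psi (1 / t))"
proof -
  let ?F = "\<lambda>x. complex_of_real (exp (- (pi * t * x\<^sup>2)))"
  let ?F1 = "\<lambda>x. complex_of_real (- 2 * pi * t * x * exp (- (pi * t * x\<^sup>2)))"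
  let ?F2 = "\<lambda>x. complex_of_real ((4 * pi\<^sup>2 * t\<^sup>2 * x\<^sup>2 - 2 * pi * t) * exp (- (pi * t * x\<^sup>2)))"
  obtain C where C: "C > 0" "\<And>u m'. u \<ge> 0 \<Longrightarrow> m' \<le> 2 \<Longrightarrow> (1 + u) powr m' \<le> C * exp (pi * t * u)"
    using one_plus_powr_le_exp[of "pi * t" 2] t by auto
  have E: "(1 + x\<^sup>2) * exp (- (pi * t * x\<^sup>2)) \<le> C / (1 + x\<^sup>2)" for x
  proof -
    have p: "1 + x\<^sup>2 > 0" by (simp add: add_pos_nonneg)
    have "(1 + x\<^sup>2)\<^sup>2 \<le> C * exp (pi * t * x\<^sup>2)" using C(2)[of "x\<^sup>2" 2] p by (simp add: powr_numeral)
    hence "(1 + x\<^sup>2)\<^sup>2 * exp (- (pi * t * x\<^sup>2)) \<le> C * exp (pi * t * x\<^sup>2) * exp (- (pi * t * x\<^sup>2))" by (intro mult_right_mono) auto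
    also have "\<dots> = C" by (simp add: exp_minus)
    finally show ?thesis using p by (simp add: power2_eq_square pos_le_divide_eq mult_ac)
  qed
  define D where "D = (1 + 4 * pi\<^sup>2 * t\<^sup>2 + 2 * pi * t) * C"
  have bnd: "norm (complex_of_real (p * exp (- (pi * t * x\<^sup>2)))) \<le> D / (1 + x\<^sup>2)"
    if "\<bar>p\<bar> \<le> (1 + 4 * pi\<^sup>2 * t\<^sup>2 + 2 * pi * t) * (1 + x\<^sup>2)" for p x
  proof -
    have "norm (complex_of_real (p * exp (- (pi * t * x\<^sup>2)))) = \<bar>p\<bar> * exp (- (pi * t * x\<^sup>2))" by (simp only: norm_of_real abs_mult abs_exp_cancel)
    also have "\<dots> \<le> (1 + 4 * pi\<^sup>2 * t\<^sup>2 + 2 * pi * t) * (1 + x\<^sup>2) * exp (- (pi * t * x\<^sup>2))" by (intro mult_right_mono that) auto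
    also have "\<dots> = (1 + 4 * pi\<^sup>2 * t\<^sup>2 + 2 * pi * t) * ((1 + x\<^sup>2) * exp (- (pi * t * x\<^sup>2)))" by (rule mult.assoc)
    also have "\<dots> \<le> (1 + 4 * pi\<^sup>2 * t\<^sup>2 + 2 * pi * t) * (C / (1 + x\<^sup>2))" using t by (intro mult_left_mono E) auto
    finally show ?thesis by (simp add: D_def)
  qed
  have x2: "\<bar>x\<bar> \<le> 1 + x\<^sup>2" for x :: real
    using zero_le_power2[of "\<bar>x\<bar> - 1"] by (simp add: power2_eq_square algebra_simps abs_if split: if_splits)
  have b0: "norm (?F x) \<le> D / (1 + x\<^sup>2)" for x
  proof -
    have "\<bar>1\<bar> \<le> (1 + 4 * pi\<^sup>2 * t\<^sup>2 + 2 * pi * t) * (1 + x\<^sup>2)"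
      using mult_mono[of 1 "1 + 4 * pi\<^sup>2 * t\<^sup>2 + 2 * pi * t" 1 "1 + x\<^sup>2"] t by (simp add: add_nonneg_nonneg)
    from bnd[OF this] show ?thesis by simp
  qed
  have b1: "norm (?F1 x) \<le> D / (1 + x\<^sup>2)" for x
  proof (rule bnd)
    have "\<bar>- 2 * pi * t * x\<bar> = 2 * pi * t * \<bar>x\<bar>" using t by (simp add: abs_mult)
    also have "\<dots> \<le> 2 * pi * t * (1 + x\<^sup>2)" using t by (intro mult_left_mono x2) auto
    also have "\<dots> \<le> (1 + 4 * pi\<^sup>2 * t\<^sup>2 + 2 * pi * t) * (1 + x\<^sup>2)" by (intro mult_right_mono) auto
    finally show "\<bar>- 2 * pi * t * x\<bar> \<le> (1 + 4 * pi\<^sup>2 * t\<^sup>2 + 2 * pi * t) * (1 + x\<^sup>2)" .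
  qed
  have b2: "norm (?F2 x) \<le> D / (1 + x\<^sup>2)" for x
  proof (rule bnd)
    have "\<bar>4 * pi\<^sup>2 * t\<^sup>2 * x\<^sup>2 - 2 * pi * t\<bar> \<le> \<bar>4 * pi\<^sup>2 * t\<^sup>2 * x\<^sup>2\<bar> + \<bar>2 * pi * t\<bar>" by (rule abs_triangle_ineq4)
    also have "\<dots> = 4 * pi\<^sup>2 * t\<^sup>2 * x\<^sup>2 + 2 * pi * t" using t by simp
    also have "\<dots> \<le> (1 + 4 * pi\<^sup>2 * t\<^sup>2 + 2 * pi * t) * (1 + x\<^sup>2)"
      using t by (simp add: algebra_simps add_nonneg_nonneg)
    finally show "\<bar>4 * pi\<^sup>2 * t\<^sup>2 * x\<^sup>2 - 2 * pi * t\<bar> \<le> (1 + 4 * pi\<^sup>2 * t\<^sup>2 + 2 * pi * t) * (1 + x\<^sup>2)" .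
  qed
  have d0: "(?F has_vector_derivative ?F1 x) (at x)" for x
    by (intro has_vector_derivative_of_real) (auto intro!: derivative_eq_intros)
  have d1: "(?F1 has_vector_derivative ?F2 x) (at x)" for x
    by (intro has_vector_derivative_of_real) (auto intro!: derivative_eq_intros simp: power2_eq_square algebra_simps)
  have c2: "continuous_on UNIV ?F2" by (intro continuous_intros)
  note P = poisson_summation[OF d0 d1 c2 b0 b1 b2]
  have ft: "fourier ?F (2 * pi * of_int n) = of_real (1 / sqrt t * exp (- (pi * (1 / t) * (of_int n)\<^sup>2)))" for n :: int
  proof -
    have "(2 * pi * of_int n)\<^sup>2 / (4 * pi * t) = pi * (1 / t) * (of_int n)\<^sup>2" using t by (simp add: power2_eq_square field_simps)
    thus ?thesis unfolding gaussian_fourier[OF t] by (simp only:)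
  qed
  have half: "(\<Sum>\<^sub>\<infinity>n::int. complex_of_real (exp (- (pi * u * (of_int n)\<^sup>2)))) = of_real (1 + 2 * psi u)"
    if u: "u > 0" and s: "(\<lambda>n::int. norm (complex_of_real (exp (- (pi * u * (of_int n)\<^sup>2))))) summable_on UNIV" for u
  proof -
    let ?f = "\<lambda>n::int. complex_of_real (exp (- (pi * u * (of_int n)\<^sup>2)))"
    have "(\<lambda>m. ?f (int (Suc m)) + ?f (- int (Suc m))) sums (infsum ?f UNIV - ?f 0)"
      by (rule infsum_int_sums[OF s])
    moreover have "(\<lambda>m. complex_of_real (2 * exp (- (pi * (real (Suc m))\<^sup>2 * u)))) sums of_real (2 * psi u)"
      unfolding psi_def by (intro sums_of_real sums_mult summable_sums psi_summable u)
    moreover have "?f (int (Suc m)) + ?f (- int (Suc m)) = complex_of_real (2 * exp (- (pi * (real (Suc m))\<^sup>2 * u)))" for m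
      by (simp only: of_int_minus of_int_of_nat_eq power2_minus) (simp add: mult_ac)
    ultimately have "infsum ?f UNIV - ?f 0 = of_real (2 * psi u)"
      using sums_unique2 by (simp only:) blast
    thus ?thesis by (simp add: algebra_simps)
  qed
  have s1: "(\<lambda>n::int. norm (?F (of_int n))) summable_on UNIV"
    by (rule abs_summable_on_int_quadratic[OF b0])
  have s2: "(\<lambda>n::int. norm (complex_of_real (exp (- (pi * (1 / t) * (of_int n)\<^sup>2))))) summable_on UNIV"
  proof -
    have "(\<lambda>n::int. sqrt t * norm (fourier ?F (2 * pi * of_int n))) summable_on UNIV"
      by (intro summable_on_cmult_right P(2))
    moreover have "sqrt t * norm (fourier ?F (2 * pi * of_int n)) = norm (complex_of_real (exp (- (pi * (1 / t) * (of_int n)\<^sup>2))))" for n :: int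
      unfolding ft using t by (simp only: norm_of_real abs_mult) simp
    ultimately show ?thesis by (simp only:)
  qed
  have "complex_of_real (1 + 2 * psi t) = (\<Sum>\<^sub>\<infinity>n::int. ?F (of_int n))"
    using half[OF t] s1 by simp
  also have "\<dots> = (\<Sum>\<^sub>\<infinity>n::int. of_real (1 / sqrt t) * complex_of_real (exp (- (pi * (1 / t) * (of_int n)\<^sup>2))))"
    unfolding P(3) ft of_real_mult ..
  also have "\<dots> = of_real (1 / sqrt t) * (\<Sum>\<^sub>\<infinity>n::int. complex_of_real (exp (- (pi * (1 / t) * (of_int n)\<^sup>2))))"
    by (rule infsum_cmult_right) (use abs_summable_summable[OF s2] in simp)
  also have "\<dots> = of_real (1 / sqrt t) * of_real (1 + 2 * psi (1 / t))"
    using half[OF _ s2] t by simp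
  finally show ?thesis by (simp only: of_real_mult[symmetric] of_real_eq_iff)
qed

definition dirichlet_zeta :: "complex \<Rightarrow> complex" where
  "dirichlet_zeta s = (\<Sum>n. of_nat (Suc n) powr (- s))"

lemma norm_nat_powr: "norm (of_nat (Suc n) powr s :: complex) = real (Suc n) powr (Re s)"
  using norm_powr_real_powr[of "of_nat (Suc n)" s] by simp

lemma zeta_norm_summable:
  assumes "Re s > 1"
  shows "summable (\<lambda>n. norm (of_nat (Suc n) powr (- s) :: complex))"
proof -
  have "summable (\<lambda>n. real n powr (- Re s))" using assms by (simp add: summable_real_powr_iff)
  hence "summable (\<lambda>n. real (Suc n) powr (- Re s))" by (subst summable_Suc_iff)
  thus ?thesis unfolding norm_nat_powr by simp
qed

lemma dirichlet_zeta_sums: "Re s > 1 \<Longrightarrow> (\<lambda>n. of_nat (Suc n) powr (- s)) sums dirichlet_zeta s"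
  unfolding dirichlet_zeta_def by (intro summable_sums summable_norm_cancel[OF zeta_norm_summable])

text \<open>Termwise Gamma integrals. Absolute values replace z by Re z in each of them, and the
  resulting series converges because 2 Re z > 1; this justifies the exchange of sum and
  integral.\<close>

lemma psi_mellin:
  assumes z: "Re z > 1/2"
  shows psi_mellin_integrable: "set_integrable lborel {0<..} (\<lambda>t. of_real (psi t) * of_real t powr (z - 1) :: complex)"
    and psi_mellin_integral: "(LINT t:{0<..}|lborel. of_real (psi t) * of_real t powr (z - 1)) = of_real pi powr (- z) * Gamma z * dirichlet_zeta (2 * z)"
proof -
  let ?f = "\<lambda>n t. indicator {0<..} t *\<^sub>R (complex_of_real t powr (z - 1) * of_real (exp (- (pi * (real (Suc n))\<^sup>2 * t))))"
  let ?r = "\<lambda>n t. indicator {0<..} t *\<^sub>R (t powr (Re z - 1) * exp (- (pi * (real (Suc n))\<^sup>2 * t)))"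
  have cp: "pi * (real (Suc n))\<^sup>2 > 0" for n by simp
  have z0: "Re z > 0" using z by simp
  have int: "integrable lborel (?f n)" for n
    using gamma_set_integrable[OF z0 cp] by (simp add: set_integrable_def)
  have pw: "of_real (pi * (real (Suc n))\<^sup>2) powr (- w) = of_real pi powr (- w) * of_nat (Suc n) powr (- (2 * w))" for n and w :: complex
  proof -
    have "of_real (pi * (real (Suc n))\<^sup>2) powr (- w) = (of_real pi powr (- w) * of_real ((real (Suc n))\<^sup>2) powr (- w) :: complex)"
      unfolding of_real_mult by (rule powr_times_real) auto
    also have "(of_real ((real (Suc n))\<^sup>2) powr (- w) :: complex) = of_nat (Suc n) powr (- (2 * w))"
    proof -
      have "complex_of_real ((real (Suc n))\<^sup>2) powr (- w) = exp (- w * of_real (ln ((real (Suc n))\<^sup>2)))"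
        using Ln_of_real[of "(real (Suc n))\<^sup>2"] by (simp only: powr_def of_real_eq_0_iff) simp
      also have "ln ((real (Suc n))\<^sup>2) = 2 * ln (real (Suc n))" by (simp add: ln_realpow)
      also have "exp (- w * of_real (2 * ln (real (Suc n)))) = exp (- (2 * w) * of_real (ln (real (Suc n))))" by (simp add: mult_ac)
      also have "\<dots> = of_nat (Suc n) powr (- (2 * w))"
        using Ln_of_real[of "real (Suc n)"] by (simp only: powr_def of_real_of_nat_eq of_nat_eq_0_iff) simp
      finally show ?thesis .
    qed
    finally show ?thesis .
  qed
  have val: "(LINT t|lborel. ?f n t) = (of_real pi powr (- z) * Gamma z) * of_nat (Suc n) powr (- (2 * z))" for n
    using gamma_set_integral[OF z0 cp, of n] unfolding set_lebesgue_integral_def pw by (simp only: mult_ac)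
  have nrm: "norm (?f n t) = norm (?r n t)" and nrm2: "norm (?r n t) = ?r n t" for n t
    by (cases "t > 0"; simp add: norm_mult norm_powr_real_powr)+
  have rr: "Re (of_real (Re z)) > 0" using z0 by simp
  have valn: "(LINT t|lborel. norm (?f n t)) = norm (of_real pi powr (- of_real (Re z)) * Gamma (of_real (Re z)) * of_nat (Suc n) powr (- (2 * of_real (Re z))) :: complex)" for n
  proof -
    have "complex_of_real (LINT t|lborel. ?r n t) = (LINT t|lborel. complex_of_real (?r n t))" by (rule integral_complex_of_real[symmetric])
    also have "\<dots> = (LINT t:{0<..}|lborel. of_real t powr (of_real (Re z) - 1) * of_real (exp (- (pi * (real (Suc n))\<^sup>2 * t))))"
    proof -
      have "complex_of_real (?r n t) = indicator {0<..} t *\<^sub>R (of_real t powr (of_real (Re z) - 1) * of_real (exp (- (pi * (real (Suc n))\<^sup>2 * t))))" for t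
        using powr_of_real[of t "Re z - 1"] by (cases "t > 0") simp_all
      thus ?thesis unfolding set_lebesgue_integral_def by (simp only:)
    qed
    also have "\<dots> = of_real pi powr (- of_real (Re z)) * Gamma (of_real (Re z)) * of_nat (Suc n) powr (- (2 * of_real (Re z)))"
      unfolding gamma_set_integral[OF rr cp] pw by (simp only: mult_ac)
    finally have E: "complex_of_real (LINT t|lborel. ?r n t) = of_real pi powr (- of_real (Re z)) * Gamma (of_real (Re z)) * of_nat (Suc n) powr (- (2 * of_real (Re z)))" .
    have "norm (of_real pi powr (- of_real (Re z)) * Gamma (of_real (Re z)) * of_nat (Suc n) powr (- (2 * of_real (Re z))) :: complex) = \<bar>LINT t|lborel. ?r n t\<bar>"
      unfolding E[symmetric] by (rule norm_of_real)
    also have "\<dots> = (LINT t|lborel. ?r n t)" by (intro abs_of_nonneg Bochner_Integration.integral_nonneg) auto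
    finally show ?thesis unfolding nrm nrm2 ..
  qed
  have S1: "AE t in lborel. summable (\<lambda>n. norm (?f n t))"
  proof (intro AE_I2)
    fix t :: real
    show "summable (\<lambda>n. norm (?f n t))"
    proof (cases "t > 0")
      case True
      hence "summable (\<lambda>n. t powr (Re z - 1) * exp (- (pi * (real (Suc n))\<^sup>2 * t)))" by (intro summable_mult psi_summable)
      thus ?thesis unfolding nrm using True by simp
    qed simp
  qed
  have S2: "summable (\<lambda>n. LINT t|lborel. norm (?f n t))"
    unfolding valn unfolding norm_mult[of "of_real pi powr (- of_real (Re z)) * Gamma (of_real (Re z))"]
    by (intro summable_mult zeta_norm_summable) (use z in simp)
  have lim: "(\<Sum>n. ?f n t) = indicator {0<..} t *\<^sub>R (of_real (psi t) * of_real t powr (z - 1))" for t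
  proof (cases "t > 0")
    case True
    have "(\<lambda>n. complex_of_real t powr (z - 1) * of_real (exp (- (pi * (real (Suc n))\<^sup>2 * t)))) sums (of_real t powr (z - 1) * of_real (psi t))"
      unfolding psi_def by (intro sums_mult sums_of_real summable_sums psi_summable True)
    from sums_unique[OF this] True show ?thesis by (simp add: mult.commute)
  qed simp
  show "set_integrable lborel {0<..} (\<lambda>t. of_real (psi t) * of_real t powr (z - 1) :: complex)"
    using integrable_suminf[OF int S1 S2] unfolding lim set_integrable_def .
  have "(\<lambda>n. LINT t|lborel. ?f n t) sums (LINT t:{0<..}|lborel. of_real (psi t) * of_real t powr (z - 1))"
    using sums_integral[OF int S1 S2] unfolding lim set_lebesgue_integral_def .
  moreover have "(\<lambda>n. LINT t|lborel. ?f n t) sums (of_real pi powr (- z) * Gamma z * dirichlet_zeta (2 * z))"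
    unfolding val by (intro sums_mult dirichlet_zeta_sums) (use z in simp)
  ultimately show "(LINT t:{0<..}|lborel. of_real (psi t) * of_real t powr (z - 1)) = of_real pi powr (- z) * Gamma z * dirichlet_zeta (2 * z)"
    by (rule sums_unique2)
qed

text \<open>The part of the Mellin transform over t > 1. Exponential decay of \<open>psi\<close>
  makes it entire, and the part over t < 1 is reduced to it by theta inversion.\<close>

definition psi_tail :: "complex \<Rightarrow> complex" where
  "psi_tail z = (LINT t:{1<..}|lborel. of_real (psi t) * of_real t powr (z - 1))"

lemma psi_tail_integrable_real: "set_integrable lborel {1<..} (\<lambda>t. psi t * t powr r)"
proof -
  obtain C where C: "C > 0" "\<And>t. t \<ge> 1 \<Longrightarrow> 0 \<le> psi t \<and> psi t \<le> C * exp (- (pi * t))" using psi_bound by blast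
  \<comment> \<open>R > 0 makes the Gamma integral converge, and R - 1 >= r makes its integrand a
    majorant for t >= 1.\<close>
  define R where "R = max r 0 + 1"
  have "set_integrable lborel {0<..} (\<lambda>t. t powr (R - 1) * exp (- (pi * t)))"
    by (rule gamma_set_integrable_real) (auto simp: R_def)
  hence "set_integrable lborel {1<..} (\<lambda>t. t powr (R - 1) * exp (- (pi * t)))"
    by (rule set_integrable_subset) auto
  hence "set_integrable lborel {1<..} (\<lambda>t. C * (t powr (R - 1) * exp (- (pi * t))))" by simp
  thus ?thesis
  proof (rule set_integrable_bound)
    show "set_borel_measurable lborel {1<..} (\<lambda>t. psi t * t powr r)"
      unfolding set_borel_measurable_def by measurable
    show "AE t in lborel. t \<in> {1<..} \<longrightarrow> norm (psi t * t powr r) \<le> norm (C * (t powr (R - 1) * exp (- (pi * t))))"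
    proof (intro AE_I2 impI)
      fix t :: real assume "t \<in> {1<..}"
      hence t: "t \<ge> 1" by simp
      have "t powr r \<le> t powr (R - 1)" using t by (intro powr_mono) (auto simp: R_def)
      hence "psi t * t powr r \<le> (C * exp (- (pi * t))) * t powr (R - 1)" using C t by (intro mult_mono) auto
      thus "norm (psi t * t powr r) \<le> norm (C * (t powr (R - 1) * exp (- (pi * t))))"
        using C(1) C(2)[OF t] by (simp add: abs_mult mult_ac)
    qed
  qed
qed

lemma psi_tail_measurable:
  "(\<lambda>t. indicator {1<..} t *\<^sub>R (of_real (psi t) * of_real t powr (z - 1)) :: complex) \<in> borel_measurable borel"
proof -
  have "(\<lambda>t. indicator {1<..} t *\<^sub>R (of_real t powr (z - 1)) :: complex) \<in> borel_measurable borel"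
    by (rule borel_measurable_continuous_on_indicator) (auto intro!: continuous_on_of_real_powr)
  moreover have "(\<lambda>t. complex_of_real (psi t)) \<in> borel_measurable borel" by measurable
  ultimately have "(\<lambda>t. complex_of_real (psi t) * (indicator {1<..} t *\<^sub>R (of_real t powr (z - 1)))) \<in> borel_measurable borel"
    by (intro borel_measurable_times)
  thus ?thesis by simp
qed

lemma psi_tail_norm:
  assumes "t > 1"
  shows "norm (of_real (psi t) * of_real t powr (z - 1) :: complex) = psi t * t powr (Re z - 1)"
proof -
  have "psi t \<ge> 0" unfolding psi_def using assms by (intro suminf_nonneg psi_summable) auto
  thus ?thesis using assms by (simp add: norm_mult norm_powr_real_powr)
qed

lemma psi_tail_integrable: "set_integrable lborel {1<..} (\<lambda>t. of_real (psi t) * of_real t powr (z - 1) :: complex)"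
proof (rule set_integrable_bound[OF psi_tail_integrable_real[of "Re z - 1"]])
  show "set_borel_measurable lborel {1<..} (\<lambda>t. of_real (psi t) * of_real t powr (z - 1) :: complex)"
    unfolding set_borel_measurable_def using psi_tail_measurable by simp
qed (intro AE_I2 impI, use psi_tail_norm in auto)

lemma psi_tail_holomorphic: "psi_tail holomorphic_on A"
proof -
  have "\<exists>d. (psi_tail has_field_derivative d) (at z0)" for z0
  proof -
    let ?f = "\<lambda>z t. indicator {1<..} t *\<^sub>R (of_real (psi t) * of_real t powr (z - 1)) :: complex"
    have "((\<lambda>z. LINT t|lborel. ?f z t) has_field_derivative (LINT t|lborel. of_real (ln t) * ?f z0 t)) (at z0)"
    proof (rule has_field_derivative_integral(2)[where r = 1 and f' = "\<lambda>z t. of_real (ln t) * ?f z t" and g = "\<lambda>t. indicator {1<..} t *\<^sub>R (psi t * t powr (Re z0))"])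
      show "?f z \<in> borel_measurable lborel" for z using psi_tail_measurable by simp
      show "integrable lborel (\<lambda>t. indicator {1<..} t *\<^sub>R (psi t * t powr (Re z0)))"
        using psi_tail_integrable_real by (simp add: set_integrable_def)
      show "((\<lambda>z. ?f z t) has_field_derivative of_real (ln t) * ?f z t) (at z)" for z t
      proof (cases "t > 1")
        case True
        have "((\<lambda>z. of_real (psi t) * exp ((z - 1) * of_real (ln t))) has_field_derivative of_real (psi t) * (exp ((z - 1) * of_real (ln t)) * of_real (ln t))) (at z)"
          by (auto intro!: derivative_eq_intros)
        thus ?thesis using True Ln_of_real[of t] by (simp add: powr_def mult_ac)
      qed simp
      fix z t assume "z \<in> ball z0 1"
      hence "Re z - 1 \<le> Re z0" using abs_Re_le_cmod[of "z0 - z"] by (simp add: dist_norm)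
      moreover have "psi t \<ge> 0" if "t > 1" unfolding psi_def using that by (intro suminf_nonneg psi_summable) auto
      ultimately show "norm (?f z t) \<le> indicator {1<..} t *\<^sub>R (psi t * t powr (Re z0))"
        using psi_tail_norm[of t z] by (cases "t > 1") (auto intro!: mult_left_mono)
    qed simp
    thus ?thesis unfolding psi_tail_def[abs_def] set_lebesgue_integral_def by blast
  qed
  thus ?thesis
    unfolding holomorphic_on_def field_differentiable_def by (meson has_field_derivative_at_within)
qed

lemma powr_tail:
  assumes c: "Re c > 0"
  shows powr_tail_integrable: "set_integrable lborel {1<..} (\<lambda>u. of_real u powr (- c - 1) :: complex)"
    and powr_tail_integral: "(LINT u:{1<..}|lborel. of_real u powr (- c - 1)) = 1 / c"
proof -
  have ein: "einterval 1 \<infinity> = {1<..}" by (auto simp: einterval_def one_ereal_def)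
  have real: "set_integrable lborel (einterval 1 \<infinity>) (\<lambda>u. u powr (- Re c - 1))"
  proof (rule interval_integral_FTC_nonneg(1)[where F = "\<lambda>u. - (u powr (- Re c)) / Re c" and A = "- 1 / Re c" and B = 0])
    fix u :: real assume "1 < ereal u"
    hence u: "u > 0" by (simp add: one_ereal_def)
    show "((\<lambda>u. - (u powr (- Re c)) / Re c) has_real_derivative u powr (- Re c - 1)) (at u)"
      using u c by (auto intro!: derivative_eq_intros)
    show "isCont (\<lambda>u. u powr (- Re c - 1)) u" using u by (intro continuous_intros) auto
  next
    show "(((\<lambda>u. - (u powr (- Re c)) / Re c) \<circ> real_of_ereal) \<longlongrightarrow> - 1 / Re c) (at_right 1)"
    proof -
      have "((\<lambda>u. - (u powr (- Re c)) / Re c) \<longlongrightarrow> - (1 powr (- Re c)) / Re c) (at_right 1)" using c by (intro tendsto_intros) auto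
      thus ?thesis by (simp add: one_ereal_def ereal_tendsto_simps1)
    qed
    show "(((\<lambda>u. - (u powr (- Re c)) / Re c) \<circ> real_of_ereal) \<longlongrightarrow> 0) (at_left \<infinity>)"
    proof -
      have "((\<lambda>u. - (u powr (- Re c)) / Re c) \<longlongrightarrow> 0) at_top" using c by real_asymp
      thus ?thesis by (simp add: ereal_tendsto_simps1)
    qed
  qed auto
  have m: "(\<lambda>u. indicator {1<..} u *\<^sub>R (of_real u powr (- c - 1)) :: complex) \<in> borel_measurable borel"
    by (rule borel_measurable_continuous_on_indicator) (auto intro!: continuous_on_of_real_powr)
  show i: "set_integrable lborel {1<..} (\<lambda>u. of_real u powr (- c - 1) :: complex)"
  proof (rule set_integrable_bound[OF real[unfolded ein]])
    show "set_borel_measurable lborel {1<..} (\<lambda>u. of_real u powr (- c - 1) :: complex)"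
      unfolding set_borel_measurable_def using m by simp
    show "AE u in lborel. u \<in> {1<..} \<longrightarrow> norm (of_real u powr (- c - 1) :: complex) \<le> norm (u powr (- Re c - 1))"
      by (intro AE_I2 impI) (simp add: norm_powr_real_powr)
  qed
  have c0: "c \<noteq> 0" using c by auto
  have "(LBINT u=1..\<infinity>. of_real u powr (- c - 1)) = 0 - (- 1 / c)"
  proof (rule interval_integral_FTC_integrable[where F = "\<lambda>u. - (of_real u powr (- c)) / c"])
    fix u :: real assume "1 < ereal u"
    hence u: "u > 0" by (simp add: one_ereal_def)
    hence uc: "complex_of_real u \<notin> \<real>\<^sub>\<le>\<^sub>0" by (auto simp: complex_nonpos_Reals_iff)
    have "((\<lambda>u. - (u powr (- c)) / c) has_field_derivative - ((- c) * of_real u powr (- c - 1)) / c) (at (of_real u))"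
      using uc by (auto intro!: derivative_eq_intros)
    from has_vector_derivative_real_field[OF this]
    show "((\<lambda>u. - (complex_of_real u powr (- c)) / c) has_vector_derivative of_real u powr (- c - 1)) (at u)" using c0 by simp
    show "isCont (\<lambda>u. complex_of_real u powr (- c - 1)) u" using uc by (intro continuous_intros) auto
  next
    show "set_integrable lborel (einterval 1 \<infinity>) (\<lambda>u. of_real u powr (- c - 1) :: complex)" unfolding ein by (rule i)
    show "(((\<lambda>u. - (complex_of_real u powr (- c)) / c) \<circ> real_of_ereal) \<longlongrightarrow> - 1 / c) (at_right 1)"
    proof -
      have "((\<lambda>u. - (complex_of_real u powr (- c)) / c) \<longlongrightarrow> - (of_real 1 powr (- c)) / c) (at_right 1)"
        by (intro tendsto_divide tendsto_minus tendsto_of_real_powr tendsto_ident_at tendsto_const c0) auto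
      thus ?thesis by (simp add: one_ereal_def ereal_tendsto_simps1)
    qed
    show "(((\<lambda>u. - (complex_of_real u powr (- c)) / c) \<circ> real_of_ereal) \<longlongrightarrow> 0) (at_left \<infinity>)"
    proof -
      have "((\<lambda>u. u powr (- Re c) / norm c) \<longlongrightarrow> 0) at_top" using c c0 by real_asymp
      moreover have "eventually (\<lambda>u. norm (- (complex_of_real u powr (- c)) / c) = u powr (- Re c) / norm c) at_top"
        by (rule eventually_mono[OF eventually_gt_at_top[of 0]]) (simp add: norm_divide norm_powr_real_powr)
      ultimately have "((\<lambda>u. norm (- (complex_of_real u powr (- c)) / c)) \<longlongrightarrow> 0) at_top" by (subst tendsto_cong)
      hence "((\<lambda>u. - (complex_of_real u powr (- c)) / c) \<longlongrightarrow> 0) at_top" by (rule tendsto_norm_zero_cancel)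
      thus ?thesis by (simp add: ereal_tendsto_simps1)
    qed
  qed (auto simp: one_ereal_def)
  thus "(LINT u:{1<..}|lborel. of_real u powr (- c - 1)) = 1 / c"
    by (simp add: interval_lebesgue_integral_def ein)
qed

text \<open>The integral is split at 1, and u = 1/t maps (0, 1) to u > 1. The three terms of
  psi(1/u) = sqrt u psi(u) + sqrt u / 2 - 1/2 yield the reflected tail and the two elementary
  fractions, which carry the poles.\<close>

lemma psi_inversion:
  assumes z: "Re z > 1/2"
  shows "of_real pi powr (- z) * Gamma z * dirichlet_zeta (2 * z) = psi_tail z + psi_tail (1/2 - z) + 1 / (2 * z - 1) - 1 / (2 * z)"
proof -
  let ?f = "\<lambda>t. complex_of_real (psi t) * of_real t powr (z - 1)"
  have i0: "set_integrable lborel {0<..<1} ?f" by (rule set_integrable_subset[OF psi_mellin_integrable[OF z]]) auto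
  have i1: "set_integrable lborel {1<..} ?f" by (rule set_integrable_subset[OF psi_mellin_integrable[OF z]]) auto
  have "of_real pi powr (- z) * Gamma z * dirichlet_zeta (2 * z) = (LINT t:{0<..}|lborel. ?f t)"
    by (rule psi_mellin_integral[OF z, symmetric])
  also have "\<dots> = (LINT t:{0<..<1} \<union> {1<..}|lborel. ?f t)"
    by (rule set_integral_discrete_difference[where X = "{1}"]) auto
  also have "\<dots> = (LINT t:{0<..<1}|lborel. ?f t) + psi_tail z"
    unfolding psi_tail_def by (rule set_integral_Un[OF _ i0 i1]) auto
  also have "(LINT t:{0<..<1}|lborel. ?f t) = psi_tail (1/2 - z) + (1 / (2 * z - 1) - 1 / (2 * z))"
  proof -
    let ?g = "\<lambda>u. \<bar>- 1 / u\<^sup>2\<bar> *\<^sub>R ?f (1 / u)"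
    let ?k = "\<lambda>u. complex_of_real (psi u) * of_real u powr (1/2 - z - 1) + (1/2 * of_real u powr (- (z - 1/2) - 1) - 1/2 * of_real u powr (- z - 1))"
    have img: "(\<lambda>u. 1 / u) ` {1<..} = {0<..<1::real}"
    proof -
      have "x \<in> (\<lambda>u. 1 / u) ` {1<..}" if "0 < x" "x < 1" for x :: real
        using that by (intro image_eqI[of _ _ "1 / x"]) auto
      thus ?thesis by auto
    qed
    have ll: "?f absolutely_integrable_on {0<..<1}"
      using i0 unfolding set_integrable_def by (simp add: integrable_completion borel_measurable_integrable)
    have S: "{1<..} \<in> sets (lebesgue :: real measure)" by simp
    have dg: "((\<lambda>u. 1 / u) has_field_derivative - 1 / u\<^sup>2) (at u within {1<..})" if "u \<in> {1<..}" for u :: real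
      using that by (auto intro!: derivative_eq_intros simp: power2_eq_square)
    have ig: "inj_on (\<lambda>u. 1 / u) {1::real<..}" by (auto intro!: inj_onI)
    have "?g absolutely_integrable_on {1<..} \<and> integral {1<..} ?g = integral {0<..<1} ?f"
      using has_absolute_integral_change_of_variables_real[OF S dg ig, of ?f "integral {0<..<1} ?f"] ll
      unfolding img by blast
    hence I: "integral {1<..} ?g = integral {0<..<1} ?f" by simp
    have k: "?g u = ?k u" if u: "u \<in> {1<..}" for u
    proof -
      have u0: "u > 0" "u > 1" using u by auto
      have "1 + 2 * psi (1 / u) = sqrt u * (1 + 2 * psi u)"
        using psi_transform[of "1 / u"] u0 by (simp add: real_sqrt_divide)
      hence ps: "psi (1 / u) = sqrt u * psi u + 1/2 * sqrt u - 1/2" by (simp add: algebra_simps)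
      have p1: "complex_of_real (1 / u) powr (z - 1) = of_real u powr (- (z - 1))"
        using u0 Ln_of_real[of u] Ln_of_real[of "1 / u"] by (simp add: powr_def ln_div) (simp add: algebra_simps)
      have p2: "complex_of_real (1 / u\<^sup>2) = of_real u powr (- 2)"
        using u0 by (simp add: powr_minus powr_numeral field_simps)
      have p3: "complex_of_real (sqrt u) = of_real u powr (1/2)"
        using u0 by (simp add: powr_half_sqrt[symmetric] powr_of_real[symmetric])
      let ?U = "complex_of_real u"
      have "?g u = ?U powr (- 2) * (of_real (psi (1 / u)) * ?U powr (- (z - 1)))"
        unfolding p1 p2[symmetric] by (simp add: scaleR_conv_of_real abs_divide)
      also have "\<dots> = of_real (psi u) * (?U powr (- 2) * (?U powr (1/2) * ?U powr (- (z - 1)))) + 1/2 * (?U powr (- 2) * (?U powr (1/2) * ?U powr (- (z - 1)))) - 1/2 * (?U powr (- 2) * ?U powr (- (z - 1)))"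
        unfolding ps of_real_diff of_real_add of_real_mult p3 by (simp add: algebra_simps)
      also have "?U powr (- 2) * (?U powr (1/2) * ?U powr (- (z - 1))) = ?U powr (1/2 - z - 1)"
        unfolding powr_add[symmetric] by (rule arg_cong[where f = "\<lambda>c. ?U powr c"]) simp
      also have "?U powr (- 2) * ?U powr (- (z - 1)) = ?U powr (- z - 1)"
        unfolding powr_add[symmetric] by (rule arg_cong[where f = "\<lambda>c. ?U powr c"]) simp
      also have "1/2 - z - 1 = - (z - 1/2) - 1" by simp
      finally show ?thesis by simp
    qed
    have z1: "Re (z - 1/2) > 0" "Re z > 0" using z by auto
    have j1: "set_integrable lborel {1<..} (\<lambda>u. complex_of_real (psi u) * of_real u powr (1/2 - z - 1))" by (rule psi_tail_integrable)
    have j2: "set_integrable lborel {1<..} (\<lambda>u. 1/2 * complex_of_real u powr (- (z - 1/2) - 1))"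
      by (intro set_integrable_mult_right powr_tail_integrable z1)
    have j3: "set_integrable lborel {1<..} (\<lambda>u. 1/2 * complex_of_real u powr (- z - 1))"
      by (intro set_integrable_mult_right powr_tail_integrable z1)
    have jk: "set_integrable lborel {1<..} ?k" by (intro set_integral_add(1) set_integral_diff(1) j1 j2 j3)
    have "(LINT t:{0<..<1}|lborel. ?f t) = integral {0<..<1} ?f" by (rule set_borel_integral_eq_integral(2)[OF i0])
    also have "\<dots> = integral {1<..} ?k" unfolding I[symmetric] by (rule integral_cong[OF k])
    also have "\<dots> = (LINT u:{1<..}|lborel. ?k u)" by (rule set_borel_integral_eq_integral(2)[OF jk, symmetric])
    also have "\<dots> = psi_tail (1/2 - z) + (1/2 * (1 / (z - 1/2)) - 1/2 * (1 / z))"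
      unfolding set_integral_add(2)[OF j1 set_integral_diff(1)[OF j2 j3]] set_integral_diff(2)[OF j2 j3] set_integral_mult_right powr_tail_integral[OF z1(1)] powr_tail_integral[OF z1(2)] psi_tail_def ..
    also have "1/2 * (1 / (z - 1/2)) = 1 / (2 * z - 1)" by (simp add: field_simps)
    also have "1/2 * (1 / z) = 1 / (2 * z)" by simp
    finally show ?thesis .
  qed
  finally show ?thesis by simp
qed

section \<open>Continuation and functional equation of zeta\<close>

definition zeta_Lambda :: "complex \<Rightarrow> complex" where
  "zeta_Lambda s = psi_tail (s / 2) + psi_tail ((1 - s) / 2) - 1 / s - 1 / (1 - s)"

text \<open>\<open>zeta_Lambda\<close> freed from its Gamma and \<pi> factors, with the fraction 1/s
  already absorbed into the reciprocal Gamma function; thus the expression is holomorphic at 0 as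
  well.\<close>

definition zeta_cont :: "complex \<Rightarrow> complex" where
  "zeta_cont s = of_real pi powr (s / 2) * ((psi_tail (s / 2) + psi_tail ((1 - s) / 2) - 1 / (1 - s)) * rGamma (s / 2) - rGamma (s / 2 + 1) / 2)"

lemma zeta_Lambda_reflect: "zeta_Lambda (1 - s) = zeta_Lambda s"
  by (simp add: zeta_Lambda_def)

lemma zeta_Lambda_dirichlet:
  assumes "Re s > 1"
  shows "zeta_Lambda s = of_real pi powr (- s / 2) * Gamma (s / 2) * dirichlet_zeta s"
proof -
  have e: "1/2 - s / 2 = (1 - s) / 2" by (simp add: field_simps)
  have s1: "s - 1 = - (1 - s)" by simp
  have "of_real pi powr (- (s / 2)) * Gamma (s / 2) * dirichlet_zeta (2 * (s / 2)) = psi_tail (s / 2) + psi_tail (1/2 - s / 2) + 1 / (2 * (s / 2) - 1) - 1 / (2 * (s / 2))"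
    by (rule psi_inversion) (use assms in simp)
  thus ?thesis unfolding zeta_Lambda_def e by (simp add: s1 del: minus_diff_eq)
qed

lemma zeta_cont_eq:
  assumes "s \<noteq> 0"
  shows "zeta_cont s = of_real pi powr (s / 2) * rGamma (s / 2) * zeta_Lambda s"
proof -
  have "rGamma (s / 2) = s / 2 * rGamma (s / 2 + 1)" by (simp add: rGamma_plus1)
  hence "rGamma (s / 2 + 1) / 2 = rGamma (s / 2) * (1 / s)" using assms by (simp add: field_simps)
  thus ?thesis unfolding zeta_cont_def zeta_Lambda_def by (simp add: algebra_simps)
qed

lemma zeta_cont_holomorphic: "zeta_cont holomorphic_on (- {1})"
proof -
  have t1: "(\<lambda>s. psi_tail (s / 2)) holomorphic_on (- {1})"
    using holomorphic_on_compose[OF _ psi_tail_holomorphic, of "\<lambda>s. s / 2" "- {1}"] by (simp add: o_def holomorphic_intros)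
  have t2: "(\<lambda>s. psi_tail ((1 - s) / 2)) holomorphic_on (- {1})"
    using holomorphic_on_compose[OF _ psi_tail_holomorphic, of "\<lambda>s. (1 - s) / 2" "- {1}"] by (simp add: o_def holomorphic_intros)
  have p: "(\<lambda>s. exp (s / 2 * of_real (ln pi))) holomorphic_on (- {1})" by (intro holomorphic_intros) auto
  have pe: "(\<lambda>s. complex_of_real pi powr (s / 2)) = (\<lambda>s. exp (s / 2 * of_real (ln pi)))"
    using Ln_of_real[of pi] by (simp add: powr_def fun_eq_iff)
  show ?thesis unfolding zeta_cont_def[abs_def]
    by (intro holomorphic_on_mult holomorphic_on_diff holomorphic_on_add holomorphic_on_divide t1 t2 p[folded pe] holomorphic_on_const holomorphic_on_id holomorphic_rGamma' holomorphic_on_ident) auto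
qed

lemma zeta_cont_dirichlet:
  assumes s: "Re s > 1"
  shows "zeta_cont s = dirichlet_zeta s"
proof -
  have s0: "s \<noteq> 0" using s by auto
  have "rGamma (s / 2) * Gamma (s / 2) = 1" using Gamma_nonzero_Re[of "s / 2"] s by (simp add: rGamma_inverse_Gamma)
  moreover have "of_real pi powr (s / 2) * of_real pi powr (- s / 2) = (1::complex)"
    by (simp add: powr_add[symmetric])
  moreover have "zeta_cont s = (of_real pi powr (s / 2) * of_real pi powr (- s / 2)) * (rGamma (s / 2) * Gamma (s / 2)) * dirichlet_zeta s"
    unfolding zeta_cont_eq[OF s0] zeta_Lambda_dirichlet[OF s] by (simp only: mult_ac)
  ultimately show ?thesis by simp
qed

text \<open>Since \<open>riemann_zeta\<close> is a choice, its properties hold only once a candidate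
  exists; \<open>zeta_cont\<close> is one.\<close>

lemma riemann_zeta_spec: "riemann_zeta holomorphic_on (- {1}) \<and> (\<forall>s. Re s > 1 \<longrightarrow> (\<lambda>n. of_nat (Suc n) powr (- s)) sums riemann_zeta s)"
  unfolding riemann_zeta_def
proof (rule someI[of "\<lambda>f. f holomorphic_on (- {1}) \<and> (\<forall>s. Re s > 1 \<longrightarrow> (\<lambda>n. of_nat (Suc n) powr (- s)) sums f s)" zeta_cont])
  show "zeta_cont holomorphic_on (- {1}) \<and> (\<forall>s. Re s > 1 \<longrightarrow> (\<lambda>n. of_nat (Suc n) powr (- s)) sums zeta_cont s)"
    using zeta_cont_holomorphic zeta_cont_dirichlet dirichlet_zeta_sums by simp
qed

lemma riemann_zeta_eq:
  assumes "s \<noteq> 1"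
  shows "riemann_zeta s = zeta_cont s"
proof (rule analytic_continuation_open[of "{s. Re s > 1}" "- {1}" riemann_zeta zeta_cont])
  show "connected (- {1::complex})" by (rule connected_punctured_universe) simp
  have "2 \<in> {s. Re s > 1}" by simp
  thus "{s. Re s > 1} \<noteq> {}" by blast
  show "riemann_zeta z = zeta_cont z" if "z \<in> {s. Re s > 1}" for z
  proof -
    have z: "Re z > 1" using that by simp
    hence "(\<lambda>n. of_nat (Suc n) powr (- z)) sums riemann_zeta z" using riemann_zeta_spec by blast
    from sums_unique2[OF this dirichlet_zeta_sums[OF z]] show ?thesis by (simp add: zeta_cont_dirichlet[OF z])
  qed
qed (use assms riemann_zeta_spec zeta_cont_holomorphic in \<open>auto simp: open_halfspace_Re_gt\<close>)

text \<open>In a punctured neighbourhood of z no pole of Gamma occurs, so the product there is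
  \<open>zeta_Lambda\<close>, which is continuous at z. The limit taken by
  \<open>remove_sings\<close> is therefore its value, also at the negative even integers.\<close>

theorem completed_zeta_eq:
  assumes z: "z \<noteq> 0" "z \<noteq> 1"
  shows "completed_zeta z = zeta_Lambda z"
  unfolding completed_zeta_def
proof (rule remove_sings_eqI, rule Lim_transform_eventually)
  have "isCont zeta_Lambda z"
  proof -
    have t1: "(\<lambda>s. psi_tail (s / 2)) holomorphic_on UNIV"
      using holomorphic_on_compose[OF _ psi_tail_holomorphic, of "\<lambda>s. s / 2" UNIV] by (simp add: o_def holomorphic_intros)
    have t2: "(\<lambda>s. psi_tail ((1 - s) / 2)) holomorphic_on UNIV"
      using holomorphic_on_compose[OF _ psi_tail_holomorphic, of "\<lambda>s. (1 - s) / 2" UNIV] by (simp add: o_def holomorphic_intros)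
    have "isCont (\<lambda>s. psi_tail (s / 2)) z" "isCont (\<lambda>s. psi_tail ((1 - s) / 2)) z"
      using holomorphic_on_imp_continuous_on[OF t1] holomorphic_on_imp_continuous_on[OF t2] by (auto simp: continuous_on_eq_continuous_at)
    thus ?thesis unfolding zeta_Lambda_def[abs_def] using z by (intro continuous_intros) auto
  qed
  thus "(zeta_Lambda \<longlongrightarrow> zeta_Lambda z) (at z)" by (simp add: isCont_def)
  have "eventually (\<lambda>w. w / 2 \<notin> \<int>\<^sub>\<le>\<^sub>0) (at z)"
  proof -
    \<comment> \<open>Distinct even integers are at distance at least 2, so the poles of Gamma(w/2)
      do not accumulate at z.\<close>
    have "\<not> z islimpt ((\<lambda>n. 2 * n) ` \<int>\<^sub>\<le>\<^sub>0)"
    proof (rule discrete_imp_not_islimpt[of 1])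
      fix x y :: complex assume xy: "x \<in> (\<lambda>n. 2 * n) ` \<int>\<^sub>\<le>\<^sub>0" "y \<in> (\<lambda>n. 2 * n) ` \<int>\<^sub>\<le>\<^sub>0" "dist y x < 1"
      then obtain m n :: int where mn: "x = 2 * of_int m" "y = 2 * of_int n" by (auto elim!: nonpos_Ints_cases)
      have "dist y x = norm (of_int (2 * n - 2 * m) :: complex)" by (simp add: mn dist_norm)
      also have "\<dots> = \<bar>of_int (2 * n - 2 * m)\<bar>" by (rule norm_of_int)
      finally have "\<bar>2 * n - 2 * m\<bar> < 1" using xy(3) by linarith
      hence "n = m" by linarith
      thus "y = x" by (simp add: mn)
    qed simp
    hence "eventually (\<lambda>w. w \<notin> (\<lambda>n. 2 * n) ` \<int>\<^sub>\<le>\<^sub>0) (at z)" by (simp add: islimpt_iff_eventually)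
    thus ?thesis by eventually_elim (auto simp: image_iff)
  qed
  moreover have "eventually (\<lambda>w. w \<noteq> 0) (at z)" "eventually (\<lambda>w. w \<noteq> 1) (at z)"
    by (rule eventually_neq_at_within)+
  ultimately show "eventually (\<lambda>w. zeta_Lambda w = of_real pi powr (- w / 2) * Gamma (w / 2) * riemann_zeta w) (at z)"
  proof eventually_elim
    case (elim w)
    have "Gamma (w / 2) * rGamma (w / 2) = 1" using elim(1) by (simp add: rGamma_inverse_Gamma Gamma_eq_zero_iff)
    moreover have "of_real pi powr (- w / 2) * of_real pi powr (w / 2) = (1::complex)" by (simp add: powr_add[symmetric])
    moreover have "of_real pi powr (- w / 2) * Gamma (w / 2) * riemann_zeta w = (of_real pi powr (- w / 2) * of_real pi powr (w / 2)) * (Gamma (w / 2) * rGamma (w / 2)) * zeta_Lambda w"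
      unfolding riemann_zeta_eq[OF elim(3)] zeta_cont_eq[OF elim(2)] by (simp only: mult_ac)
    ultimately show ?case by simp
  qed
qed

text \<open>The second equation is the functional equation in the form that the term n = 0 needs: a
  convergent series evaluates the completed zeta function to the left of the critical strip.\<close>

lemma completed_zeta_dirichlet:
  assumes "Re s > 1"
  shows "completed_zeta s = of_real pi powr (- s / 2) * Gamma (s / 2) * dirichlet_zeta s"
    and "completed_zeta (1 - s) = of_real pi powr (- s / 2) * Gamma (s / 2) * dirichlet_zeta s"
proof -
  have "s \<noteq> 0" "s \<noteq> 1" using assms by auto
  thus "completed_zeta s = of_real pi powr (- s / 2) * Gamma (s / 2) * dirichlet_zeta s"
    "completed_zeta (1 - s) = of_real pi powr (- s / 2) * Gamma (s / 2) * dirichlet_zeta s"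
    using completed_zeta_eq[of s] completed_zeta_eq[of "1 - s"] zeta_Lambda_reflect zeta_Lambda_dirichlet[OF assms] by auto
qed

section \<open>Lattice and divisor sums\<close>

lemma prod_of_bool:
  assumes "finite X"
  shows "(\<Prod>p\<in>X. of_bool (Q p) :: complex) = of_bool (\<forall>p\<in>X. Q p)"
  using assms by (induction rule: finite_induct) auto

lemma has_sum_finite_sum':
  fixes f :: "'i \<Rightarrow> 'a \<Rightarrow> complex"
  assumes "finite I" "\<And>i. i \<in> I \<Longrightarrow> (f i has_sum s i) A"
  shows "((\<lambda>x. \<Sum>i\<in>I. f i x) has_sum (\<Sum>i\<in>I. s i)) A"
  using assms by (induction rule: finite_induct) (auto intro!: has_sum_add)

lemma norm_summable_subset:
  fixes f :: "'i \<Rightarrow> complex"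
  assumes "(\<lambda>i. norm (f i)) summable_on A" "B \<subseteq> A"
  shows "f summable_on B"
  using assms summable_on_subset_banach[OF assms] abs_summable_summable by blast

lemma norm_summable_le:
  fixes f :: "'i \<Rightarrow> complex"
  assumes "g summable_on A" "\<And>x. x \<in> A \<Longrightarrow> norm (f x) \<le> g x"
  shows "(\<lambda>x. norm (f x)) summable_on A"
  by (rule summable_on_comparison_test[OF assms]) auto

text \<open>Expanding the product over subsets X of P leaves, for each X, a sum over the indices
  divisible by all of X. The weights are free because several pairs (\<beta>, \<alpha>) occur: (-1,
  1) is the indicator of coprimality, and (1, -p^(-2\<sigma>)) arises from the left lattice.\<close>

lemma weight_expand:
  fixes f :: "'i \<Rightarrow> complex" and \<alpha> \<beta> :: "nat \<Rightarrow> complex" and D :: "nat \<Rightarrow> 'i \<Rightarrow> bool"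
  assumes f: "(\<lambda>i. norm (f i)) summable_on S" and P: "finite P"
  shows "((\<lambda>c. f c * (\<Prod>p\<in>P. \<beta> p * of_bool (D p c) + \<alpha> p)) has_sum
    (\<Sum>X\<in>Pow P. (\<Prod>p\<in>X. \<beta> p) * (\<Prod>p\<in>P-X. \<alpha> p) * infsum f {c\<in>S. \<forall>p\<in>X. D p c})) S"
proof -
  have "f c * (\<Prod>p\<in>P. \<beta> p * of_bool (D p c) + \<alpha> p) =
      (\<Sum>X\<in>Pow P. ((\<Prod>p\<in>X. \<beta> p) * (\<Prod>p\<in>P-X. \<alpha> p)) * (f c * of_bool (\<forall>p\<in>X. D p c)))" for c
  proof -
    have "(\<Prod>p\<in>P. \<beta> p * of_bool (D p c) + \<alpha> p) = (\<Sum>X\<in>Pow P. (\<Prod>p\<in>X. \<beta> p * of_bool (D p c)) * (\<Prod>p\<in>P-X. \<alpha> p))"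
      by (rule prod_add[OF P])
    also have "\<dots> = (\<Sum>X\<in>Pow P. (\<Prod>p\<in>X. \<beta> p) * (\<Prod>p\<in>P-X. \<alpha> p) * of_bool (\<forall>p\<in>X. D p c))"
    proof (rule sum.cong[OF refl])
      fix X assume "X \<in> Pow P"
      hence "finite X" using P finite_subset by auto
      thus "(\<Prod>p\<in>X. \<beta> p * of_bool (D p c)) * (\<Prod>p\<in>P-X. \<alpha> p) = (\<Prod>p\<in>X. \<beta> p) * (\<Prod>p\<in>P-X. \<alpha> p) * of_bool (\<forall>p\<in>X. D p c)"
        by (simp add: prod.distrib prod_of_bool)
    qed
    finally show ?thesis by (simp add: sum_distrib_left mult_ac)
  qed
  note e = this
  have "((\<lambda>c. f c * of_bool (\<forall>p\<in>X. D p c)) has_sum infsum f {c\<in>S. \<forall>p\<in>X. D p c}) S" for X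
  proof -
    have "(f has_sum infsum f {c\<in>S. \<forall>p\<in>X. D p c}) {c\<in>S. \<forall>p\<in>X. D p c}"
      by (rule has_sum_infsum, rule norm_summable_subset[OF f]) auto
    thus ?thesis by (rule has_sum_cong_neutral[THEN iffD1, rotated -1]) auto
  qed
  thus ?thesis unfolding e
    by (intro has_sum_finite_sum' has_sum_cmult_right) (use P in auto)
qed

lemma prime_set_prod_dvd:
  assumes "finite X" "\<And>p. p \<in> X \<Longrightarrow> prime (p :: nat)"
  shows "(\<forall>p\<in>X. p dvd n) \<longleftrightarrow> \<Prod>X dvd (n :: nat)"
  using assms
proof (induction rule: finite_induct)
  case (insert p F)
  have "coprime p (\<Prod>F)"
    by (rule prod_coprime_right) (use insert in \<open>auto intro!: primes_coprime\<close>)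
  thus ?case using insert by (auto intro: divides_mult dest: dvd_mult_left dvd_mult_right)
qed simp

lemma nat_powr_mult: "of_nat (a * b) powr (w :: complex) = of_nat a powr w * of_nat b powr w"
proof -
  have "(of_nat a * of_nat b :: complex) powr w = of_nat a powr w * of_nat b powr w"
    by (rule powr_times_real) simp_all
  thus ?thesis by simp
qed

lemma nat_powr_prod: "finite X \<Longrightarrow> of_nat (\<Prod>X) powr (w :: complex) = (\<Prod>p\<in>X. of_nat p powr w)"
  by (induction rule: finite_induct) (simp_all add: nat_powr_mult del: of_nat_mult of_nat_prod)

lemma nat_powr_norm_summable:
  assumes "Re w < -1"
  shows "(\<lambda>n. norm (of_nat n powr w :: complex)) summable_on {1..}"
proof -
  have bij: "bij_betw Suc UNIV {1..}" by (rule bij_betwI[where g = "\<lambda>n. n - 1"]) auto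
  have "(\<lambda>n. norm (of_nat (Suc n) powr (- (- w)) :: complex)) summable_on UNIV"
    by (rule norm_summable_imp_summable_on) (use zeta_norm_summable[of "- w"] assms in simp)
  thus ?thesis using summable_on_reindex_bij_betw[OF bij, of "\<lambda>n. norm (of_nat n powr w :: complex)"] by simp
qed

lemma dirichlet_zeta_infsum:
  assumes "Re w < -1"
  shows "(\<Sum>\<^sub>\<infinity>n\<in>{1..}. of_nat n powr w) = dirichlet_zeta (- w)"
proof -
  have bij: "bij_betw Suc UNIV {1..}" by (rule bij_betwI[where g = "\<lambda>n. n - 1"]) auto
  have "((\<lambda>n. of_nat (Suc n) powr (- (- w))) has_sum dirichlet_zeta (- w)) UNIV"
    by (rule norm_summable_imp_has_sum) (use zeta_norm_summable[of "- w"] dirichlet_zeta_sums[of "- w"] assms in simp_all)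
  thus ?thesis using has_sum_reindex_bij_betw[OF bij, of "\<lambda>n. of_nat n powr w"] by (simp add: infsumI)
qed

lemma multiples_reindex:
  assumes "finite X" "\<And>p. p \<in> X \<Longrightarrow> prime (p :: nat)"
  shows "infsum f {c\<in>{1..}. \<forall>p\<in>X. p dvd c} = (\<Sum>\<^sub>\<infinity>m\<in>{1..}. f (\<Prod>X * m))"
proof -
  have pos: "\<Prod>X > 0" using assms by (auto intro!: prod_pos prime_gt_0_nat)
  have dv: "(\<forall>p\<in>X. p dvd c) = (\<Prod>X dvd c)" for c by (rule prime_set_prod_dvd) (use assms in auto)
  have "bij_betw (\<lambda>m. \<Prod>X * m) {1..} {c\<in>{1..}. \<forall>p\<in>X. p dvd c}"
    unfolding dv
  proof (rule bij_betwI[where g = "\<lambda>c. c div \<Prod>X"])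
    show "(\<lambda>c. c div \<Prod>X) \<in> {c\<in>{1..}. \<Prod>X dvd c} \<rightarrow> {1..}"
      using pos by (auto simp: Suc_le_eq div_greater_zero_iff dvd_imp_le)
  qed (use pos in \<open>auto simp: Suc_le_eq\<close>)
  thus ?thesis by (rule infsum_reindex_bij_betw[symmetric])
qed

text \<open>An Euler product computation: passing to the multiples of a product of primes scales the
  Dirichlet series by the power w of that product, so that each indicator of p | c is replaced by
  p^w.\<close>

lemma zeta_weight:
  assumes w: "Re w < -1" and P: "finite P" "\<And>p. p \<in> P \<Longrightarrow> prime (p :: nat)"
  shows "((\<lambda>c. of_nat c powr w * (\<Prod>p\<in>P. \<beta> p * of_bool (p dvd c) + \<alpha> p)) has_sum
    dirichlet_zeta (- w) * (\<Prod>p\<in>P. \<beta> p * of_nat p powr w + \<alpha> p)) {1..}"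
proof -
  have "infsum (\<lambda>c. of_nat c powr w) {c\<in>{1..}. \<forall>p\<in>X. p dvd c} = dirichlet_zeta (- w) * (\<Prod>p\<in>X. of_nat p powr w)" if "X \<in> Pow P" for X
  proof -
    have X: "finite X" "\<And>p. p \<in> X \<Longrightarrow> prime p" using that P finite_subset by auto
    have "infsum (\<lambda>c. of_nat c powr w) {c\<in>{1..}. \<forall>p\<in>X. p dvd c} = (\<Sum>\<^sub>\<infinity>m\<in>{1..}. of_nat (\<Prod>X) powr w * of_nat m powr w)"
      using multiples_reindex[OF X, of "\<lambda>c. of_nat c powr w :: complex"] unfolding nat_powr_mult .
    also have "\<dots> = of_nat (\<Prod>X) powr w * dirichlet_zeta (- w)"
      unfolding dirichlet_zeta_infsum[OF w, symmetric]
      by (rule infsum_cmult_right) (use norm_summable_subset[OF nat_powr_norm_summable[OF w] order_refl] in simp)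
    finally show ?thesis unfolding nat_powr_prod[OF X(1)] by (simp only: mult.commute)
  qed
  hence "(\<Sum>X\<in>Pow P. (\<Prod>p\<in>X. \<beta> p) * (\<Prod>p\<in>P-X. \<alpha> p) * infsum (\<lambda>c. of_nat c powr w) {c\<in>{1..}. \<forall>p\<in>X. p dvd c}) =
     (\<Sum>X\<in>Pow P. dirichlet_zeta (- w) * ((\<Prod>p\<in>X. \<beta> p * of_nat p powr w) * (\<Prod>p\<in>P-X. \<alpha> p)))"
    by (intro sum.cong refl) (simp add: prod.distrib mult_ac)
  also have "\<dots> = dirichlet_zeta (- w) * (\<Prod>p\<in>P. \<beta> p * of_nat p powr w + \<alpha> p)"
    unfolding prod_add[OF P(1)] sum_distrib_left ..
  finally show ?thesis using weight_expand[OF nat_powr_norm_summable[OF w] P(1), of \<beta> "\<lambda>p c. p dvd c" \<alpha>] by simp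
qed

section \<open>Coprimality conditions on lattice points\<close>

lemma coprime_prime_factors:
  fixes n :: int and N :: nat
  assumes "N > 0"
  shows "coprime n (int N) \<longleftrightarrow> (\<forall>p\<in>prime_factors N. \<not> int p dvd n)"
proof
  assume c: "coprime n (int N)"
  show "\<forall>p\<in>prime_factors N. \<not> int p dvd n"
  proof (intro ballI notI)
    fix p assume p: "p \<in> prime_factors N" "int p dvd n"
    hence "int p dvd int N" by auto
    hence "int p dvd 1" using c p by (meson coprime_common_divisor)
    hence "p = 1" by simp
    thus False using p in_prime_factors_imp_prime not_prime_1 by metis
  qed
next
  assume a: "\<forall>p\<in>prime_factors N. \<not> int p dvd n"
  show "coprime n (int N)"
  proof (rule ccontr)
    assume "\<not> coprime n (int N)"
    hence "\<not> coprime (nat \<bar>n\<bar>) N" by simp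
    hence "gcd (nat \<bar>n\<bar>) N \<noteq> 1" unfolding coprime_iff_gcd_eq_1 .
    then obtain p where pp: "prime p" "p dvd gcd (nat \<bar>n\<bar>) N" using prime_factor_nat[of "gcd (nat \<bar>n\<bar>) N"] by metis
    have p: "prime p" "p dvd nat \<bar>n\<bar>" "p dvd N" using pp by (simp_all only: gcd_greatest_iff)
    have "int p dvd n" using p(2) by simp
    moreover have "p \<in> prime_factors N" using p assms by (simp add: prime_factors_dvd)
    ultimately show False using a by blast
  qed
qed

lemma coprime_weight:
  assumes "N > 0"
  shows "(\<Prod>p\<in>prime_factors N. (-1) * of_bool (int p dvd n) + 1) = (of_bool (coprime n (int N)) :: complex)"
proof -
  have "(\<Prod>p\<in>prime_factors N. (-1) * of_bool (int p dvd n) + 1) = (\<Prod>p\<in>prime_factors N. of_bool (\<not> int p dvd n) :: complex)"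
    by (intro prod.cong) auto
  thus ?thesis unfolding coprime_prime_factors[OF assms] by (simp add: prod_of_bool)
qed

text \<open>After division by t the gcd condition says that N c and d are coprime, and this splits
  into two conditions on d.\<close>

lemma lattice_L_iff:
  "(m, n) \<in> lattice_L N \<longleftrightarrow> (\<exists>t c d. t \<ge> 1 \<and> m = t * c \<and> n = t * d \<and> coprime c d \<and> coprime d (int N))"
proof
  assume "(m, n) \<in> lattice_L N"
  then obtain t where t: "t \<ge> 1" "t dvd m" "t dvd n" "gcd (int N * m) n = t" by (auto simp: lattice_L_def)
  obtain c where c: "m = t * c" using t(2) by (rule dvdE)
  obtain d where d: "n = t * d" using t(3) by (rule dvdE)
  note cd = c d
  have "gcd (t * (int N * c)) (t * d) = t" using t(4) unfolding cd by (simp only: mult.left_commute)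
  hence "\<bar>t\<bar> * gcd (int N * c) d = t" by (simp only: gcd_mult_distrib_int)
  hence "t * gcd (int N * c) d = t * 1" using t(1) by simp
  hence "gcd (int N * c) d = 1" using t(1) by simp
  hence "coprime (int N * c) d" by (simp add: coprime_iff_gcd_eq_1)
  hence "coprime c d" "coprime d (int N)" by (simp_all add: coprime_commute)
  thus "\<exists>t c d. t \<ge> 1 \<and> m = t * c \<and> n = t * d \<and> coprime c d \<and> coprime d (int N)"
    using t(1) cd by blast
next
  assume "\<exists>t c d. t \<ge> 1 \<and> m = t * c \<and> n = t * d \<and> coprime c d \<and> coprime d (int N)"
  then obtain t c d where t: "t \<ge> 1" "m = t * c" "n = t * d" "coprime c d" "coprime d (int N)" by blast
  hence "coprime (int N * c) d" by (auto simp: coprime_commute)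
  hence "gcd (t * (int N * c)) (t * d) = t" using t(1) by (simp add: gcd_mult_distrib_int[symmetric] del: coprime_mult_left_iff)
  hence "gcd (int N * m) n = t" unfolding t by (simp add: mult.left_commute)
  thus "(m, n) \<in> lattice_L N" using t by (auto simp: lattice_L_def)
qed

lemma lattice_R_iff: "(m, n) \<in> lattice_R N \<longleftrightarrow> (n, m) \<in> lattice_L N"
  unfolding lattice_L_def lattice_R_def by (auto simp: gcd.commute)

text \<open>Let B be the coprime pairs (c, d) with d prime to N. Multiplying B by all t >= 1 gives
  the lattice; multiplying by the t prime to N gives all pairs with second coordinate prime to N, t
  being the gcd. By homogeneity the two sums are the sum over B times the full Dirichlet series, or
  times the one without Euler factors at N, and these differ by the product over p.\<close>

lemma lattice_scaling:
  fixes F :: "int \<times> int \<Rightarrow> complex"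
  assumes F: "(\<lambda>p. norm (F p)) summable_on UNIV"
    and hom: "\<And>t m n. t \<ge> 1 \<Longrightarrow> F (int t * m, int t * n) = of_nat t powr w * F (m, n)"
    and w: "Re w < -1" and N: "N > 1"
  shows "infsum F (lattice_L N) * (\<Prod>p\<in>prime_factors N. 1 - of_nat p powr w) = infsum F {(m :: int, n). coprime n (int N)}"
proof -
  define B where "B = {(c :: int, d). coprime c d \<and> coprime d (int N)}"
  define \<phi> where "\<phi> = (\<lambda>(t :: nat, (c :: int, d :: int)). (int t * c, int t * d))"
  have inj: "inj_on \<phi> ({1..} \<times> B)"
  proof (rule inj_onI)
    fix u v assume u: "u \<in> {1..} \<times> B" and v: "v \<in> {1..} \<times> B" and e: "\<phi> u = \<phi> v"
    obtain t c d where uu: "u = (t, (c, d))" by (cases u) auto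
    obtain t' c' d' where vv: "v = (t', (c', d'))" by (cases v) auto
    have g: "gcd (int t * c) (int t * d) = int t" if "coprime c d" for t c d
      using that by (simp add: gcd_mult_distrib_int[symmetric])
    have "int t = int t'" using e u v g[of c d t] g[of c' d' t'] by (simp add: uu vv \<phi>_def B_def)
    thus "u = v" using e u by (simp add: uu vv \<phi>_def)
  qed
  have img: "\<phi> ` ({1..} \<times> B) = lattice_L N"
  proof (intro equalityI subsetI)
    fix x assume "x \<in> \<phi> ` ({1..} \<times> B)"
    then obtain t c d where "t \<ge> 1" "(c, d) \<in> B" "x = (int t * c, int t * d)" by (auto simp: \<phi>_def)
    moreover have "int t \<ge> 1" using \<open>t \<ge> 1\<close> by simp
    ultimately show "x \<in> lattice_L N" unfolding B_def by (auto simp only: lattice_L_iff mem_Collect_eq prod.case)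
  next
    fix x assume x: "x \<in> lattice_L N"
    obtain m n where mn: "x = (m, n)" by (cases x)
    obtain t c d where t: "t \<ge> 1" "m = t * c" "n = t * d" "coprime c d" "coprime d (int N)"
      using x unfolding mn lattice_L_iff by blast
    have "x = \<phi> (nat t, (c, d))" using t by (simp add: mn \<phi>_def)
    moreover have "(nat t, (c, d)) \<in> {1..} \<times> B" using t by (auto simp: B_def)
    ultimately show "x \<in> \<phi> ` ({1..} \<times> B)" by blast
  qed
  have img2: "\<phi> ` ({t\<in>{1..}. coprime (int t) (int N)} \<times> B) = {(m :: int, n). coprime n (int N)}"
  proof (intro equalityI subsetI)
    fix x assume "x \<in> \<phi> ` ({t\<in>{1..}. coprime (int t) (int N)} \<times> B)"
    thus "x \<in> {(m :: int, n). coprime n (int N)}" by (auto simp: \<phi>_def B_def)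
  next
    fix x assume "x \<in> {(m :: int, n). coprime n (int N)}"
    then obtain m n :: int where mn: "x = (m, n)" "coprime n (int N)" by (cases x) auto
    have n0: "n \<noteq> 0" using mn(2) N by auto
    define t where "t = gcd m n"
    have t1: "t \<ge> 1" using n0 by (simp add: t_def int_one_le_iff_zero_less)
    have "t dvd m" "t dvd n" by (simp_all add: t_def)
    then obtain c d where cd: "m = t * c" "n = t * d" by (elim dvdE) blast
    have "\<bar>t\<bar> * gcd c d = t" using t_def unfolding gcd_mult_distrib_int cd[symmetric] by simp
    hence "t * gcd c d = t * 1" using t1 by simp
    hence "coprime c d" using t1 by (simp add: coprime_iff_gcd_eq_1)
    moreover have "coprime t (int N)" "coprime d (int N)" using mn(2) unfolding cd by auto
    moreover have "x = \<phi> (nat t, (c, d))" using t1 cd by (simp add: mn \<phi>_def)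
    ultimately show "x \<in> \<phi> ` ({t\<in>{1..}. coprime (int t) (int N)} \<times> B)"
      using t1 by (intro image_eqI[of _ _ "(nat t, (c, d))"]) (auto simp: B_def simp flip: coprime_int_iff)
  qed
  have main: "infsum F (\<phi> ` (T \<times> B)) = infsum (\<lambda>t. of_nat t powr w) T * infsum F B" if T: "T \<subseteq> {1..}" for T
  proof -
    have i: "inj_on \<phi> (T \<times> B)" using inj T by (auto intro: inj_on_subset)
    have sB: "F summable_on B" by (rule norm_summable_subset[OF F]) auto
    have "F summable_on (\<phi> ` (T \<times> B))" by (rule norm_summable_subset[OF F]) auto
    hence s: "(\<lambda>u. F (\<phi> u)) summable_on (T \<times> B)" using i by (simp add: summable_on_reindex o_def)
    have "infsum F (\<phi> ` (T \<times> B)) = infsum (\<lambda>(t, b). F (\<phi> (t, b))) (T \<times> B)"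
      using i by (simp add: infsum_reindex o_def case_prod_unfold)
    also have "\<dots> = infsum (\<lambda>t. infsum (\<lambda>b. F (\<phi> (t, b))) B) T"
      by (rule infsum_Sigma'_banach[symmetric]) (use s in \<open>simp add: case_prod_unfold\<close>)
    also have "\<dots> = infsum (\<lambda>t. of_nat t powr w * infsum F B) T"
    proof (rule infsum_cong)
      fix t assume "t \<in> T"
      hence t: "t \<ge> 1" using T by auto
      have "infsum (\<lambda>b. F (\<phi> (t, b))) B = infsum (\<lambda>b. of_nat t powr w * F b) B"
        by (rule infsum_cong) (auto simp: \<phi>_def hom[OF t])
      thus "infsum (\<lambda>b. F (\<phi> (t, b))) B = of_nat t powr w * infsum F B"
        using sB by (simp add: infsum_cmult_right)
    qed
    also have "\<dots> = infsum (\<lambda>t. of_nat t powr w) T * infsum F B"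
      by (rule infsum_cmult_left) (use norm_summable_subset[OF nat_powr_norm_summable[OF w] T] in simp)
    finally show ?thesis .
  qed
  have L: "infsum F (lattice_L N) = dirichlet_zeta (- w) * infsum F B"
    using main[of "{1..}"] dirichlet_zeta_infsum[OF w] unfolding img by simp
  have N0: "N > 0" using N by simp
  have "infsum F {(m :: int, n). coprime n (int N)} = infsum (\<lambda>t. of_nat t powr w) {t\<in>{1..}. coprime (int t) (int N)} * infsum F B"
    using main[of "{t\<in>{1..}. coprime (int t) (int N)}"] unfolding img2 by auto
  also have "infsum (\<lambda>t. of_nat t powr w) {t\<in>{1..}. coprime (int t) (int N)} = dirichlet_zeta (- w) * (\<Prod>p\<in>prime_factors N. 1 - of_nat p powr w)"
  proof -
    have "infsum (\<lambda>t. of_nat t powr w) {t\<in>{1..}. coprime (int t) (int N)} = (\<Sum>\<^sub>\<infinity>t\<in>{1..}. of_nat t powr w * (\<Prod>p\<in>prime_factors N. (-1) * of_bool (p dvd t) + 1))"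
    proof (rule infsum_cong_neutral)
      fix t :: nat
      have "(\<Prod>p\<in>prime_factors N. (-1) * of_bool (p dvd t) + 1) = (of_bool (coprime (int t) (int N)) :: complex)"
        unfolding coprime_weight[OF N0, of "int t", symmetric] by (simp only: int_dvd_int_iff)
      note e = this
      show "of_nat t powr w * (\<Prod>p\<in>prime_factors N. (-1) * of_bool (p dvd t) + 1) = 0" if "t \<in> {1..} - {t\<in>{1..}. coprime (int t) (int N)}"
        unfolding e using that by auto
      show "of_nat t powr w = of_nat t powr w * (\<Prod>p\<in>prime_factors N. (-1) * of_bool (p dvd t) + 1)" if "t \<in> {t\<in>{1..}. coprime (int t) (int N)} \<inter> {1..}"
        unfolding e using that by auto
    qed auto
    also have "\<dots> = dirichlet_zeta (- w) * (\<Prod>p\<in>prime_factors N. (-1) * of_nat p powr w + 1)"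
      by (rule infsumI, rule zeta_weight[OF w]) auto
    finally show ?thesis by simp
  qed
  finally show ?thesis unfolding L by (simp add: mult_ac)
qed

section \<open>Lambert series and sums over divisors\<close>

text \<open>The double sum over c >= 1 and l \<noteq> 0 is reindexed by n = l c with c | n, which
  needs joint absolute convergence: 1/(l c)^2 <= 1/l^2 leaves a convergent sum in l, and Re w < -1
  gives one in c. The terms l = 0 all hit \<open>a 0\<close> and are set apart.\<close>

lemma lambert_sum:
  fixes a :: "int \<Rightarrow> complex" and g :: "nat \<Rightarrow> complex"
  assumes a: "\<And>n. n \<noteq> 0 \<Longrightarrow> norm (a n) \<le> K / (of_int n)\<^sup>2" and g: "\<And>c. norm (g c) \<le> G"
    and w: "Re w < -1"
  shows lambert_summable: "(\<lambda>n. (\<Sum>c | c dvd nat \<bar>n\<bar>. of_nat c powr w * g c) * a n) summable_on {n. n \<noteq> 0}"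
    and lambert_infsum: "(\<Sum>\<^sub>\<infinity>c\<in>{1..}. of_nat c powr w * g c * (\<Sum>\<^sub>\<infinity>l. a (l * int c))) =
      (\<Sum>\<^sub>\<infinity>c\<in>{1..}. of_nat c powr w * g c) * a 0 + (\<Sum>\<^sub>\<infinity>n\<in>{n. n \<noteq> 0}. (\<Sum>c | c dvd nat \<bar>n\<bar>. of_nat c powr w * g c) * a n)"
proof -
  define h where "h = (\<lambda>c. of_nat c powr w * g c)"
  have G0: "G \<ge> 0" using order_trans[OF norm_ge_zero g[of 0]] .
  have K0: "K \<ge> 0" using order_trans[OF norm_ge_zero a[of 1]] by simp
  have hn: "norm (h c) \<le> G * norm (of_nat c powr w :: complex)" for c
    unfolding h_def norm_mult using mult_right_mono[OF g[of c] norm_ge_zero[of "of_nat c powr w"]] by (simp only: mult.commute)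
  have hs: "(\<lambda>c. norm (h c)) summable_on {1..}"
    by (rule norm_summable_le[OF summable_on_cmult_right[OF nat_powr_norm_summable[OF w], of G]]) (rule hn)
  define U where "U = (UNIV - {0} :: int set)"
  have U: "U = {n. n \<noteq> 0}" by (auto simp: U_def)
  have qs: "(\<lambda>l::int. 1 / (of_int l)\<^sup>2 :: real) summable_on U"
  proof -
    have "(\<lambda>l::int. norm (if l = 0 then 0 else 1 / (of_int l)\<^sup>2 :: real)) summable_on UNIV"
    proof (rule abs_summable_on_int_quadratic[where C = 2])
      fix n :: int
      show "norm (if n = 0 then 0 else 1 / (of_int n)\<^sup>2 :: real) \<le> 2 / (1 + (of_int n)\<^sup>2)"
      proof (cases "n = 0")
        case False
        hence "1 \<le> \<bar>n\<bar>" by simp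
        hence "1 \<le> \<bar>real_of_int n\<bar>" by linarith
        hence "1 \<le> (real_of_int n)\<^sup>2" by (metis abs_1 abs_le_square_iff one_power2)
        thus ?thesis using False by (simp add: divide_simps)
      qed simp
    qed
    hence "(\<lambda>l::int. norm (if l = 0 then 0 else 1 / (of_int l)\<^sup>2 :: real)) summable_on U" by (rule summable_on_subset_banach) auto
    thus ?thesis by (rule summable_on_cong[THEN iffD1, rotated]) (auto simp: U_def)
  qed
  define f where "f = (\<lambda>(c, l). h c * a (l * int c))"
  have fb: "norm (f (c, l)) \<le> (norm (h c) * K) * (1 / (of_int l)\<^sup>2)" if "c \<ge> 1" "l \<in> U" for c l
  proof -
    have l0: "l * int c \<noteq> 0" "l \<noteq> 0" using that by (auto simp: U_def)
    have c1: "real c \<ge> 1" using that by simp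
    have l2: "(real_of_int l)\<^sup>2 > 0" using l0 by simp
    have "(real_of_int l)\<^sup>2 * 1 \<le> (real_of_int l)\<^sup>2 * (real c)\<^sup>2" using c1 by (intro mult_left_mono) auto
    hence "K / (real_of_int (l * int c))\<^sup>2 \<le> K / (real_of_int l)\<^sup>2"
      using K0 l2 c1 by (intro divide_left_mono) (auto simp: power_mult_distrib)
    hence "norm (a (l * int c)) \<le> K / (of_int l)\<^sup>2" using a[OF l0(1)] by linarith
    hence "norm (h c) * norm (a (l * int c)) \<le> norm (h c) * (K / (of_int l)\<^sup>2)" by (intro mult_left_mono) auto
    thus ?thesis by (simp add: f_def norm_mult)
  qed
  have fs: "(\<lambda>x. norm (f x)) summable_on ({1..} \<times> U)"
  proof (rule norm_summable_le)
    show "(\<lambda>(c, l). (norm (h c) * K) * (1 / (of_int l)\<^sup>2)) summable_on ({1..} \<times> U)"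
    proof (rule summable_on_SigmaI)
      fix c :: nat
      show "((\<lambda>l. case (c, l) of (c, l) \<Rightarrow> (norm (h c) * K) * (1 / (of_int l)\<^sup>2)) has_sum (norm (h c) * K) * infsum (\<lambda>l. 1 / (of_int l)\<^sup>2) U) U"
        unfolding prod.case by (intro has_sum_cmult_right has_sum_infsum qs)
    next
      show "(\<lambda>c. (norm (h c) * K) * infsum (\<lambda>l. 1 / (of_int l)\<^sup>2) U) summable_on {1..}"
        by (intro summable_on_cmult_left hs)
    qed (use K0 in auto)
  qed (use fb in auto)
  define \<phi> where "\<phi> = (\<lambda>(c, l). (l * int c, c))"
  define S where "S = (SIGMA n:U. {c. c dvd nat \<bar>n\<bar>})"
  have bij: "bij_betw \<phi> ({1..} \<times> U) S"
  proof (rule bij_betwI[where g = "\<lambda>(n, c). (c, n div int c)"])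
    show "\<phi> \<in> {1..} \<times> U \<rightarrow> S" by (auto simp: \<phi>_def S_def U_def abs_mult nat_mult_distrib)
    show "(\<lambda>(n, c). (c, n div int c)) \<in> S \<rightarrow> {1..} \<times> U"
    proof
      fix x assume "x \<in> S"
      then obtain n c where x: "x = (n, c)" "n \<noteq> 0" "c dvd nat \<bar>n\<bar>" by (auto simp: S_def U_def)
      have "c \<noteq> 0" using x by auto
      moreover have "int c dvd n" using x(3) by simp
      hence "n div int c \<noteq> 0" using x(2) by auto
      ultimately show "(case x of (n, c) \<Rightarrow> (c, n div int c)) \<in> {1..} \<times> U" by (simp add: x U_def Suc_le_eq)
    qed
    show "(case \<phi> x of (n, c) \<Rightarrow> (c, n div int c)) = x" if "x \<in> {1..} \<times> U" for x
      using that by (auto simp: \<phi>_def)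
    show "\<phi> (case y of (n, c) \<Rightarrow> (c, n div int c)) = y" if "y \<in> S" for y
    proof -
      obtain n c where x: "y = (n, c)" "n \<noteq> 0" "c dvd nat \<bar>n\<bar>" using \<open>y \<in> S\<close> by (auto simp: S_def U_def)
      have "int c dvd n" using x(3) by simp
      thus ?thesis by (simp add: x \<phi>_def)
    qed
  qed
  have e: "f x = (\<lambda>(n, c). h c * a n) (\<phi> x)" for x by (simp add: f_def \<phi>_def case_prod_unfold)
  have fs': "f summable_on ({1..} \<times> U)" by (rule abs_summable_summable[OF fs])
  have Ss: "(\<lambda>(n, c). h c * a n) summable_on S"
    using fs' summable_on_reindex_bij_betw[OF bij, of "\<lambda>(n, c). h c * a n"] unfolding e[symmetric] by blast
  have fin: "finite {c. c dvd nat \<bar>n\<bar>}" if "n \<in> U" for n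
    by (rule finite_divisors_nat) (use that in \<open>simp add: U_def\<close>)
  have inner: "infsum (\<lambda>c. h c * a n) {c. c dvd nat \<bar>n\<bar>} = (\<Sum>c | c dvd nat \<bar>n\<bar>. h c) * a n" if "n \<in> U" for n
    using fin[OF that] by (simp add: sum_distrib_right)
  have "(\<lambda>n. infsum (\<lambda>c. h c * a n) {c. c dvd nat \<bar>n\<bar>}) summable_on U"
    using summable_on_Sigma_banach[of "\<lambda>n c. h c * a n" U "\<lambda>n. {c. c dvd nat \<bar>n\<bar>}"] Ss unfolding S_def by simp
  hence S1: "(\<lambda>n. (\<Sum>c | c dvd nat \<bar>n\<bar>. h c) * a n) summable_on U"
    by (rule summable_on_cong[THEN iffD1, rotated]) (rule inner)
  thus "(\<lambda>n. (\<Sum>c | c dvd nat \<bar>n\<bar>. of_nat c powr w * g c) * a n) summable_on {n. n \<noteq> 0}"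
    unfolding h_def U .
  have "infsum f ({1..} \<times> U) = infsum (\<lambda>(n, c). h c * a n) S"
    using infsum_reindex_bij_betw[OF bij, of "\<lambda>(n, c). h c * a n"] unfolding e[symmetric] .
  also have "\<dots> = infsum (\<lambda>n. infsum (\<lambda>c. h c * a n) {c. c dvd nat \<bar>n\<bar>}) U"
    unfolding S_def by (rule infsum_Sigma'_banach[symmetric]) (use Ss in \<open>simp add: S_def\<close>)
  also have "\<dots> = infsum (\<lambda>n. (\<Sum>c | c dvd nat \<bar>n\<bar>. h c) * a n) U"
    by (rule infsum_cong) (rule inner)
  finally have R: "infsum f ({1..} \<times> U) = infsum (\<lambda>n. (\<Sum>c | c dvd nat \<bar>n\<bar>. h c) * a n) U" .
  have ff: "(\<lambda>(c, l). h c * a (l * int c)) summable_on ({1..} \<times> U)" using fs' by (simp add: f_def)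
  have L: "infsum f ({1..} \<times> U) = infsum (\<lambda>c. infsum (\<lambda>l. h c * a (l * int c)) U) {1..}"
    unfolding f_def by (rule infsum_Sigma'_banach[symmetric, OF ff])
  have Ls: "(\<lambda>c. infsum (\<lambda>l. h c * a (l * int c)) U) summable_on {1..}"
    using summable_on_Sigma_banach[OF ff] by simp
  have row: "h c * (\<Sum>\<^sub>\<infinity>l. a (l * int c)) = h c * a 0 + infsum (\<lambda>l. h c * a (l * int c)) U" if c: "c \<in> {1..}" for c
  proof -
    have as: "(\<lambda>l. norm (a (l * int c))) summable_on U"
    proof (rule norm_summable_le[OF summable_on_cmult_right[OF qs, of K]])
      fix l assume l: "l \<in> U"
      have l0: "l * int c \<noteq> 0" "l \<noteq> 0" using c l by (auto simp: U_def)
      have c1: "real c \<ge> 1" using c by simp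
      have l2: "(real_of_int l)\<^sup>2 > 0" using l0 by simp
      have "(real_of_int l)\<^sup>2 * 1 \<le> (real_of_int l)\<^sup>2 * (real c)\<^sup>2" using c1 by (intro mult_left_mono) auto
      hence "K / (real_of_int (l * int c))\<^sup>2 \<le> K / (real_of_int l)\<^sup>2"
        using K0 l2 c1 by (intro divide_left_mono) (auto simp: power_mult_distrib)
      thus "norm (a (l * int c)) \<le> K * (1 / (of_int l)\<^sup>2)" using a[OF l0(1)] by simp
    qed
    have asU: "(\<lambda>l. a (l * int c)) summable_on U" by (rule abs_summable_summable[OF as])
    have "(\<Sum>\<^sub>\<infinity>l. a (l * int c)) = infsum (\<lambda>l. a (l * int c)) ({0} \<union> U)" by (rule arg_cong[where f = "infsum _"]) (auto simp: U_def)
    also have "\<dots> = a 0 + infsum (\<lambda>l. a (l * int c)) U"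
      by (subst infsum_Un_disjoint) (use asU in \<open>auto simp: U_def\<close>)
    finally show ?thesis using asU by (simp add: infsum_cmult_right distrib_left)
  qed
  have "(\<Sum>\<^sub>\<infinity>c\<in>{1..}. h c * (\<Sum>\<^sub>\<infinity>l. a (l * int c))) = (\<Sum>\<^sub>\<infinity>c\<in>{1..}. h c * a 0 + infsum (\<lambda>l. h c * a (l * int c)) U)"
    by (rule infsum_cong) (rule row)
  also have "\<dots> = (\<Sum>\<^sub>\<infinity>c\<in>{1..}. h c * a 0) + (\<Sum>\<^sub>\<infinity>c\<in>{1..}. infsum (\<lambda>l. h c * a (l * int c)) U)"
    by (rule infsum_add) (intro summable_on_cmult_left abs_summable_summable[OF hs], rule Ls)
  also have "(\<Sum>\<^sub>\<infinity>c\<in>{1..}. h c * a 0) = (\<Sum>\<^sub>\<infinity>c\<in>{1..}. h c) * a 0"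
    by (rule infsum_cmult_left) (use abs_summable_summable[OF hs] in simp)
  finally show "(\<Sum>\<^sub>\<infinity>c\<in>{1..}. of_nat c powr w * g c * (\<Sum>\<^sub>\<infinity>l. a (l * int c))) =
      (\<Sum>\<^sub>\<infinity>c\<in>{1..}. of_nat c powr w * g c) * a 0 + (\<Sum>\<^sub>\<infinity>n\<in>{n. n \<noteq> 0}. (\<Sum>c | c dvd nat \<bar>n\<bar>. of_nat c powr w * g c) * a n)"
    unfolding L[symmetric] R unfolding h_def U .
qed

text \<open>Induction over the primes in P. A divisor is uniquely p^i c with c dividing the part of
  n prime to p; the weight at p sees only whether i > 0, the weights at other primes see only c. So
  one local factor splits off at each step, and in the end divisors prime to all of P
  remain.\<close>

lemma divisor_sum_local:
  fixes h :: "nat \<Rightarrow> bool \<Rightarrow> complex"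
  assumes "finite P" "\<And>p. p \<in> P \<Longrightarrow> prime p" "n > 0"
  shows "(\<Sum>c | c dvd n. of_nat c powr w * (\<Prod>p\<in>P. h p (p dvd c))) =
    (\<Prod>p\<in>P. \<Sum>i\<le>multiplicity p n. of_nat p powr (of_nat i * w) * h p (i > 0)) * (\<Sum>c | c dvd n \<and> (\<forall>p\<in>P. \<not> p dvd c). of_nat c powr w)"
  using assms
proof (induction arbitrary: n rule: finite_induct)
  case (insert p P)
  have p: "prime p" and P: "\<And>q. q \<in> P \<Longrightarrow> prime q" using insert.prems by auto
  define v where "v = multiplicity p n"
  obtain n' where n': "n = p ^ v * n'" "\<not> p dvd n'"
    using multiplicity_decompose'[of n p] insert.prems p unfolding v_def by (metis not_gr_zero not_prime_unit)
  have n0: "n' > 0" using insert.prems n' by (cases "n' = 0") auto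
  have p0: "p > 0" using p by (rule prime_gt_0_nat)
  have cp: "coprime (p ^ i) c" if "c dvd n'" for i c
    using that n'(2) p by (metis coprime_power_left_iff dvd_trans prime_imp_coprime)
  let ?D = "{c. c dvd n'}"
  have bij: "bij_betw (\<lambda>(i, c). p ^ i * c) ({..v} \<times> ?D) {c. c dvd n}"
  proof (rule bij_betw_imageI)
    show "inj_on (\<lambda>(i, c). p ^ i * c) ({..v} \<times> ?D)"
    proof (rule inj_onI, clarify)
      fix i c j d assume a: "c dvd n'" "d dvd n'" "p ^ i * c = p ^ j * d"
      have nd: "\<not> p dvd c" "\<not> p dvd d" using a n'(2) dvd_trans by blast+
      have "multiplicity p (p ^ i * c) = i" "multiplicity p (p ^ j * d) = j"
        using nd p p0 by (auto intro!: multiplicity_decomposeI)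
      hence "i = j" using a(3) by simp
      thus "i = j \<and> c = d" using a(3) p0 by simp
    qed
    show "(\<lambda>(i, c). p ^ i * c) ` ({..v} \<times> ?D) = {c. c dvd n}"
    proof (intro equalityI subsetI)
      fix x assume "x \<in> (\<lambda>(i, c). p ^ i * c) ` ({..v} \<times> ?D)"
      thus "x \<in> {c. c dvd n}" by (auto simp: n'(1) intro!: mult_dvd_mono le_imp_power_dvd)
    next
      fix x assume "x \<in> {c. c dvd n}"
      hence x: "x dvd p ^ v * n'" by (simp add: n'(1))
      obtain a b where ab: "x = a * b" "a dvd p ^ v" "b dvd n'" using division_decomp[OF x] by blast
      obtain i where "i \<le> v" "a = p ^ i" using ab(2) p by (auto simp: divides_primepow_nat)
      thus "x \<in> (\<lambda>(i, c). p ^ i * c) ` ({..v} \<times> ?D)" using ab by (intro image_eqI[of _ _ "(i, b)"]) auto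
    qed
  qed
  have dv: "q dvd p ^ i * c \<longleftrightarrow> q dvd c" if "q \<in> P" for q i c
  proof -
    have "q \<noteq> p" using that insert.hyps by auto
    hence "coprime q (p ^ i)" using primes_coprime[OF P[OF that] p] by simp
    thus ?thesis by (simp add: coprime_dvd_mult_right_iff)
  qed
  have dp: "p dvd p ^ i * c \<longleftrightarrow> i > 0" if "c dvd n'" for i c
  proof -
    have "\<not> p dvd c" using that n'(2) dvd_trans by blast
    thus ?thesis using p by (cases i) (auto simp: prime_dvd_mult_iff)
  qed
  have mq: "multiplicity q n' = multiplicity q n" if "q \<in> P" for q
  proof -
    have "\<not> q dvd p ^ v" using that insert.hyps P[OF that] p by (metis prime_dvd_power primes_dvd_imp_eq)
    thus ?thesis unfolding n'(1) using P[OF that] n0 p0 by (subst prime_elem_multiplicity_mult_distrib) (auto simp: not_dvd_imp_multiplicity_0)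
  qed
  have pw: "of_nat (p ^ i) powr w = of_nat p powr (of_nat i * w)" for i
  proof -
    have "of_nat (p ^ i) powr w = exp (w * of_real (ln (real (p ^ i))))"
      using Ln_of_real[of "real (p ^ i)"] p0 by (simp add: powr_def del: of_nat_power)
    also have "\<dots> = exp (of_nat i * w * of_real (ln (real p)))" using p0 by (simp add: ln_realpow mult_ac)
    also have "\<dots> = of_nat p powr (of_nat i * w)" using Ln_of_real[of "real p"] p0 by (simp add: powr_def)
    finally show ?thesis .
  qed
  have "(\<Sum>c | c dvd n. of_nat c powr w * (\<Prod>q\<in>insert p P. h q (q dvd c))) =
     (\<Sum>(i, c)\<in>{..v} \<times> ?D. of_nat (p ^ i * c) powr w * (\<Prod>q\<in>insert p P. h q (q dvd p ^ i * c)))"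
    by (subst sum.reindex_bij_betw[OF bij, symmetric]) (simp add: case_prod_unfold)
  also have "\<dots> = (\<Sum>(i, c)\<in>{..v} \<times> ?D. (of_nat p powr (of_nat i * w) * h p (i > 0)) * (of_nat c powr w * (\<Prod>q\<in>P. h q (q dvd c))))"
  proof (rule sum.cong[OF refl], clarify)
    fix i c assume c: "c dvd n'"
    have "(\<Prod>q\<in>insert p P. h q (q dvd p ^ i * c)) = h p (i > 0) * (\<Prod>q\<in>P. h q (q dvd c))"
      using insert.hyps by (simp add: dp[OF c] dv)
    thus "of_nat (p ^ i * c) powr w * (\<Prod>q\<in>insert p P. h q (q dvd p ^ i * c)) = (of_nat p powr (of_nat i * w) * h p (i > 0)) * (of_nat c powr w * (\<Prod>q\<in>P. h q (q dvd c)))"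
      unfolding nat_powr_mult pw by (simp only: mult_ac)
  qed
  also have "\<dots> = (\<Sum>i\<le>v. of_nat p powr (of_nat i * w) * h p (i > 0)) * (\<Sum>c\<in>?D. of_nat c powr w * (\<Prod>q\<in>P. h q (q dvd c)))"
    by (simp only: sum_product sum.cartesian_product)
  also have "(\<Sum>c\<in>?D. of_nat c powr w * (\<Prod>q\<in>P. h q (q dvd c))) = (\<Prod>q\<in>P. \<Sum>i\<le>multiplicity q n. of_nat q powr (of_nat i * w) * h q (i > 0)) * (\<Sum>c | c dvd n' \<and> (\<forall>p\<in>P. \<not> p dvd c). of_nat c powr w)"
    using insert.IH[OF P n0] mq by simp
  also have "{c. c dvd n' \<and> (\<forall>p\<in>P. \<not> p dvd c)} = {c. c dvd n \<and> (\<forall>p\<in>insert p P. \<not> p dvd c)}"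
  proof -
    have "c dvd n' \<longleftrightarrow> c dvd n \<and> \<not> p dvd c" for c
    proof
      assume "c dvd n'" thus "c dvd n \<and> \<not> p dvd c" using n' dvd_trans by (metis dvd_mult)
    next
      assume c: "c dvd n \<and> \<not> p dvd c"
      hence "coprime c (p ^ v)" using p by (metis coprime_commute coprime_power_right_iff prime_imp_coprime)
      thus "c dvd n'" using c unfolding n'(1) by (simp add: coprime_dvd_mult_right_iff)
    qed
    thus ?thesis by auto
  qed
  finally show ?case using insert.hyps by (simp add: v_def mult_ac)
qed simp

section \<open>The Eisenstein summand and its absolute convergence\<close>

lemma norm_real_powr: "r \<ge> 0 \<Longrightarrow> norm (of_real r powr s :: complex) = r powr Re s"
  using norm_powr_real_powr[of "of_real r" s] by simp

lemma norm_eisenstein_term: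
  assumes "y > 0"
  shows "norm (eisenstein_term k s y w) = y powr Re s * cmod w powr (- (2 * Re s + of_int k))"
proof (cases "w = 0")
  case False
  hence c: "cmod w > 0" by simp
  have "cmod (w powi k) = cmod w powr of_int k" using c by (simp add: norm_power_int powr_real_of_int')
  moreover have "cmod w powr (- (2 * Re s + of_int k)) = inverse (cmod w powr (2 * Re s) * cmod w powr of_int k)"
    by (simp only: powr_minus powr_add)
  ultimately show ?thesis using assms
    by (simp add: eisenstein_term_def norm_divide norm_mult norm_inverse norm_real_powr divide_inverse)
qed (simp add: eisenstein_term_def)

lemma eisenstein_term_scale:
  assumes r: "r > 0" and k: "even k"
  shows "eisenstein_term k s y (of_real r * w) = of_real r powr (- (2 * s + of_int k)) * eisenstein_term k s y w"
    and "eisenstein_term k s y (- w) = eisenstein_term k s y w"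
proof -
  have 1: "of_real (cmod (of_real r * w)) powr (2 * s) = of_real r powr (2 * s) * (of_real (cmod w) powr (2 * s) :: complex)"
    using r powr_times_real[of "of_real r" "of_real (cmod w)" "2 * s"] by (simp add: norm_mult)
  have 2: "(of_real r * w) powi k = of_real r powr of_int k * w powi k"
    using r by (simp add: power_int_mult_distrib powr_of_int')
  show "eisenstein_term k s y (of_real r * w) = of_real r powr (- (2 * s + of_int k)) * eisenstein_term k s y w"
    unfolding eisenstein_term_def 1 2 powr_minus powr_add by (simp add: divide_inverse)
  show "eisenstein_term k s y (- w) = eisenstein_term k s y w"
    using k by (simp add: eisenstein_term_def power_int_minus_left_even)
qed

text \<open>|w|^(-k) (cnj w / w)^(k/2) = w^(-k), because |w|^2 = w cnj w; evenness of k makes k/2 an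
  integer, so that no branch has to be chosen.\<close>

lemma eisenstein_term_kern:
  assumes Y: "Y > 0" and k: "even k"
  shows "eisenstein_term k s y (Complex X Y) =
    of_real y powr s * kern (s + of_int k / 2 + of_int (k div 2)) (s + of_int k / 2 - of_int (k div 2)) (of_real Y) X"
proof -
  define w where "w = Complex X Y"
  define j where "j = k div 2"
  have kj: "k = 2 * j" using k by (simp add: j_def)
  have w: "w = of_real X + \<i> * of_real Y" "cnj w = of_real X - \<i> * of_real Y"
    by (simp_all add: w_def complex_eq_iff)
  have w0: "w \<noteq> 0" "cnj w \<noteq> 0" using Y by (auto simp: w_def complex_eq_iff)
  have ww: "w * cnj w = (of_real (cmod w))\<^sup>2"
    unfolding of_real_power[symmetric] by (rule complex_norm_square[symmetric])
  have wk: "w powi k = (w\<^sup>2) powi j" unfolding kj by (simp add: power_int_mult)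
  have ck: "of_real (cmod w) powr of_int k = (w * cnj w) powi j"
  proof -
    have "of_real (cmod w) powr of_int k = (of_real (cmod w) powi (2 * j) :: complex)"
      using w0 by (subst powr_of_int') (simp_all add: kj)
    thus ?thesis unfolding ww power_int_mult by simp
  qed
  have ex: "- 2 * (s + of_int k / 2) = - (2 * s) + - of_int k" by (simp add: algebra_simps)
  have "of_real (cmod w) powr (- 2 * (s + of_int k / 2)) * (cnj w / w) powi j =
     of_real (cmod w) powr (- (2 * s)) * (of_real (cmod w) powr (- of_int k) * (cnj w / w) powi j)"
    unfolding ex powr_add by (simp only: mult.assoc)
  also have "of_real (cmod w) powr (- of_int k) * (cnj w / w) powi j = inverse (w powi k)"
  proof -
    have "of_real (cmod w) powr (- of_int k) * (cnj w / w) powi j = inverse ((w * cnj w) powi j) * (cnj w / w) powi j"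
      unfolding powr_minus ck ..
    also have "\<dots> = (inverse (w * cnj w) * (cnj w / w)) powi j"
      by (simp only: power_int_mult_distrib power_int_inverse)
    also have "inverse (w * cnj w) * (cnj w / w) = inverse (w\<^sup>2)"
      using w0 by (simp add: field_simps power2_eq_square)
    finally show ?thesis unfolding wk by (simp only: power_int_inverse)
  qed
  finally show ?thesis
    unfolding kern_integer[OF Y] w_def[symmetric] j_def[symmetric] w(1)[symmetric] w(2)[symmetric] eisenstein_term_def
    by (simp only: powr_minus divide_inverse inverse_mult_distrib)
qed

lemma max_powr_summable_int:
  assumes p: "p > 1"
  shows "(\<lambda>m::int. max 1 \<bar>real_of_int m\<bar> powr (- p)) summable_on UNIV"
proof -
  have s: "summable (\<lambda>n. max 1 (real n) powr (- p))"
  proof (rule summable_comparison_test_ev)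
    show "summable (\<lambda>n. real n powr (- p))" using p by (simp add: summable_real_powr_iff)
    show "\<forall>\<^sub>F n in sequentially. norm (max 1 (real n) powr (- p)) \<le> real n powr (- p)"
      using eventually_ge_at_top[of 1] by eventually_elim (simp add: max_def)
  qed
  have "(\<lambda>m::int. norm (max 1 \<bar>real_of_int m\<bar> powr (- p))) summable_on UNIV"
    by (rule abs_summable_on_int) (use s in simp_all)
  thus ?thesis by simp
qed

text \<open>Away from the origin |m|, |n| and 1 are all at most C |w|. With p = Re s + k/2 > 1 the
  size |w|^(-2p) is split into two equal powers, one estimated through m and one through n, and the
  lattice sum is majorised by a product of two convergent sums.\<close>

lemma eisenstein_lattice_summable:
  assumes u: "u > 0" and v: "v > 0" and z: "Im z > 0" and y: "y > 0" and s: "Re s + of_int k / 2 > 1"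
  shows "(\<lambda>(m::int, n::int). norm (eisenstein_term k s y (of_real u * of_int m * z + of_real v * of_int n))) summable_on UNIV"
proof -
  define p where "p = Re s + of_int k / 2"
  \<comment> \<open>The first entry bounds |m| through Im w, the second bounds |n| through Re w once
    m is controlled.\<close>
  define C where "C = max (1 / (u * Im z)) ((1 + \<bar>Re z\<bar> / Im z) / v)"
  define g where "g = (\<lambda>m::int. max 1 \<bar>real_of_int m\<bar> powr (- p))"
  define K where "K = y powr Re s * C powr (2 * p)"
  have C: "C > 0" unfolding C_def using u z by (simp add: less_max_iff_disj)
  have p: "p > 1" using s by (simp add: p_def)
  have bnd: "norm (eisenstein_term k s y (of_real u * of_int m * z + of_real v * of_int n)) \<le> K * (g m * g n)" for m n :: int
  proof (cases "m = 0 \<and> n = 0")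
    case True
    thus ?thesis by (simp add: eisenstein_term_def K_def g_def)
  next
    case False
    define w where "w = of_real u * of_int m * z + of_real v * of_int n"
    have Im: "Im w = u * of_int m * Im z" and Re: "Re w = u * of_int m * Re z + v * of_int n"
      by (simp_all add: w_def)
    have m1: "\<bar>u * of_int m\<bar> \<le> cmod w / Im z"
      using abs_Im_le_cmod[of w] z unfolding Im by (simp add: abs_mult field_simps)
    have m2: "\<bar>real_of_int m\<bar> \<le> 1 / (u * Im z) * cmod w" using m1 u z by (simp add: abs_mult field_simps)
    have "\<bar>v * of_int n\<bar> = \<bar>Re w - (u * of_int m) * Re z\<bar>" by (simp add: Re)
    also have "\<dots> \<le> \<bar>Re w\<bar> + \<bar>u * of_int m\<bar> * \<bar>Re z\<bar>" unfolding abs_mult[symmetric] by (rule abs_triangle_ineq4)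
    also have "\<dots> \<le> cmod w + cmod w / Im z * \<bar>Re z\<bar>"
      by (intro add_mono mult_right_mono m1 abs_Re_le_cmod) auto
    finally have n1: "\<bar>v * of_int n\<bar> \<le> cmod w * (1 + \<bar>Re z\<bar> / Im z)" by (simp add: algebra_simps)
    have n2: "\<bar>real_of_int n\<bar> \<le> (1 + \<bar>Re z\<bar> / Im z) / v * cmod w" using n1 v by (simp add: abs_mult field_simps)
    have m3: "\<bar>real_of_int m\<bar> \<le> C * cmod w"
      by (rule order_trans[OF m2 mult_right_mono]) (auto simp: C_def)
    have n3: "\<bar>real_of_int n\<bar> \<le> C * cmod w"
      by (rule order_trans[OF n2 mult_right_mono]) (auto simp: C_def)
    have one: "1 \<le> C * cmod w"
    proof (cases "m = 0")
      case True
      hence "1 \<le> \<bar>real_of_int n\<bar>" using False by (simp add: Suc_le_eq flip: of_int_abs)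
      thus ?thesis using n3 by linarith
    next
      case False
      hence "1 \<le> \<bar>real_of_int m\<bar>" by (simp flip: of_int_abs)
      thus ?thesis using m3 by linarith
    qed
    have w0: "cmod w > 0" using one C by (cases "w = 0") auto
    have a: "(C * cmod w) powr (- p) \<le> g m" "(C * cmod w) powr (- p) \<le> g n"
      unfolding g_def using m3 n3 one p by (auto intro!: powr_mono2')
    have "norm (eisenstein_term k s y w) = y powr Re s * cmod w powr (- (2 * p))"
      by (simp add: norm_eisenstein_term[OF y] p_def algebra_simps)
    also have "cmod w powr (- (2 * p)) = C powr (2 * p) * (C * cmod w) powr (- (2 * p))"
      using C w0 by (simp add: powr_mult powr_minus)
    also have "(C * cmod w) powr (- (2 * p)) = (C * cmod w) powr (- p) * (C * cmod w) powr (- p)"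
      by (simp flip: powr_add)
    also have "y powr Re s * (C powr (2 * p) * ((C * cmod w) powr (- p) * (C * cmod w) powr (- p))) \<le> y powr Re s * (C powr (2 * p) * (g m * g n))"
      using a by (intro mult_left_mono mult_mono) (auto simp: g_def)
    finally show ?thesis unfolding w_def K_def by (simp only: mult.assoc)
  qed
  have gs: "g summable_on UNIV" unfolding g_def by (rule max_powr_summable_int[OF p])
  have "(\<lambda>(m, n). K * (g m * g n)) summable_on (UNIV \<times> UNIV)"
  proof (rule summable_on_SigmaI)
    fix m :: int
    show "((\<lambda>n. case (m, n) of (m, n) \<Rightarrow> K * (g m * g n)) has_sum K * (g m * infsum g UNIV)) UNIV"
      unfolding prod.case by (intro has_sum_cmult_right has_sum_infsum gs)
    show "(\<lambda>m. K * (g m * infsum g UNIV)) summable_on UNIV"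
      by (intro summable_on_cmult_right summable_on_cmult_left gs)
  qed (auto simp: K_def g_def)
  hence gg: "(\<lambda>x. K * (g (fst x) * g (snd x))) summable_on UNIV" by (simp add: case_prod_unfold)
  show ?thesis unfolding case_prod_unfold
    by (rule norm_summable_le[OF gg]) (rule bnd)
qed

lemma even_int_infsum:
  fixes f :: "int \<Rightarrow> complex"
  assumes f: "(\<lambda>n. norm (f n)) summable_on UNIV" and e: "\<And>n. f (- n) = f n"
  shows "infsum f UNIV = f 0 + 2 * (\<Sum>\<^sub>\<infinity>n\<in>{1..}. f (int n))"
proof -
  have s: "f summable_on A" for A by (rule norm_summable_subset[OF f]) auto
  have b1: "bij_betw int {1..} {n. n > 0}"
    by (rule bij_betwI[where g = nat]) auto
  have b2: "bij_betw (\<lambda>n. - int n) {1..} {n. n < 0}"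
    by (rule bij_betwI[where g = "\<lambda>n. nat (- n)"]) auto
  have "UNIV = {0} \<union> ({n. n > 0} \<union> {n::int. n < 0})" by auto
  hence "infsum f UNIV = infsum f ({0} \<union> ({n. n > 0} \<union> {n. n < 0}))" by simp
  also have "\<dots> = infsum f {0} + infsum f ({n. n > 0} \<union> {n. n < 0})"
    by (rule infsum_Un_disjoint) (auto intro: s)
  also have "infsum f ({n. n > 0} \<union> {n. n < 0}) = infsum f {n. n > 0} + infsum f {n. n < 0}"
    by (rule infsum_Un_disjoint) (auto intro: s)
  also have "infsum f {n. n > 0} = (\<Sum>\<^sub>\<infinity>n\<in>{1..}. f (int n))"
    by (rule infsum_reindex_bij_betw[OF b1, symmetric])
  also have "infsum f {n. n < 0} = (\<Sum>\<^sub>\<infinity>n\<in>{1..}. f (int n))"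
    using infsum_reindex_bij_betw[OF b2, of f] by (simp add: e)
  finally show ?thesis by simp
qed

text \<open>Evenness makes the rows m and -m equal, so that row 0 and twice the positive rows
  remain.\<close>

lemma even_lattice_infsum:
  fixes F :: "int \<times> int \<Rightarrow> complex"
  assumes F: "(\<lambda>p. norm (F p)) summable_on UNIV" and e: "\<And>m n. F (- m, - n) = F (m, n)"
    and D: "\<And>m n. D (- m) (- n) = D m n"
  shows "infsum F {(m, n). D m n} = infsum (\<lambda>n. F (0, n)) {n. D 0 n} + 2 * (\<Sum>\<^sub>\<infinity>m\<in>{1..}. infsum (\<lambda>n. F (int m, n)) {n. D (int m) n})"
proof -
  define r where "r = (\<lambda>m. infsum (\<lambda>n. F (m, n)) {n. D m n})"
  have S: "{(m, n). D m n} = (SIGMA m:UNIV. {n. D m n})" by auto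
  have Fs: "(\<lambda>(m, n). norm (F (m, n))) summable_on (SIGMA m:UNIV. {n. D m n})"
    using summable_on_subset_banach[OF F, of "SIGMA m:UNIV. {n. D m n}"] by (simp add: case_prod_unfold)
  have Fs': "(\<lambda>(m, n). F (m, n)) summable_on (SIGMA m:UNIV. {n. D m n})"
    using norm_summable_subset[OF F, of "SIGMA m:UNIV. {n. D m n}"] by (simp add: case_prod_unfold)
  have inner: "(\<lambda>n. norm (F (m, n))) summable_on A" for m A
  proof -
    have "(\<lambda>p. norm (F p)) summable_on ({m} \<times> A)" by (rule summable_on_subset_banach[OF F]) auto
    moreover have "inj_on (Pair m) A" by (auto simp: inj_on_def)
    moreover have "{m} \<times> A = Pair m ` A" by auto
    ultimately show ?thesis by (simp add: summable_on_reindex o_def)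
  qed
  have "(\<lambda>m. norm (r m)) summable_on UNIV"
  proof (rule norm_summable_le)
    show "(\<lambda>m. infsum (\<lambda>n. norm (F (m, n))) {n. D m n}) summable_on UNIV"
      using summable_on_Sigma_banach[OF Fs] by simp
    show "norm (r m) \<le> infsum (\<lambda>n. norm (F (m, n))) {n. D m n}" for m
      unfolding r_def by (rule norm_infsum_bound) (rule inner)
  qed
  moreover have "r (- m) = r m" for m
  proof -
    have b: "bij_betw uminus {n. D m n} {n. D (- m) n}"
      by (rule bij_betwI[where g = uminus]) (auto simp: D, metis D add.inverse_inverse)
    show ?thesis unfolding r_def using infsum_reindex_bij_betw[OF b, of "\<lambda>n. F (- m, n)"] by (simp add: e)
  qed
  ultimately have "infsum r UNIV = r 0 + 2 * (\<Sum>\<^sub>\<infinity>m\<in>{1..}. r (int m))" by (rule even_int_infsum)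
  moreover have "infsum F {(m, n). D m n} = infsum r UNIV"
    unfolding S r_def using infsum_Sigma'_banach[OF Fs'] by (simp add: case_prod_unfold)
  ultimately show ?thesis by (simp add: r_def)
qed

section \<open>Rows of the Eisenstein series\<close>

lemma squarefree_prod_prime_factors:
  fixes N :: nat
  assumes "squarefree N"
  shows "\<Prod>(prime_factors N) = N"
proof -
  have N0: "N \<noteq> 0" using assms by (metis not_squarefree_0)
  have "N = (\<Prod>p\<in>prime_factors N. p ^ multiplicity p N)"
    using prime_factorization_nat[of N] N0 by (simp add: prime_factors_multiplicity)
  also have "\<dots> = (\<Prod>p\<in>prime_factors N. p)"
    by (intro prod.cong refl) (use assms N0 squarefree_factorial_semiring'[of N] in auto)
  finally show ?thesis by simp
qed

lemma int_multiples_reindex: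
  assumes "finite X" "\<And>p. p \<in> X \<Longrightarrow> prime (p :: nat)"
  shows "infsum f {n. \<forall>p\<in>X. int p dvd n} = (\<Sum>\<^sub>\<infinity>l. f (int (\<Prod>X) * l))"
proof -
  have pos: "\<Prod>X > 0" using assms by (auto intro!: prod_pos prime_gt_0_nat)
  have dv: "(\<forall>p\<in>X. int p dvd n) \<longleftrightarrow> int (\<Prod>X) dvd n" for n
    using prime_set_prod_dvd[OF assms, of "nat \<bar>n\<bar>"] unfolding dvd_nat_abs_iff by simp
  have "bij_betw (\<lambda>l. int (\<Prod>X) * l) UNIV {n. \<forall>p\<in>X. int p dvd n}"
    unfolding dv
  proof (rule bij_betwI[where g = "\<lambda>n. n div int (\<Prod>X)"])
    have "int (\<Prod>X) \<noteq> 0" using pos by linarith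
    thus "\<And>l. int (\<Prod>X) * l div int (\<Prod>X) = l" by (rule nonzero_mult_div_cancel_left)
  qed (auto simp del: of_nat_prod)
  thus ?thesis by (rule infsum_reindex_bij_betw[symmetric])
qed

definition eisenstein_coeff :: "complex \<Rightarrow> int \<Rightarrow> real \<Rightarrow> real \<Rightarrow> int \<Rightarrow> complex" where
  "eisenstein_coeff \<sigma> j X Y n =
     kern_hat (\<sigma> + of_int j) (\<sigma> - of_int j) (2 * pi * of_int n) (of_real Y) * exp (2 * of_real pi * \<i> * of_int n * of_real X)"

definition eisenstein_row :: "int \<Rightarrow> complex \<Rightarrow> real \<Rightarrow> complex \<Rightarrow> nat \<Rightarrow> complex" where
  "eisenstein_row k s y z c = (\<Sum>\<^sub>\<infinity>l::int. eisenstein_term k s y (of_nat c * z + of_int l))"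

text \<open>Poisson summation at height c Y followed by scaling: up to a power of c, the coefficient
  of index l of row c is the coefficient of index l c of row 1. This is what produces divisor
  sums.\<close>

lemma eisenstein_row_eq:
  assumes c: "c \<ge> 1" and Y: "Y > 0" and k: "even k" and s: "Re (s + of_int k / 2) > 1"
  shows "eisenstein_row k s y (Complex X Y) c = of_real y powr s * (of_nat c powr (1 - 2 * (s + of_int k / 2)) *
    (\<Sum>\<^sub>\<infinity>l. eisenstein_coeff (s + of_int k / 2) (k div 2) X Y (l * int c)))"
proof -
  define \<sigma> where "\<sigma> = s + of_int k / 2"
  define j where "j = k div 2"
  have cY: "real c * Y > 0" using c Y by simp
  have c0: "real c > 0" using c by simp
  have ab: "Re ((\<sigma> + of_int j) + (\<sigma> - of_int j)) \<ge> 2" using s by (simp add: \<sigma>_def)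
  have "eisenstein_term k s y (of_nat c * Complex X Y + of_int l) =
      of_real y powr s * kern (\<sigma> + of_int j) (\<sigma> - of_int j) (of_real (real c * Y)) (real c * X + of_int l)" for l
  proof -
    have "of_nat c * Complex X Y + of_int l = Complex (real c * X + of_int l) (real c * Y)"
      by (simp add: complex_eq_iff)
    thus ?thesis using eisenstein_term_kern[OF cY k, of s y "real c * X + of_int l"] by (simp only: \<sigma>_def j_def)
  qed
  hence "eisenstein_row k s y (Complex X Y) c = of_real y powr s *
      (\<Sum>\<^sub>\<infinity>l::int. kern (\<sigma> + of_int j) (\<sigma> - of_int j) (of_real (real c * Y)) (real c * X + of_int l))"
    unfolding eisenstein_row_def by (simp only: infsum_cmult_right')
  also have "(\<Sum>\<^sub>\<infinity>l::int. kern (\<sigma> + of_int j) (\<sigma> - of_int j) (of_real (real c * Y)) (real c * X + of_int l)) =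
      (\<Sum>\<^sub>\<infinity>l::int. kern_hat (\<sigma> + of_int j) (\<sigma> - of_int j) (2 * pi * of_int l) (of_real (real c * Y)) *
         exp (2 * of_real pi * \<i> * of_int l * of_real (real c * X)))"
    by (rule kern_hat_poisson_infsum) (use cY ab in simp_all)
  also have "\<dots> = (\<Sum>\<^sub>\<infinity>l::int. of_nat c powr (1 - 2 * \<sigma>) * eisenstein_coeff \<sigma> j X Y (l * int c))"
  proof (rule infsum_cong)
    fix l :: int
    have 1: "1 - (\<sigma> + of_int j) - (\<sigma> - of_int j) = 1 - 2 * \<sigma>" by simp
    have 2: "real c * (2 * pi * of_int l) = 2 * pi * of_int (l * int c)" by simp
    have 3: "2 * of_real pi * \<i> * of_int l * of_real (real c * X) = 2 * of_real pi * \<i> * of_int (l * int c) * of_real X"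
      by simp
    show "kern_hat (\<sigma> + of_int j) (\<sigma> - of_int j) (2 * pi * of_int l) (of_real (real c * Y)) * exp (2 * of_real pi * \<i> * of_int l * of_real (real c * X)) =
      of_nat c powr (1 - 2 * \<sigma>) * eisenstein_coeff \<sigma> j X Y (l * int c)"
      unfolding kern_hat_scale[OF c0 Y] 1 2 3 eisenstein_coeff_def of_real_of_nat_eq by (simp only: mult.assoc)
  qed
  finally show ?thesis unfolding infsum_cmult_right' \<sigma>_def j_def .
qed

lemma prime_powr_norm_less:
  assumes "p > 1" "Re w < 0"
  shows "norm (of_nat p powr w :: complex) < 1"
proof -
  have "real p powr Re w < real p powr 0" by (rule powr_less_mono) (use assms in auto)
  thus ?thesis using norm_real_powr[of "real p" w] assms by simp
qed

section \<open>The two lattice sums as weighted sums of rows\<close>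

context
  fixes N :: nat and k :: int and s z :: complex and y :: real
  assumes N: "N > 1" "squarefree N" and k: "even k" and y: "y > 0" and z: "Im z > 0" and s: "Re (s + of_int k / 2) > 1"
begin

private abbreviation (input) "\<sigma> \<equiv> s + of_int k / 2"
private abbreviation (input) "T \<equiv> eisenstein_term k s y"
private abbreviation (input) "P \<equiv> prime_factors N"
private abbreviation (input) "\<rho> \<equiv> eisenstein_row k s y z"

private lemma P: "finite P" "\<And>p. p \<in> P \<Longrightarrow> prime p" by auto

private lemma T_scale: "r > 0 \<Longrightarrow> T (of_real r * w) = of_real r powr (- 2 * \<sigma>) * T w"
  using eisenstein_term_scale(1)[OF _ k, of r s y w] by (simp add: algebra_simps)

private lemma T_minus: "T (- w) = T w" by (rule eisenstein_term_scale(2)[OF zero_less_one k])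

private lemma s': "Re s + of_int k / 2 > 1" using s by simp

private lemma lattice_summable:
  assumes "u > 0" "v > 0"
  shows "(\<lambda>p. norm (T (of_real u * of_int (fst p) * z + of_real v * of_int (snd p)))) summable_on UNIV"
  using eisenstein_lattice_summable[OF assms z y s'] by (simp add: case_prod_unfold)

private lemma row_term_summable:
  assumes u: "u > 0"
  shows "(\<lambda>n. norm (T (of_real u * of_int m * z + of_int n))) summable_on A"
proof -
  have "(\<lambda>p. norm (T (of_real u * of_int (fst p) * z + of_real 1 * of_int (snd p)))) summable_on (Pair m ` A)"
    by (rule summable_on_subset_banach[OF lattice_summable[OF u zero_less_one]]) auto
  moreover have "inj_on (Pair m) A" by (auto simp: inj_on_def)
  ultimately show ?thesis by (simp add: summable_on_reindex o_def)
qed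

private lemma row_norm_summable: "(\<lambda>c. norm (\<rho> c)) summable_on {1..}"
proof -
  define F where "F = (\<lambda>(c::nat, l::int). norm (T (of_nat c * z + of_int l)))"
  have inj: "inj_on (\<lambda>(c, l). (int c, l)) ({1..} \<times> UNIV)" by (auto simp: inj_on_def)
  have "(\<lambda>p. norm (T (of_real 1 * of_int (fst p) * z + of_real 1 * of_int (snd p)))) summable_on ((\<lambda>(c, l). (int c, l)) ` ({1..} \<times> UNIV))"
    by (rule summable_on_subset_banach[OF lattice_summable[OF zero_less_one zero_less_one]]) auto
  hence "F summable_on ({1..} \<times> UNIV)"
    unfolding summable_on_reindex[OF inj] by (simp add: o_def case_prod_unfold F_def)
  hence F: "(\<lambda>(c, l). norm (T (of_nat c * z + of_int l))) summable_on ({1..} \<times> UNIV)" by (simp add: F_def)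
  show ?thesis
  proof (rule norm_summable_le)
    show "(\<lambda>c. \<Sum>\<^sub>\<infinity>l. norm (T (of_nat c * z + of_int l))) summable_on {1..}"
      using summable_on_Sigma_banach[OF F] by simp
    show "norm (\<rho> c) \<le> (\<Sum>\<^sub>\<infinity>l. norm (T (of_nat c * z + of_int l)))" for c
      unfolding eisenstein_row_def
      by (rule norm_infsum_bound) (use row_term_summable[OF zero_less_one, of "int c" UNIV] in simp)
  qed
qed

text \<open>Inclusion-exclusion in n. Since N is squarefree, it is the product over X times the
  product over P - X. For n divisible by the product over X, that product can be extracted by
  homogeneity, and a full row remains whose index is the complementary product times m.\<close>

private lemma row_weight:
  assumes m: "m \<ge> 1"
  shows "infsum (\<lambda>n. T (of_nat N * of_nat m * z + of_int n)) {n. coprime n (int N)} =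
    (\<Sum>X\<in>Pow P. (\<Prod>p\<in>X. - (of_nat p powr (- 2 * \<sigma>))) * \<rho> (\<Prod>(P - X) * m))"
proof -
  define f where "f = (\<lambda>n. T (of_nat N * of_nat m * z + of_int n))"
  have f: "(\<lambda>n. norm (f n)) summable_on UNIV"
    using row_term_summable[of "real N" "int m" UNIV] N by (simp add: f_def)
  have "infsum f {n. coprime n (int N)} = infsum (\<lambda>n. f n * (\<Prod>p\<in>P. (-1) * of_bool (int p dvd n) + 1)) UNIV"
    by (rule infsum_cong_neutral) (use N coprime_weight[of N] in auto)
  also have "\<dots> = (\<Sum>X\<in>Pow P. (\<Prod>p\<in>X. -1) * (\<Prod>p\<in>P-X. 1) * infsum f {c\<in>UNIV. \<forall>p\<in>X. int p dvd c})"
    by (rule infsumI, rule weight_expand[OF f P(1)])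
  also have "\<dots> = (\<Sum>X\<in>Pow P. (\<Prod>p\<in>X. - (of_nat p powr (- 2 * \<sigma>))) * \<rho> (\<Prod>(P - X) * m))"
  proof (rule sum.cong[OF refl])
    fix X assume "X \<in> Pow P"
    hence XP: "X \<subseteq> P" by simp
    hence X: "finite X" "\<And>p. p \<in> X \<Longrightarrow> prime p" using finite_subset[OF XP] P by auto
    have pos: "real (\<Prod>X) > 0" using X by (simp only: of_nat_0_less_iff) (auto intro!: prod_pos prime_gt_0_nat)
    have NX: "N = \<Prod>X * \<Prod>(P - X)"
      using squarefree_prod_prime_factors[OF N(2)] prod.subset_diff[OF XP P(1), of "\<lambda>p. p"] by (simp add: mult.commute)
    have "infsum f {c\<in>UNIV. \<forall>p\<in>X. int p dvd c} = (\<Sum>\<^sub>\<infinity>l. f (int (\<Prod>X) * l))"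
      using int_multiples_reindex[OF X, of f] by simp
    also have "\<dots> = (\<Sum>\<^sub>\<infinity>l. of_real (real (\<Prod>X)) powr (- 2 * \<sigma>) * T (of_nat (\<Prod>(P - X) * m) * z + of_int l))"
    proof (rule infsum_cong)
      fix l
      have "of_nat N * of_nat m * z + of_int (int (\<Prod>X) * l) = of_real (real (\<Prod>X)) * (of_nat (\<Prod>(P - X) * m) * z + of_int l)"
        unfolding of_real_of_nat_eq of_int_mult of_int_of_nat_eq
        by (subst NX) (simp add: algebra_simps del: of_nat_prod)
      thus "f (int (\<Prod>X) * l) = of_real (real (\<Prod>X)) powr (- 2 * \<sigma>) * T (of_nat (\<Prod>(P - X) * m) * z + of_int l)"
        unfolding f_def T_scale[OF pos, symmetric] by (rule arg_cong)
    qed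
    also have "\<dots> = (\<Prod>p\<in>X. of_nat p powr (- 2 * \<sigma>)) * \<rho> (\<Prod>(P - X) * m)"
      unfolding infsum_cmult_right' eisenstein_row_def of_real_of_nat_eq nat_powr_prod[OF X(1)] ..
    finally show "(\<Prod>p\<in>X. -1) * (\<Prod>p\<in>P-X. 1) * infsum f {c\<in>UNIV. \<forall>p\<in>X. int p dvd c} =
        (\<Prod>p\<in>X. - (of_nat p powr (- 2 * \<sigma>))) * \<rho> (\<Prod>(P - X) * m)"
      by (simp add: prod_uminus)
  qed
  finally show ?thesis unfolding f_def .
qed

text \<open>With m summed as well, the rows that belong to X are those divisible by all primes of P
  - X. Passing to the complement gives an inclusion-exclusion expansion once more, which closes up
  to a single multiplicative weight on the row index c.\<close>

private lemma row_weight_sum: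
  "(\<Sum>\<^sub>\<infinity>m\<in>{1..}. infsum (\<lambda>n. T (of_nat N * of_nat m * z + of_int n)) {n. coprime n (int N)}) =
     (\<Sum>\<^sub>\<infinity>c\<in>{1..}. \<rho> c * (\<Prod>p\<in>P. of_bool (p dvd c) - of_nat p powr (- 2 * \<sigma>)))"
proof -
  let ?q = "\<lambda>p. of_nat p powr (- 2 * \<sigma>) :: complex"
  have "(\<Sum>\<^sub>\<infinity>m\<in>{1..}. infsum (\<lambda>n. T (of_nat N * of_nat m * z + of_int n)) {n. coprime n (int N)}) =
     (\<Sum>\<^sub>\<infinity>m\<in>{1..}. \<Sum>X\<in>Pow P. (\<Prod>p\<in>X. - ?q p) * \<rho> (\<Prod>(P - X) * m))"
    by (rule infsum_cong) (simp only: row_weight atLeast_iff)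
  also have "\<dots> = (\<Sum>X\<in>Pow P. (\<Prod>p\<in>X. - ?q p) * (\<Sum>\<^sub>\<infinity>m\<in>{1..}. \<rho> (\<Prod>(P - X) * m)))"
  proof (rule infsumI, intro has_sum_finite_sum' has_sum_cmult_right has_sum_infsum)
    fix X assume "X \<in> Pow P"
    have pos: "\<Prod>(P - X) > 0" using P by (auto intro!: prod_pos prime_gt_0_nat)
    hence inj: "inj_on (\<lambda>m. \<Prod>(P - X) * m) {1..}" by (auto simp: inj_on_def)
    have "\<rho> summable_on ((\<lambda>m. \<Prod>(P - X) * m) ` {1..})"
      by (rule norm_summable_subset[OF row_norm_summable]) (use pos in \<open>auto simp: Suc_le_eq\<close>)
    thus "(\<lambda>m. \<rho> (\<Prod>(P - X) * m)) summable_on {1..}"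
      unfolding summable_on_reindex[OF inj] by (simp only: o_def)
  qed (use P in auto)
  also have "\<dots> = (\<Sum>X\<in>Pow P. (\<Prod>p\<in>X. - ?q p) * infsum \<rho> {c\<in>{1..}. \<forall>p\<in>P - X. p dvd c})"
    by (intro sum.cong refl arg_cong2[of _ _ _ _ "\<lambda>u v. u * v"] multiples_reindex[symmetric]) (use P in auto)
  also have "\<dots> = (\<Sum>Y\<in>Pow P. (\<Prod>p\<in>Y. 1) * (\<Prod>p\<in>P - Y. - ?q p) * infsum \<rho> {c\<in>{1..}. \<forall>p\<in>Y. p dvd c})"
    by (rule sum.reindex_bij_witness[of _ "\<lambda>X. P - X" "\<lambda>X. P - X"]) (auto simp: double_diff)
  also have "\<dots> = (\<Sum>\<^sub>\<infinity>c\<in>{1..}. \<rho> c * (\<Prod>p\<in>P. 1 * of_bool (p dvd c) + - ?q p))"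
    by (rule infsumI[symmetric], rule weight_expand[OF row_norm_summable P(1)])
  finally show ?thesis by simp
qed

private lemma row_zero:
  "infsum (\<lambda>n. T (of_int n)) {n. coprime n (int N)} =
     2 * of_real y powr s * dirichlet_zeta (2 * \<sigma>) * (\<Prod>p\<in>P. 1 - of_nat p powr (- 2 * \<sigma>))"
proof -
  define f where "f = (\<lambda>n. T (of_int n) * of_bool (coprime n (int N)))"
  have "(\<lambda>n. norm (T (of_real 1 * of_int 0 * z + of_int n))) summable_on UNIV"
    by (rule row_term_summable) simp
  hence T0: "(\<lambda>n. norm (T (of_int n))) summable_on UNIV" by simp
  have fs: "(\<lambda>n. norm (f n)) summable_on UNIV"
    by (rule norm_summable_le[OF T0]) (simp add: f_def)
  have N0: "N > 0" using N by simp
  have fe: "f (- n) = f n" for n using T_minus[of "of_int n"] by (simp add: f_def)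
  \<comment> \<open>The origin contributes 0, since the summand there is a quotient with denominator
    0.\<close>
  have f0: "f 0 = 0" by (simp add: f_def eisenstein_term_def)
  have "infsum (\<lambda>n. T (of_int n)) {n. coprime n (int N)} = infsum f UNIV"
    by (rule infsum_cong_neutral) (auto simp: f_def)
  also have "\<dots> = 2 * (\<Sum>\<^sub>\<infinity>n\<in>{1..}. f (int n))" using even_int_infsum[OF fs fe] f0 by simp
  also have "(\<Sum>\<^sub>\<infinity>n\<in>{1..}. f (int n)) = (\<Sum>\<^sub>\<infinity>n\<in>{1..}. of_real y powr s * (of_nat n powr (- 2 * \<sigma>) * (\<Prod>p\<in>P. (-1) * of_bool (p dvd n) + 1)))"
  proof (rule infsum_cong)
    fix n :: nat assume "n \<in> {1..}"
    hence n: "real n > 0" by simp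
    have "T (of_real (real n) * 1) = of_real (real n) powr (- 2 * \<sigma>) * T 1" by (rule T_scale[OF n])
    hence "T (of_int (int n)) = of_real y powr s * of_nat n powr (- 2 * \<sigma>)"
      by (simp add: eisenstein_term_def)
    moreover have "(\<Prod>p\<in>P. (-1) * of_bool (p dvd n) + 1) = (of_bool (coprime (int n) (int N)) :: complex)"
      unfolding coprime_weight[OF N0, of "int n", symmetric] by (simp only: int_dvd_int_iff)
    ultimately show "f (int n) = of_real y powr s * (of_nat n powr (- 2 * \<sigma>) * (\<Prod>p\<in>P. (-1) * of_bool (p dvd n) + 1))"
      unfolding f_def by (simp only: mult.assoc)
  qed
  also have "\<dots> = of_real y powr s * (dirichlet_zeta (- (- 2 * \<sigma>)) * (\<Prod>p\<in>P. (-1) * of_nat p powr (- 2 * \<sigma>) + 1))"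
  proof -
    have "(\<Sum>\<^sub>\<infinity>n\<in>{1..}. of_nat n powr (- 2 * \<sigma>) * (\<Prod>p\<in>P. (-1) * of_bool (p dvd n) + 1)) =
        dirichlet_zeta (- (- 2 * \<sigma>)) * (\<Prod>p\<in>P. (-1) * of_nat p powr (- 2 * \<sigma>) + 1)"
      by (rule infsumI, rule zeta_weight) (use s P in auto)
    thus ?thesis unfolding infsum_cmult_right' by (simp only:)
  qed
  also have "- (- 2 * \<sigma>) = 2 * \<sigma>" by simp
  also have "(\<Prod>p\<in>P. (-1) * of_nat p powr (- 2 * \<sigma>) + 1) = (\<Prod>p\<in>P. 1 - of_nat p powr (- 2 * \<sigma>))" by simp
  finally show ?thesis by (simp only: mult.assoc)
qed

lemma lattice_L_sum:
  "infsum (\<lambda>(m, n). T (of_nat N * of_int m * z + of_int n)) (lattice_L N) * (\<Prod>p\<in>P. 1 - of_nat p powr (- 2 * \<sigma>)) =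
     2 * of_real y powr s * dirichlet_zeta (2 * \<sigma>) * (\<Prod>p\<in>P. 1 - of_nat p powr (- 2 * \<sigma>)) +
     2 * (\<Sum>\<^sub>\<infinity>c\<in>{1..}. \<rho> c * (\<Prod>p\<in>P. of_bool (p dvd c) - of_nat p powr (- 2 * \<sigma>)))"
proof -
  define F where "F = (\<lambda>(m, n). T (of_nat N * of_int m * z + of_int n))"
  have Fs: "(\<lambda>p. norm (F p)) summable_on UNIV"
    using lattice_summable[of "real N" 1] N by (simp add: F_def case_prod_unfold)
  have "infsum F (lattice_L N) * (\<Prod>p\<in>P. 1 - of_nat p powr (- 2 * \<sigma>)) = infsum F {(m, n). coprime n (int N)}"
  proof (rule lattice_scaling[OF Fs])
    fix t m n assume t: "t \<ge> (1::nat)"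
    have "of_nat N * of_int (int t * m) * z + of_int (int t * n) = of_real (real t) * (of_nat N * of_int m * z + of_int n)"
      by (simp add: algebra_simps)
    thus "F (int t * m, int t * n) = of_nat t powr (- 2 * \<sigma>) * F (m, n)"
      using T_scale[of "real t"] t unfolding F_def prod.case by (simp only: of_real_of_nat_eq)
  qed (use s N in auto)
  also have "\<dots> = infsum (\<lambda>n. F (0, n)) {n. coprime n (int N)} + 2 * (\<Sum>\<^sub>\<infinity>m\<in>{1..}. infsum (\<lambda>n. F (int m, n)) {n. coprime n (int N)})"
  proof (rule even_lattice_infsum[OF Fs])
    fix m n
    have "of_nat N * of_int (- m) * z + of_int (- n) = - (of_nat N * of_int m * z + of_int n)" by simp
    thus "F (- m, - n) = F (m, n)" unfolding F_def prod.case by (simp only: T_minus)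
  qed simp
  finally show ?thesis using row_zero row_weight_sum by (simp add: F_def)
qed

text \<open>Here the coordinate prime to N multiplies z, so the condition falls on the row index
  itself, and row 0 is absent because N > 1. The factor sqrt N inside the summand becomes
  N^(-\<sigma>).\<close>

lemma lattice_R_sum:
  "infsum (\<lambda>(m, n). T (of_real (sqrt (real N)) * (of_int m * z + of_int n))) (lattice_R N) * (\<Prod>p\<in>P. 1 - of_nat p powr (- 2 * \<sigma>)) =
     2 * of_nat N powr (- \<sigma>) * (\<Sum>\<^sub>\<infinity>c\<in>{1..}. \<rho> c * (\<Prod>p\<in>P. 1 - of_bool (p dvd c)))"
proof -
  define r where "r = sqrt (real N)"
  have r: "r > 0" using N by (simp add: r_def)
  define F where "F = (\<lambda>(m, n). T (of_real r * (of_int m * z + of_int n)))"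
  define F' where "F' = (\<lambda>(m, n). F (n, m))"
  have Fs: "(\<lambda>p. norm (F p)) summable_on UNIV"
    using lattice_summable[OF r r] by (simp add: F_def case_prod_unfold distrib_left mult.assoc)
  have "(\<lambda>p. norm (F p)) summable_on (prod.swap ` UNIV)" using Fs by simp
  hence "(\<lambda>p. norm (F (prod.swap p))) summable_on UNIV"
    by (subst (asm) summable_on_reindex) (auto simp: o_def)
  hence Fs': "(\<lambda>p. norm (F' p)) summable_on UNIV" by (simp add: F'_def case_prod_unfold prod.swap_def)
  have swap: "infsum F {(m, n). D m n} = infsum F' {(m, n). D n m}" for D
  proof -
    have "bij_betw prod.swap {(m, n). D n m} {(m, n). D m n}"
      by (rule bij_betwI[where g = prod.swap]) auto
    from infsum_reindex_bij_betw[OF this, of F] show ?thesis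
      by (simp add: F'_def case_prod_unfold prod.swap_def)
  qed
  have e: "(\<Prod>p\<in>P. 1 - of_bool (p dvd c)) = (of_bool (coprime (int c) (int N)) :: complex)" for c
    using coprime_weight[of N "int c"] N by simp
  have "infsum F (lattice_R N) = infsum F' (lattice_L N)"
  proof -
    have "lattice_R N = {(m, n). (n, m) \<in> lattice_L N}" by (auto simp: lattice_R_iff)
    thus ?thesis using swap[of "\<lambda>m n. (n, m) \<in> lattice_L N"] by simp
  qed
  also have "infsum F' (lattice_L N) * (\<Prod>p\<in>P. 1 - of_nat p powr (- 2 * \<sigma>)) = infsum F' {(m, n). coprime n (int N)}"
  proof (rule lattice_scaling[OF Fs'])
    fix t m n assume t: "t \<ge> (1::nat)"
    have "of_real r * (of_int (int t * n) * z + of_int (int t * m)) = of_real (real t) * (of_real r * (of_int n * z + of_int m))"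
      by (simp add: algebra_simps)
    thus "F' (int t * m, int t * n) = of_nat t powr (- 2 * \<sigma>) * F' (m, n)"
      using T_scale[of "real t"] t unfolding F_def F'_def prod.case by (simp only: of_real_of_nat_eq)
  qed (use s N in auto)
  also have "\<dots> = infsum F {(m, n). coprime m (int N)}" by (simp only: swap)
  also have "\<dots> = infsum (\<lambda>n. F (0, n)) {n. coprime 0 (int N)} + 2 * (\<Sum>\<^sub>\<infinity>m\<in>{1..}. infsum (\<lambda>n. F (int m, n)) {n. coprime (int m) (int N)})"
  proof (rule even_lattice_infsum[OF Fs])
    fix m n
    have "of_real r * (of_int (- m) * z + of_int (- n)) = - (of_real r * (of_int m * z + of_int n))" by (simp add: algebra_simps)
    thus "F (- m, - n) = F (m, n)" unfolding F_def prod.case by (simp only: T_minus)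
  qed simp
  also have "infsum (\<lambda>n. F (0, n)) {n. coprime 0 (int N)} = 0" using N by simp
  also have "(\<Sum>\<^sub>\<infinity>m\<in>{1..}. infsum (\<lambda>n. F (int m, n)) {n. coprime (int m) (int N)}) =
      (\<Sum>\<^sub>\<infinity>m\<in>{1..}. of_nat N powr (- \<sigma>) * (\<rho> m * (\<Prod>p\<in>P. 1 - of_bool (p dvd m))))"
  proof (rule infsum_cong)
    fix m :: nat
    have rN: "of_real r powr (- 2 * \<sigma>) = of_nat N powr (- \<sigma>)"
    proof -
      have 1: "of_nat N = complex_of_real r * of_real r" using N by (simp add: r_def flip: of_real_mult)
      have 2: "- 2 * \<sigma> = - \<sigma> + - \<sigma>" by simp
      have 3: "(of_real r * of_real r) powr (- \<sigma>) = of_real r powr (- \<sigma>) * (of_real r powr (- \<sigma>) :: complex)"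
        by (rule powr_times_real) (use r in simp_all)
      show ?thesis unfolding 1 3 2 powr_add ..
    qed
    have "infsum (\<lambda>n. F (int m, n)) UNIV = of_nat N powr (- \<sigma>) * \<rho> m"
      unfolding F_def prod.case T_scale[OF r] infsum_cmult_right' eisenstein_row_def rN by simp
    thus "infsum (\<lambda>n. F (int m, n)) {n. coprime (int m) (int N)} = of_nat N powr (- \<sigma>) * (\<rho> m * (\<Prod>p\<in>P. 1 - of_bool (p dvd m)))"
      unfolding e by (cases "coprime (int m) (int N)") simp_all
  qed
  finally show ?thesis unfolding F_def r_def infsum_cmult_right' add_0 mult.assoc .
qed

lemma eisenstein_lattice_sum:
  "1 / 2 * infsum (\<lambda>(m, n). T (of_nat N * of_int m * z + of_int n)) (lattice_L N) +
   1 / 2 * infsum (\<lambda>(m, n). T (of_real (sqrt (real N)) * (of_int m * z + of_int n))) (lattice_R N) =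
     of_real y powr s * dirichlet_zeta (2 * \<sigma>) +
     (\<Sum>\<^sub>\<infinity>c\<in>{1..}. \<rho> c * ((\<Prod>p\<in>P. of_bool (p dvd c) - of_nat p powr (- 2 * \<sigma>)) +
        of_nat N powr (- \<sigma>) * (\<Prod>p\<in>P. 1 - of_bool (p dvd c)))) / (\<Prod>p\<in>P. 1 - of_nat p powr (- 2 * \<sigma>))"
    (is "1 / 2 * ?L + 1 / 2 * ?R = ?c + ?S / ?Q")
proof -
  let ?A = "\<lambda>c. \<rho> c * (\<Prod>p\<in>P. of_bool (p dvd c) - of_nat p powr (- 2 * \<sigma>))"
  let ?B = "\<lambda>c. \<rho> c * (\<Prod>p\<in>P. 1 - of_bool (p dvd c))"
  \<comment> \<open>Every p^(-2\<sigma>) has modulus below 1, so the product multiplied onto the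
    lattice sums can be divided out again.\<close>
  have Q: "?Q \<noteq> 0"
  proof -
    have "of_nat p powr (- 2 * \<sigma>) \<noteq> (1 :: complex)" if "p \<in> P" for p
      using prime_powr_norm_less[of p "- 2 * \<sigma>"] P(2)[OF that] s prime_gt_1_nat[of p] by auto
    thus ?thesis using P(1) by (simp add: prod_zero_iff)
  qed
  have A: "?A summable_on {1..}"
    using has_sum_imp_summable[OF weight_expand[OF row_norm_summable P(1), of "\<lambda>p. 1" "\<lambda>p c. p dvd c" "\<lambda>p. - (of_nat p powr (- 2 * \<sigma>))"]]
    by simp
  have B: "?B summable_on {1..}"
    using has_sum_imp_summable[OF weight_expand[OF row_norm_summable P(1), of "\<lambda>p. -1" "\<lambda>p c. p dvd c" "\<lambda>p. 1"]]
    by simp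
  have "?S = (\<Sum>\<^sub>\<infinity>c\<in>{1..}. ?A c + of_nat N powr (- \<sigma>) * ?B c)"
    by (rule infsum_cong) (simp only: distrib_left mult.left_commute)
  also have "\<dots> = infsum ?A {1..} + of_nat N powr (- \<sigma>) * infsum ?B {1..}"
    unfolding infsum_cmult_right'[symmetric] by (rule infsum_add[OF A summable_on_cmult_right[OF B]])
  finally have S: "?S = infsum ?A {1..} + of_nat N powr (- \<sigma>) * infsum ?B {1..}" .
  have "(1 / 2 * ?L + 1 / 2 * ?R) * ?Q = 1 / 2 * (?L * ?Q) + 1 / 2 * (?R * ?Q)" by (simp only: distrib_right mult.assoc)
  also have "\<dots> = ?c * ?Q + ?S"
    unfolding lattice_L_sum lattice_R_sum S by simp
  finally show ?thesis using Q by (simp add: field_simps)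
qed

end

section \<open>Fourier coefficients\<close>

lemma real_powr_exp: "a > 0 \<Longrightarrow> of_real a powr s = (exp (s * of_real (ln a)) :: complex)"
  by (simp add: powr_def Ln_of_real)

lemma eisenstein_coeff_zero:
  assumes \<sigma>: "Re \<sigma> > 1" and Y: "Y > 0"
  shows "eisenstein_coeff \<sigma> j X Y 0 = of_real Y powr (1 - 2 * \<sigma>) * (of_real (sqrt pi) * Gamma (\<sigma> - 1/2) * Gamma \<sigma> * (-1) powi j *
    rGamma (\<sigma> + of_int j) * rGamma (\<sigma> - of_int j))"
proof -
  have "kern_hat (\<sigma> + of_int j) (\<sigma> - of_int j) 0 (of_real (Y * 1)) =
      of_real Y powr (1 - (\<sigma> + of_int j) - (\<sigma> - of_int j)) * kern_hat (\<sigma> + of_int j) (\<sigma> - of_int j) (Y * 0) (of_real 1)"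
    by (rule kern_hat_scale[OF Y zero_less_one])
  moreover have "1 - (\<sigma> + of_int j) - (\<sigma> - of_int j) = 1 - 2 * \<sigma>" by simp
  ultimately have "kern_hat (\<sigma> + of_int j) (\<sigma> - of_int j) 0 (of_real Y) = of_real Y powr (1 - 2 * \<sigma>) * kern_hat (\<sigma> + of_int j) (\<sigma> - of_int j) 0 1"
    by (simp only: mult_1_right mult_zero_right of_real_1)
  thus ?thesis unfolding eisenstein_coeff_def kern_hat_zero_half[OF \<sigma>] by simp
qed

text \<open>A negative n is reflected to |n| with weight i = sgn n * j, and then the Whittaker
  formula applies at \<nu> = 2 \<pi> |n|. The sign (-1)^j is unaffected by the reflection.\<close>

lemma eisenstein_coeff_nonzero:
  assumes \<sigma>: "Re \<sigma> > 1" and Y: "Y > 0" and n: "n \<noteq> 0"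
  shows "eisenstein_coeff \<sigma> j X Y n = (-1) powi j * of_real pi powr \<sigma> * of_int \<bar>n\<bar> powr (\<sigma> - 1) * of_real Y powr (- \<sigma>) *
    rGamma (\<sigma> + of_int (sgn n) * of_int j) * whittaker_W (of_int (sgn n) * of_int j) (\<sigma> - 1/2) (4 * pi * of_int \<bar>n\<bar> * Y) *
    exp (2 * of_real pi * \<i> * of_int n * of_real X)"
proof -
  define i where "i = sgn n * j"
  define \<nu> where "\<nu> = 2 * pi * real_of_int \<bar>n\<bar>"
  define H where "H = 2 * \<nu> * Y"
  have a: "real_of_int \<bar>n\<bar> > 0" using n by simp
  have \<nu>: "\<nu> > 0" using a by (simp add: \<nu>_def)
  have H: "H > 0" using \<nu> Y by (simp add: H_def)
  have J: "kern_hat (\<sigma> + of_int j) (\<sigma> - of_int j) (2 * pi * of_int n) (of_real Y) = kern_hat (\<sigma> + of_int i) (\<sigma> - of_int i) \<nu> (of_real Y)"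
  proof (cases "n > 0")
    case True
    thus ?thesis by (simp add: i_def \<nu>_def)
  next
    case False
    hence "n < 0" using n by simp
    thus ?thesis using kern_hat_reflect[OF Y, of \<sigma> j "2 * pi * of_int n"] by (simp add: i_def \<nu>_def)
  qed
  have sg: "(-1) powi i = ((-1) powi j :: complex)"
    using n by (cases "n > 0") (simp_all add: i_def power_int_minus_one_minus)
  have "of_real H powr \<sigma> * kern_hat (\<sigma> + of_int i) (\<sigma> - of_int i) \<nu> (of_real Y) = kern_whit \<sigma> \<nu> i H"
    using \<nu> by (simp add: kern_whit_def H_def)
  also have "\<dots> = (-1) powi j * 2 * of_real pi * of_real \<nu> powr (2 * \<sigma> - 1) * rGamma (\<sigma> + of_int i) * whittaker_W (of_int i) (\<sigma> - 1/2) H"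
    unfolding kern_whit_whittaker[OF \<sigma> \<nu> H] kern_whit_const_def sg ..
  finally have W: "of_real H powr \<sigma> * kern_hat (\<sigma> + of_int i) (\<sigma> - of_int i) \<nu> (of_real Y) =
     (-1) powi j * (2 * of_real pi * of_real \<nu> powr (2 * \<sigma> - 1)) * rGamma (\<sigma> + of_int i) * whittaker_W (of_int i) (\<sigma> - 1/2) H"
    by (simp only: mult.assoc)
  \<comment> \<open>The powers of 2, \<pi>, |n| and Y on both sides are compared for H = 4 \<pi> |n|
    Y; all bases are positive, so it suffices to compare logarithms.\<close>
  have P: "2 * of_real pi * of_real \<nu> powr (2 * \<sigma> - 1) = of_real H powr \<sigma> * (of_real pi powr \<sigma> * of_int \<bar>n\<bar> powr (\<sigma> - 1) * of_real Y powr (- \<sigma>))"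
  proof -
    have l\<nu>: "ln \<nu> = ln 2 + ln pi + ln (real_of_int \<bar>n\<bar>)" unfolding \<nu>_def using a by (simp add: ln_mult)
    have lH: "ln H = ln 2 + ln \<nu> + ln Y" unfolding H_def using \<nu> Y by (simp add: ln_mult)
    have n': "complex_of_int \<bar>n\<bar> = of_real (real_of_int \<bar>n\<bar>)" by (rule of_real_of_int_eq[symmetric])
    have "2 * of_real pi = exp (complex_of_real (ln 2 + ln pi))"
      unfolding exp_of_real by (simp add: exp_add)
    hence "2 * of_real pi * of_real \<nu> powr (2 * \<sigma> - 1) = exp (of_real (ln 2 + ln pi) + (2 * \<sigma> - 1) * of_real (ln \<nu>))"
      unfolding real_powr_exp[OF \<nu>] exp_add by (simp only:)
    also have "of_real (ln 2 + ln pi) + (2 * \<sigma> - 1) * of_real (ln \<nu>) =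
        \<sigma> * of_real (ln H) + (\<sigma> * of_real (ln pi) + (\<sigma> - 1) * of_real (ln (real_of_int \<bar>n\<bar>)) + (- \<sigma>) * of_real (ln Y))"
      unfolding lH l\<nu> by (simp add: algebra_simps)
    also have "exp \<dots> = of_real H powr \<sigma> * (of_real pi powr \<sigma> * of_int \<bar>n\<bar> powr (\<sigma> - 1) * of_real Y powr (- \<sigma>))"
      unfolding n' real_powr_exp[OF H] real_powr_exp[OF pi_gt_zero] real_powr_exp[OF a] real_powr_exp[OF Y] exp_add ..
    finally show ?thesis .
  qed
  have H0: "of_real H powr \<sigma> \<noteq> 0" using H by simp
  have "of_real H powr \<sigma> * kern_hat (\<sigma> + of_int i) (\<sigma> - of_int i) \<nu> (of_real Y) =
     of_real H powr \<sigma> * ((-1) powi j * of_real pi powr \<sigma> * of_int \<bar>n\<bar> powr (\<sigma> - 1) * of_real Y powr (- \<sigma>) * rGamma (\<sigma> + of_int i) * whittaker_W (of_int i) (\<sigma> - 1/2) H)"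
    unfolding W P by (simp only: mult_ac)
  hence JW: "kern_hat (\<sigma> + of_int i) (\<sigma> - of_int i) \<nu> (of_real Y) =
     (-1) powi j * of_real pi powr \<sigma> * of_int \<bar>n\<bar> powr (\<sigma> - 1) * of_real Y powr (- \<sigma>) * rGamma (\<sigma> + of_int i) * whittaker_W (of_int i) (\<sigma> - 1/2) H"
    unfolding mult_left_cancel[OF H0] .
  have H4: "H = 4 * pi * of_int \<bar>n\<bar> * Y" by (simp add: H_def \<nu>_def)
  show ?thesis unfolding eisenstein_coeff_def J JW by (simp only: i_def H4 of_int_mult)
qed

section \<open>Local factors of the divisor sums\<close>

text \<open>Pairing each divisor with its cofactor changes the exponent from u to -u, the form in
  which the Lambert series delivers the divisor function.\<close>

lemma divisor_sigma_inverse: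
  assumes n: "n \<noteq> 0"
  shows "divisor_sigma u n = of_int \<bar>n\<bar> powr u * (\<Sum>c | c dvd nat \<bar>n\<bar>. of_nat c powr (- u))"
proof -
  define m where "m = nat \<bar>n\<bar>"
  have m: "m > 0" and nm: "\<bar>n\<bar> = int m" using n by (auto simp: m_def)
  have "divisor_sigma u n = (\<Sum>c | c dvd m. of_nat (m div c) powr u)"
    unfolding divisor_sigma_def
  proof (rule sum.reindex_bij_witness[of _ "\<lambda>c. int (m div c)" "\<lambda>d. m div nat d"])
    fix d assume "d \<in> {d. d > 0 \<and> d dvd n}"
    hence d: "d > 0" "d dvd n" by auto
    have "nat d dvd m" using d unfolding m_def by (simp add: nat_dvd_iff)
    then obtain c where c: "m = nat d * c" by (rule dvdE)
    have c0: "c > 0" using c m by (cases "c = 0") auto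
    show "int (m div (m div nat d)) = d" using c c0 d by simp
    show "m div nat d \<in> {c. c dvd m}" using c d by simp
    show "of_nat (m div (m div nat d)) powr u = of_int d powr u" using c c0 d by simp
  next
    fix c assume "c \<in> {c. c dvd m}"
    then obtain e where e: "m = c * e" by auto
    have ce: "c > 0" "e > 0" using e m by auto
    show "m div nat (int (m div c)) = c" using e ce by simp
    have "int e dvd n" using e by (simp flip: dvd_nat_abs_iff add: m_def[symmetric])
    thus "int (m div c) \<in> {d. d > 0 \<and> d dvd n}" using e ce by simp
  qed
  also have "\<dots> = (\<Sum>c | c dvd m. of_nat m powr u * of_nat c powr (- u))"
  proof (rule sum.cong[OF refl])
    fix c assume "c \<in> {c. c dvd m}"
    then obtain e where e: "m = c * e" by auto
    have ce: "c > 0" "e > 0" using e m by auto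
    have "of_nat c powr u * of_nat c powr (- u) = (1 :: complex)" using ce by (simp flip: powr_add)
    hence "of_nat m powr u * of_nat c powr (- u) = (of_nat e powr u :: complex)"
      unfolding e nat_powr_mult by (simp add: mult_ac)
    thus "of_nat (m div c) powr u = (of_nat m powr u * of_nat c powr (- u) :: complex)" using e ce by simp
  qed
  finally show ?thesis unfolding sum_distrib_left[symmetric] nm by simp
qed

lemma multiplicity_int_abs:
  assumes p: "prime p" and n: "n \<noteq> 0"
  shows "multiplicity (int p) n = multiplicity p (nat \<bar>n\<bar>)"
proof (rule multiplicity_eqI)
  have m: "nat \<bar>n\<bar> \<noteq> 0" "\<not> is_unit p" using n p by auto
  show "int p ^ multiplicity p (nat \<bar>n\<bar>) dvd n"
    using multiplicity_dvd[of p "nat \<bar>n\<bar>"] unfolding dvd_nat_abs_iff of_nat_power .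
  have "\<not> p ^ Suc (multiplicity p (nat \<bar>n\<bar>)) dvd nat \<bar>n\<bar>"
    using m by (subst power_dvd_iff_le_multiplicity) auto
  thus "\<not> int p ^ Suc (multiplicity p (nat \<bar>n\<bar>)) dvd n" unfolding dvd_nat_abs_iff of_nat_power .
qed

text \<open>The negative part -p^(i(1+e)+e) of the term i meets the positive part p^((i+1)(1+e)),
  which is p times p^(i(1+e)+e), of the term i + 1; together they give (p - 1) p^(i+(i+1)e). The
  last negative part is left over. This is the origin of the numerator of
  \<open>eisenstein_fb\<close>.\<close>

lemma local_factor_sum:
  assumes p: "p > 0"
  shows "(\<Sum>i\<le>v. of_nat p powr (of_nat i * (1 + e)) * (of_bool (i > 0) - of_nat p powr e)) =
     (\<Sum>i=1..v. (of_nat p - 1) * of_nat p powr (of_nat i - 1 + of_nat i * e)) - (of_nat p powr (of_nat v + (of_nat v + 1) * e) :: complex)"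
proof (induction v)
  case 0
  show ?case using p by simp
next
  case (Suc v)
  let ?x = "of_nat p :: complex"
  let ?A = "?x powr (of_nat (Suc v) * (1 + e))"
  have 1: "of_nat (Suc v) - 1 + of_nat (Suc v) * e = of_nat v + (of_nat v + 1) * e"
    "of_nat (Suc v) + (of_nat (Suc v) + 1) * e = of_nat (Suc v) * (1 + e) + e"
    "of_nat (Suc v) * (1 + e) = 1 + (of_nat v + (of_nat v + 1) * e)"
    by (simp_all add: algebra_simps)
  have 2: "?A = ?x * ?x powr (of_nat v + (of_nat v + 1) * e)"
  proof -
    have x1: "?x powr 1 = ?x" by simp
    show ?thesis unfolding 1(3) by (subst powr_add) (simp only: x1)
  qed
  have 3: "?x powr (of_nat (Suc v) + (of_nat (Suc v) + 1) * e) = ?A * ?x powr e"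
    unfolding 1(2) powr_add ..
  have "(\<Sum>i\<le>Suc v. ?x powr (of_nat i * (1 + e)) * (of_bool (i > 0) - ?x powr e)) =
     (\<Sum>i=1..v. (?x - 1) * ?x powr (of_nat i - 1 + of_nat i * e)) - ?x powr (of_nat v + (of_nat v + 1) * e) + ?A * (1 - ?x powr e)"
    unfolding sum.atMost_Suc Suc.IH by simp
  also have "\<dots> = (\<Sum>i=1..Suc v. (?x - 1) * ?x powr (of_nat i - 1 + of_nat i * e)) - ?x powr (of_nat (Suc v) + (of_nat (Suc v) + 1) * e)"
  proof -
    have "(\<Sum>i=1..Suc v. (?x - 1) * ?x powr (of_nat i - 1 + of_nat i * e)) =
        (\<Sum>i=1..v. (?x - 1) * ?x powr (of_nat i - 1 + of_nat i * e)) + (?x - 1) * ?x powr (of_nat v + (of_nat v + 1) * e)"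
      by (simp only: sum.cl_ivl_Suc 1(1)) simp
    thus ?thesis unfolding 3 unfolding 2 by (simp add: algebra_simps)
  qed
  finally show ?case .
qed

text \<open>For a ratio r of modulus below 1, the geometric sum times 1 - r equals 1 - r^(v+1),
  which is not 0. This permits division by the truncated zeta factor.\<close>

lemma powr_geometric_nonzero:
  assumes "p > 1" "Re w < 0"
  shows "(\<Sum>i\<le>v. of_nat p powr (of_nat i * w)) \<noteq> (0 :: complex)"
proof
  let ?r = "of_nat p powr w :: complex"
  assume a: "(\<Sum>i\<le>v. of_nat p powr (of_nat i * w)) = (0 :: complex)"
  have r: "norm ?r < 1" by (rule prime_powr_norm_less[OF assms])
  have "of_nat p powr (of_nat i * w) = ?r ^ i" for i
    using assms by (simp add: powr_def mult.assoc exp_of_nat_mult)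
  hence "(\<Sum>i\<le>v. ?r ^ i) = 0" using a by simp
  hence "1 - ?r ^ Suc v = 0" using sum_gp_basic[of ?r v] by simp
  hence "?r ^ Suc v = 1" by (simp only: right_minus_eq)
  hence "norm ?r ^ Suc v = 1" unfolding norm_power[symmetric] by (simp only: norm_one)
  moreover have "norm ?r ^ Suc v \<le> norm ?r ^ 1" by (rule power_decreasing) (use r in auto)
  ultimately show False using r by simp
qed

text \<open>The divisor sums from the two lattices and the divisor function itself share the factor
  R from divisors prime to N; their local parts are A, 1 and L. Dividing by the divisor function and
  by Q leaves (N^\<sigma> A + 1)/(Q L), and with e = -2\<sigma> this is \<open>eisenstein_fb\<close>
  at 1 - k - s.\<close>

lemma divisor_sum_fb:
  assumes N: "N > 1" and n: "n \<noteq> 0" and \<sigma>: "\<sigma> = s + of_int k / 2" "Re \<sigma> > 1"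
  shows "of_int \<bar>n\<bar> powr (2 * \<sigma> - 1) * (of_nat N powr \<sigma> * (\<Sum>c | c dvd nat \<bar>n\<bar>. of_nat c powr (1 - 2 * \<sigma>) *
      ((\<Prod>p\<in>prime_factors N. of_bool (p dvd c) - of_nat p powr (- 2 * \<sigma>)) +
        of_nat N powr (- \<sigma>) * (\<Prod>p\<in>prime_factors N. 1 - of_bool (p dvd c))))) /
      (\<Prod>p\<in>prime_factors N. 1 - of_nat p powr (- 2 * \<sigma>)) =
    divisor_sigma (2 * s + of_int k - 1) n * eisenstein_fb N k n (1 - of_int k - s)"
proof -
  let ?P = "prime_factors N"
  define w where "w = 1 - 2 * \<sigma>"
  define e where "e = - 2 * \<sigma>"
  define m where "m = nat \<bar>n\<bar>"
  define v where "v = (\<lambda>p. multiplicity p m)"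
  define R where "R = (\<Sum>c | c dvd m \<and> (\<forall>p\<in>?P. \<not> p dvd c). of_nat c powr w :: complex)"
  define A where "A = (\<Prod>p\<in>?P. (\<Sum>i=1..v p. (of_nat p - 1) * of_nat p powr (of_nat i - 1 + of_nat i * e)) - (of_nat p powr (of_nat (v p) + (of_nat (v p) + 1) * e) :: complex))"
  define L where "L = (\<Prod>p\<in>?P. \<Sum>i\<le>v p. of_nat p powr (of_nat i * w) :: complex)"
  define Q where "Q = (\<Prod>p\<in>?P. 1 - of_nat p powr e :: complex)"
  have P: "finite ?P" "\<And>p. p \<in> ?P \<Longrightarrow> prime p" by auto
  have m0: "m > 0" using n by (simp add: m_def)
  have N0: "of_nat N \<noteq> (0 :: complex)" using N by simp
  have we: "w = 1 + e" by (simp add: w_def e_def)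
  have vp: "v p = multiplicity p m" for p by (simp add: v_def)
  note ds = divisor_sum_local[OF P m0, of w, folded R_def, folded vp]
  have S1: "(\<Sum>c | c dvd m. of_nat c powr w * (\<Prod>p\<in>?P. of_bool (p dvd c) - of_nat p powr e)) = A * R"
  proof -
    have "(\<Prod>p\<in>?P. \<Sum>i\<le>v p. of_nat p powr (of_nat i * w) * (of_bool (i > 0) - of_nat p powr e)) = A"
      unfolding A_def we by (intro prod.cong refl local_factor_sum) (use P prime_gt_0_nat in auto)
    thus ?thesis using ds[of "\<lambda>p b. of_bool b - of_nat p powr e"] by simp
  qed
  have S2: "(\<Sum>c | c dvd m. of_nat c powr w * (\<Prod>p\<in>?P. 1 - of_bool (p dvd c))) = R"
  proof -
    have "(\<Sum>i\<le>v p. of_nat p powr (of_nat i * w) * (1 - of_bool (i > 0))) = (1 :: complex)" if "p \<in> ?P" for p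
    proof -
      have "(\<Sum>i\<le>v p. of_nat p powr (of_nat i * w) * (1 - of_bool (i > 0))) = (\<Sum>i\<in>{0}. of_nat p powr (of_nat i * w) * (1 - of_bool (i > 0)))"
        by (rule sum.mono_neutral_right) auto
      also have "\<dots> = 1" using P(2)[OF that] by (auto simp: prime_gt_0_nat)
      finally show ?thesis .
    qed
    hence "(\<Prod>p\<in>?P. \<Sum>i\<le>v p. of_nat p powr (of_nat i * w) * (1 - of_bool (i > 0))) = (1 :: complex)"
      by (intro prod.neutral) blast
    thus ?thesis using ds[of "\<lambda>p b. 1 - of_bool b"] by simp
  qed
  have S3: "(\<Sum>c | c dvd m. of_nat c powr w) = L * R"
    using ds[of "\<lambda>p b. 1"] by (simp add: L_def)
  have "(\<Sum>c | c dvd m. of_nat c powr w * ((\<Prod>p\<in>?P. of_bool (p dvd c) - of_nat p powr e) + of_nat N powr (- \<sigma>) * (\<Prod>p\<in>?P. 1 - of_bool (p dvd c)))) =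
     (\<Sum>c | c dvd m. of_nat c powr w * (\<Prod>p\<in>?P. of_bool (p dvd c) - of_nat p powr e)) +
     of_nat N powr (- \<sigma>) * (\<Sum>c | c dvd m. of_nat c powr w * (\<Prod>p\<in>?P. 1 - of_bool (p dvd c)))"
    unfolding sum_distrib_left sum.distrib[symmetric] by (intro sum.cong refl) (simp only: distrib_left mult.left_commute)
  also have "\<dots> = (A + of_nat N powr (- \<sigma>)) * R" unfolding S1 S2 by (simp only: distrib_right)
  finally have D: "of_nat N powr \<sigma> * (\<Sum>c | c dvd m. of_nat c powr w * ((\<Prod>p\<in>?P. of_bool (p dvd c) - of_nat p powr e) + of_nat N powr (- \<sigma>) * (\<Prod>p\<in>?P. 1 - of_bool (p dvd c)))) =
     (of_nat N powr \<sigma> * A + of_nat N powr (\<sigma> + - \<sigma>)) * R"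
    unfolding powr_add by (simp only: distrib_left distrib_right mult.assoc)
  have L0: "L \<noteq> 0"
  proof -
    have "(\<Sum>i\<le>v p. of_nat p powr (of_nat i * w)) \<noteq> (0 :: complex)" if "p \<in> ?P" for p
      by (rule powr_geometric_nonzero) (use P(2)[OF that] prime_gt_1_nat \<sigma> in \<open>auto simp: w_def\<close>)
    thus ?thesis unfolding L_def using P(1) by (simp add: prod_zero_iff)
  qed
  have ds': "divisor_sigma (2 * s + of_int k - 1) n = of_int \<bar>n\<bar> powr (2 * \<sigma> - 1) * (L * R)"
  proof -
    have 1: "2 * s + of_int k - 1 = 2 * \<sigma> - 1" "- (2 * \<sigma> - 1) = w" by (simp_all add: \<sigma> w_def)
    show ?thesis unfolding divisor_sigma_inverse[OF n] 1 m_def[symmetric] S3 ..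
  qed
  have fb: "eisenstein_fb N k n (1 - of_int k - s) = (of_nat N powr \<sigma> * A + 1) / (Q * L)"
  proof -
    have 1: "- (1 - of_int k - s - 1) - of_int k / 2 = \<sigma>" "2 * (1 - of_int k - s) + of_int k - 2 = e"
      "- 2 * (1 - of_int k - s) - of_int k + 2 = 2 * \<sigma>" "- 2 * (1 - of_int k - s) - of_int k + 1 = - w"
      by (simp_all add: \<sigma> e_def w_def field_simps)
    have 2: "multiplicity (int p) n = v p" if "p \<in> ?P" for p
      unfolding v_def m_def by (rule multiplicity_int_abs[OF P(2)[OF that] n])
    have 3: "local_zeta_inverse p (2 * \<sigma>) = 1 - of_nat p powr e" for p
      by (simp add: local_zeta_inverse_def e_def)
    have 4: "local_zeta_trunc p (- w) u = (\<Sum>i\<le>u. of_nat p powr (of_nat i * w))" for p u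
      by (simp add: local_zeta_trunc_def)
    show ?thesis unfolding eisenstein_fb_def Let_def 1 A_def L_def Q_def prod.distrib[symmetric]
      by (intro arg_cong2[of _ _ _ _ "\<lambda>u v. u / v"] arg_cong2[of _ _ _ _ "\<lambda>u v. u + v"] arg_cong2[of _ _ _ _ "\<lambda>u v. u * v"] refl prod.cong) (simp_all only: 2 3 4)
  qed
  have pw: "of_nat N powr (\<sigma> + - \<sigma>) = (1 :: complex)" using N0 by simp
  show ?thesis
    unfolding w_def[symmetric] e_def[symmetric] m_def[symmetric] D pw ds' fb Q_def[symmetric]
  proof -
    have "x * (B * R) / Q = x * (L * R) * (B / (Q * L))" for x B
    proof -
      have "x * (L * R) * (B / (Q * L)) = (L * inverse L) * (x * (B * R) / Q)"
        unfolding divide_inverse inverse_mult_distrib by (simp only: mult_ac)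
      thus ?thesis using L0 by simp
    qed
    thus "of_int \<bar>n\<bar> powr (2 * \<sigma> - 1) * ((of_nat N powr \<sigma> * A + 1) * R) / Q =
        of_int \<bar>n\<bar> powr (2 * \<sigma> - 1) * (L * R) * ((of_nat N powr \<sigma> * A + 1) / (Q * L))" .
  qed
qed

section \<open>The Fourier expansion\<close>

text \<open>At the point z' = z / sqrt N both lattices consist of integral rows: sqrt N m z + n = N
  m z' + n and m z + sqrt N n = sqrt N (m z' + n). The coefficient D collects the row weights of all
  c dividing n, and Q undoes the extension of the lattices to all pairs with one coordinate prime to
  N.\<close>

lemma eisenstein_G_expansion:
  fixes N :: nat and k :: int and s :: complex and x y :: real
  defines "\<sigma> \<equiv> s + of_int k / 2" and "X \<equiv> x / sqrt (real N)" and "Y \<equiv> y / sqrt (real N)"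
  defines "Q \<equiv> \<Prod>p\<in>prime_factors N. 1 - of_nat p powr (- 2 * \<sigma>) :: complex"
    and "a \<equiv> eisenstein_coeff \<sigma> (k div 2) X Y"
    and "D \<equiv> \<lambda>n. \<Sum>c | c dvd nat \<bar>n\<bar>. of_nat c powr (1 - 2 * \<sigma>) *
      ((\<Prod>p\<in>prime_factors N. of_bool (p dvd c) - of_nat p powr (- 2 * \<sigma>)) +
        of_nat N powr (- \<sigma>) * (\<Prod>p\<in>prime_factors N. 1 - of_bool (p dvd c))) :: complex"
  assumes N: "N > 1" "squarefree N" and k: "even k" and y: "y > 0" and s: "Re \<sigma> > 1"
  shows "(\<lambda>n. D n * a n) summable_on {n. n \<noteq> 0}"
    and "eisenstein_G N k (Complex x y) s = of_real y powr s * (dirichlet_zeta (2 * \<sigma>) +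
      (dirichlet_zeta (2 * \<sigma> - 1) * ((\<Prod>p\<in>prime_factors N. of_nat p powr (1 - 2 * \<sigma>) - of_nat p powr (- 2 * \<sigma>)) +
         of_nat N powr (- \<sigma>) * (\<Prod>p\<in>prime_factors N. 1 - of_nat p powr (1 - 2 * \<sigma>))) * a 0 +
       (\<Sum>\<^sub>\<infinity>n\<in>{n. n \<noteq> 0}. D n * a n)) / Q)"
proof -
  let ?P = "prime_factors N"
  define r where "r = sqrt (real N)"
  define z where "z = Complex X Y"
  define w where "w = 1 - 2 * \<sigma>"
  define g where "g = (\<lambda>c. (\<Prod>p\<in>?P. of_bool (p dvd c) - of_nat p powr (- 2 * \<sigma>)) + of_nat N powr (- \<sigma>) * (\<Prod>p\<in>?P. 1 - of_bool (p dvd c)) :: complex)"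
  have r: "r > 0" "r * r = real N" using N by (simp_all add: r_def)
  have Y: "Y > 0" using y r by (simp add: Y_def r_def)
  have z: "Im z > 0" using Y by (simp add: z_def)
  have w: "Re w < - 1" using s by (simp add: w_def)
  have P: "finite ?P" "\<And>p. p \<in> ?P \<Longrightarrow> prime p" by auto
  have rz: "Complex x y = of_real r * z"
    using r by (simp add: z_def X_def Y_def r_def[symmetric] complex_eq_iff)
  have s': "Re (s + of_int k / 2) > 1" using s by (simp add: \<sigma>_def)
  have L: "of_real r * of_int m * Complex x y + of_int n = of_nat N * of_int m * z + of_int n" for m n
  proof -
    have "of_real r * of_real r = (of_nat N :: complex)" using r(2) by (metis of_real_mult of_real_of_nat_eq)
    thus ?thesis unfolding rz by (metis mult.assoc mult.commute)
  qed
  have R: "of_int m * Complex x y + of_real r * of_int n = of_real r * (of_int m * z + of_int n)" for m n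
    unfolding rz by (simp add: algebra_simps)
  have G: "eisenstein_G N k (Complex x y) s =
     1 / 2 * infsum (\<lambda>(m, n). eisenstein_term k s y (of_nat N * of_int m * z + of_int n)) (lattice_L N) +
     1 / 2 * infsum (\<lambda>(m, n). eisenstein_term k s y (of_real (sqrt (real N)) * (of_int m * z + of_int n))) (lattice_R N)"
    unfolding eisenstein_G_def r_def[symmetric] L R complex.sel ..
  define K where "K = of_real y powr s"
  \<comment> \<open>Quadratic decay in the frequency, a by-product of Poisson summation, is the
    bound that the rearrangement into divisor sums requires.\<close>
  obtain K0 where K0: "\<And>\<nu>. \<nu>\<^sup>2 * norm (kern_hat (\<sigma> + of_int (k div 2)) (\<sigma> - of_int (k div 2)) \<nu> (of_real Y)) \<le> K0"
    using kern_hat_decay[of "of_real Y" "\<sigma> + of_int (k div 2)" "\<sigma> - of_int (k div 2)"] Y s by auto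
  have a_bound: "norm (a n) \<le> K0 / (of_int n)\<^sup>2" if "n \<noteq> 0" for n
  proof -
    define J where "J = norm (kern_hat (\<sigma> + of_int (k div 2)) (\<sigma> - of_int (k div 2)) (2 * pi * of_int n) (of_real Y))"
    have J0: "J \<ge> 0" by (simp add: J_def)
    have n2: "(real_of_int n)\<^sup>2 > 0" using that by simp
    have "1 \<le> 2 * pi" using pi_ge_two by linarith
    hence "1 \<le> (2 * pi)\<^sup>2" by (rule one_le_power)
    hence "1 * ((real_of_int n)\<^sup>2 * J) \<le> (2 * pi)\<^sup>2 * ((real_of_int n)\<^sup>2 * J)"
      by (rule mult_right_mono) (use J0 in simp)
    also have "\<dots> = (2 * pi * of_int n)\<^sup>2 * J" by (simp only: power_mult_distrib mult.assoc)
    also have "\<dots> \<le> K0" unfolding J_def by (rule K0)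
    finally have "J * (real_of_int n)\<^sup>2 \<le> K0" by (simp only: mult_1_left mult.commute)
    moreover have "norm (a n) = J"
    proof -
      have "2 * of_real pi * \<i> * of_int n * of_real X = \<i> * of_real (2 * pi * of_int n * X)" by simp
      thus ?thesis unfolding a_def eisenstein_coeff_def norm_mult J_def by (simp only: norm_exp_i_times mult_1_right)
    qed
    ultimately show ?thesis using n2 by (simp add: pos_le_divide_eq)
  qed
  define B where "B = (\<Prod>p\<in>?P. 1 + norm (of_nat p powr (- 2 * \<sigma>) :: complex)) + norm (of_nat N powr (- \<sigma>) :: complex) * (\<Prod>p\<in>?P. 1)"
  have g_bound: "norm (g c) \<le> B" for c
  proof -
    have "norm (\<Prod>p\<in>?P. of_bool (p dvd c) - of_nat p powr (- 2 * \<sigma>) :: complex) \<le> (\<Prod>p\<in>?P. 1 + norm (of_nat p powr (- 2 * \<sigma>) :: complex))"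
      unfolding prod_norm[symmetric]
      by (intro prod_mono conjI norm_ge_zero order_trans[OF norm_triangle_ineq4] add_right_mono) auto
    moreover have "norm (\<Prod>p\<in>?P. 1 - of_bool (p dvd c) :: complex) \<le> (\<Prod>p\<in>?P. 1)"
      unfolding prod_norm[symmetric] by (intro prod_mono) auto
    hence "norm (of_nat N powr (- \<sigma>) * (\<Prod>p\<in>?P. 1 - of_bool (p dvd c)) :: complex) \<le> norm (of_nat N powr (- \<sigma>) :: complex) * (\<Prod>p\<in>?P. 1)"
      unfolding norm_mult by (rule mult_left_mono[OF _ norm_ge_zero])
    ultimately show ?thesis unfolding g_def B_def
      by (intro order_trans[OF norm_triangle_ineq] add_mono)
  qed
  have Dg: "D n = (\<Sum>c | c dvd nat \<bar>n\<bar>. of_nat c powr w * g c)" for n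
    unfolding D_def g_def w_def ..
  show "(\<lambda>n. D n * a n) summable_on {n. n \<noteq> 0}"
    unfolding Dg by (rule lambert_summable[OF a_bound g_bound w])
  have row: "eisenstein_row k s y z c * g c = K * (of_nat c powr w * g c * (\<Sum>\<^sub>\<infinity>l. a (l * int c)))" if "c \<in> {1..}" for c
    unfolding z_def eisenstein_row_eq[OF that[unfolded atLeast_iff] Y k s'] \<sigma>_def[symmetric] a_def[symmetric] w_def[symmetric] K_def[symmetric]
    by (simp only: mult_ac)
  have "(\<Sum>\<^sub>\<infinity>c\<in>{1..}. eisenstein_row k s y z c * g c) = (\<Sum>\<^sub>\<infinity>c\<in>{1..}. K * (of_nat c powr w * g c * (\<Sum>\<^sub>\<infinity>l. a (l * int c))))"
    by (rule infsum_cong) (rule row)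
  also have "\<dots> = K * (\<Sum>\<^sub>\<infinity>c\<in>{1..}. of_nat c powr w * g c * (\<Sum>\<^sub>\<infinity>l. a (l * int c)))"
    by (rule infsum_cmult_right')
  also have "(\<Sum>\<^sub>\<infinity>c\<in>{1..}. of_nat c powr w * g c * (\<Sum>\<^sub>\<infinity>l. a (l * int c))) =
      (\<Sum>\<^sub>\<infinity>c\<in>{1..}. of_nat c powr w * g c) * a 0 + (\<Sum>\<^sub>\<infinity>n\<in>{n. n \<noteq> 0}. D n * a n)"
    unfolding Dg by (rule lambert_infsum[OF a_bound g_bound w])
  finally have S: "(\<Sum>\<^sub>\<infinity>c\<in>{1..}. eisenstein_row k s y z c * g c) =
      K * ((\<Sum>\<^sub>\<infinity>c\<in>{1..}. of_nat c powr w * g c) * a 0 + (\<Sum>\<^sub>\<infinity>n\<in>{n. n \<noteq> 0}. D n * a n))" .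
  \<comment> \<open>Every row contributes to \<open>a 0\<close>, so its coefficient is a full
    Dirichlet series with local weights, not a finite divisor sum.\<close>
  have Z: "(\<Sum>\<^sub>\<infinity>c\<in>{1..}. of_nat c powr w * g c) = dirichlet_zeta (2 * \<sigma> - 1) *
      ((\<Prod>p\<in>?P. of_nat p powr w - of_nat p powr (- 2 * \<sigma>)) + of_nat N powr (- \<sigma>) * (\<Prod>p\<in>?P. 1 - of_nat p powr w))"
  proof -
    have mw: "- w = 2 * \<sigma> - 1" by (simp add: w_def)
    have 1: "((\<lambda>c. of_nat c powr w * (\<Prod>p\<in>?P. of_bool (p dvd c) - of_nat p powr (- 2 * \<sigma>))) has_sum
        dirichlet_zeta (- w) * (\<Prod>p\<in>?P. of_nat p powr w - of_nat p powr (- 2 * \<sigma>))) {1..}"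
      using zeta_weight[OF w P, of "\<lambda>p. 1" "\<lambda>p. - (of_nat p powr (- 2 * \<sigma>))"] by simp
    have 2: "((\<lambda>c. of_nat c powr w * (\<Prod>p\<in>?P. 1 - of_bool (p dvd c))) has_sum
        dirichlet_zeta (- w) * (\<Prod>p\<in>?P. 1 - of_nat p powr w)) {1..}"
      using zeta_weight[OF w P, of "\<lambda>p. -1" "\<lambda>p. 1"] by simp
    have "((\<lambda>c. of_nat c powr w * g c) has_sum (dirichlet_zeta (- w) * (\<Prod>p\<in>?P. of_nat p powr w - of_nat p powr (- 2 * \<sigma>)) +
        of_nat N powr (- \<sigma>) * (dirichlet_zeta (- w) * (\<Prod>p\<in>?P. 1 - of_nat p powr w)))) {1..}"
      unfolding g_def distrib_left mult.left_commute[of "of_nat _ powr w"]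
      by (rule has_sum_add[OF 1 has_sum_cmult_right[OF 2]])
    from infsumI[OF this] show ?thesis unfolding mw by (simp only: distrib_left mult.left_commute)
  qed
  have "eisenstein_G N k (Complex x y) s = K * dirichlet_zeta (2 * \<sigma>) + (\<Sum>\<^sub>\<infinity>c\<in>{1..}. eisenstein_row k s y z c * g c) / Q"
    unfolding G g_def Q_def K_def \<sigma>_def by (rule eisenstein_lattice_sum[OF N k y z s'])
  thus "eisenstein_G N k (Complex x y) s = of_real y powr s * (dirichlet_zeta (2 * \<sigma>) +
      (dirichlet_zeta (2 * \<sigma> - 1) * ((\<Prod>p\<in>prime_factors N. of_nat p powr (1 - 2 * \<sigma>) - of_nat p powr (- 2 * \<sigma>)) +
         of_nat N powr (- \<sigma>) * (\<Prod>p\<in>prime_factors N. 1 - of_nat p powr (1 - 2 * \<sigma>))) * a 0 +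
       (\<Sum>\<^sub>\<infinity>n\<in>{n. n \<noteq> 0}. D n * a n)) / Q)"
    unfolding S Z K_def[symmetric] w_def[symmetric] by (simp only: distrib_left times_divide_eq_right)
qed

text \<open>Summability is part of the claim because an unordered sum over a non-summable family
  would take a default value.\<close>

theorem corollary1p4:
  fixes N :: nat and k :: int and z s :: complex and x y :: real
  assumes "N > 1" and "squarefree N" and "even k"
    and "y > 0" and "z = Complex x y" and "Re s > 1 - of_int k / 2"
  shows "fourier_term N k s x y summable_on {n. n \<noteq> 0} \<and>
    eisenstein_G_completed N k z s =
      Gamma (s + of_int k / 2 + of_int \<bar>k\<bar> / 2) / Gamma (s + of_int k / 2) *
        completed_zeta (2 * s + of_int k) * of_real y powr s *
        of_real (sqrt (real N)) powr (s + of_int k / 2) * eisenstein_f N k s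
      + (- 1) powi (k div 2) *
        (Gamma (s + of_int k / 2) * Gamma (s + of_int k / 2 + of_int \<bar>k\<bar> / 2) /
           (Gamma (s + of_int k) * Gamma s)) *
        completed_zeta (2 - of_int k - 2 * s) * of_real y powr (1 - of_int k - s) *
        eisenstein_f N k s *
        (of_real (sqrt (real N)) powr (1 - s - of_int k / 2) *
           (\<Prod>p\<in>prime_factors N. (1 - of_nat p powr (- 1)) /
              (1 - of_nat p powr (- 2 * s - of_int k))) +
         of_real (sqrt (real N)) powr (- 1 + s + of_int k / 2) *
           (\<Prod>p\<in>prime_factors N. (1 - of_nat p powr (1 - of_int k - 2 * s)) /
              (1 - of_nat p powr (- 2 * s - of_int k))))
      + (\<Sum>\<^sub>\<infinity>n\<in>{n. n \<noteq> 0}. fourier_term N k s x y n)"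
proof -
  note N = assms(1,2) and k = assms(3) and y = assms(4)
  let ?P = "prime_factors N"
  define \<sigma> where "\<sigma> = s + of_int k / 2"
  define j where "j = k div 2"
  define r where "r = sqrt (real N)"
  define X where "X = x / r"
  define Y where "Y = y / r"
  define a where "a = eisenstein_coeff \<sigma> j X Y"
  define Q where "Q = (\<Prod>p\<in>?P. 1 - of_nat p powr (- 2 * \<sigma>) :: complex)"
  define D where "D = (\<lambda>n. \<Sum>c | c dvd nat \<bar>n\<bar>. of_nat c powr (1 - 2 * \<sigma>) *
      ((\<Prod>p\<in>?P. of_bool (p dvd c) - of_nat p powr (- 2 * \<sigma>)) +
        of_nat N powr (- \<sigma>) * (\<Prod>p\<in>?P. 1 - of_bool (p dvd c))) :: complex)"
  define G1 where "G1 = Gamma (s + of_int k / 2 + of_int \<bar>k\<bar> / 2)"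
  define f where "f = eisenstein_f N k s"
  define C where "C = of_real (pi / r) powr (- \<sigma>) * G1 * f"
  have \<sigma>: "Re \<sigma> > 1" using assms(6) by (simp add: \<sigma>_def)
  have kj: "k = 2 * j" using k by (simp add: j_def)
  have cj: "of_int k / 2 = (of_int j :: complex)" "(of_int k :: complex) = 2 * of_int j" by (simp_all add: kj)
  have r: "r > 0" "r * r = real N" using N by (simp_all add: r_def)
  have Y: "Y > 0" using y r by (simp add: Y_def)
  \<comment> \<open>All powers in question have positive bases built from \<pi>, r and y. Writing
    them as exponentials of combinations of three logarithms reduces every identity between powers
    to arithmetic in the exponent.\<close>
  define lp where "lp = complex_of_real (ln pi)"
  define lr where "lr = complex_of_real (ln r)"
  define ly where "ly = complex_of_real (ln y)"
  have pr: "pi / r > 0" using r by simp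
  have ex: "of_real pi powr u = exp (u * lp)" "of_real r powr u = exp (u * lr)" "of_real y powr u = exp (u * ly)"
    "of_real (pi / r) powr u = exp (u * (lp - lr))" "of_real Y powr u = exp (u * (ly - lr))"
    "of_nat N powr u = exp (u * (2 * lr))" for u :: complex
  proof -
    have "ln (real N) = 2 * ln r" unfolding r(2)[symmetric] using r(1) by (simp add: ln_mult)
    moreover have "real N > 0" using N by simp
    ultimately show "of_nat N powr u = exp (u * (2 * lr))"
      using real_powr_exp[of "real N" u] by (simp add: lr_def)
    show "of_real (pi / r) powr u = exp (u * (lp - lr))"
      unfolding real_powr_exp[OF pr] lp_def lr_def using r by (simp add: ln_div)
    show "of_real Y powr u = exp (u * (ly - lr))"
      unfolding real_powr_exp[OF Y] ly_def lr_def unfolding Y_def using r(1) y by (simp add: ln_div)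
  qed (simp_all add: real_powr_exp lp_def lr_def ly_def r y)
  define Z where "Z = dirichlet_zeta (2 * \<sigma> - 1) * ((\<Prod>p\<in>?P. of_nat p powr (1 - 2 * \<sigma>) - of_nat p powr (- 2 * \<sigma>)) +
         of_nat N powr (- \<sigma>) * (\<Prod>p\<in>?P. 1 - of_nat p powr (1 - 2 * \<sigma>)))"
  note expansion = eisenstein_G_expansion[OF N k y \<sigma>[unfolded \<sigma>_def], of x]
  have Da: "(\<lambda>n. D n * a n) summable_on {n. n \<noteq> 0}"
    unfolding D_def a_def j_def X_def Y_def r_def \<sigma>_def by (rule expansion(1))
  have G: "eisenstein_G N k (Complex x y) s = of_real y powr s * (dirichlet_zeta (2 * \<sigma>) + (Z * a 0 + (\<Sum>\<^sub>\<infinity>n\<in>{n. n \<noteq> 0}. D n * a n)) / Q)"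
    unfolding Z_def Q_def D_def a_def j_def X_def Y_def r_def \<sigma>_def by (rule expansion(2))
  \<comment> \<open>The argument 2\<sigma> lies in the region of convergence, where the completed
    zeta function is the plain product of its factors; its \<open>Gamma \<sigma>\<close> is
    cancelled by the denominator of the Gamma quotient.\<close>
  have T1: "C * of_real y powr s * dirichlet_zeta (2 * \<sigma>) =
      G1 / Gamma \<sigma> * completed_zeta (2 * s + of_int k) * of_real y powr s * of_real r powr \<sigma> * f"
  proof -
    have 1: "2 * s + of_int k = 2 * \<sigma>" by (simp add: \<sigma>_def)
    have "completed_zeta (2 * \<sigma>) = of_real pi powr (- (2 * \<sigma>) / 2) * Gamma (2 * \<sigma> / 2) * dirichlet_zeta (2 * \<sigma>)"
      by (rule completed_zeta_dirichlet) (use \<sigma> in simp)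
    hence 2: "completed_zeta (2 * \<sigma>) = of_real pi powr (- \<sigma>) * Gamma \<sigma> * dirichlet_zeta (2 * \<sigma>)" by simp
    have 3: "of_real (pi / r) powr (- \<sigma>) = of_real pi powr (- \<sigma>) * of_real r powr \<sigma>"
      unfolding ex exp_add[symmetric] by (simp add: algebra_simps)
    have "Gamma \<sigma> \<noteq> 0" by (rule Gamma_nonzero_Re) (use \<sigma> in simp)
    thus ?thesis unfolding C_def 1 2 3 by simp
  qed
  have T2: "C * of_real y powr s * (Z * a 0) / Q =
      (- 1) powi j * (Gamma \<sigma> * G1 / (Gamma (s + of_int k) * Gamma s)) *
        completed_zeta (2 - of_int k - 2 * s) * of_real y powr (1 - of_int k - s) * f *
        (of_real r powr (1 - s - of_int k / 2) * (\<Prod>p\<in>?P. (1 - of_nat p powr (- 1)) / (1 - of_nat p powr (- 2 * s - of_int k))) +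
         of_real r powr (- 1 + s + of_int k / 2) * (\<Prod>p\<in>?P. (1 - of_nat p powr (1 - of_int k - 2 * s)) / (1 - of_nat p powr (- 2 * s - of_int k))))"
  proof -
    define M1 where "M1 = (\<Prod>p\<in>?P. 1 - of_nat p powr (- 1) :: complex)"
    define M2 where "M2 = (\<Prod>p\<in>?P. 1 - of_nat p powr (1 - 2 * \<sigma>) :: complex)"
    define \<zeta>' where "\<zeta>' = dirichlet_zeta (2 * \<sigma> - 1)"
    define g where "g = Gamma (\<sigma> - 1/2)"
    have e1: "- 2 * s - of_int k = - 2 * \<sigma>" "1 - of_int k - 2 * s = 1 - 2 * \<sigma>" "1 - s - of_int k / 2 = 1 - \<sigma>"
      "- 1 + s + of_int k / 2 = \<sigma> - 1" "2 - of_int k - 2 * s = 1 - (2 * \<sigma> - 1)" "s + of_int k = \<sigma> + of_int j" "s = \<sigma> - of_int j"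
      by (simp_all add: \<sigma>_def cj)
    \<comment> \<open>Each factor is p^(1-2\<sigma>) (1 - p^(-1)), and the powers combine to a power
      of N because N is squarefree.\<close>
    have M1: "(\<Prod>p\<in>?P. of_nat p powr (1 - 2 * \<sigma>) - of_nat p powr (- 2 * \<sigma>)) = of_nat N powr (1 - 2 * \<sigma>) * M1"
    proof -
      have "of_nat p powr (1 - 2 * \<sigma>) - of_nat p powr (- 2 * \<sigma>) = of_nat p powr (1 - 2 * \<sigma>) * (1 - of_nat p powr (- 1) :: complex)" for p
      proof -
        have "- 2 * \<sigma> = 1 - 2 * \<sigma> + - 1" by simp
        thus ?thesis by (metis powr_add mult.right_neutral right_diff_distrib)
      qed
      moreover have "of_nat N powr (1 - 2 * \<sigma>) = (\<Prod>p\<in>?P. of_nat p powr (1 - 2 * \<sigma>) :: complex)"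
        using nat_powr_prod[of ?P "1 - 2 * \<sigma>"] unfolding squarefree_prod_prime_factors[OF N(2)] by simp
      ultimately show ?thesis unfolding M1_def by (simp only: prod.distrib)
    qed
    \<comment> \<open>The functional equation carries the Dirichlet series at 2\<sigma> - 1 to the
      completed zeta function at 2 - k - 2s.\<close>
    have cz: "completed_zeta (1 - (2 * \<sigma> - 1)) = of_real pi powr (1/2 - \<sigma>) * g * \<zeta>'"
    proof -
      have "completed_zeta (1 - (2 * \<sigma> - 1)) = of_real pi powr (- (2 * \<sigma> - 1) / 2) * Gamma ((2 * \<sigma> - 1) / 2) * dirichlet_zeta (2 * \<sigma> - 1)"
        by (rule completed_zeta_dirichlet) (use \<sigma> in simp)
      moreover have "- (2 * \<sigma> - 1) / 2 = 1/2 - \<sigma>" "(2 * \<sigma> - 1) / 2 = \<sigma> - 1/2" by (simp_all add: field_simps)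
      ultimately show ?thesis by (simp only: g_def \<zeta>'_def)
    qed
    have sp: "complex_of_real (sqrt pi) = exp (1/2 * lp)"
    proof -
      have "sqrt pi = exp (ln pi / 2)"
        using exp_ln[of "sqrt pi"] by (simp add: ln_sqrt)
      thus ?thesis by (simp add: lp_def flip: exp_of_real)
    qed
    \<comment> \<open>N^(1-2\<sigma>) from the left lattice and N^(-\<sigma>) from the right one end
      up as r^(1-\<sigma>) and r^(\<sigma>-1), the two powers of sqrt N in the constant
      term.\<close>
    have p1: "of_real (pi / r) powr (- \<sigma>) * of_real y powr s * of_nat N powr (1 - 2 * \<sigma>) * of_real Y powr (1 - 2 * \<sigma>) * of_real (sqrt pi) =
        of_real pi powr (1/2 - \<sigma>) * of_real y powr (1 - of_int k - s) * of_real r powr (1 - \<sigma>)"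
      unfolding ex sp exp_add[symmetric] by (rule arg_cong[of _ _ exp]) (simp add: \<sigma>_def field_simps)
    have p2: "of_real (pi / r) powr (- \<sigma>) * of_real y powr s * of_nat N powr (- \<sigma>) * of_real Y powr (1 - 2 * \<sigma>) * of_real (sqrt pi) =
        of_real pi powr (1/2 - \<sigma>) * of_real y powr (1 - of_int k - s) * of_real r powr (\<sigma> - 1)"
      unfolding ex sp exp_add[symmetric] by (rule arg_cong[of _ _ exp]) (simp add: \<sigma>_def field_simps)
    let ?U = "(- 1) powi j * G1 * Gamma \<sigma> * g * rGamma (\<sigma> + of_int j) * rGamma (\<sigma> - of_int j) * f * \<zeta>'"
    have a0: "a 0 = of_real Y powr (1 - 2 * \<sigma>) * (of_real (sqrt pi) * g * Gamma \<sigma> * (-1) powi j * rGamma (\<sigma> + of_int j) * rGamma (\<sigma> - of_int j))"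
      unfolding a_def g_def by (rule eisenstein_coeff_zero[OF \<sigma> Y])
    have "C * of_real y powr s * (Z * a 0) =
       ?U * ((of_real (pi / r) powr (- \<sigma>) * of_real y powr s * of_nat N powr (1 - 2 * \<sigma>) * of_real Y powr (1 - 2 * \<sigma>) * of_real (sqrt pi)) * M1 +
             (of_real (pi / r) powr (- \<sigma>) * of_real y powr s * of_nat N powr (- \<sigma>) * of_real Y powr (1 - 2 * \<sigma>) * of_real (sqrt pi)) * M2)"
      unfolding C_def Z_def M1 M2_def[symmetric] \<zeta>'_def[symmetric] a0 by (simp only: distrib_left distrib_right mult_ac)
    also have "\<dots> = ?U * (of_real pi powr (1/2 - \<sigma>) * of_real y powr (1 - of_int k - s)) * (of_real r powr (1 - \<sigma>) * M1 + of_real r powr (\<sigma> - 1) * M2)"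
      unfolding p1 p2 by (simp only: distrib_left mult_ac)
    finally have *: "C * of_real y powr s * (Z * a 0) = \<dots>" .
    \<comment> \<open>At a pole of Gamma the quotient is 0 by the conventions for Gamma and
      division, in agreement with the reciprocal Gamma function; hence no exceptional s.\<close>
    have rg: "Gamma \<sigma> * G1 / (Gamma (\<sigma> + of_int j) * Gamma (\<sigma> - of_int j)) = Gamma \<sigma> * G1 * rGamma (\<sigma> + of_int j) * rGamma (\<sigma> - of_int j)"
      by (simp add: rGamma_inverse_Gamma divide_inverse mult_ac)
    have rg': "Gamma \<sigma> * G1 / (Gamma (s + of_int k) * Gamma s) = Gamma \<sigma> * G1 * rGamma (\<sigma> + of_int j) * rGamma (\<sigma> - of_int j)"
      unfolding e1(6) unfolding e1(7) by (rule rg)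
    show ?thesis
    proof -
      have V: "u * (M1 / Q) + v * (M2 / Q) = (u * M1 + v * M2) / Q" for u v by (simp add: add_divide_distrib)
      show ?thesis
        unfolding * e1(1-5) rg' cz prod_dividef Q_def[symmetric] M1_def[symmetric] M2_def[symmetric] V
        by (simp only: times_divide_eq_right mult_ac)
    qed
  qed
  have T3: "fourier_term N k s x y n = C * of_real y powr s / Q * (D n * a n)" if n: "n \<noteq> 0" for n
  proof -
    define W where "W = whittaker_W (of_int (sgn n) * of_int j) (\<sigma> - 1/2) (4 * pi * of_int \<bar>n\<bar> * Y)"
    define E where "E = exp (2 * of_real pi * \<i> * of_int n * of_real X)"
    define R where "R = rGamma (\<sigma> + of_int (sgn n) * of_int j)"
    have aa: "a n = (-1) powi j * of_real pi powr \<sigma> * of_int \<bar>n\<bar> powr (\<sigma> - 1) * of_real Y powr (- \<sigma>) * R * W * E"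
      unfolding a_def W_def E_def R_def by (rule eisenstein_coeff_nonzero[OF \<sigma> Y n])
    have e: "s + (of_int k - 1) / 2 = \<sigma> - 1/2" "4 * pi * of_int \<bar>n\<bar> * y / r = 4 * pi * of_int \<bar>n\<bar> * Y"
      "2 * of_real pi * \<i> * of_int n * of_real x / of_real r = 2 * of_real pi * \<i> * of_int n * of_real X"
      "- s - of_int k / 2 = - \<sigma>" "- of_int k / 2 = (- of_int j :: complex)"
      by (simp_all add: \<sigma>_def Y_def X_def cj(2) field_simps)
    have a0: "real_of_int \<bar>n\<bar> > 0" using n by simp
    \<comment> \<open>Splits off |n|^(2\<sigma>-1), the power that turns a sum of c^(1-2\<sigma>)
      over divisors into the divisor function.\<close>
    have np: "of_int \<bar>n\<bar> powr (\<sigma> - 1) = of_int \<bar>n\<bar> powr (- \<sigma>) * (of_int \<bar>n\<bar> powr (2 * \<sigma> - 1) :: complex)"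
      unfolding powr_add[symmetric] by simp
    \<comment> \<open>The factors r^\<sigma> from the completion and from Y^(-\<sigma>) combine to
      N^\<sigma>, exactly the power that the local computation expects in front of
      \<open>D n\<close>.\<close>
    have pw: "of_real (pi / r) powr (- \<sigma>) * of_real y powr s * of_real pi powr \<sigma> * of_real Y powr (- \<sigma>) = of_nat N powr \<sigma> * of_real y powr (- of_int j)"
      unfolding ex exp_add[symmetric] by (rule arg_cong[of _ _ exp]) (simp add: \<sigma>_def cj algebra_simps)
    have gr: "G1 / Gamma (\<sigma> + of_int (sgn n) * of_int j) = G1 * R"
      by (simp add: R_def rGamma_inverse_Gamma divide_inverse)
    have ft: "fourier_term N k s x y n = (-1) powi j * of_real y powr (- of_int j) * (G1 * R) * of_int \<bar>n\<bar> powr (- \<sigma>) *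
        divisor_sigma (2 * s + of_int k - 1) n * W * eisenstein_fb N k n (1 - of_int k - s) * f * E"
      unfolding fourier_term_def r_def[symmetric] G1_def[symmetric] f_def[symmetric] j_def[symmetric] e
      unfolding \<sigma>_def[symmetric]
      unfolding cj(1) gr W_def E_def ..
    have fb: "of_int \<bar>n\<bar> powr (2 * \<sigma> - 1) * (of_nat N powr \<sigma> * D n) / Q = divisor_sigma (2 * s + of_int k - 1) n * eisenstein_fb N k n (1 - of_int k - s)"
      unfolding D_def Q_def by (rule divisor_sum_fb[OF N(1) n \<sigma>_def \<sigma>])
    have "C * of_real y powr s / Q * (D n * a n) =
      (-1) powi j * G1 * f * R * W * E * (of_real (pi / r) powr (- \<sigma>) * of_real y powr s * of_real pi powr \<sigma> * of_real Y powr (- \<sigma>)) *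
        of_int \<bar>n\<bar> powr (- \<sigma>) * (of_int \<bar>n\<bar> powr (2 * \<sigma> - 1) * D n / Q)"
      unfolding C_def aa np by (simp only: times_divide_eq_right times_divide_eq_left mult_ac)
    also have "\<dots> = (-1) powi j * G1 * f * R * W * E * of_real y powr (- of_int j) * of_int \<bar>n\<bar> powr (- \<sigma>) * (of_int \<bar>n\<bar> powr (2 * \<sigma> - 1) * (of_nat N powr \<sigma> * D n) / Q)"
      unfolding pw by (simp only: times_divide_eq_right mult_ac)
    also have "\<dots> = fourier_term N k s x y n"
      unfolding fb ft by (simp only: mult_ac)
    finally show ?thesis by (rule sym)
  qed
  have fs: "fourier_term N k s x y summable_on {n. n \<noteq> 0}"
  proof -
    have "(\<lambda>n. C * of_real y powr s / Q * (D n * a n)) summable_on {n. n \<noteq> 0}"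
      by (rule summable_on_cmult_right[OF Da])
    thus ?thesis by (rule summable_on_cong[THEN iffD1, rotated]) (rule T3[symmetric], simp)
  qed
  have sum: "(\<Sum>\<^sub>\<infinity>n\<in>{n. n \<noteq> 0}. fourier_term N k s x y n) = C * of_real y powr s / Q * (\<Sum>\<^sub>\<infinity>n\<in>{n. n \<noteq> 0}. D n * a n)"
    unfolding infsum_cmult_right'[symmetric] by (rule infsum_cong) (rule T3, simp)
  have "eisenstein_G_completed N k z s = C * eisenstein_G N k (Complex x y) s"
    unfolding eisenstein_G_completed_def C_def G1_def f_def r_def \<sigma>_def assms(5) by simp
  also have "\<dots> = C * of_real y powr s * dirichlet_zeta (2 * \<sigma>) + C * of_real y powr s * (Z * a 0) / Q +
      C * of_real y powr s / Q * (\<Sum>\<^sub>\<infinity>n\<in>{n. n \<noteq> 0}. D n * a n)"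
    unfolding G by (simp add: distrib_left add_divide_distrib mult.assoc)
  also have "\<dots> = G1 / Gamma \<sigma> * completed_zeta (2 * s + of_int k) * of_real y powr s * of_real r powr \<sigma> * f +
      (- 1) powi j * (Gamma \<sigma> * G1 / (Gamma (s + of_int k) * Gamma s)) *
        completed_zeta (2 - of_int k - 2 * s) * of_real y powr (1 - of_int k - s) * f *
        (of_real r powr (1 - s - of_int k / 2) * (\<Prod>p\<in>?P. (1 - of_nat p powr (- 1)) / (1 - of_nat p powr (- 2 * s - of_int k))) +
         of_real r powr (- 1 + s + of_int k / 2) * (\<Prod>p\<in>?P. (1 - of_nat p powr (1 - of_int k - 2 * s)) / (1 - of_nat p powr (- 2 * s - of_int k)))) +
      (\<Sum>\<^sub>\<infinity>n\<in>{n. n \<noteq> 0}. fourier_term N k s x y n)"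
    unfolding T1 T2 sum ..
  finally show ?thesis using fs unfolding G1_def f_def r_def \<sigma>_def j_def by (intro conjI)
qed

end
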